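(* There is an algorithm which, given a homogeneous relation $H$ on a finite set $X$ whose umodule family $\mathcal{U}_H$ is self-complemented, computes in $O(|X|^4\log|X|)$ time the unique umodular decomposition tree of $H$ (with its node labels and orderings).
   Context: Let $X$ be a finite set. A reflectless triple is $(x|yz)$ with $x,y,z\in X$, $x\neq y$, $x\neq z$. A homogeneous relation $H$ on $X$ is a boolean relation on reflectless triples such that for every $x\in X$ the binary relation $H_x$ on $X\setminus\{x\}$ given by $H_x(y,z)\Leftrightarrow H(x|yz)$ is an equivalence relation. The input $H$ is given by listing, for each $x\in X$, the partition of $X\setminus\{x\}$ into the classes of $H_x$. A subset $U\subseteq X$ is a umodule of $H$ if for all $u,u'\in U$ and all $x,x'\in X\setminus U$: $H(u|xx')\Leftrightarrow H(u'|xx')$. The family of umodules is $\mathcal{U}_H$; it is self-complemented if $U\in\mathcal{U}_H$ implies $X\setminus U\in\mathcal{U}_H$. Umodular decomposition tree (for self-complemented $\mathcal{U}_H$). Let $\mathcal{B}=\{\{U,X\setminus U\}: U\in\mathcal{U}_H,\ \emptyset\neq U\neq X\}$. Two bipartitions $\{A^1,A^2\}$, $\{B^1,B^2\}$ of $X$ overlap if all four intersections $A^i\cap B^j$ are nonempty; a bipartition in $\mathcal{B}$ is strong if it overlaps no other member of $\mathcal{B}$. The umodular decomposition tree is the unique unrooted tree $T$ whose leaves are labelled bijectively by $X$ and whose edges $e$ correspond bijectively to the strong bipartitions of $\mathcal{B}$ (the leaf labels of the two components of $T-e$ being the two parts). For an internal node $N$ of degree $k$, the leaf labels of the components of $T-N$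 form a partition $X_1,\dots,X_k$ of $X$; for $I\subseteq\{1,\dots,k\}$, $1\le|I|<k$, let $B_N(I)=\{\bigcup_{i\in I}X_i, X\setminus\bigcup_{i\in I}X_i\}$. Internal nodes are labelled complete, circular or prime, and the neighbouring subtrees of circular nodes are ordered, so that $\mathcal{B}$ consists exactly of: all $B_N(I)$ for $N$ complete; all $B_N(I)$ with $I$ an interval of $\{1,\dots,k\}$ for $N$ circular; all $B_N(\{a\})$ for $N$ prime. *)

theory Defs
  imports Complex_Main "HOL-Library.Landau_Symbols"
begin

section \<open>Homogeneous relations and umodules\<close>

text \<open>A relation on reflectless triples is a ternary predicate \<open>H\<close>, with \<open>H x y z\<close> for $H(x|yz)$;
  its values at triples that are not reflectless triples of \<open>X\<close> are never inspected.\<close>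

definition rel_at :: "'a set \<Rightarrow> ('a \<Rightarrow> 'a \<Rightarrow> 'a \<Rightarrow> bool) \<Rightarrow> 'a \<Rightarrow> 'a rel" where
  "rel_at X H x = {(y, z). y \<in> X - {x} \<and> z \<in> X - {x} \<and> H x y z}"

definition homogeneous :: "'a set \<Rightarrow> ('a \<Rightarrow> 'a \<Rightarrow> 'a \<Rightarrow> bool) \<Rightarrow> bool" where
  "homogeneous X H \<longleftrightarrow> (\<forall>x\<in>X. equiv (X - {x}) (rel_at X H x))"

definition umodule :: "'a set \<Rightarrow> ('a \<Rightarrow> 'a \<Rightarrow> 'a \<Rightarrow> bool) \<Rightarrow> 'a set \<Rightarrow> bool" where
  "umodule X H U \<longleftrightarrow> U \<subseteq> X \<and>
     (\<forall>u\<in>U. \<forall>u'\<in>U. \<forall>x\<in>X - U. \<forall>x'\<in>X - U. H u x x' \<longleftrightarrow> H u' x x')"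

definition self_complemented :: "'a set \<Rightarrow> ('a \<Rightarrow> 'a \<Rightarrow> 'a \<Rightarrow> bool) \<Rightarrow> bool" where
  "self_complemented X H \<longleftrightarrow> (\<forall>U. umodule X H U \<longrightarrow> umodule X H (X - U))"

text \<open>A bipartition is represented as the set of its two parts.\<close>

definition bipartitions :: "'a set \<Rightarrow> ('a \<Rightarrow> 'a \<Rightarrow> 'a \<Rightarrow> bool) \<Rightarrow> 'a set set set" where
  "bipartitions X H = {{U, X - U} | U. umodule X H U \<and> U \<noteq> {} \<and> U \<noteq> X}"

definition overlap :: "'a set set \<Rightarrow> 'a set set \<Rightarrow> bool" where
  "overlap P Q \<longleftrightarrow> (\<forall>A\<in>P. \<forall>B\<in>Q. A \<inter> B \<noteq> {})"

definition strong_bipartitions ::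
    "'a set \<Rightarrow> ('a \<Rightarrow> 'a \<Rightarrow> 'a \<Rightarrow> bool) \<Rightarrow> 'a set set set" where
  "strong_bipartitions X H =
     {P \<in> bipartitions X H. \<forall>Q\<in>bipartitions X H. Q \<noteq> P \<longrightarrow> \<not> overlap P Q}"


section \<open>Umodular decomposition trees\<close>

datatype kind = Complete | Circular | Prime

text \<open>Unrooted trees given by ordered adjacency lists. The order of \<open>nbrs v\<close> matters at circular
  nodes only, \<open>lab\<close> at leaves only, and \<open>kind\<close> at internal nodes only.\<close>

record ('v, 'a) dtree =
  verts :: "'v set"
  nbrs :: "'v \<Rightarrow> 'v list"
  lab :: "'v \<Rightarrow> 'a"
  kind :: "'v \<Rightarrow> kind"

definition arcs :: "('v, 'a) dtree \<Rightarrow> 'v rel" where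
  "arcs T = {(u, v). u \<in> verts T \<and> v \<in> set (nbrs T u)}"

definition edges :: "('v, 'a) dtree \<Rightarrow> 'v set set" where
  "edges T = {{u, v} | u v. (u, v) \<in> arcs T}"

definition cyclic_path :: "'v rel \<Rightarrow> 'v list \<Rightarrow> bool" where
  "cyclic_path R vs \<longleftrightarrow> 3 \<le> length vs \<and> distinct vs \<and>
     successively (\<lambda>u v. (u, v) \<in> R) vs \<and> (last vs, hd vs) \<in> R"

text \<open>The null graph is admitted; it is the tree with no leaves, belonging to \<open>X = {}\<close>.\<close>

definition is_tree :: "('v, 'a) dtree \<Rightarrow> bool" where
  "is_tree T \<longleftrightarrow> finite (verts T) \<and>
     (\<forall>v\<in>verts T. distinct (nbrs T v) \<and> set (nbrs T v) \<subseteq> verts T - {v}) \<and>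
     sym (arcs T) \<and>
     (\<forall>u\<in>verts T. \<forall>v\<in>verts T. (u, v) \<in> (arcs T)\<^sup>*) \<and>
     (\<nexists>vs. cyclic_path (arcs T) vs)"

text \<open>Degree 0 occurs only in the one-vertex tree, whose vertex is its leaf.\<close>

definition leaves :: "('v, 'a) dtree \<Rightarrow> 'v set" where
  "leaves T = {v \<in> verts T. length (nbrs T v) \<le> 1}"

definition internal_nodes :: "('v, 'a) dtree \<Rightarrow> 'v set" where
  "internal_nodes T = verts T - leaves T"

text \<open>Leaf labels in the component of \<open>v\<close> of the graph with arcs \<open>R\<close>.\<close>

definition labels_from :: "('v, 'a) dtree \<Rightarrow> 'v rel \<Rightarrow> 'v \<Rightarrow> 'a set" where
  "labels_from T R v = lab T ` {l \<in> leaves T. (v, l) \<in> R\<^sup>*}"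

definition edge_split :: "('v, 'a) dtree \<Rightarrow> 'v set \<Rightarrow> 'a set set" where
  "edge_split T e = labels_from T {(u, v) \<in> arcs T. {u, v} \<noteq> e} ` e"

text \<open>The part $X_i$ at the node \<open>N\<close>, counting neighbours from 0.\<close>

definition node_part :: "('v, 'a) dtree \<Rightarrow> 'v \<Rightarrow> nat \<Rightarrow> 'a set" where
  "node_part T N i = labels_from T {(u, v) \<in> arcs T. u \<noteq> N \<and> v \<noteq> N} (nbrs T N ! i)"

definition node_split :: "'a set \<Rightarrow> ('v, 'a) dtree \<Rightarrow> 'v \<Rightarrow> nat set \<Rightarrow> 'a set set" where
  "node_split X T N I = {\<Union>i\<in>I. node_part T N i, X - (\<Union>i\<in>I. node_part T N i)}"

fun index_sets :: "kind \<Rightarrow> nat \<Rightarrow> nat set set" where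
  "index_sets Complete k = {I. I \<subseteq> {..<k} \<and> 1 \<le> card I \<and> card I < k}"
| "index_sets Circular k = {I. (\<exists>i j. j \<le> k \<and> I = {i..<j}) \<and> 1 \<le> card I \<and> card I < k}"
| "index_sets Prime k = {{a} | a. a < k}"

definition node_splits :: "'a set \<Rightarrow> ('v, 'a) dtree \<Rightarrow> 'v \<Rightarrow> 'a set set set" where
  "node_splits X T N = node_split X T N ` index_sets (kind T N) (length (nbrs T N))"

definition strong_split_tree ::
    "'a set \<Rightarrow> ('a \<Rightarrow> 'a \<Rightarrow> 'a \<Rightarrow> bool) \<Rightarrow> ('v, 'a) dtree \<Rightarrow> bool" where
  "strong_split_tree X H T \<longleftrightarrow> is_tree T \<and> bij_betw (lab T) (leaves T) X \<and>
     bij_betw (edge_split T) (edges T) (strong_bipartitions X H)"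

text \<open>Including the splits of the edges matters only for \<open>card X = 2\<close>, where the tree is a single
  edge without internal nodes; otherwise every edge has an internal end, and its split is
  already among the splits of that end.\<close>

definition umodular_decomposition_tree ::
    "'a set \<Rightarrow> ('a \<Rightarrow> 'a \<Rightarrow> 'a \<Rightarrow> bool) \<Rightarrow> ('v, 'a) dtree \<Rightarrow> bool" where
  "umodular_decomposition_tree X H T \<longleftrightarrow> strong_split_tree X H T \<and>
     bipartitions X H =
       edge_split T ` edges T \<union> (\<Union>N\<in>internal_nodes T. node_splits X T N)"

definition tree_iso :: "('v, 'a) dtree \<Rightarrow> ('w, 'a) dtree \<Rightarrow> bool" where
  "tree_iso T T' \<longleftrightarrow> (\<exists>f. bij_betw f (verts T) (verts T') \<and>
     (\<forall>u\<in>verts T. \<forall>v\<in>verts T. (u, v) \<in> arcs T \<longleftrightarrow> (f u, f v) \<in> arcs T') \<and>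
     f ` leaves T = leaves T' \<and> (\<forall>l\<in>leaves T. lab T' (f l) = lab T l))"


section \<open>Word RAM programs\<close>

text \<open>Structured programs over natural-number registers and finitely many arrays, with unit cost
  per operation. The word bound \<open>W\<close> is the largest number that fits into a machine word: a run
  that would compute a larger value does not exist, so packing large amounts of data into one
  register is impossible as long as \<open>W\<close> is polynomial in the input size.\<close>

datatype aexp =
    Num nat
  | Reg nat
  | Arr nat aexp
  | Plus aexp aexp
  | Minus aexp aexp
  | Times aexp aexp

datatype bexp =
    Less aexp aexp
  | Equal aexp aexp
  | Neg bexp
  | Conj bexp bexp

datatype com =
    Skip
  | Assign nat aexp
  | Store nat aexp aexp
  | Seq com com
  | Cond bexp com com
  | While bexp com

record state =
  regs :: "nat \<Rightarrow> nat"
  arrs :: "nat \<Rightarrow> nat \<Rightarrow> nat"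

fun aval :: "state \<Rightarrow> aexp \<Rightarrow> nat" where
  "aval s (Num k) = k"
| "aval s (Reg x) = regs s x"
| "aval s (Arr a i) = arrs s a (aval s i)"
| "aval s (Plus e f) = aval s e + aval s f"
| "aval s (Minus e f) = aval s e - aval s f"
| "aval s (Times e f) = aval s e * aval s f"

fun acost :: "aexp \<Rightarrow> nat" where
  "acost (Num k) = 1"
| "acost (Reg x) = 1"
| "acost (Arr a i) = 1 + acost i"
| "acost (Plus e f) = 1 + acost e + acost f"
| "acost (Minus e f) = 1 + acost e + acost f"
| "acost (Times e f) = 1 + acost e + acost f"

fun afits :: "nat \<Rightarrow> state \<Rightarrow> aexp \<Rightarrow> bool" where
  "afits W s (Num k) \<longleftrightarrow> k \<le> W"
| "afits W s (Reg x) \<longleftrightarrow> regs s x \<le> W"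
| "afits W s (Arr a i) \<longleftrightarrow> afits W s i \<and> arrs s a (aval s i) \<le> W"
| "afits W s (Plus e f) \<longleftrightarrow> afits W s e \<and> afits W s f \<and> aval s e + aval s f \<le> W"
| "afits W s (Minus e f) \<longleftrightarrow> afits W s e \<and> afits W s f"
| "afits W s (Times e f) \<longleftrightarrow> afits W s e \<and> afits W s f \<and> aval s e * aval s f \<le> W"

fun bval :: "state \<Rightarrow> bexp \<Rightarrow> bool" where
  "bval s (Less e f) \<longleftrightarrow> aval s e < aval s f"
| "bval s (Equal e f) \<longleftrightarrow> aval s e = aval s f"
| "bval s (Neg b) \<longleftrightarrow> \<not> bval s b"
| "bval s (Conj b c) \<longleftrightarrow> bval s b \<and> bval s c"

fun bcost :: "bexp \<Rightarrow> nat" where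
  "bcost (Less e f) = 1 + acost e + acost f"
| "bcost (Equal e f) = 1 + acost e + acost f"
| "bcost (Neg b) = 1 + bcost b"
| "bcost (Conj b c) = 1 + bcost b + bcost c"

fun bfits :: "nat \<Rightarrow> state \<Rightarrow> bexp \<Rightarrow> bool" where
  "bfits W s (Less e f) \<longleftrightarrow> afits W s e \<and> afits W s f"
| "bfits W s (Equal e f) \<longleftrightarrow> afits W s e \<and> afits W s f"
| "bfits W s (Neg b) \<longleftrightarrow> bfits W s b"
| "bfits W s (Conj b c) \<longleftrightarrow> bfits W s b \<and> bfits W s c"

text \<open>\<open>run W c s t s'\<close>: started in \<open>s\<close>, the program \<open>c\<close> halts in \<open>s'\<close> after \<open>t\<close> steps, and all
  values it handles are at most \<open>W\<close>.\<close>

inductive run :: "nat \<Rightarrow> com \<Rightarrow> state \<Rightarrow> nat \<Rightarrow> state \<Rightarrow> bool" for W where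
  Skip: "run W Skip s 1 s"
| Assign: "afits W s e \<Longrightarrow>
    run W (Assign x e) s (1 + acost e) (s\<lparr>regs := (regs s)(x := aval s e)\<rparr>)"
| Store: "afits W s i \<Longrightarrow> afits W s e \<Longrightarrow>
    run W (Store a i e) s (1 + acost i + acost e)
      (s\<lparr>arrs := (arrs s)(a := (arrs s a)(aval s i := aval s e))\<rparr>)"
| Seq: "run W c s t s' \<Longrightarrow> run W d s' t' s'' \<Longrightarrow> run W (Seq c d) s (t + t') s''"
| CondTrue: "bfits W s b \<Longrightarrow> bval s b \<Longrightarrow> run W c s t s' \<Longrightarrow>
    run W (Cond b c d) s (1 + bcost b + t) s'"
| CondFalse: "bfits W s b \<Longrightarrow> \<not> bval s b \<Longrightarrow> run W d s t s' \<Longrightarrow>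
    run W (Cond b c d) s (1 + bcost b + t) s'"
| WhileFalse: "bfits W s b \<Longrightarrow> \<not> bval s b \<Longrightarrow> run W (While b c) s (1 + bcost b) s"
| WhileTrue: "bfits W s b \<Longrightarrow> bval s b \<Longrightarrow> run W c s t s' \<Longrightarrow> run W (While b c) s' t' s'' \<Longrightarrow>
    run W (While b c) s (1 + bcost b + t + t') s''"


section \<open>Input and output\<close>

text \<open>The machine refers to the elements of \<open>X\<close> by their positions in an enumeration \<open>xs\<close> of \<open>X\<close>.
  A listing \<open>L\<close> of \<open>H\<close> gives, for each position \<open>x\<close>, the classes of $H_x$ in any order, each as a
  list of positions in any order.\<close>

definition lists_classes ::
    "'a list \<Rightarrow> ('a \<Rightarrow> 'a \<Rightarrow> 'a \<Rightarrow> bool) \<Rightarrow> nat list list list \<Rightarrow> bool" where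
  "lists_classes xs H L \<longleftrightarrow> length L = length xs \<and>
     (\<forall>i<length xs.
        (\<forall>C\<in>set (L ! i). distinct C \<and> set C \<subseteq> {..<length xs}) \<and>
        distinct (map set (L ! i)) \<and>
        (\<lambda>C. (!) xs ` set C) ` set (L ! i) =
          (set xs - {xs ! i}) // rel_at (set xs) H (xs ! i))"

definition serialize :: "nat list list list \<Rightarrow> nat list" where
  "serialize L = concat (map (\<lambda>P. length P # concat (map (\<lambda>C. length C # C) P)) L)"

text \<open>Register 0 holds $|X|$ and array 0 the serialized listing; all other memory is 0.\<close>

definition input_state :: "nat list list list \<Rightarrow> state" where
  "input_state L =
     \<lparr>regs = (\<lambda>_. 0)(0 := length L),
      arrs = (\<lambda>_ _. 0)(0 := (\<lambda>i. if i < length (serialize L) then serialize L ! i else 0))\<rparr>"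

text \<open>Register 1 holds the number of vertices. Array 1 holds the degrees; the adjacency lists are
  segments of array 3, starting at the offsets in array 2. Array 4 holds the leaf labels, as
  positions in \<open>xs\<close>, and array 5 the codes of the kinds.\<close>

definition decode_kind :: "nat \<Rightarrow> kind" where
  "decode_kind k = (if k = 0 then Complete else if k = 1 then Circular else Prime)"

definition output_tree :: "'a list \<Rightarrow> state \<Rightarrow> (nat, 'a) dtree" where
  "output_tree xs s =
     \<lparr>verts = {..<regs s 1},
      nbrs = (\<lambda>v. map (\<lambda>j. arrs s 3 (arrs s 2 v + j)) [0..<arrs s 1 v]),
      lab = (\<lambda>v. xs ! arrs s 4 v),
      kind = (\<lambda>v. decode_kind (arrs s 5 v))\<rparr>"

end

theory Submission
  imports Defs
begin

text \<open>Fix a point \<open>r\<close>. The nonempty umodules that avoid \<open>r\<close> represent all bipartitions, and by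
  self-complementedness they form a weakly partitive family: intersecting members have their union
  and intersection in the family, and crossing members their differences. Hence the strong members
  form a tree, and the quotient of the family at each of its nodes has no nontrivial strong member,
  which makes it complete, prime, or the family of intervals of a linear order; together with the
  part that contains \<open>r\<close>, the linear order becomes a circular one.

  The algorithm computes for each pair \<open>a\<close>, \<open>b\<close> the least member that contains both, in $O(n^2)$ steps: by
  self-complementedness, a set is a umodule iff the relations $H_y$ of the outer elements \<open>y\<close> agree on it
  with $H_r$, so that an element \<open>y\<close> is added as soon as $H_y$ and $H_r$ disagree. These $n^2$ sets
  determine the strong members, their inclusions, and betweenness in the quotients. There are at
  most $n^2$ different pairs, so that even comparing all pairs of pairs takes $O(n^4)$ steps. No value
  that is stored exceeds a stored value by more than 1, so that all words have polynomial size.\<close>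

section \<open>Weakly partitive families\<close>

text \<open>The family may have exponentially many members, so strong members have to be recognised
  from the least members of pairs alone. What makes this possible is a count. Take three points from
  different children of a node and ask how many of them lie in the least member of the other two:
  none at a complete node, exactly one at a linear node, all three at a prime node, but never two. A
  point \<open>c\<close> outside the strong hull of \<open>a\<close> and \<open>b\<close> shows a
  pattern that cannot occur inside it: each of \<open>a\<close> and \<open>b\<close> lies between
  the other one and \<open>c\<close>, while \<open>c\<close> does not lie between them. The same
  count reveals the kind of a node. The order at a linear node is betweenness seen from one of its
  ends, and an end is recognised by a least member that fills the node. Two strong hulls are
  compared by four membership tests, so that a comparison takes constant time. On the side of the
  machine, every loop counts up to \<open>n\<close> or to \<open>n * n\<close>; the running time can
  therefore be read off the program text, and the correctness proofs never mention time.\<close>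

definition crossing :: "'a set \<Rightarrow> 'a set \<Rightarrow> bool" where
  "crossing A B \<longleftrightarrow> A \<inter> B \<noteq> {} \<and> \<not> A \<subseteq> B \<and> \<not> B \<subseteq> A"

locale weakly_partitive =
  fixes Y :: "'a set" and F :: "'a set set"
  assumes finite_ground: "finite Y"
    and member_subset: "A \<in> F \<Longrightarrow> A \<subseteq> Y"
    and member_nonempty: "A \<in> F \<Longrightarrow> A \<noteq> {}"
    and ground_member: "Y \<noteq> {} \<Longrightarrow> Y \<in> F"
    and singleton_member: "a \<in> Y \<Longrightarrow> {a} \<in> F"
    and union_member: "A \<in> F \<Longrightarrow> B \<in> F \<Longrightarrow> A \<inter> B \<noteq> {} \<Longrightarrow> A \<union> B \<in> F"
    and inter_member: "A \<in> F \<Longrightarrow> B \<in> F \<Longrightarrow> A \<inter> B \<noteq> {} \<Longrightarrow> A \<inter> B \<in> F"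
    and diff_member: "A \<in> F \<Longrightarrow> B \<in> F \<Longrightarrow> crossing A B \<Longrightarrow> A - B \<in> F"

definition convex_in :: "('a \<Rightarrow> int) \<Rightarrow> 'a set \<Rightarrow> 'a set \<Rightarrow> bool" where
  "convex_in p K I \<longleftrightarrow> (\<forall>a\<in>I. \<forall>b\<in>I. \<forall>c\<in>K. p a < p c \<longrightarrow> p c < p b \<longrightarrow> c \<in> I)"

definition complete_family :: "'a set \<Rightarrow> 'a set set \<Rightarrow> bool" where
  "complete_family K G \<longleftrightarrow> G = Pow K - {{}}"

text \<open>An integer key instead of a list makes reversal a negation and leaves room for a new
  element below all others.\<close>

definition linear_family :: "('a \<Rightarrow> int) \<Rightarrow> 'a set \<Rightarrow> 'a set set \<Rightarrow> bool" where
  "linear_family p K G \<longleftrightarrow> inj_on p K \<and> G = {I. I \<subseteq> K \<and> I \<noteq> {} \<and> convex_in p K I}"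

definition prime_family :: "'a set \<Rightarrow> 'a set set \<Rightarrow> bool" where
  "prime_family K G \<longleftrightarrow> (\<forall>I\<in>G. card I = 1 \<or> I = K)"

definition no_strong :: "'a set \<Rightarrow> 'a set set \<Rightarrow> bool" where
  "no_strong K G \<longleftrightarrow> (\<forall>I\<in>G. card I \<noteq> 1 \<longrightarrow> I \<noteq> K \<longrightarrow> (\<exists>J\<in>G. crossing I J))"

lemma linear_family_uminus:
  assumes "linear_family p K G" shows "linear_family (\<lambda>x. - p x) K G"
proof -
  have "convex_in (\<lambda>x. - p x) K I = convex_in p K I" for I
    unfolding convex_in_def neg_less_iff_less by blast
  then show ?thesis using assms by (simp add: linear_family_def inj_on_def)
qed

context weakly_partitive
begin

lemma member_finite: "A \<in> F \<Longrightarrow> finite A"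
  using finite_ground member_subset finite_subset by blast

lemma restrict:
  assumes "A \<in> F" shows "weakly_partitive A {I \<in> F. I \<subseteq> A}"
proof
  show "finite A" using assms by (rule member_finite)
  show "\<And>B. B \<in> {I \<in> F. I \<subseteq> A} \<Longrightarrow> B \<subseteq> A" by auto
  show "\<And>B. B \<in> {I \<in> F. I \<subseteq> A} \<Longrightarrow> B \<noteq> {}" using member_nonempty by auto
  show "A \<in> {I \<in> F. I \<subseteq> A}" using assms by auto
  show "\<And>a. a \<in> A \<Longrightarrow> {a} \<in> {I \<in> F. I \<subseteq> A}" using assms member_subset singleton_member by auto
  fix B C assume BC: "B \<in> {I \<in> F. I \<subseteq> A}" "C \<in> {I \<in> F. I \<subseteq> A}"
  show "B \<inter> C \<noteq> {} \<Longrightarrow> B \<union> C \<in> {I \<in> F. I \<subseteq> A}" using BC union_member by auto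
  show "B \<inter> C \<noteq> {} \<Longrightarrow> B \<inter> C \<in> {I \<in> F. I \<subseteq> A}" using BC inter_member by auto
  show "crossing B C \<Longrightarrow> B - C \<in> {I \<in> F. I \<subseteq> A}" using BC diff_member by auto
qed

text \<open>A nontrivial member of maximal size misses exactly one point, since its complement is a
  member, and a member crossing that complement would enlarge it.\<close>

lemma ex_cosingleton:
  assumes "no_strong Y F" "\<not> prime_family Y F"
  obtains x where "x \<in> Y" "Y - {x} \<in> F" "card (Y - {x}) \<ge> 2"
proof -
  let ?P = "\<lambda>I. I \<in> F \<and> card I \<noteq> 1 \<and> I \<noteq> Y"
  obtain I0 where I0: "?P I0" using assms(2) unfolding prime_family_def by auto
  have bound: "card I < Suc (card Y)" if "I \<in> F" for I
    using card_mono[OF finite_ground member_subset[OF that]] by simp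
  have "\<exists>A. ?P A \<and> (\<forall>I. ?P I \<longrightarrow> card I \<le> card A)"
    by (rule ex_has_greatest_nat[of ?P I0 card "Suc (card Y)", OF I0]) (use bound in auto)
  then obtain A where A: "A \<in> F" "card A \<noteq> 1" "A \<noteq> Y"
    and A_max: "\<And>I. I \<in> F \<Longrightarrow> card I \<noteq> 1 \<Longrightarrow> I \<noteq> Y \<Longrightarrow> card I \<le> card A" by blast
  have A_pos: "card A > 0" using member_nonempty[OF A(1)] member_finite[OF A(1)]
    by (simp add: card_gt_0_iff)
  have A_top: "Y = C" if C: "C \<in> F" "A \<subset> C" for C
  proof (rule ccontr)
    assume ne: "Y \<noteq> C"
    have lt: "card A < card C" by (rule psubset_card_mono[OF member_finite[OF C(1)] C(2)])
    then have "card C \<noteq> 1" using A_pos by simp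
    then have "card C \<le> card A" using A_max[OF C(1)] ne by simp
    then show False using lt by simp
  qed
  obtain B where B: "B \<in> F" "crossing A B" using A assms(1) unfolding no_strong_def by blast
  have YAB: "Y = A \<union> B"
  proof (rule A_top)
    show "A \<union> B \<in> F" by (rule union_member[OF A(1) B(1)]) (use B(2) in \<open>simp add: crossing_def\<close>)
    show "A \<subset> A \<union> B" using B(2) by (auto simp: crossing_def)
  qed
  have cr: "crossing B A" using B(2) by (auto simp: crossing_def)
  have "B - A \<in> F" by (rule diff_member[OF B(1) A(1) cr])
  then have R: "Y - A \<in> F" using YAB by (simp add: Un_Diff)
  have "card (Y - A) = 1"
  proof (rule ccontr)
    assume c1: "card (Y - A) \<noteq> 1"
    have "A \<noteq> {}" by (rule member_nonempty[OF A(1)])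
    moreover have "A \<subseteq> Y" by (rule member_subset[OF A(1)])
    ultimately have "Y - A \<noteq> Y" by blast
    then obtain C where C: "C \<in> F" "crossing (Y - A) C"
      using assms(1) R c1 unfolding no_strong_def by blast
    have CY: "C \<subseteq> Y" by (rule member_subset[OF C(1)])
    have "A \<inter> C \<noteq> {}" using C(2) CY by (auto simp: crossing_def)
    then have "A \<union> C \<in> F" by (rule union_member[OF A(1) C(1)])
    moreover have "A \<subset> A \<union> C" using C(2) by (auto simp: crossing_def)
    ultimately have "Y = A \<union> C" by (rule A_top)
    then show False using C(2) by (auto simp: crossing_def)
  qed
  then obtain x where x: "Y - A = {x}" using card_1_singletonE by blast
  have AY: "A \<subseteq> Y" by (rule member_subset[OF A(1)])
  have Ax: "A = Y - {x}" using x AY by blast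
  have "card A \<ge> 2" using A(2) A_pos by linarith
  with x Ax A show ?thesis by (intro that[of x]) auto
qed

text \<open>A member \<open>B\<close> that crosses \<open>I\<close> in \<open>Y\<close> may contain
  \<open>x\<close>. Its trace on \<open>Y - {x}\<close> still crosses \<open>I\<close> unless that
  trace lies inside \<open>I\<close>; in this case the remainder \<open>Y - {x} - B\<close>, again a
  member, crosses \<open>I\<close>.\<close>

lemma no_strong_restrict:
  assumes ns: "no_strong Y F" and x: "x \<in> Y" and A: "Y - {x} \<in> F"
  shows "no_strong (Y - {x}) {I \<in> F. I \<subseteq> Y - {x}}"
  unfolding no_strong_def
proof (intro ballI impI)
  fix I assume I: "I \<in> {I \<in> F. I \<subseteq> Y - {x}}" and c: "card I \<noteq> 1" and ne: "I \<noteq> Y - {x}"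
  have "I \<noteq> Y" using I x by auto
  then obtain B where B: "B \<in> F" "crossing I B" using ns I c unfolding no_strong_def by blast
  show "\<exists>J\<in>{I \<in> F. I \<subseteq> Y - {x}}. crossing I J"
  proof (cases "x \<in> B")
    case False
    then have "B \<in> {I \<in> F. I \<subseteq> Y - {x}}" using B(1) member_subset[OF B(1)] by blast
    then show ?thesis using B(2) by blast
  next
    case True
    let ?J = "B \<inter> (Y - {x})"
    have BY: "B \<subseteq> Y" using B(1) member_subset by blast
    have meet: "I \<inter> ?J \<noteq> {}" using B(2) I unfolding crossing_def by blast
    then have "?J \<in> F" using inter_member[OF B(1) A] by blast
    have nsub: "\<not> I \<subseteq> ?J" using B(2) unfolding crossing_def by blast
    show ?thesis
    proof (cases "?J \<subseteq> I")
      case False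
      then have "crossing I ?J" using meet nsub unfolding crossing_def by blast
      then show ?thesis using \<open>?J \<in> F\<close> by blast
    next
      case sub: True
      have "crossing (Y - {x}) B" using True meet nsub I unfolding crossing_def by blast
      then have "Y - {x} - B \<in> F" using diff_member[OF A B(1)] by blast
      moreover have "crossing I (Y - {x} - B)"
        using sub meet nsub I ne unfolding crossing_def by blast
      ultimately show ?thesis by blast
    qed
  qed
qed

lemma star_member:
  assumes "finite I" "I \<noteq> {}" "\<And>i. i \<in> I \<Longrightarrow> {x, i} \<in> F" shows "insert x I \<in> F"
  using assms
proof (induction rule: finite_ne_induct)
  case (singleton i) then show ?case by simp
next
  case (insert i I)
  have "insert x I \<union> {x, i} \<in> F" using insert by (intro union_member) auto
  moreover have "insert x I \<union> {x, i} = insert x (insert i I)" by blast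
  ultimately show ?case by simp
qed

text \<open>A member that crosses \<open>Y - {x}\<close> meets it in a segment reaching one of the
  ends; the last assumption says that this is the low end, and callers negate the key otherwise.
  Then \<open>{x, lo}\<close> is a member and \<open>{x, hi}\<close> is not, so that every member
  through \<open>x\<close> continues with an initial segment and \<open>x\<close> becomes the new
  minimum.\<close>

lemma linear_extend:
  assumes x: "x \<in> Y" and AF: "Y - {x} \<in> F" and c3: "card (Y - {x}) \<ge> 3"
    and lin: "linear_family p (Y - {x}) {I \<in> F. I \<subseteq> Y - {x}}"
    and B: "B \<in> F" "crossing (Y - {x}) B"
    and down: "\<And>j c. j \<in> B - {x} \<Longrightarrow> c \<in> Y - {x} \<Longrightarrow> p c < p j \<Longrightarrow> c \<in> B"
  shows "\<exists>q. linear_family q Y F"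
proof -
  define A where "A = Y - {x}"
  have finA: "finite A" using finite_ground by (simp add: A_def)
  have neA: "A \<noteq> {}"
  proof
    assume "A = {}"
    then show False using c3 by (simp flip: A_def)
  qed
  have Y: "Y = insert x A" "x \<notin> A" using x by (auto simp: A_def)
  have AF': "A \<in> F" using AF by (simp add: A_def)
  have inj: "inj_on p A" using lin by (simp add: linear_family_def A_def)
  have mem: "I \<in> F \<longleftrightarrow> I \<noteq> {} \<and> convex_in p A I" if "I \<subseteq> A" for I
    using lin that unfolding linear_family_def A_def[symmetric] by blast
  obtain lo where lo: "lo \<in> A" "\<And>c. c \<in> A \<Longrightarrow> p lo \<le> p c"
  proof -
    have "Min (p ` A) \<in> p ` A" by (rule Min_in) (use finA neA in auto)
    then obtain l where "l \<in> A" "p l = Min (p ` A)" by auto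
    moreover have "\<And>c. c \<in> A \<Longrightarrow> Min (p ` A) \<le> p c" using finA by simp
    ultimately show thesis by (intro that[of l]) simp_all
  qed
  have lo_less: "p lo < p c" if "c \<in> A" "c \<noteq> lo" for c
    using lo(2)[OF that(1)] inj_onD[OF inj _ lo(1) that(1)] that(2) by (auto simp: order_less_le)
  obtain hi where hi: "hi \<in> A" "\<And>c. c \<in> A \<Longrightarrow> p c \<le> p hi"
  proof -
    have "Max (p ` A) \<in> p ` A" by (rule Max_in) (use finA neA in auto)
    then obtain l where "l \<in> A" "p l = Max (p ` A)" by auto
    moreover have "\<And>c. c \<in> A \<Longrightarrow> p c \<le> Max (p ` A)" using finA by simp
    ultimately show thesis by (intro that[of l]) simp_all
  qed
  have hi_less: "p c < p hi" if "c \<in> A" "c \<noteq> hi" for c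
    using hi(2)[OF that(1)] inj_onD[OF inj _ that(1) hi(1)] that(2) by (auto simp: order_less_le)
  have BY: "B \<subseteq> Y" by (rule member_subset[OF B(1)])
  have cr: "A \<inter> B \<noteq> {}" "\<not> A \<subseteq> B" "x \<in> B"
    using B(2) BY Y unfolding crossing_def A_def[symmetric] by blast+
  obtain j where j: "j \<in> A" "j \<in> B" using cr(1) by blast
  have loB: "lo \<in> B"
  proof (cases "j = lo")
    case False
    then show ?thesis using down[of j lo] lo_less[OF j(1)] lo(1) j Y(2) by (auto simp: A_def)
  qed (use j in simp)
  text \<open>Cutting all but one end element off a member that contains \<open>x\<close> and this element.\<close>
  have pair: "{x, e} \<in> F" if C: "C \<in> F" "x \<in> C" "e \<in> C" "e \<in> A" "\<not> A \<subseteq> C"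
    and cv: "convex_in p A (A - {e})" for C e
  proof (cases "C = {x, e}")
    case False
    have CY: "C \<subseteq> Y" by (rule member_subset[OF C(1)])
    have "A - {e} \<noteq> {}" using C by blast
    then have D: "A - {e} \<in> F" using mem[of "A - {e}"] cv by blast
    have "crossing C (A - {e})" unfolding crossing_def using False C CY Y by blast
    then have "C - (A - {e}) \<in> F" using diff_member[OF C(1) D] by blast
    moreover have "C - (A - {e}) = {x, e}" using C CY Y by blast
    ultimately show ?thesis by simp
  qed (use C in simp)
  have xlo: "{x, lo} \<in> F"
  proof (rule pair[OF B(1) cr(3) loB lo(1) cr(2)])
    show "convex_in p A (A - {lo})" unfolding convex_in_def using lo_less lo(1) by fastforce
  qed
  have lohi: "lo \<noteq> hi"
  proof
    assume "lo = hi"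
    then have "A \<subseteq> {lo}" using lo_less hi(2) by fastforce
    then have "card A \<le> 1" using card_mono[of "{lo}" A] by simp
    then show False using c3 by (simp add: A_def)
  qed
  \<comment> \<open>Together with \<open>{x, lo}\<close> it would leave the trace
    \<open>{lo, hi}\<close> on \<open>A\<close>. This is not convex, because \<open>A\<close> has a
    third point.\<close>
  have xhi: "{x, hi} \<notin> F"
  proof
    assume xh: "{x, hi} \<in> F"
    have "{x, lo} \<union> {x, hi} \<in> F" by (rule union_member[OF xlo xh]) simp
    then have "({x, lo} \<union> {x, hi}) \<inter> A \<in> F"
      by (rule inter_member[OF _ AF']) (use lo in blast)
    moreover have "({x, lo} \<union> {x, hi}) \<inter> A = {lo, hi}" using lo(1) hi(1) Y(2) by blast
    ultimately have "{lo, hi} \<in> F" by simp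
    then have cv: "convex_in p A {lo, hi}" using mem[of "{lo, hi}"] lo(1) hi(1) by blast
    have "\<not> A \<subseteq> {lo, hi}"
    proof
      assume "A \<subseteq> {lo, hi}"
      then have "card A \<le> 2" using card_mono[of "{lo, hi}" A] lohi by simp
      then show False using c3 by (simp add: A_def)
    qed
    then obtain c where c: "c \<in> A" "c \<noteq> lo" "c \<noteq> hi" by blast
    then show False using cv lo_less[OF c(1,2)] hi_less[OF c(1,3)]
      unfolding convex_in_def by blast
  qed
  \<comment> \<open>If \<open>C\<close> misses some \<open>c\<close> below \<open>i\<close>,
    convexity of \<open>A - C\<close> forces \<open>hi\<close> into \<open>C\<close>, and cutting
    \<open>C\<close> down yields the excluded pair \<open>{x, hi}\<close>.\<close>
  have downC: "c \<in> C" if C: "C \<in> F" "x \<in> C" and i: "i \<in> C" "i \<in> A" and c: "c \<in> A" "p c < p i"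
    for C i c
  proof (rule ccontr)
    assume nc: "c \<notin> C"
    have CY: "C \<subseteq> Y" by (rule member_subset[OF C(1)])
    have crA: "crossing A C" unfolding crossing_def using C i nc c Y by blast
    have "A - C \<in> F" by (rule diff_member[OF AF' C(1) crA])
    then have cv1: "convex_in p A (A - C)" using mem[of "A - C"] by blast
    have "A \<inter> C \<in> F" by (rule inter_member[OF AF' C(1)]) (use i in blast)
    then have cv2: "convex_in p A (A \<inter> C)" using mem[of "A \<inter> C"] by blast
    have "hi \<in> C"
    proof (rule ccontr)
      assume h: "hi \<notin> C"
      have "p i < p hi" by (rule hi_less) (use i h in auto)
      then have "i \<in> A - C" using cv1 c nc hi(1) h i(2) unfolding convex_in_def by blast
      then show False using i by simp
    qed
    have "{x, hi} \<in> F"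
    proof (rule pair[OF C \<open>hi \<in> C\<close> hi(1)])
      show "\<not> A \<subseteq> C" using nc c(1) by blast
      show "convex_in p A (A - {hi})" unfolding convex_in_def using hi_less hi(1) by fastforce
    qed
    then show False using xhi by simp
  qed
  \<comment> \<open>The value \<open>p lo - 1\<close> puts \<open>x\<close> below all of
    \<open>A\<close>.\<close>
  define q where "q = p(x := p lo - 1)"
  have qA: "q c = p c" if "c \<in> A" for c using that Y(2) by (auto simp: q_def)
  have qx: "q x < q c" if "c \<in> A" for c using lo(2)[OF that] qA[OF that] by (simp add: q_def)
  have injq: "inj_on q Y"
  proof (rule inj_onI)
    fix a b assume ab: "a \<in> Y" "b \<in> Y" "q a = q b"
    show "a = b"
    proof (cases "a \<in> A \<and> b \<in> A")
      case True
      then show ?thesis using inj_onD[OF inj, of a b] ab(3) qA by simp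
    next
      case False
      then have "a = x \<or> b = x" using ab Y(1) by blast
      then show ?thesis using qx[of a] qx[of b] ab Y(1) by (metis insertE less_irrefl)
    qed
  qed
  have "I \<in> F \<longleftrightarrow> I \<noteq> {} \<and> convex_in q Y I" if IY: "I \<subseteq> Y" for I
  proof (cases "x \<in> I")
    case False
    then have IA: "I \<subseteq> A" using IY Y by blast
    have "convex_in q Y I \<longleftrightarrow> convex_in p A I"
    proof -
      have q: "q a = p a" if "a \<in> I" for a using that IA qA by blast
      have "\<not> q a < q x" if "a \<in> I" for a using qx[of a] that IA by auto
      then have "convex_in q Y I \<longleftrightarrow>
          (\<forall>a\<in>I. \<forall>b\<in>I. \<forall>c\<in>A. q a < q c \<longrightarrow> q c < q b \<longrightarrow> c \<in> I)"
        unfolding convex_in_def Y(1) by blast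
      then show ?thesis unfolding convex_in_def by (simp add: q qA cong: ball_cong)
    qed
    then show ?thesis using mem[OF IA] by simp
  next
    case True
    show ?thesis
    proof
      assume I: "I \<in> F"
      have "convex_in q Y I" unfolding convex_in_def
      proof (intro ballI impI)
        fix a b c assume abc: "a \<in> I" "b \<in> I" "c \<in> Y" "q a < q c" "q c < q b"
        show "c \<in> I"
        proof (cases "c = x \<or> b = x")
          case True
          then show ?thesis using \<open>x \<in> I\<close> abc qx[of c] Y(1) by auto
        next
          case False
          then have "c \<in> A" "b \<in> A" using abc IY Y(1) by auto
          then show ?thesis using downC[OF I \<open>x \<in> I\<close> abc(2)] abc(5) qA by simp
        qed
      qed
      then show "I \<noteq> {} \<and> convex_in q Y I" using True by blast
    next
      assume cv: "I \<noteq> {} \<and> convex_in q Y I"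
      show "I \<in> F"
      proof (cases "I = {x}")
        case True then show ?thesis using singleton_member[OF x] by simp
      next
        case ne: False
        then obtain i where i: "i \<in> I" "i \<in> A" using True IY Y by blast
        have lower: "c \<in> I" if "c \<in> A" "p c < p b" "b \<in> I" "b \<in> A" for b c
          using cv True that qA qx[of c] Y(1) unfolding convex_in_def
          by (metis insertCI)
        have "convex_in p A (I \<inter> A)" unfolding convex_in_def using lower by blast
        then have IA: "I \<inter> A \<in> F" using mem[of "I \<inter> A"] i by blast
        have "lo \<in> I" using lower[OF lo(1) _ i] lo_less[OF i(2)] i(1) by blast
        then have "{x, lo} \<union> (I \<inter> A) \<in> F"
          by (intro union_member[OF xlo IA]) (use lo in blast)
        moreover have "{x, lo} \<union> (I \<inter> A) = I" using True IY Y \<open>lo \<in> I\<close> by blast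
        ultimately show ?thesis by simp
      qed
    qed
  qed
  then have "F = {I. I \<subseteq> Y \<and> I \<noteq> {} \<and> convex_in q Y I}" using member_subset by blast
  then show ?thesis using injq unfolding linear_family_def by blast
qed

text \<open>If all pairs \<open>{x, i}\<close> are members, unions of them give every set through
  \<open>x\<close>. Otherwise \<open>{x, j}\<close> is a member and some \<open>{x, a}\<close> is
  not. A third point \<open>b\<close> of \<open>Y - {x}\<close> would produce \<open>{x, a}\<close>
  as \<open>{x, j, a} - {j, b}\<close>, so there is none, and \<open>Y\<close> is the line
  \<open>x\<close>, \<open>j\<close>, \<open>a\<close>.\<close>

lemma complete_extend:
  assumes x: "x \<in> Y" and AF: "Y - {x} \<in> F" and c2: "card (Y - {x}) \<ge> 2"
    and com: "complete_family (Y - {x}) {I \<in> F. I \<subseteq> Y - {x}}"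
    and B: "B \<in> F" "crossing (Y - {x}) B"
  shows "complete_family Y F \<or> (\<exists>q. linear_family q Y F)"
proof -
  define A where "A = Y - {x}"
  have finA: "finite A" using finite_ground by (simp add: A_def)
  have Y: "Y = insert x A" "x \<notin> A" using x by (auto simp: A_def)
  have mem: "I \<in> F" if "I \<subseteq> A" "I \<noteq> {}" for I
    using com that unfolding complete_family_def A_def[symmetric] by blast
  have BY: "B \<subseteq> Y" by (rule member_subset[OF B(1)])
  have cr: "A \<inter> B \<noteq> {}" "\<not> A \<subseteq> B" "x \<in> B"
    using B(2) BY Y unfolding crossing_def A_def[symmetric] by blast+
  obtain j where j: "j \<in> A" "j \<in> B" using cr(1) by blast
  \<comment> \<open>All points of \<open>A\<close> except \<open>j\<close> form a member; removing
    it from \<open>B\<close> leaves the pair.\<close>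
  have xj: "{x, j} \<in> F"
  proof (cases "B = {x, j}")
    case False
    have "crossing B (A - {j})" unfolding crossing_def using False j cr BY Y by blast
    moreover have "A - {j} \<in> F" by (rule mem) (use cr j in blast)+
    ultimately have "B - (A - {j}) \<in> F" using diff_member[OF B(1)] by blast
    moreover have "B - (A - {j}) = {x, j}" using j cr BY Y by blast
    ultimately show ?thesis by simp
  qed (use B in simp)
  show ?thesis
  proof (cases "\<forall>i\<in>A. {x, i} \<in> F")
    case True
    have "I \<in> F" if "I \<subseteq> Y" "I \<noteq> {}" for I
    proof (cases "x \<in> I \<and> I \<noteq> {x}")
      case xI: True
      have "finite (I - {x})" using finA that Y by (meson finite_Diff finite_insert finite_subset)
      then have "insert x (I - {x}) \<in> F"
        by (rule star_member) (use xI True that Y in blast)+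
      then show ?thesis using xI by (simp add: insert_absorb)
    next
      case False
      show ?thesis
      proof (cases "I = {x}")
        case True then show ?thesis using singleton_member[OF x] by simp
      next
        case ne: False
        then have "I \<subseteq> A" using False that Y by blast
        then show ?thesis using mem that by blast
      qed
    qed
    then have "F = Pow Y - {{}}" using member_subset member_nonempty by blast
    then show ?thesis unfolding complete_family_def by blast
  next
    case False
    then obtain a where a: "a \<in> A" "{x, a} \<notin> F" by blast
    have aj: "a \<noteq> j" using a xj by blast
    have A2: "A = {j, a}"
    proof (rule ccontr)
      assume "A \<noteq> {j, a}"
      then obtain b where b: "b \<in> A" "b \<noteq> j" "b \<noteq> a" using a j by blast
      have ja: "{j, a} \<in> F" and jb: "{j, b} \<in> F" using mem a j b by auto
      have u: "{x, j} \<union> {j, a} \<in> F" by (rule union_member[OF xj ja]) simp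
      have "crossing ({x, j} \<union> {j, a}) {j, b}" unfolding crossing_def using b a j Y by blast
      then have "({x, j} \<union> {j, a}) - {j, b} \<in> F" using diff_member[OF u jb] by blast
      moreover have "({x, j} \<union> {j, a}) - {j, b} = {x, a}" using b a j aj Y by blast
      ultimately show False using a by simp
    qed
    \<comment> \<open>The key puts \<open>j\<close> in the middle, since \<open>{x, a}\<close> is
      the only nonempty set that fails to be a member.\<close>
    define q :: "'a \<Rightarrow> int" where "q = (\<lambda>y. if y = x then 0 else if y = j then 1 else 2)"
    have d: "x \<noteq> j" "x \<noteq> a" using Y(2) j a by auto
    have Y3: "Y = {x, j, a}" using A2 Y by simp
    have inj: "inj_on q Y" unfolding Y3 q_def using d aj by (auto simp: inj_on_def)
    have "I \<in> F \<longleftrightarrow> I \<noteq> {} \<and> convex_in q Y I" if IY: "I \<subseteq> Y" for I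
    proof -
      have cv: "convex_in q Y I \<longleftrightarrow> (x \<in> I \<longrightarrow> a \<in> I \<longrightarrow> j \<in> I)"
        unfolding convex_in_def Y3 q_def using d aj IY Y3 by auto
      have sub: "I \<subseteq> {x, j, a}" using IY Y3 by simp
      consider "I \<subseteq> A" | "I = {x}" | "I = {x, j}" | "I = {x, a}" | "I = Y"
        unfolding A2 Y3 using sub by blast
      then show ?thesis
      proof cases
        case 1
        then have "x \<notin> I" using Y(2) by blast
        then show ?thesis using cv mem[OF 1] member_nonempty[of I] by blast
      next
        case 2 then show ?thesis using cv singleton_member[OF x] d by simp
      next
        case 3 then show ?thesis using cv xj by simp
      next
        case 4 then show ?thesis using cv a d aj by simp
      next
        case 5
        have "Y \<noteq> {}" using x by blast
        then show ?thesis using cv 5 ground_member Y3 by simp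
      qed
    qed
    then have "F = {I. I \<subseteq> Y \<and> I \<noteq> {} \<and> convex_in q Y I}" using member_subset by blast
    then show ?thesis using inj unfolding linear_family_def by blast
  qed
qed

end

text \<open>Induction on the size: the point missed by a largest nontrivial member is taken away,
  and a member crossing the remaining set says how the point is attached again. The three cases are
  not exclusive; on two points they coincide, which is why \<open>card A = 2\<close> is treated as
  complete.\<close>

theorem no_strong_trichotomy:
  assumes "weakly_partitive K G" "no_strong K G"
  shows "prime_family K G \<or> complete_family K G \<or> (\<exists>p. linear_family p K G)"
  using assms
proof (induction "card K" arbitrary: K G rule: less_induct)
  case less
  interpret weakly_partitive K G by (rule less.prems)
  show ?case
  proof (cases "prime_family K G")
    case False
    then obtain x where x: "x \<in> K" "K - {x} \<in> G" "card (K - {x}) \<ge> 2"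
      using ex_cosingleton[OF less.prems(2)] by blast
    define A where "A = K - {x}"
    define GA where "GA = {I \<in> G. I \<subseteq> A}"
    have wA: "weakly_partitive A GA" unfolding GA_def A_def by (rule restrict[OF x(2)])
    have nA: "no_strong A GA" unfolding GA_def A_def
      by (rule no_strong_restrict[OF less.prems(2) x(1,2)])
    have cA: "card A < card K" unfolding A_def by (rule card_Diff1_less[OF finite_ground x(1)])
    have AK: "A \<noteq> K" "card A \<noteq> 1" using x by (auto simp: A_def)
    then obtain B where B: "B \<in> G" "crossing A B"
      using less.prems(2) x(2) unfolding no_strong_def A_def[symmetric] by blast
    have AG: "A \<in> G" using x(2) by (simp add: A_def)
    have finA: "finite A" using finite_ground by (simp add: A_def)
    show ?thesis
    proof (cases "card A = 2")
      case True
      then obtain a b where ab: "A = {a, b}" "a \<noteq> b" by (meson card_2_iff)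
      have "a \<in> K" "b \<in> K" using ab by (auto simp: A_def)
      then have "{a} \<in> G" "{b} \<in> G" by (simp_all add: singleton_member)
      moreover have "I \<in> GA \<longleftrightarrow> I \<in> G \<and> I \<subseteq> {a, b}" for I by (simp add: GA_def ab)
      moreover have "Pow {a, b} - {{}} = {{a}, {b}, {a, b}}" by auto
      ultimately have "complete_family A GA"
        unfolding complete_family_def GA_def using AG member_nonempty ab by auto
      then have "complete_family K G \<or> (\<exists>q. linear_family q K G)"
        unfolding GA_def A_def by (rule complete_extend[OF x _ B[unfolded A_def]])
      then show ?thesis by blast
    next
      case False
      then have c3: "card A \<ge> 3" using x(3) unfolding A_def[symmetric] by linarith
      \<comment> \<open>\<open>B\<close> splits \<open>A\<close> into two proper members, which in a
        prime family would both be singletons.\<close>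
      have "\<not> prime_family A GA"
      proof
        assume pr: "prime_family A GA"
        have BK: "A \<inter> B \<noteq> {}" "A - B \<noteq> {}" using B(2) unfolding crossing_def by blast+
        have "A - B \<in> G" by (rule diff_member[OF AG B])
        then have "A - B \<in> GA" by (simp add: GA_def)
        moreover have "A - B \<noteq> A" using BK by blast
        ultimately have 1: "card (A - B) = 1" using pr unfolding prime_family_def by blast
        have "A \<inter> B \<in> G" by (rule inter_member[OF AG B(1) BK(1)])
        then have "A \<inter> B \<in> GA" by (simp add: GA_def)
        moreover have "A \<inter> B \<noteq> A" using BK by blast
        ultimately have 2: "card (A \<inter> B) = 1" using pr unfolding prime_family_def by blast
        have "card A = card (A \<inter> B) + card (A - B)"
          using finA by (simp add: card_Int_Diff)
        then show False using 1 2 c3 by simp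
      qed
      then consider "complete_family A GA" | p where "linear_family p A GA"
        using less.hyps[OF cA wA nA] by blast
      then show ?thesis
      proof cases
        case 1
        then have "complete_family K G \<or> (\<exists>q. linear_family q K G)"
          unfolding GA_def A_def by (rule complete_extend[OF x _ B[unfolded A_def]])
        then show ?thesis by blast
      next
        case (2 p)
        have AB: "A \<inter> B \<noteq> {}" "A - B \<noteq> {}" using B(2) unfolding crossing_def by blast+
        have "A - B \<in> GA" using diff_member[OF AG B] by (simp add: GA_def)
        then have cv1: "convex_in p A (A - B)" using 2 unfolding linear_family_def by blast
        have "A \<inter> B \<in> GA" using inter_member[OF AG B(1) AB(1)] by (simp add: GA_def)
        then have cv2: "convex_in p A (A \<inter> B)" using 2 unfolding linear_family_def by blast
        have xA: "i \<in> A \<and> i \<in> B" if "i \<in> B - {x}" for i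
          using that member_subset[OF B(1)] by (auto simp: A_def)
        have lin: "linear_family p (K - {x}) {I \<in> G. I \<subseteq> K - {x}}"
          using 2 by (simp add: GA_def A_def)
        have c3': "card (K - {x}) \<ge> 3" using c3 by (simp add: A_def)
        have "\<exists>q. linear_family q K G"
        proof (cases "\<forall>j\<in>A \<inter> B. \<forall>c\<in>A. p c < p j \<longrightarrow> c \<in> B")
          case True
          show ?thesis
            by (rule linear_extend[OF x(1,2) c3' lin B[unfolded A_def]])
              (use True xA in \<open>unfold A_def[symmetric], blast\<close>)
        next
          case False
          then obtain j c where jc: "j \<in> A" "j \<in> B" "c \<in> A" "p c < p j" "c \<notin> B" by blast
          \<comment> \<open>\<open>A \<inter> B\<close> and \<open>A - B\<close> are both convex, so
            \<open>B\<close> takes either an initial or a final segment of \<open>A\<close>. Here it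
            is a final one, and the negated key makes it initial.\<close>
          have up: "d \<in> B" if "i \<in> A" "i \<in> B" "d \<in> A" "p i < p d" for i d
          proof (rule ccontr)
            assume d: "d \<notin> B"
            show False
            proof (cases "p c < p i")
              case True
              then show False using cv1 that jc d unfolding convex_in_def by blast
            next
              case False
              then have "p i < p c"
                using that jc 2 unfolding linear_family_def inj_on_def by (metis linorder_neqE)
              then show False using cv2 that jc unfolding convex_in_def by blast
            qed
          qed
          show ?thesis
            by (rule linear_extend[OF x(1,2) c3' linear_family_uminus[OF lin] B[unfolded A_def]])
              (use up xA in \<open>unfold A_def[symmetric] neg_less_iff_less, blast\<close>)
        qed
        then show ?thesis by blast
      qed
    qed
  qed simp
qed

section \<open>Strong members, least members, and the quotient at a strong member\<close>

context weakly_partitive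
begin

definition strong :: "'a set \<Rightarrow> bool" where
  "strong S \<longleftrightarrow> S \<in> F \<and> (\<forall>A\<in>F. \<not> crossing S A)"

text \<open>An intersection over no sets is \<open>UNIV\<close>; the definition is meaningful for
  points of \<open>Y\<close>, where the ground set itself is among the candidates. The same holds
  for \<open>strong_hull\<close>.\<close>

definition least :: "'a \<Rightarrow> 'a \<Rightarrow> 'a set" where
  "least a b = \<Inter>{A \<in> F. a \<in> A \<and> b \<in> A}"

definition strong_hull :: "'a \<Rightarrow> 'a \<Rightarrow> 'a set" where
  "strong_hull a b = \<Inter>{A. strong A \<and> a \<in> A \<and> b \<in> A}"

text \<open>The strong sets through \<open>x\<close> form a chain, so the union is simply the
  largest of those strictly inside \<open>N\<close>.\<close>

definition child :: "'a set \<Rightarrow> 'a \<Rightarrow> 'a set" where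
  "child N x = \<Union>{S. strong S \<and> S \<subset> N \<and> x \<in> S}"

definition quotient :: "'a set \<Rightarrow> 'a set set set" where
  "quotient N = {I. I \<subseteq> child N ` N \<and> I \<noteq> {} \<and> \<Union>I \<in> F}"

lemma finite_F: "finite F"
proof (rule finite_subset)
  show "F \<subseteq> Pow Y" using member_subset by blast
qed (simp add: finite_ground)

lemma Inter_member:
  assumes "C \<subseteq> F" "C \<noteq> {}" "x \<in> \<Inter>C" shows "\<Inter>C \<in> F"
proof -
  have "finite C" using finite_subset[OF assms(1) finite_F] .
  then show ?thesis using assms(2,1,3)
  proof (induction rule: finite_ne_induct)
    case (insert A C)
    have "\<Inter>C \<in> F" using insert by auto
    then have "A \<inter> \<Inter>C \<in> F" by (rule inter_member[rotated]) (use insert.prems in auto)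
    then show ?case by simp
  qed simp
qed

lemma least_member:
  assumes "a \<in> Y" "b \<in> Y" shows "least a b \<in> F" "a \<in> least a b" "b \<in> least a b"
proof -
  have "Y \<in> F" using ground_member assms by blast
  then have "Y \<in> {A \<in> F. a \<in> A \<and> b \<in> A}" using assms by simp
  then show "least a b \<in> F" unfolding least_def
    by (intro Inter_member[of _ a]) auto
  show "a \<in> least a b" "b \<in> least a b" by (auto simp: least_def)
qed

lemma least_subset: "A \<in> F \<Longrightarrow> a \<in> A \<Longrightarrow> b \<in> A \<Longrightarrow> least a b \<subseteq> A"
  by (auto simp: least_def)

lemma least_commute: "least a b = least b a"
  unfolding least_def by (rule arg_cong[of _ _ Inter]) blast

lemma strongD: "strong S \<Longrightarrow> S \<in> F" by (simp add: strong_def)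

lemma strong_cases:
  assumes "strong S" "A \<in> F" "x \<in> S" "x \<in> A" shows "S \<subseteq> A \<or> A \<subseteq> S"
  using assms unfolding strong_def crossing_def by blast

lemma strong_singleton: "a \<in> Y \<Longrightarrow> strong {a}"
  unfolding strong_def crossing_def by (auto simp: singleton_member)

lemma strong_ground: "Y \<noteq> {} \<Longrightarrow> strong Y"
  unfolding strong_def crossing_def using ground_member member_subset by blast

text \<open>Strong sets with a common point are nested, so a finite collection of them contains its
  own intersection.\<close>

lemma strong_Inter:
  assumes "\<And>S. S \<in> C \<Longrightarrow> strong S" "C \<noteq> {}" "x \<in> \<Inter>C" shows "\<Inter>C \<in> C"
proof -
  have CF: "C \<subseteq> F" using assms(1) strongD by blast
  have fin: "finite C" by (rule finite_subset[OF CF finite_F])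
  obtain S where S: "S \<in> C" "\<And>T. T \<in> C \<Longrightarrow> \<not> T \<subset> S"
    using finite_has_minimal[OF fin assms(2)] by (metis psubsetE)
  have "S \<subseteq> T" if T: "T \<in> C" for T
    using strong_cases[OF assms(1)[OF S(1)] strongD[OF assms(1)[OF T]], of x] assms(3) S T by blast
  then have "\<Inter>C = S" using S(1) by blast
  then show ?thesis using S(1) by simp
qed

lemma hull_strong:
  assumes "a \<in> Y" "b \<in> Y" shows "strong (strong_hull a b)" "a \<in> strong_hull a b" "b \<in> strong_hull a b"
proof -
  have "Y \<in> {A. strong A \<and> a \<in> A \<and> b \<in> A}" using assms strong_ground by blast
  then have "strong_hull a b \<in> {A. strong A \<and> a \<in> A \<and> b \<in> A}"
    unfolding strong_hull_def by (intro strong_Inter[of _ a]) auto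
  then show "strong (strong_hull a b)" "a \<in> strong_hull a b" "b \<in> strong_hull a b" by auto
qed

lemma hull_subset: "strong S \<Longrightarrow> a \<in> S \<Longrightarrow> b \<in> S \<Longrightarrow> strong_hull a b \<subseteq> S"
  by (auto simp: strong_hull_def)

lemma hull_same: "a \<in> Y \<Longrightarrow> strong_hull a a = {a}"
  using hull_subset[OF strong_singleton, of a a a] hull_strong(2)[of a a] by blast

lemma least_subset_hull: "a \<in> Y \<Longrightarrow> b \<in> Y \<Longrightarrow> least a b \<subseteq> strong_hull a b"
  using least_subset[OF strongD[OF hull_strong(1)], of a b] hull_strong[of a b] by blast

lemma least_same: "a \<in> Y \<Longrightarrow> least a a = {a}"
  using least_subset_hull[of a a] hull_same[of a] least_member(2)[of a a] by blast

end

text \<open>The children of \<open>N\<close> are its maximal proper strong subsets.\<close>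

locale strong_node = weakly_partitive +
  fixes N
  assumes N: "strong N" and N2: "card N \<ge> 2"
begin

lemma N_subset: "N \<subseteq> Y" by (rule member_subset[OF strongD[OF N]])

lemma N_finite: "finite N" by (rule member_finite[OF strongD[OF N]])

lemma child:
  assumes "x \<in> N" shows "strong (child N x)" "child N x \<subset> N" "x \<in> child N x"
    "\<And>S. strong S \<Longrightarrow> S \<subset> N \<Longrightarrow> x \<in> S \<Longrightarrow> S \<subseteq> child N x"
proof -
  let ?C = "{S. strong S \<and> S \<subset> N \<and> x \<in> S}"
  have "N \<noteq> {x}" using N2 by auto
  then have ne: "{x} \<in> ?C" using assms strong_singleton N_subset by blast
  have "?C \<subseteq> F" using strongD by blast
  then have fin: "finite ?C" by (rule finite_subset[OF _ finite_F])
  obtain S where S: "S \<in> ?C" "\<And>T. T \<in> ?C \<Longrightarrow> \<not> S \<subset> T"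
    using finite_has_maximal[OF fin] ne by (metis (no_types, lifting) empty_iff psubsetE)
  have "T \<subseteq> S" if T: "T \<in> ?C" for T
  proof -
    have "strong S" "T \<in> F" "x \<in> S" "x \<in> T" using S(1) T strongD by blast+
    then have "S \<subseteq> T \<or> T \<subseteq> S" by (rule strong_cases)
    then show ?thesis using S(2)[OF T] by blast
  qed
  then have "child N x = S" unfolding child_def using S(1) by blast
  then show "strong (child N x)" "child N x \<subset> N" "x \<in> child N x" using S(1) by auto
  show "\<And>S. strong S \<Longrightarrow> S \<subset> N \<Longrightarrow> x \<in> S \<Longrightarrow> S \<subseteq> child N x"
    unfolding child_def by blast
qed

lemma child_eq:
  assumes "x \<in> N" "y \<in> child N x" shows "child N y = child N x"
proof -
  have yN: "y \<in> N" using assms child(2) by blast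
  have 1: "child N x \<subseteq> child N y" by (rule child(4)[OF yN child(1,2)[OF assms(1)] assms(2)])
  then have "x \<in> child N y" using child(3)[OF assms(1)] by blast
  then have "child N y \<subseteq> child N x" by (rule child(4)[OF assms(1) child(1,2)[OF yN]])
  with 1 show ?thesis by blast
qed

lemma child_mem_iff:
  assumes "x \<in> N" "y \<in> N" shows "y \<in> child N x \<longleftrightarrow> child N x = child N y"
  using assms child_eq[OF assms(1)] child(3)[OF assms(2)] by blast

lemma child_disjoint:
  assumes "C \<in> child N ` N" "D \<in> child N ` N" "x \<in> C" "x \<in> D" shows "C = D"
  using assms child_eq by (metis imageE)

lemma Union_children: "\<Union>(child N ` N) = N" using child(2,3) by blast

lemma mem_Union_children:
  assumes "I \<subseteq> child N ` N" "x \<in> N" shows "x \<in> \<Union>I \<longleftrightarrow> child N x \<in> I"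
proof
  assume "x \<in> \<Union>I"
  then obtain C where "C \<in> I" "x \<in> C" by blast
  moreover have "C = child N x"
    by (rule child_disjoint) (use calculation assms child(3) in auto)
  ultimately show "child N x \<in> I" by simp
next
  assume "child N x \<in> I"
  then show "x \<in> \<Union>I" using child(3)[OF assms(2)] by blast
qed

lemma Union_subset: "I \<subseteq> child N ` N \<Longrightarrow> \<Union>I \<subseteq> N"
  using Union_children by blast

text \<open>This links nodes to pairs of points: a strong set with at least two points is the hull
  of any two points from different children, and three points whose pairs have the same hull lie in
  three children of it.\<close>

lemma hull_eq_iff:
  assumes "x \<in> N" "y \<in> N" shows "strong_hull x y = N \<longleftrightarrow> child N x \<noteq> child N y"
proof
  assume h: "strong_hull x y = N"
  show "child N x \<noteq> child N y"
  proof
    assume "child N x = child N y"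
    then have "y \<in> child N x" using child(3)[OF assms(2)] by simp
    then have "strong_hull x y \<subseteq> child N x" by (rule hull_subset[OF child(1)[OF assms(1)] child(3)[OF assms(1)]])
    then show False using h child(2)[OF assms(1)] by blast
  qed
next
  assume ne: "child N x \<noteq> child N y"
  have Yx: "x \<in> Y" "y \<in> Y" using assms N_subset by auto
  have sub: "strong_hull x y \<subseteq> N" by (rule hull_subset[OF N assms])
  show "strong_hull x y = N"
  proof (rule ccontr)
    assume "strong_hull x y \<noteq> N"
    then have "strong_hull x y \<subseteq> child N x"
      using child(4)[OF assms(1) hull_strong(1)[OF Yx]] hull_strong(2)[OF Yx] sub by blast
    then have "y \<in> child N x" using hull_strong(3)[OF Yx] by blast
    then show False using ne child_mem_iff[OF assms] by simp
  qed
qed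

lemma ex_hull: "\<exists>a\<in>N. \<exists>b\<in>N. a \<noteq> b \<and> strong_hull a b = N"
proof -
  obtain a where a: "a \<in> N" using N2 by fastforce
  then obtain b where b: "b \<in> N" "b \<notin> child N a" using child(2) by blast
  then have "child N a \<noteq> child N b" using child(3)[OF b(1)] by blast
  then have "strong_hull a b = N" using hull_eq_iff[OF a b(1)] by blast
  moreover have "a \<noteq> b" using child(3)[OF a] b(2) by blast
  ultimately show ?thesis using a b(1) by blast
qed

text \<open>Once \<open>A\<close> is not contained in a single child, every child that it meets is
  comparable with it by strength, and hence is contained in \<open>A\<close>.\<close>

lemma member_cases:
  assumes A: "A \<in> F" "A \<subseteq> N" "x \<in> A" "\<not> A \<subseteq> child N x"
  shows "A = \<Union>(child N ` A)"
proof
  show "A \<subseteq> \<Union>(child N ` A)" using child(3) A(2) by blast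
  show "\<Union>(child N ` A) \<subseteq> A"
  proof clarify
    fix y z assume y: "y \<in> A" and z: "z \<in> child N y"
    have yN: "y \<in> N" and xN: "x \<in> N" using y A by auto
    have "\<not> A \<subseteq> child N y"
      using A(3,4) child_mem_iff[OF yN xN] by auto
    then have "child N y \<subseteq> A"
      using strong_cases[OF child(1)[OF yN] A(1) child(3)[OF yN] y] by blast
    then show "z \<in> A" using z by blast
  qed
qed

text \<open>Children are nonempty and disjoint, so \<open>Union\<close> commutes with intersections
  and differences of sets of children and preserves crossing.\<close>

lemma quotient_weakly_partitive: "weakly_partitive (child N ` N) (quotient N)"
proof
  let ?K = "child N ` N"
  show "finite ?K" using N_finite by simp
  show "\<And>A. A \<in> quotient N \<Longrightarrow> A \<subseteq> ?K" "\<And>A. A \<in> quotient N \<Longrightarrow> A \<noteq> {}"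
    by (auto simp: quotient_def)
  show "?K \<noteq> {} \<Longrightarrow> ?K \<in> quotient N"
    using strongD[OF N] unfolding quotient_def by (simp add: Union_children)
  show "{a} \<in> quotient N" if "a \<in> ?K" for a
    using that child(1) strongD by (auto simp: quotient_def)
  fix A B assume AB: "A \<in> quotient N" "B \<in> quotient N"
  have K: "A \<subseteq> ?K" "B \<subseteq> ?K" "\<Union>A \<in> F" "\<Union>B \<in> F" using AB by (auto simp: quotient_def)
  have ne: "C \<noteq> {}" if "C \<in> ?K" for C using that child(3) by blast
  have Int: "\<Union>(A \<inter> B) = \<Union>A \<inter> \<Union>B"
  proof
    show "\<Union>A \<inter> \<Union>B \<subseteq> \<Union>(A \<inter> B)"
    proof clarify
      fix x C D assume "x \<in> C" "C \<in> A" "x \<in> D" "D \<in> B"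
      moreover then have "C = D" using child_disjoint[of C D x] K by blast
      ultimately show "x \<in> \<Union>(A \<inter> B)" by blast
    qed
  qed blast
  have Diff: "\<Union>(A - B) = \<Union>A - \<Union>B"
  proof
    show "\<Union>(A - B) \<subseteq> \<Union>A - \<Union>B"
    proof clarify
      fix x C assume xC: "x \<in> C" "C \<in> A" "C \<notin> B"
      have "x \<notin> \<Union>B"
      proof
        assume "x \<in> \<Union>B"
        then obtain D where D: "D \<in> B" "x \<in> D" by blast
        have "C = D" by (rule child_disjoint[OF _ _ xC(1) D(2)]) (use xC(2) D(1) K(1,2) in auto)
        then show False using D(1) xC(3) by simp
      qed
      then show "x \<in> \<Union>A - \<Union>B" using xC by blast
    qed
  qed blast
  have meet: "\<Union>A \<inter> \<Union>B \<noteq> {}" if m: "A \<inter> B \<noteq> {}"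
  proof -
    obtain C where C: "C \<in> A" "C \<in> B" using m by blast
    have "C \<noteq> {}" by (rule ne) (use K(1) C(1) in auto)
    then show ?thesis using C by blast
  qed
  show "A \<union> B \<in> quotient N" if "A \<inter> B \<noteq> {}"
    using union_member[OF K(3,4) meet[OF that]] K that unfolding quotient_def by auto
  show "A \<inter> B \<in> quotient N" if "A \<inter> B \<noteq> {}"
    using inter_member[OF K(3,4) meet[OF that]] K that Int unfolding quotient_def by auto
  show "A - B \<in> quotient N" if cr: "crossing A B"
  proof -
    have 1: "\<Union>P - \<Union>Q \<noteq> {}" if "P \<subseteq> ?K" "Q \<subseteq> ?K" "\<not> P \<subseteq> Q" for P Q
    proof -
      obtain C where C: "C \<in> P" "C \<notin> Q" using \<open>\<not> P \<subseteq> Q\<close> by blast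
      have CK: "C \<in> ?K" using C(1) \<open>P \<subseteq> ?K\<close> by blast
      obtain x where x: "x \<in> C" using ne[OF CK] by blast
      have "x \<notin> \<Union>Q"
      proof
        assume "x \<in> \<Union>Q"
        then obtain D where D: "D \<in> Q" "x \<in> D" by blast
        have "C = D" by (rule child_disjoint[OF CK _ x D(2)]) (use D(1) \<open>Q \<subseteq> ?K\<close> in auto)
        then show False using D(1) C(2) by simp
      qed
      then show ?thesis using C(1) x by blast
    qed
    have "\<not> A \<subseteq> B" "\<not> B \<subseteq> A" "A \<inter> B \<noteq> {}" using cr unfolding crossing_def by blast+
    then have "crossing (\<Union>A) (\<Union>B)"
      using 1[OF K(1,2)] 1[OF K(2,1)] meet unfolding crossing_def by blast
    then have "\<Union>A - \<Union>B \<in> F" by (rule diff_member[OF K(3,4)])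
    moreover have "A - B \<noteq> {}" using \<open>\<not> A \<subseteq> B\<close> by blast
    ultimately show ?thesis using Diff K(1) unfolding quotient_def by auto
  qed
qed

text \<open>The union of a nontrivial set of children lies strictly between a child and
  \<open>N\<close>, hence is not strong. A member crossing it stays inside \<open>N\<close> because
  \<open>N\<close> is strong, and it is a union of children by \<open>member_cases\<close>; so the
  crossing is already visible in the quotient.\<close>

lemma quotient_no_strong: "no_strong (child N ` N) (quotient N)"
  unfolding no_strong_def
proof (intro ballI impI)
  fix I assume I: "I \<in> quotient N" "card I \<noteq> 1" "I \<noteq> child N ` N"
  have IK: "I \<subseteq> child N ` N" "I \<noteq> {}" "\<Union>I \<in> F" using I(1) by (auto simp: quotient_def)
  obtain x where x: "x \<in> N" "child N x \<in> I" using IK by blast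
  obtain y where y: "y \<in> N" "child N y \<notin> I" using I(3) IK by blast
  have xI: "x \<in> \<Union>I" "y \<notin> \<Union>I" using mem_Union_children[OF IK(1)] x y by auto
  have IN: "\<Union>I \<subseteq> N" by (rule Union_subset[OF IK(1)])
  have "\<not> strong (\<Union>I)"
  proof
    assume s: "strong (\<Union>I)"
    have "\<Union>I \<subset> N" using IN xI(2) y(1) by blast
    then have sub: "\<Union>I \<subseteq> child N x" using child(4)[OF x(1) s _ xI(1)] by blast
    have "C = child N x" if C: "C \<in> I" for C
    proof -
      obtain z where z: "z \<in> N" "C = child N z" using C IK by blast
      then have "z \<in> child N x" using child(3)[OF z(1)] C sub by blast
      then show ?thesis using child_eq[OF x(1)] z by simp
    qed
    then have "I = {child N x}" using x by blast
    then show False using I(2) by simp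
  qed
  then obtain B where B: "B \<in> F" "crossing (\<Union>I) B" using IK(3) unfolding strong_def by blast
  then obtain z where z: "z \<in> \<Union>I" "z \<in> B" unfolding crossing_def by blast
  have zN: "z \<in> N" using z IN by blast
  have "\<not> N \<subseteq> B" using B(2) IN unfolding crossing_def by blast
  then have BN: "B \<subseteq> N" using strong_cases[OF N B(1) zN z(2)] by blast
  have "child N z \<in> I" using mem_Union_children[OF IK(1) zN] z by blast
  then have "\<not> B \<subseteq> child N z" using B(2) unfolding crossing_def by blast
  then have Beq: "B = \<Union>(child N ` B)" by (rule member_cases[OF B(1) BN z(2)])
  have JK: "child N ` B \<subseteq> child N ` N" using BN by blast
  have "child N ` B \<in> quotient N" unfolding quotient_def using JK z(2) B(1) Beq by auto
  moreover have "crossing I (child N ` B)" unfolding crossing_def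
  proof (intro conjI)
    show "I \<inter> child N ` B \<noteq> {}" using \<open>child N z \<in> I\<close> z(2) by blast
    show "\<not> I \<subseteq> child N ` B"
    proof
      assume "I \<subseteq> child N ` B"
      then have "\<Union>I \<subseteq> B" using Beq by blast
      then show False using B(2) unfolding crossing_def by blast
    qed
    show "\<not> child N ` B \<subseteq> I"
    proof
      assume "child N ` B \<subseteq> I"
      then have "B \<subseteq> \<Union>I" using Beq by blast
      then show False using B(2) unfolding crossing_def by blast
    qed
  qed
  ultimately show "\<exists>J\<in>quotient N. crossing I J" by blast
qed

lemma trichotomy:
  "prime_family (child N ` N) (quotient N) \<or> complete_family (child N ` N) (quotient N) \<or>
   (\<exists>p. linear_family p (child N ` N) (quotient N))"
  by (rule no_strong_trichotomy[OF quotient_weakly_partitive quotient_no_strong])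

text \<open>For points of different children the least member is itself a union of children, so it
  can be computed in the quotient, where the trichotomy is available.\<close>

lemma mem_least_iff:
  assumes "a \<in> N" "b \<in> N" "c \<in> N" "child N a \<noteq> child N b"
  shows "c \<in> least a b \<longleftrightarrow>
    (\<forall>I\<in>quotient N. child N a \<in> I \<longrightarrow> child N b \<in> I \<longrightarrow> child N c \<in> I)"
proof
  assume c: "c \<in> least a b"
  show "\<forall>I\<in>quotient N. child N a \<in> I \<longrightarrow> child N b \<in> I \<longrightarrow> child N c \<in> I"
  proof (intro ballI impI)
    fix I assume I: "I \<in> quotient N" "child N a \<in> I" "child N b \<in> I"
    then have IK: "I \<subseteq> child N ` N" "\<Union>I \<in> F" by (auto simp: quotient_def)
    have "a \<in> \<Union>I" "b \<in> \<Union>I" using mem_Union_children[OF IK(1)] I assms by auto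
    then have "c \<in> \<Union>I" using least_subset[OF IK(2)] c by blast
    then show "child N c \<in> I" using mem_Union_children[OF IK(1) assms(3)] by blast
  qed
next
  assume r: "\<forall>I\<in>quotient N. child N a \<in> I \<longrightarrow> child N b \<in> I \<longrightarrow> child N c \<in> I"
  have Yab: "a \<in> Y" "b \<in> Y" using assms N_subset by auto
  note l = least_member[OF Yab]
  have lN: "least a b \<subseteq> N" by (rule least_subset[OF strongD[OF N] assms(1,2)])
  have "\<not> least a b \<subseteq> child N a" using l(3) child_mem_iff[OF assms(1,2)] assms(4) by blast
  then have eq: "least a b = \<Union>(child N ` least a b)" by (rule member_cases[OF l(1) lN l(2)])
  have K: "child N ` least a b \<subseteq> child N ` N" using lN by blast
  have "\<Union>(child N ` least a b) \<in> F" using l(1) eq by simp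
  then have Q: "child N ` least a b \<in> quotient N" unfolding quotient_def using K l(2) by blast
  have "child N c \<in> child N ` least a b"
    by (rule r[rule_format, OF Q]) (rule imageI[OF l(2)], rule imageI[OF l(3)])
  then have "c \<in> \<Union>(child N ` least a b)" using child(3)[OF assms(3)] by blast
  then show "c \<in> least a b" using eq by blast
qed

lemma least_prime:
  assumes "prime_family (child N ` N) (quotient N)"
    "a \<in> N" "b \<in> N" "c \<in> N" "child N a \<noteq> child N b"
  shows "c \<in> least a b"
proof -
  have "child N c \<in> I" if I: "I \<in> quotient N" "child N a \<in> I" "child N b \<in> I" for I
  proof -
    have "card I \<noteq> 1" using I assms(5) by (metis card_1_singletonE singletonD)
    then have "I = child N ` N" using assms(1) I(1) unfolding prime_family_def by blast
    then show ?thesis using assms(4) by simp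
  qed
  then show ?thesis using mem_least_iff[OF assms(2-5)] by blast
qed

lemma least_complete:
  assumes "complete_family (child N ` N) (quotient N)"
    "a \<in> N" "b \<in> N" "c \<in> N" "child N a \<noteq> child N b"
  shows "c \<in> least a b \<longleftrightarrow> child N c = child N a \<or> child N c = child N b"
proof -
  have "{child N a, child N b} \<in> quotient N" using assms unfolding complete_family_def by auto
  then show ?thesis unfolding mem_least_iff[OF assms(2-5)] by auto
qed

lemma least_linear:
  assumes lin: "linear_family p (child N ` N) (quotient N)"
    and abc: "a \<in> N" "b \<in> N" "c \<in> N" "p (child N a) < p (child N b)"
  shows "c \<in> least a b \<longleftrightarrow> p (child N a) \<le> p (child N c) \<and> p (child N c) \<le> p (child N b)"
proof -
  let ?J = "{C \<in> child N ` N. p (child N a) \<le> p C \<and> p C \<le> p (child N b)}"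
  have J: "?J \<in> quotient N" using lin abc unfolding linear_family_def convex_in_def by auto
  have ne: "child N a \<noteq> child N b" using abc(4) by auto
  have inj: "inj_on p (child N ` N)" using lin by (simp add: linear_family_def)
  show ?thesis unfolding mem_least_iff[OF abc(1-3) ne]
  proof
    assume r: "\<forall>I\<in>quotient N. child N a \<in> I \<longrightarrow> child N b \<in> I \<longrightarrow> child N c \<in> I"
    have "child N c \<in> ?J" by (rule r[rule_format, OF J]) (use abc in auto)
    then show "p (child N a) \<le> p (child N c) \<and> p (child N c) \<le> p (child N b)" by simp
  next
    assume b: "p (child N a) \<le> p (child N c) \<and> p (child N c) \<le> p (child N b)"
    show "\<forall>I\<in>quotient N. child N a \<in> I \<longrightarrow> child N b \<in> I \<longrightarrow> child N c \<in> I"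
    proof (intro ballI impI)
      fix I assume I: "I \<in> quotient N" "child N a \<in> I" "child N b \<in> I"
      then have cv: "convex_in p (child N ` N) I" using lin unfolding linear_family_def by blast
      consider "p (child N c) = p (child N a)" | "p (child N c) = p (child N b)"
        | "p (child N a) < p (child N c)" "p (child N c) < p (child N b)" using b by linarith
      then show "child N c \<in> I"
      proof cases
        case 1 then show ?thesis using inj_onD[OF inj 1] abc I by simp
      next
        case 2 then show ?thesis using inj_onD[OF inj 2] abc I by simp
      next
        case 3
        then show ?thesis using cv I(2,3) abc(3) unfolding convex_in_def by blast
      qed
    qed
  qed
qed

end

section \<open>Betweenness of three points, the kind of a node, and its linear order\<close>

context weakly_partitive
begin

text \<open>The count doubles as the output code of the kind: \<open>decode_kind\<close> sends 0 to
  \<open>Complete\<close>, 1 to \<open>Circular\<close> and anything else, here 3, to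
  \<open>Prime\<close>.\<close>

definition betweenness_code :: "'a \<Rightarrow> 'a \<Rightarrow> 'a \<Rightarrow> nat" where
  "betweenness_code a b c =
     of_bool (c \<in> least a b) + of_bool (a \<in> least b c) + of_bool (b \<in> least a c)"

end

context strong_node
begin

lemma code_prime:
  assumes "prime_family (child N ` N) (quotient N)" "a \<in> N" "b \<in> N" "c \<in> N"
    "child N a \<noteq> child N b" "child N a \<noteq> child N c" "child N b \<noteq> child N c"
  shows "betweenness_code a b c = 3"
  unfolding betweenness_code_def
  using least_prime[OF assms(1-5)] least_prime[OF assms(1,3,4,2,7)]
    least_prime[OF assms(1,2,4,3,6)] by simp

lemma code_complete:
  assumes "complete_family (child N ` N) (quotient N)" "a \<in> N" "b \<in> N" "c \<in> N"
    "child N a \<noteq> child N b" "child N a \<noteq> child N c" "child N b \<noteq> child N c"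
  shows "betweenness_code a b c = 0"
  unfolding betweenness_code_def
  using least_complete[OF assms(1-5)] least_complete[OF assms(1,3,4,2,7)]
    least_complete[OF assms(1,2,4,3,6)] assms(5-7) by auto

lemma least_linear_iff:
  assumes "linear_family p (child N ` N) (quotient N)" "a \<in> N" "b \<in> N" "c \<in> N"
    "child N a \<noteq> child N b"
  shows "c \<in> least a b \<longleftrightarrow>
    min (p (child N a)) (p (child N b)) \<le> p (child N c) \<and>
    p (child N c) \<le> max (p (child N a)) (p (child N b))"
proof -
  have "inj_on p (child N ` N)" using assms(1) by (simp add: linear_family_def)
  then have "p (child N a) \<noteq> p (child N b)" using assms inj_onD by fastforce
  then consider "p (child N a) < p (child N b)" | "p (child N b) < p (child N a)" by linarith
  then show ?thesis
  proof cases
    case 1 then show ?thesis using least_linear[OF assms(1-4) 1] by simp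
  next
    case 2
    then show ?thesis
      using least_linear[OF assms(1,3,2,4) 2] by (simp add: least_commute[of a b])
  qed
qed

lemma code_linear:
  assumes "linear_family p (child N ` N) (quotient N)" "a \<in> N" "b \<in> N" "c \<in> N"
    "child N a \<noteq> child N b" "child N a \<noteq> child N c" "child N b \<noteq> child N c"
  shows "betweenness_code a b c = 1"
proof -
  have "inj_on p (child N ` N)" using assms(1) by (simp add: linear_family_def)
  then have "p (child N a) \<noteq> p (child N b)" "p (child N a) \<noteq> p (child N c)"
    "p (child N b) \<noteq> p (child N c)" using assms inj_onD by fastforce+
  then show ?thesis
    unfolding betweenness_code_def least_linear_iff[OF assms(1-5)]
      least_linear_iff[OF assms(1,3,4,2,7)] least_linear_iff[OF assms(1,2,4,3,6)]
    by (auto simp: min_def max_def)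
qed

text \<open>The three kinds produce different counts, so a single triple from three children decides
  the kind.\<close>

lemma code_cases:
  assumes "a \<in> N" "b \<in> N" "c \<in> N"
    "child N a \<noteq> child N b" "child N a \<noteq> child N c" "child N b \<noteq> child N c"
  shows "betweenness_code a b c = 0 \<and> complete_family (child N ` N) (quotient N) \<or>
    betweenness_code a b c = 1 \<and> (\<exists>p. linear_family p (child N ` N) (quotient N)) \<or>
    betweenness_code a b c = 3 \<and> prime_family (child N ` N) (quotient N)"
  using trichotomy code_prime[OF _ assms] code_complete[OF _ assms] code_linear[OF _ assms]
  by blast

text \<open>A node with only two children has no triple to be probed. It is complete, which agrees
  with the code 0 of fresh memory.\<close>

lemma two_children_complete:
  assumes "\<And>a b c. a \<in> N \<Longrightarrow> b \<in> N \<Longrightarrow> c \<in> N \<Longrightarrow> child N a \<noteq> child N b \<Longrightarrow>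
    child N a \<noteq> child N c \<Longrightarrow> child N b \<noteq> child N c \<Longrightarrow> False"
  shows "complete_family (child N ` N) (quotient N)"
proof -
  interpret Q: weakly_partitive "child N ` N" "quotient N" by (rule quotient_weakly_partitive)
  have "I \<in> quotient N" if I: "I \<subseteq> child N ` N" "I \<noteq> {}" for I
  proof (cases "\<exists>C. I = {C}")
    case True then show ?thesis using I Q.singleton_member by auto
  next
    case False
    then obtain C D where CD: "C \<in> I" "D \<in> I" "C \<noteq> D" using I(2) by blast
    obtain a b where ab: "a \<in> N" "C = child N a" "b \<in> N" "D = child N b" using CD I by blast
    have "child N c = C \<or> child N c = D" if "c \<in> N" for c
      using assms[OF ab(1,3) that] CD ab by auto
    then have "I = child N ` N" using I CD by blast
    then show ?thesis using Q.ground_member CD(1) by blast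
  qed
  then show ?thesis unfolding complete_family_def
    using Q.member_subset Q.member_nonempty by blast
qed

text \<open>A pair whose least member is all of \<open>N\<close> lies in the two extreme children.
  Which of them holds \<open>e\<close> is unknown, so the key is negated if \<open>e\<close> is at
  the top.\<close>

lemma linear_end:
  assumes lin: "linear_family p (child N ` N) (quotient N)" and e: "e \<in> N" "y \<in> N" "least e y = N"
  obtains q where "linear_family q (child N ` N) (quotient N)"
    "\<And>v. v \<in> N \<Longrightarrow> q (child N e) \<le> q (child N v)"
proof -
  have Y: "e \<in> Y" "y \<in> Y" using e N_subset by auto
  have ne: "child N e \<noteq> child N y"
  proof
    assume "child N e = child N y"
    then have "y \<in> child N e" using child(3)[OF e(2)] by simp
    then have "least e y \<subseteq> child N e"
      by (rule least_subset[OF strongD[OF child(1)[OF e(1)]] child(3)[OF e(1)]])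
    then show False using e(3) child(2)[OF e(1)] by blast
  qed
  have btw: "min (p (child N e)) (p (child N y)) \<le> p (child N v) \<and>
    p (child N v) \<le> max (p (child N e)) (p (child N y))" if "v \<in> N" for v
    using least_linear_iff[OF lin e(1,2) that ne] that e(3) by simp
  show ?thesis
  proof (cases "p (child N e) \<le> p (child N y)")
    case True
    then show ?thesis using btw by (intro that[OF lin]) (fastforce simp: min_def)
  next
    case False
    show ?thesis
    proof (rule that[OF linear_family_uminus[OF lin]])
      show "- p (child N e) \<le> - p (child N v)" if "v \<in> N" for v
        using btw[OF that] False by (simp add: max_def)
    qed
  qed
qed

text \<open>Seen from a lowest point \<open>e\<close>, least members are initial segments, up to the
  child of \<open>v\<close>. If \<open>v\<close> lies in the child of \<open>e\<close>, the least
  member stays in that child, and indeed nothing comes before it.\<close>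

lemma linear_before:
  assumes lin: "linear_family q (child N ` N) (quotient N)"
    and e: "e \<in> N" "\<And>v. v \<in> N \<Longrightarrow> q (child N e) \<le> q (child N v)"
    and vw: "v \<in> N" "w \<in> N" "child N v \<noteq> child N w"
  shows "w \<in> least e v \<longleftrightarrow> q (child N w) < q (child N v)"
proof -
  have "inj_on q (child N ` N)" using lin by (simp add: linear_family_def)
  then have ne: "q (child N v) \<noteq> q (child N w)" using vw inj_onD by fastforce
  show ?thesis
  proof (cases "child N e = child N v")
    case True
    then have "v \<in> child N e" using child(3)[OF vw(1)] by simp
    then have "least e v \<subseteq> child N e"
      by (rule least_subset[OF strongD[OF child(1)[OF e(1)]] child(3)[OF e(1)]])
    moreover have "w \<notin> child N e" using child_mem_iff[OF vw(1,2)] vw(3) True by simp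
    ultimately show ?thesis using e(2)[OF vw(2)] True by auto
  next
    case False
    then show ?thesis using least_linear_iff[OF lin e(1) vw(1,2) False] e(2)[OF vw(1)] e(2)[OF vw(2)] ne
      by auto
  qed
qed

text \<open>Points of the lowest and of the highest child do it; so the search for an end among all
  pairs succeeds.\<close>

lemma linear_ex_end:
  assumes lin: "linear_family p (child N ` N) (quotient N)"
  shows "\<exists>e\<in>N. \<exists>y\<in>N. least e y = N"
proof -
  let ?P = "(\<lambda>v. p (child N v)) ` N"
  have fin: "finite ?P" using N_finite by simp
  have ne: "?P \<noteq> {}" using N2 by auto
  obtain e where e: "e \<in> N" "p (child N e) = Min ?P" using Min_in[OF fin ne] by auto
  obtain y where y: "y \<in> N" "p (child N y) = Max ?P" using Max_in[OF fin ne] by auto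
  have le: "p (child N e) \<le> p (child N v)" "p (child N v) \<le> p (child N y)" if "v \<in> N" for v
    using that fin e y by simp_all
  have neq: "child N e \<noteq> child N y"
  proof
    assume eq: "child N e = child N y"
    have "child N v = child N e" if "v \<in> N" for v
    proof -
      have "p (child N v) = p (child N e)" using le[OF that] eq by simp
      then show ?thesis using lin that e(1) unfolding linear_family_def inj_on_def by blast
    qed
    then have "N \<subseteq> child N e" using child(3) by blast
    then show False using child(2)[OF e(1)] by blast
  qed
  have "N \<subseteq> least e y"
    using least_linear_iff[OF lin e(1) y(1) _ neq] le by (auto simp: min_le_iff_disj le_max_iff_disj)
  moreover have "least e y \<subseteq> N" by (rule least_subset[OF strongD[OF N] e(1) y(1)])
  ultimately show ?thesis using e(1) y(1) by blast
qed

end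

section \<open>Every member comes from a quotient; strong hulls from least members\<close>

context weakly_partitive
begin

lemma strong_nodeI: "strong N \<Longrightarrow> card N \<ge> 2 \<Longrightarrow> strong_node Y F N"
  by (simp add: strong_node_def strong_node_axioms_def weakly_partitive_axioms)

text \<open>The node is the smallest strong set containing \<open>A\<close>. There \<open>A\<close>
  lies in no single child, so \<open>member_cases\<close> applies.\<close>

lemma member_in_quotient:
  assumes "A \<in> F" "card A \<ge> 2"
  shows "\<exists>N I. strong N \<and> card N \<ge> 2 \<and> I \<in> quotient N \<and> A = \<Union>I"
proof -
  obtain x where x: "x \<in> A" using assms member_nonempty by blast
  define N where "N = \<Inter>{S. strong S \<and> A \<subseteq> S}"
  have AY: "A \<subseteq> Y" by (rule member_subset[OF assms(1)])
  then have "Y \<in> {S. strong S \<and> A \<subseteq> S}" using strong_ground x by blast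
  then have "N \<in> {S. strong S \<and> A \<subseteq> S}"
    unfolding N_def by (intro strong_Inter[of _ x]) (use x in auto)
  then have SN: "strong N" "A \<subseteq> N" by auto
  have N2: "card N \<ge> 2"
    using card_mono[OF member_finite[OF strongD[OF SN(1)]] SN(2)] assms(2) by linarith
  interpret strong_node Y F N by (rule strong_nodeI[OF SN(1) N2])
  have xN: "x \<in> N" using x SN by blast
  have "\<not> A \<subseteq> child N x"
  proof
    assume "A \<subseteq> child N x"
    then have "child N x \<in> {S. strong S \<and> A \<subseteq> S}" using child(1)[OF xN] by blast
    then have "N \<subseteq> child N x" unfolding N_def by (rule Inter_lower)
    then show False using child(2)[OF xN] by blast
  qed
  then have eq: "A = \<Union>(child N ` A)" by (rule member_cases[OF assms(1) SN(2) x])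
  have "\<Union>(child N ` A) \<in> F" using eq assms(1) by simp
  then have "child N ` A \<in> quotient N" unfolding quotient_def using SN(2) x by blast
  then show ?thesis using SN(1) N2 eq by blast
qed

text \<open>If \<open>a\<close>, \<open>b\<close>, \<open>c\<close> lie in three children of a node, then \<open>c\<close> is between \<open>a\<close> and \<open>b\<close>, or at most
  one of \<open>a\<close> and \<open>b\<close> is between the other two points.\<close>

lemma mem_hull_iff:
  assumes "a \<in> Y" "b \<in> Y" "c \<in> Y"
  shows "c \<in> strong_hull a b \<longleftrightarrow> c \<in> least a b \<or> b \<notin> least a c \<or> a \<notin> least b c"
proof (cases "a = b")
  case True
  then show ?thesis using assms by (simp add: hull_same least_same least_member)
next
  case False
  let ?N = "strong_hull a b"
  note h = hull_strong[OF assms(1,2)]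
  have "card {a, b} \<le> card ?N"
    by (rule card_mono[OF member_finite[OF strongD[OF h(1)]]]) (use h in simp)
  then have N2: "card ?N \<ge> 2" using False by simp
  interpret strong_node Y F ?N by (rule strong_nodeI[OF h(1) N2])
  have ab: "child ?N a \<noteq> child ?N b" using hull_eq_iff[OF h(2,3)] by simp
  show ?thesis
  proof (cases "c \<in> ?N")
    case False
    have "least a b \<subseteq> ?N" by (rule least_subset_hull[OF assms(1,2)])
    \<comment> \<open>The hull is strong, so a member that contains \<open>a\<close> and also leaves
      the hull contains all of it.\<close>
    moreover have "b \<in> least a c"
      using strong_cases[OF h(1) least_member(1)[OF assms(1,3)] h(2) least_member(2)[OF assms(1,3)]]
        least_member(3)[OF assms(1,3)] False h(3) by blast
    moreover have "a \<in> least b c"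
      using strong_cases[OF h(1) least_member(1)[OF assms(2,3)] h(3) least_member(2)[OF assms(2,3)]]
        least_member(3)[OF assms(2,3)] False h(2) by blast
    ultimately show ?thesis using False by blast
  next
    case c: True
    consider "child ?N a = child ?N c" | "child ?N b = child ?N c"
      | "child ?N a \<noteq> child ?N c" "child ?N b \<noteq> child ?N c" by blast
    then show ?thesis
    proof cases
      case 1
      then have "c \<in> child ?N a" using child(3)[OF c] by simp
      then have "least a c \<subseteq> child ?N a"
        by (rule least_subset[OF strongD[OF child(1)[OF h(2)]] child(3)[OF h(2)]])
      moreover have "b \<notin> child ?N a" using child_mem_iff[OF h(2,3)] ab by simp
      ultimately show ?thesis using c by blast
    next
      case 2
      then have "c \<in> child ?N b" using child(3)[OF c] by simp
      then have "least b c \<subseteq> child ?N b"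
        by (rule least_subset[OF strongD[OF child(1)[OF h(3)]] child(3)[OF h(3)]])
      moreover have "a \<notin> child ?N b" using child_mem_iff[OF h(3,2)] ab by simp
      ultimately show ?thesis using c by blast
    next
      case 3
      \<comment> \<open>The count is 0, 1 or 3. If \<open>c\<close> does not contribute to it, it is
        not 3, and then \<open>a\<close> and \<open>b\<close> cannot both contribute.\<close>
      show ?thesis using code_cases[OF h(2,3) c ab 3] c
        unfolding betweenness_code_def by (auto split: if_splits)
    qed
  qed
qed

end

section \<open>Umodules that avoid a point\<close>

locale pointed_relation =
  fixes X :: "'a set" and H :: "'a \<Rightarrow> 'a \<Rightarrow> 'a \<Rightarrow> bool" and r :: 'a
  assumes finite_X: "finite X" and self_compl: "self_complemented X H" and r: "r \<in> X"
begin

definition away :: "'a set set" where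
  "away = {U. umodule X H U \<and> U \<noteq> {} \<and> r \<notin> U}"

lemma umodule_compl: "umodule X H U \<Longrightarrow> umodule X H (X - U)"
  using self_compl by (simp add: self_complemented_def)

lemma umodule_Un:
  assumes A: "umodule X H A" and B: "umodule X H B" and m: "A \<inter> B \<noteq> {}"
  shows "umodule X H (A \<union> B)"
proof -
  obtain w where w: "w \<in> A" "w \<in> B" using m by blast
  have 1: "H u x x' = H w x x'" if "u \<in> A \<union> B" "x \<in> X - (A \<union> B)" "x' \<in> X - (A \<union> B)" for u x x'
  proof -
    have x: "x \<in> X - A" "x \<in> X - B" "x' \<in> X - A" "x' \<in> X - B" using that(2,3) by auto
    show ?thesis
    proof (cases "u \<in> A")
      case True
      show ?thesis using A[unfolded umodule_def, THEN conjunct2, rule_format, OF True w(1) x(1,3)] .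
    next
      case False
      then have "u \<in> B" using that(1) by blast
      then show ?thesis using B[unfolded umodule_def, THEN conjunct2, rule_format, OF _ w(2) x(2,4)] by simp
    qed
  qed
  have "A \<union> B \<subseteq> X" using A B by (simp add: umodule_def)
  then show ?thesis unfolding umodule_def
    by (intro conjI ballI) (simp_all only: 1)
qed

lemma umodule_singleton: "a \<in> X \<Longrightarrow> umodule X H {a}"
  by (simp add: umodule_def)

text \<open>De Morgan: the complements are umodules, and they meet because \<open>A\<close> and
  \<open>B\<close> do not cover \<open>X\<close>.\<close>

lemma umodule_Int:
  assumes "umodule X H A" "umodule X H B" "A \<union> B \<noteq> X" shows "umodule X H (A \<inter> B)"
proof -
  have AB: "A \<subseteq> X" "B \<subseteq> X" using assms(1,2) by (simp_all add: umodule_def)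
  have "umodule X H ((X - A) \<union> (X - B))"
    by (rule umodule_Un) (use assms AB in \<open>auto intro: umodule_compl\<close>)
  then have "umodule X H (X - ((X - A) \<union> (X - B)))" by (rule umodule_compl)
  moreover have "X - ((X - A) \<union> (X - B)) = A \<inter> B" using AB by blast
  ultimately show ?thesis by simp
qed

lemma away_subset: "U \<in> away \<Longrightarrow> U \<subseteq> X - {r}"
proof -
  assume U: "U \<in> away"
  then have "U \<subseteq> X" unfolding away_def umodule_def by simp
  then show ?thesis using U by (auto simp: away_def)
qed

text \<open>The point \<open>r\<close> supplies the side condition of \<open>umodule_Int\<close>, as
  sets that avoid \<open>r\<close> never cover \<open>X\<close>. A difference is an intersection
  with a complement; there the side condition holds because \<open>B\<close> is not contained in
  \<open>A\<close>.\<close>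

sublocale weakly_partitive "X - {r}" away
proof
  show "finite (X - {r})" using finite_X by simp
  show "\<And>A. A \<in> away \<Longrightarrow> A \<subseteq> X - {r}" by (rule away_subset)
  show "\<And>A. A \<in> away \<Longrightarrow> A \<noteq> {}" by (simp add: away_def)
  show "X - {r} \<noteq> {} \<Longrightarrow> X - {r} \<in> away"
    using umodule_compl[OF umodule_singleton[OF r]] by (simp add: away_def)
  show "\<And>a. a \<in> X - {r} \<Longrightarrow> {a} \<in> away" using umodule_singleton by (auto simp: away_def)
  fix A B assume AB: "A \<in> away" "B \<in> away"
  then have AB': "umodule X H A" "umodule X H B" "r \<notin> A" "r \<notin> B" "A \<subseteq> X" "B \<subseteq> X"
    using away_subset[of A] away_subset[of B] by (auto simp: away_def)
  show "A \<union> B \<in> away" if "A \<inter> B \<noteq> {}"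
    using umodule_Un[OF AB'(1,2) that] AB' that by (auto simp: away_def)
  have "A \<union> B \<noteq> X" using AB' r by blast
  then show "A \<inter> B \<in> away" if "A \<inter> B \<noteq> {}"
    using umodule_Int[OF AB'(1,2)] AB' that by (auto simp: away_def)
  show "A - B \<in> away" if cr: "crossing A B"
  proof -
    have "A \<union> (X - B) \<noteq> X" using cr AB' unfolding crossing_def by blast
    then have "umodule X H (A \<inter> (X - B))"
      by (rule umodule_Int[OF AB'(1) umodule_compl[OF AB'(2)]])
    moreover have "A \<inter> (X - B) = A - B" using AB' by blast
    moreover have "A - B \<noteq> {}" using cr unfolding crossing_def by blast
    ultimately show ?thesis using AB' by (simp add: away_def)
  qed
qed

definition split :: "'a set \<Rightarrow> 'a set set" where
  "split U = {U, X - U}"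

lemma split_inj:
  assumes "U \<subseteq> X" "V \<subseteq> X" "r \<notin> U" "r \<notin> V" "split U = split V" shows "U = V"
proof -
  have "U \<in> {V, X - V}" using assms(5) unfolding split_def by blast
  then show ?thesis using assms r by blast
qed

lemma split_compl: "U \<subseteq> X \<Longrightarrow> split (X - U) = split U"
  by (simp add: split_def double_diff insert_commute)

lemma bipartitions_eq: "bipartitions X H = split ` away"
proof
  show "split ` away \<subseteq> bipartitions X H"
    using r by (auto simp: bipartitions_def split_def away_def)
  show "bipartitions X H \<subseteq> split ` away"
  proof
    fix P assume "P \<in> bipartitions X H"
    then obtain U where U: "P = split U" "umodule X H U" "U \<noteq> {}" "U \<noteq> X"
      by (auto simp: bipartitions_def split_def)
    have UX: "U \<subseteq> X" using U by (simp add: umodule_def)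
    show "P \<in> split ` away"
    proof (cases "r \<in> U")
      case False
      then show ?thesis using U by (auto simp: away_def)
    next
      case True
      have "X - U \<in> away" using U UX True umodule_compl[OF U(2)] by (auto simp: away_def)
      then show ?thesis using split_compl[OF UX] U(1) by (metis imageI)
    qed
  qed
qed

text \<open>Of the four intersections, the one of the two complements always contains
  \<open>r\<close>; the other three make up \<open>crossing\<close>.\<close>

lemma overlap_split:
  assumes "U \<in> away" "V \<in> away" shows "overlap (split U) (split V) \<longleftrightarrow> crossing U V"
proof -
  have UV: "U \<subseteq> X" "V \<subseteq> X" "r \<notin> U" "r \<notin> V" using assms away_subset by (auto simp: away_def)
  have "(X - U) \<inter> (X - V) \<noteq> {}" using UV r by blast
  moreover have "U \<inter> (X - V) \<noteq> {} \<longleftrightarrow> \<not> U \<subseteq> V" using UV by blast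
  moreover have "(X - U) \<inter> V \<noteq> {} \<longleftrightarrow> \<not> V \<subseteq> U" using UV by blast
  ultimately show ?thesis unfolding overlap_def split_def crossing_def by simp
qed

lemma strong_bipartitions_eq: "strong_bipartitions X H = split ` {S. strong S}"
proof -
  have sub: "U \<subseteq> X" "r \<notin> U" if "U \<in> away" for U using that away_subset by (auto simp: away_def)
  have "split U \<in> strong_bipartitions X H \<longleftrightarrow> strong U" if U: "U \<in> away" for U
  proof -
    have "split U \<in> strong_bipartitions X H \<longleftrightarrow>
      (\<forall>V\<in>away. split V \<noteq> split U \<longrightarrow> \<not> overlap (split U) (split V))"
      unfolding strong_bipartitions_def bipartitions_eq using U by blast
    also have "\<dots> \<longleftrightarrow> (\<forall>V\<in>away. V \<noteq> U \<longrightarrow> \<not> crossing U V)"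
      using overlap_split[OF U] split_inj[OF sub(1) sub(1)[OF U] sub(2) sub(2)[OF U]] by metis
    also have "\<dots> \<longleftrightarrow> strong U"
      unfolding strong_def using U by (auto simp: crossing_def)
    finally show ?thesis .
  qed
  moreover have "strong_bipartitions X H \<subseteq> split ` away"
    unfolding strong_bipartitions_def bipartitions_eq by blast
  ultimately show ?thesis using strongD by blast
qed

end

section \<open>Rooted trees and their clusters\<close>

text \<open>\<open>depth\<close> may be any measure that drops towards the root. It excludes cycles
  of \<open>par\<close> and serves inductions, but need not be the distance to the root; for
  clusters it will be the number of missing elements.\<close>

locale parent_tree =
  fixes V :: "'v set" and root :: 'v and par :: "'v \<Rightarrow> 'v" and depth :: "'v \<Rightarrow> nat"
  assumes finite_V: "finite V" and root: "root \<in> V"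
    and par: "v \<in> V \<Longrightarrow> v \<noteq> root \<Longrightarrow> par v \<in> V"
    and depth_par: "v \<in> V \<Longrightarrow> v \<noteq> root \<Longrightarrow> depth (par v) < depth v"
begin

definition up :: "'v rel" where
  "up = {(v, par v) | v. v \<in> V \<and> v \<noteq> root}"

definition tree_arcs :: "'v rel" where
  "tree_arcs = up \<union> up\<inverse>"

definition desc :: "'v \<Rightarrow> 'v set" where
  "desc v = {w \<in> V. (w, v) \<in> up\<^sup>*}"

lemma up_iff: "(v, u) \<in> up \<longleftrightarrow> v \<in> V \<and> v \<noteq> root \<and> u = par v"
  by (auto simp: up_def)

lemma up_depth: "(v, u) \<in> up \<Longrightarrow> depth u < depth v"
  using depth_par by (simp add: up_iff)

lemma rtrancl_up_depth: "(v, u) \<in> up\<^sup>* \<Longrightarrow> v = u \<or> depth u < depth v"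
  by (induction rule: rtrancl_induct) (use up_depth in fastforce)+

lemma up_antisym: "(v, u) \<in> up\<^sup>* \<Longrightarrow> (u, v) \<in> up\<^sup>* \<Longrightarrow> u = v"
  using rtrancl_up_depth[of v u] rtrancl_up_depth[of u v] by auto

lemma rtrancl_up_V: "(v, u) \<in> up\<^sup>* \<Longrightarrow> v \<in> V \<Longrightarrow> u \<in> V"
  by (induction rule: rtrancl_induct) (auto simp: up_iff par)

lemma up_root: "v \<in> V \<Longrightarrow> (v, root) \<in> up\<^sup>*"
proof (induction "depth v" arbitrary: v rule: less_induct)
  case less
  show ?case
  proof (cases "v = root")
    case False
    have "(par v, root) \<in> up\<^sup>*"
      using less False by (simp add: par depth_par)
    moreover have "(v, par v) \<in> up" using less.prems False by (simp add: up_iff)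
    ultimately show ?thesis by (rule converse_rtrancl_into_rtrancl[rotated])
  qed simp
qed

lemma rtrancl_up_par:
  assumes "(w, v) \<in> up\<^sup>*" "w \<noteq> v" shows "w \<in> V" "w \<noteq> root" "(par w, v) \<in> up\<^sup>*"
proof -
  obtain u where "(w, u) \<in> up" "(u, v) \<in> up\<^sup>*"
    using assms by (metis converse_rtranclE)
  then show "w \<in> V" "w \<noteq> root" "(par w, v) \<in> up\<^sup>*" by (auto simp: up_iff)
qed

lemma desc_self: "v \<in> V \<Longrightarrow> v \<in> desc v" by (simp add: desc_def)

lemma desc_subset: "desc v \<subseteq> V" by (auto simp: desc_def)

lemma desc_root: "desc root = V" using up_root by (auto simp: desc_def)

lemma desc_par: "w \<in> desc v \<Longrightarrow> w \<noteq> v \<Longrightarrow> w \<noteq> root \<and> par w \<in> desc v"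
  using rtrancl_up_par[of w v] par by (auto simp: desc_def)

lemma desc_child: "w \<in> V \<Longrightarrow> w \<noteq> root \<Longrightarrow> par w \<in> desc v \<Longrightarrow> w \<in> desc v"
  using converse_rtrancl_into_rtrancl[of w "par w" up v] by (simp add: desc_def up_iff)

lemma desc_mono: "w \<in> desc v \<Longrightarrow> desc w \<subseteq> desc v"
  unfolding desc_def by (auto intro: rtrancl_trans)

lemma par_notin_desc:
  assumes "v \<in> V" "v \<noteq> root" shows "par v \<notin> desc v"
  using rtrancl_up_depth[of "par v" v] depth_par[OF assms] by (auto simp: desc_def)

lemma desc_antisym: "v \<in> desc w \<Longrightarrow> w \<in> desc v \<Longrightarrow> v = w"
  using up_antisym[of w v] by (simp add: desc_def)

text \<open>Parents are unique, so two ancestors of the same vertex are comparable.\<close>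

lemma desc_disjoint:
  assumes "w \<in> desc u" "w \<in> desc v" shows "u \<in> desc v \<or> v \<in> desc u"
proof -
  have sv: "single_valued up" by (auto simp: single_valued_def up_iff)
  have "(w, u) \<in> up\<^sup>*" "(w, v) \<in> up\<^sup>*" "w \<in> V" using assms by (auto simp: desc_def)
  then have "(u, v) \<in> up\<^sup>* \<or> (v, u) \<in> up\<^sup>*" using single_valued_confluent[OF sv] by blast
  moreover have "u \<in> V" "v \<in> V" using rtrancl_up_V \<open>w \<in> V\<close> \<open>(w, u) \<in> up\<^sup>*\<close> \<open>(w, v) \<in> up\<^sup>*\<close> by blast+
  ultimately show ?thesis by (auto simp: desc_def)
qed

text \<open>The parent is the least proper ancestor. Expressed by the order alone, this can be
  compared with the covering relation of clusters.\<close>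

lemma up_desc_iff:
  assumes "v \<in> V" "u \<in> V"
  shows "(v, u) \<in> up \<longleftrightarrow>
    v \<in> desc u \<and> v \<noteq> u \<and> (\<forall>w\<in>V. v \<in> desc w \<longrightarrow> w \<noteq> v \<longrightarrow> u \<in> desc w)"
proof
  assume up: "(v, u) \<in> up"
  then have v: "v \<noteq> root" "u = par v" by (auto simp: up_iff)
  have "v \<in> desc u" using up assms by (auto simp: desc_def)
  moreover have "v \<noteq> u" using up_depth[OF up] by auto
  ultimately show "v \<in> desc u \<and> v \<noteq> u \<and> (\<forall>w\<in>V. v \<in> desc w \<longrightarrow> w \<noteq> v \<longrightarrow> u \<in> desc w)"
    using desc_par v by blast
next
  assume r: "v \<in> desc u \<and> v \<noteq> u \<and> (\<forall>w\<in>V. v \<in> desc w \<longrightarrow> w \<noteq> v \<longrightarrow> u \<in> desc w)"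
  then have v: "v \<noteq> root" "par v \<in> desc u" using desc_par by blast+
  have pV: "par v \<in> V" by (rule par[OF assms(1) v(1)])
  have "v \<in> desc (par v)" using desc_child[OF assms(1) v(1) desc_self[OF pV]] .
  moreover have "par v \<noteq> v" using depth_par[OF assms(1) v(1)] by auto
  ultimately have "u \<in> desc (par v)" using r pV by blast
  then have "u = par v" by (rule desc_antisym[OF _ v(2)])
  then show "(v, u) \<in> up" using assms v by (simp add: up_iff)
qed

lemma tree_arcs_iff:
  "(u, w) \<in> tree_arcs \<longleftrightarrow> u \<in> V \<and> w \<in> V \<and> (u \<noteq> root \<and> w = par u \<or> w \<noteq> root \<and> u = par w)"
  by (auto simp: tree_arcs_def up_iff par)

lemma par_edge_inj:
  assumes "v \<in> V" "v \<noteq> root" "w \<in> V" "w \<noteq> root" "{v, par v} = {w, par w}" shows "v = w"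
  using assms depth_par[of v] depth_par[of w] by (auto simp: doubleton_eq_iff)

lemma closed_component:
  assumes "(v, w) \<in> R\<^sup>*" "v \<in> S" "\<And>a b. (a, b) \<in> R \<Longrightarrow> a \<in> S \<Longrightarrow> b \<in> S" shows "w \<in> S"
  using assms by (induction rule: rtrancl_induct) auto

lemma desc_connected:
  assumes R: "sym R" "\<And>a. a \<in> desc v \<Longrightarrow> a \<noteq> v \<Longrightarrow> (a, par a) \<in> R" and w: "w \<in> desc v"
  shows "(v, w) \<in> R\<^sup>*"
  using w
proof (induction "depth w" arbitrary: w rule: less_induct)
  case less
  show ?case
  proof (cases "w = v")
    case False
    have p: "w \<noteq> root" "par w \<in> desc v" using desc_par[OF less.prems False] by auto
    have wV: "w \<in> V" using less.prems desc_subset by blast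
    have "(v, par w) \<in> R\<^sup>*" by (rule less.hyps[OF depth_par[OF wV p(1)] p(2)])
    moreover have "(par w, w) \<in> R" using R(1) R(2)[OF less.prems False] by (simp add: symD)
    ultimately show ?thesis by (rule rtrancl_into_rtrancl)
  qed simp
qed

lemma outside_connected:
  assumes R: "sym R" "\<And>a. a \<in> V - desc v \<Longrightarrow> a \<noteq> root \<Longrightarrow> (a, par a) \<in> R"
    and w: "w \<in> V - desc v" "w' \<in> V - desc v"
  shows "(w, w') \<in> R\<^sup>*"
proof -
  have *: "(w, root) \<in> R\<^sup>*" if "w \<in> V - desc v" for w
    using that
  proof (induction "depth w" arbitrary: w rule: less_induct)
    case less
    show ?case
    proof (cases "w = root")
      case False
      have "par w \<in> V - desc v" using less.prems False par desc_child by blast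
      then have "(par w, root) \<in> R\<^sup>*" using less.hyps depth_par less.prems False by blast
      then show ?thesis using R(2)[OF less.prems False] by (rule converse_rtrancl_into_rtrancl[rotated])
    qed simp
  qed
  have "(root, w') \<in> R\<^sup>*" using *[OF w(2)] sym_rtrancl[OF R(1)] by (simp add: symD)
  then show ?thesis using *[OF w(1)] by (rule rtrancl_trans[rotated])
qed

lemma sym_tree_arcs: "sym tree_arcs"
  by (auto simp: tree_arcs_def sym_def)

text \<open>The only parent arc that leaves \<open>desc v\<close> is the removed one. Inside
  \<open>desc v\<close> the remaining parent arcs lead to \<open>v\<close>, outside they lead to the
  root.\<close>

lemma edge_components:
  assumes v: "v \<in> V" "v \<noteq> root"
  defines "R \<equiv> {(a, b) \<in> tree_arcs. {a, b} \<noteq> {v, par v}}"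
  shows "{w. (v, w) \<in> R\<^sup>*} = desc v" "{w. (par v, w) \<in> R\<^sup>*} = V - desc v"
proof -
  have symR: "sym R" using sym_tree_arcs unfolding R_def sym_def by (auto simp: insert_commute)
  have RI: "(a, par a) \<in> R" if "a \<in> V" "a \<noteq> root" "a \<noteq> v" for a
    unfolding R_def using that par[OF that(1,2)] par_edge_inj[OF that(1,2) v]
    by (auto simp: tree_arcs_iff)
  have closed: "b \<in> desc v \<longleftrightarrow> a \<in> desc v" if ab: "(a, b) \<in> R" for a b
  proof -
    have *: "b \<in> desc v \<longleftrightarrow> a \<in> desc v" if "(a, b) \<in> up" "{a, b} \<noteq> {v, par v}" for a b
    proof -
      have a: "a \<in> V" "a \<noteq> root" "b = par a" using that(1) by (auto simp: up_iff)
      then have "a \<noteq> v" using that(2) by auto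
      then show ?thesis using desc_par[of a v] desc_child[OF a(1,2)] a(3) by blast
    qed
    show ?thesis using ab *[of a b] *[of b a] unfolding R_def tree_arcs_def
      by (auto simp: insert_commute)
  qed
  show "{w. (v, w) \<in> R\<^sup>*} = desc v"
  proof
    show "{w. (v, w) \<in> R\<^sup>*} \<subseteq> desc v"
      using closed_component[of v _ R "desc v"] closed desc_self[OF v(1)] by blast
    show "desc v \<subseteq> {w. (v, w) \<in> R\<^sup>*}"
    proof
      fix w assume w: "w \<in> desc v"
      have "(v, w) \<in> R\<^sup>*"
      proof (rule desc_connected[OF symR _ w])
        fix a assume "a \<in> desc v" "a \<noteq> v"
        then show "(a, par a) \<in> R" using RI desc_par desc_subset by blast
      qed
      then show "w \<in> {w. (v, w) \<in> R\<^sup>*}" by simp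
    qed
  qed
  have pv: "par v \<in> V - desc v" using par[OF v] par_notin_desc[OF v] by simp
  have RV: "b \<in> V" if "(a, b) \<in> R" for a b using that unfolding R_def by (auto simp: tree_arcs_iff)
  show "{w. (par v, w) \<in> R\<^sup>*} = V - desc v"
  proof
    show "{w. (par v, w) \<in> R\<^sup>*} \<subseteq> V - desc v"
      using closed_component[of "par v" _ R "V - desc v"] closed RV pv by blast
    show "V - desc v \<subseteq> {w. (par v, w) \<in> R\<^sup>*}"
    proof
      fix w assume w: "w \<in> V - desc v"
      have "(par v, w) \<in> R\<^sup>*"
      proof (rule outside_connected[OF symR _ pv w])
        fix a assume a: "a \<in> V - desc v" "a \<noteq> root"
        then have "a \<noteq> v" using desc_self[OF v(1)] by blast
        then show "(a, par a) \<in> R" using RI a by blast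
      qed
      then show "w \<in> {w. (par v, w) \<in> R\<^sup>*}" by simp
    qed
  qed
qed

lemma node_components:
  assumes N: "N \<in> V"
  defines "R \<equiv> {(a, b) \<in> tree_arcs. a \<noteq> N \<and> b \<noteq> N}"
  shows "c \<in> V \<Longrightarrow> c \<noteq> root \<Longrightarrow> par c = N \<Longrightarrow> {w. (c, w) \<in> R\<^sup>*} = desc c"
    and "N \<noteq> root \<Longrightarrow> {w. (par N, w) \<in> R\<^sup>*} = V - desc N"
proof -
  have symR: "sym R" using sym_tree_arcs unfolding R_def sym_def by auto
  have RI: "(a, par a) \<in> R" if "a \<in> V" "a \<noteq> root" "a \<noteq> N" "par a \<noteq> N" for a
    unfolding R_def using that par[OF that(1,2)] by (auto simp: tree_arcs_iff)
  have RV: "b \<in> V" if "(a, b) \<in> R" for a b using that unfolding R_def by (auto simp: tree_arcs_iff)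
  {
    assume c: "c \<in> V" "c \<noteq> root" "par c = N"
    have Nc: "N \<notin> desc c" using par_notin_desc[OF c(1,2)] c(3) by simp
    show "{w. (c, w) \<in> R\<^sup>*} = desc c"
    proof
      have "b \<in> desc c" if ab: "(a, b) \<in> R" "a \<in> desc c" for a b
      proof (cases "(a, b) \<in> up")
        case True
        then have b: "b = par a" by (simp add: up_iff)
        have "a \<noteq> c" using ab(1) b c(3) unfolding R_def by auto
        then show ?thesis using desc_par[OF ab(2)] b by simp
      next
        case False
        then have "b \<in> V" "b \<noteq> root" "a = par b"
          using ab(1) unfolding R_def tree_arcs_def by (auto simp: up_iff)
        then show ?thesis using desc_child[of b c] ab(2) by simp
      qed
      then show "{w. (c, w) \<in> R\<^sup>*} \<subseteq> desc c"
        using closed_component[of c _ R "desc c"] desc_self[OF c(1)] by blast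
      show "desc c \<subseteq> {w. (c, w) \<in> R\<^sup>*}"
      proof
        fix w assume w: "w \<in> desc c"
        have "(c, w) \<in> R\<^sup>*"
        proof (rule desc_connected[OF symR _ w])
          fix a assume a: "a \<in> desc c" "a \<noteq> c"
          then have "par a \<in> desc c" "a \<noteq> root" using desc_par by auto
          then show "(a, par a) \<in> R" using RI a Nc desc_subset by blast
        qed
        then show "w \<in> {w. (c, w) \<in> R\<^sup>*}" by simp
      qed
    qed
  }
  assume Nr: "N \<noteq> root"
  have pN: "par N \<in> V - desc N" using par[OF N Nr] par_notin_desc[OF N Nr] by simp
  show "{w. (par N, w) \<in> R\<^sup>*} = V - desc N"
  proof
    have "b \<in> V - desc N" if ab: "(a, b) \<in> R" "a \<in> V - desc N" for a b
    proof (cases "(a, b) \<in> up")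
      case True
      then show ?thesis using ab desc_child[of a N] RV[OF ab(1)] by (auto simp: up_iff)
    next
      case False
      then have b: "b \<in> V" "b \<noteq> root" "a = par b" "b \<noteq> N"
        using ab(1) unfolding R_def tree_arcs_def by (auto simp: up_iff)
      then show ?thesis using desc_par[of b N] ab(2) by auto
    qed
    then show "{w. (par N, w) \<in> R\<^sup>*} \<subseteq> V - desc N"
      using closed_component[of "par N" _ R "V - desc N"] pN by blast
    show "V - desc N \<subseteq> {w. (par N, w) \<in> R\<^sup>*}"
    proof
      fix w assume w: "w \<in> V - desc N"
      have "(par N, w) \<in> R\<^sup>*"
      proof (rule outside_connected[OF symR _ pN w])
        fix a assume a: "a \<in> V - desc N" "a \<noteq> root"
        have "a \<noteq> N" using a desc_self[OF N] by blast
        moreover have "par a \<noteq> N"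
          using desc_child[of a N] a desc_self[OF N] by auto
        ultimately show "(a, par a) \<in> R" using RI a by blast
      qed
      then show "w \<in> {w. (par N, w) \<in> R\<^sup>*}" by simp
    qed
  qed
qed

lemma tree_arcs_connected: "u \<in> V \<Longrightarrow> v \<in> V \<Longrightarrow> (u, v) \<in> tree_arcs\<^sup>*"
proof -
  assume uv: "u \<in> V" "v \<in> V"
  have *: "(w, root) \<in> tree_arcs\<^sup>*" if "w \<in> V" for w
    using up_root[OF that] rtrancl_mono[of up tree_arcs] by (auto simp: tree_arcs_def)
  have "(root, v) \<in> tree_arcs\<^sup>*"
    using *[OF uv(2)] sym_rtrancl[OF sym_tree_arcs] by (simp add: symD)
  with *[OF uv(1)] show ?thesis by (rule rtrancl_trans)
qed

text \<open>Both neighbours of a deepest vertex of a cycle would have to be its parent.\<close>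

lemma tree_arcs_no_cycle: "\<not> cyclic_path tree_arcs vs"
proof
  assume "cyclic_path tree_arcs vs"
  then have cp: "length vs \<ge> 3" "distinct vs" "successively (\<lambda>u v. (u, v) \<in> tree_arcs) vs"
    "(last vs, hd vs) \<in> tree_arcs" by (auto simp: cyclic_path_def)
  let ?n = "length vs"
  have arc: "(vs ! i, vs ! (Suc i mod ?n)) \<in> tree_arcs" if "i < ?n" for i
  proof (cases "Suc i = ?n")
    case True
    then have "vs ! i = last vs" by (metis diff_Suc_1 last_conv_nth length_0_conv nat.distinct(1))
    moreover have "vs ! 0 = hd vs" using cp(1) by (cases vs) auto
    ultimately show ?thesis using cp(4) True by simp
  next
    case False
    then show ?thesis using cp(3) that by (auto simp: successively_conv_nth)
  qed
  have "finite (set vs)" "set vs \<noteq> {}" using cp(1) by auto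
  then obtain x where x: "x \<in> set vs" "\<And>y. y \<in> set vs \<Longrightarrow> depth y \<le> depth x"
    using obtains_MAX[of "set vs" depth] by (metis Max_ge finite_imageI imageI)
  then obtain i where i: "i < ?n" "vs ! i = x" by (metis in_set_conv_nth)
  \<comment> \<open>\<open>j\<close> is the cyclic predecessor of \<open>i\<close>. It differs from
    the successor since a cycle has at least three vertices.\<close>
  define j where "j = (if i = 0 then ?n - 1 else i - 1)"
  have j: "j < ?n" "Suc j mod ?n = i" "j \<noteq> Suc i mod ?n"
    using i cp(1) unfolding j_def by (auto simp: mod_Suc)
  have si: "Suc i mod ?n < ?n" using cp(1) by (intro mod_less_divisor) linarith
  have eq: "w = par x" if "(x, w) \<in> tree_arcs" "w \<in> set vs" for w
    using that x(2)[OF that(2)] depth_par[of w] by (auto simp: tree_arcs_iff)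
  have 1: "(x, vs ! (Suc i mod ?n)) \<in> tree_arcs" using arc[OF i(1)] i(2) by simp
  have 2: "(x, vs ! j) \<in> tree_arcs"
    using arc[OF j(1)] j(2) i(2) sym_tree_arcs by (simp add: symD)
  have "vs ! (Suc i mod ?n) = vs ! j" using eq[OF 1] eq[OF 2] si j(1) by simp
  then show False using cp(2) si j by (simp add: nth_eq_iff_index_eq)
qed

lemma ex_bottom:
  assumes "v \<in> V" shows "\<exists>w\<in>desc v. \<forall>u\<in>V. u \<noteq> root \<longrightarrow> par u \<noteq> w"
proof -
  have "finite (desc v)" "desc v \<noteq> {}"
    using finite_subset[OF desc_subset finite_V] desc_self[OF assms] by auto
  then obtain w where w: "w \<in> desc v" "\<And>y. y \<in> desc v \<Longrightarrow> depth y \<le> depth w"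
    using obtains_MAX[of "desc v" depth] by (metis Max_ge finite_imageI imageI)
  have "par u \<noteq> w" if u: "u \<in> V" "u \<noteq> root" for u
  proof
    assume "par u = w"
    then have "u \<in> desc v" using desc_child[OF u] w(1) by simp
    then show False using w(2) depth_par[OF u] \<open>par u = w\<close> by fastforce
  qed
  then show ?thesis using w(1) by blast
qed

end

section \<open>Rooting an unrooted tree\<close>

lemma rtrancl_distinct_path:
  assumes "(a, b) \<in> R\<^sup>*"
  shows "\<exists>vs. vs \<noteq> [] \<and> distinct vs \<and> hd vs = a \<and> last vs = b \<and>
    successively (\<lambda>u v. (u, v) \<in> R) vs"
  using assms
proof (induction rule: rtrancl_induct)
  case base
  have "[a] \<noteq> [] \<and> distinct [a] \<and> hd [a] = a \<and> last [a] = a \<and>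
    successively (\<lambda>u v. (u, v) \<in> R) [a]" by simp
  then show ?case by blast
next
  case (step b c)
  then obtain vs where vs: "vs \<noteq> []" "distinct vs" "hd vs = a" "last vs = b"
    "successively (\<lambda>u v. (u, v) \<in> R) vs" by blast
  show ?case
  proof (cases "c \<in> set vs")
    case True
    then obtain ys zs where s: "vs = ys @ c # zs" by (meson split_list)
    have "distinct (ys @ [c])" "hd (ys @ [c]) = a"
      using vs(2,3) s by (auto simp: hd_append)
    moreover have "successively (\<lambda>u v. (u, v) \<in> R) (ys @ [c])"
      using vs(5) unfolding s by (auto simp: successively_append_iff)
    ultimately have "ys @ [c] \<noteq> [] \<and> distinct (ys @ [c]) \<and> hd (ys @ [c]) = a \<and>
      last (ys @ [c]) = c \<and> successively (\<lambda>u v. (u, v) \<in> R) (ys @ [c])" by simp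
    then show ?thesis by blast
  next
    case False
    have "vs @ [c] \<noteq> [] \<and> distinct (vs @ [c]) \<and> hd (vs @ [c]) = a \<and> last (vs @ [c]) = c \<and>
      successively (\<lambda>u v. (u, v) \<in> R) (vs @ [c])"
      using vs False step(2) by (auto simp: successively_append_iff)
    then show ?thesis by blast
  qed
qed

text \<open>A path from \<open>v\<close> to \<open>u\<close> without repetitions that avoids the
  edge has at least three vertices, and the arc from \<open>u\<close> to \<open>v\<close> closes it
  to a cycle.\<close>

lemma tree_bridge:
  assumes T: "is_tree T" and uv: "(u, v) \<in> arcs T"
  shows "(v, u) \<notin> {(a, b) \<in> arcs T. {a, b} \<noteq> {u, v}}\<^sup>*"
proof
  let ?R = "{(a, b) \<in> arcs T. {a, b} \<noteq> {u, v}}"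
  assume "(v, u) \<in> ?R\<^sup>*"
  then obtain vs where vs: "vs \<noteq> []" "distinct vs" "hd vs = v" "last vs = u"
    "successively (\<lambda>a b. (a, b) \<in> ?R) vs"
    using rtrancl_distinct_path[OF \<open>(v, u) \<in> ?R\<^sup>*\<close>] by blast
  have ne: "u \<noteq> v" using T uv unfolding is_tree_def arcs_def by auto
  have "length vs \<ge> 3"
  proof (rule ccontr)
    assume "\<not> length vs \<ge> 3"
    moreover have "length vs \<noteq> 0" using vs(1) by simp
    ultimately have "length vs = Suc 0 \<or> length vs = Suc (Suc 0)" by linarith
    then consider a where "vs = [a]" | a b where "vs = [a, b]"
      by (auto simp: length_Suc_conv)
    then show False
    proof cases
      case 1 then show ?thesis using vs ne by simp
    next
      case 2 then show ?thesis using vs by (auto simp: insert_commute)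
    qed
  qed
  moreover have "successively (\<lambda>a b. (a, b) \<in> arcs T) vs"
    by (rule successively_mono[OF vs(5)]) auto
  ultimately have "cyclic_path (arcs T) vs"
    unfolding cyclic_path_def using vs uv by simp
  then show False using T unfolding is_tree_def by blast
qed

text \<open>The parent of a vertex is a neighbour closer to the root. An arc between vertices of which
  neither is the parent of the other would be bypassed by parent arcs.\<close>

lemma is_tree_parent:
  fixes T :: "('v, 'a) dtree" and root :: 'v
  assumes T: "is_tree T" and root: "root \<in> verts T"
  obtains par depth where "parent_tree (verts T) root par depth"
    "arcs T = parent_tree.tree_arcs (verts T) root par"
proof -
  define depth where "depth v = (LEAST n. (v, root) \<in> arcs T ^^ n)" for v
  have conn: "\<exists>n. (v, root) \<in> arcs T ^^ n" if "v \<in> verts T" for v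
    using T root that unfolding is_tree_def by (meson rtrancl_imp_relpow)
  have ex: "\<exists>w. (v, w) \<in> arcs T \<and> depth w < depth v" if v: "v \<in> verts T" "v \<noteq> root" for v
  proof -
    have d: "(v, root) \<in> arcs T ^^ depth v" unfolding depth_def by (rule LeastI_ex[OF conn[OF v(1)]])
    then have "depth v \<noteq> 0" using v(2) by (metis relpow_0_E)
    then obtain n where n: "depth v = Suc n" using not0_implies_Suc by blast
    then obtain w where w: "(v, w) \<in> arcs T" "(w, root) \<in> arcs T ^^ n"
      using d by (metis relpow_Suc_E2)
    have "depth w \<le> n" unfolding depth_def by (rule Least_le[of "\<lambda>n. (w, root) \<in> arcs T ^^ n", OF w(2)])
    then show ?thesis using w n by auto
  qed
  define par where "par v = (SOME w. (v, w) \<in> arcs T \<and> depth w < depth v)" for v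
  have par: "(v, par v) \<in> arcs T" "depth (par v) < depth v" if "v \<in> verts T" "v \<noteq> root" for v
    using someI_ex[of "\<lambda>w. (v, w) \<in> arcs T \<and> depth w < depth v"] ex[OF that] unfolding par_def
    by auto
  have arcsV: "u \<in> verts T \<and> w \<in> verts T" if "(u, w) \<in> arcs T" for u w
    using that T unfolding is_tree_def arcs_def by auto
  have symT: "sym (arcs T)" using T unfolding is_tree_def by blast
  interpret P: parent_tree "verts T" root par depth
  proof
    show "finite (verts T)" using T unfolding is_tree_def by blast
  qed (use root par arcsV in blast)+
  have sub: "P.tree_arcs \<subseteq> arcs T"
    using par symT unfolding P.tree_arcs_def by (auto simp: P.up_iff symD)
  moreover have "arcs T \<subseteq> P.tree_arcs"
  proof (rule subrelI, rule ccontr)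
    fix u v assume uv: "(u, v) \<in> arcs T" "(u, v) \<notin> P.tree_arcs"
    have "(v, u) \<notin> P.tree_arcs" using uv(2) P.sym_tree_arcs by (meson symD)
    then have "P.tree_arcs \<subseteq> {(a, b) \<in> arcs T. {a, b} \<noteq> {u, v}}"
      using sub uv(2) by (auto simp: doubleton_eq_iff)
    then have "P.tree_arcs\<^sup>* \<subseteq> {(a, b) \<in> arcs T. {a, b} \<noteq> {u, v}}\<^sup>*" by (rule rtrancl_mono)
    moreover have "(v, u) \<in> P.tree_arcs\<^sup>*"
      using P.tree_arcs_connected arcsV[OF uv(1)] by blast
    ultimately show False using tree_bridge[OF T uv(1)] by blast
  qed
  ultimately show ?thesis using P.parent_tree_axioms that by blast
qed

locale labelled_tree = parent_tree "verts T" root par depth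
  for T :: "('v, 'a) dtree" and root par depth +
  fixes X :: "'a set"
  assumes arcs_eq: "arcs T = tree_arcs"
    and distinct_nbrs: "v \<in> verts T \<Longrightarrow> distinct (nbrs T v)"
    and root_leaf: "root \<in> leaves T"
    and lab_bij: "bij_betw (lab T) (leaves T) X"
begin

text \<open>For \<open>v\<close> other than the root this will be the part of the split at the edge
  above \<open>v\<close> that lacks the label of the root.\<close>

definition cluster :: "'v \<Rightarrow> 'a set" where
  "cluster v = lab T ` (leaves T \<inter> desc v)"

lemma set_nbrs: "v \<in> verts T \<Longrightarrow> set (nbrs T v) = {w. (v, w) \<in> tree_arcs}"
  using arcs_eq by (auto simp: arcs_def)

lemma leaves_subset: "leaves T \<subseteq> verts T" by (auto simp: leaves_def)

lemma leaf_iff: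
  assumes v: "v \<in> verts T" "v \<noteq> root"
  shows "v \<in> leaves T \<longleftrightarrow> (\<forall>u\<in>verts T. u \<noteq> root \<longrightarrow> par u \<noteq> v)"
proof -
  have len: "length (nbrs T v) = card {w. (v, w) \<in> tree_arcs}"
    using distinct_card[OF distinct_nbrs[OF v(1)]] set_nbrs[OF v(1)] by simp
  have p: "(v, par v) \<in> tree_arcs" using v par by (simp add: tree_arcs_iff)
  have fin: "finite {w. (v, w) \<in> tree_arcs}"
    by (rule finite_subset[OF _ finite_V]) (auto simp: tree_arcs_iff)
  show ?thesis
  proof
    assume "v \<in> leaves T"
    then have c: "card {w. (v, w) \<in> tree_arcs} \<le> 1" using len by (simp add: leaves_def)
    show "\<forall>u\<in>verts T. u \<noteq> root \<longrightarrow> par u \<noteq> v"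
    proof (intro ballI impI notI)
      fix u assume u: "u \<in> verts T" "u \<noteq> root" "par u = v"
      have "(v, u) \<in> tree_arcs" using u v by (auto simp: tree_arcs_iff)
      then have "u = par v" using c p fin by (metis card_le_Suc0_iff_eq mem_Collect_eq One_nat_def)
      then show False using depth_par[OF u(1,2)] depth_par[OF v] u(3) by simp
    qed
  next
    assume r: "\<forall>u\<in>verts T. u \<noteq> root \<longrightarrow> par u \<noteq> v"
    have "{w. (v, w) \<in> tree_arcs} \<subseteq> {par v}" using r by (auto simp: tree_arcs_iff)
    then have "card {w. (v, w) \<in> tree_arcs} \<le> 1" using card_mono[of "{par v}"] by simp
    then show "v \<in> leaves T" using len v by (simp add: leaves_def)
  qed
qed

lemma edges_eq: "edges T = (\<lambda>v. {v, par v}) ` (verts T - {root})"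
proof
  show "edges T \<subseteq> (\<lambda>v. {v, par v}) ` (verts T - {root})"
    unfolding edges_def arcs_eq by (auto simp: tree_arcs_iff insert_commute)
  show "(\<lambda>v. {v, par v}) ` (verts T - {root}) \<subseteq> edges T"
  proof (rule image_subsetI)
    fix v assume "v \<in> verts T - {root}"
    then have "(v, par v) \<in> arcs T" unfolding arcs_eq by (simp add: tree_arcs_iff par)
    then show "{v, par v} \<in> edges T" unfolding edges_def by blast
  qed
qed

lemma lab_image: "lab T ` leaves T = X" using lab_bij by (simp add: bij_betw_def)

lemma lab_inj: "inj_on (lab T) (leaves T)" using lab_bij by (simp add: bij_betw_def)

lemma cluster_subset: "cluster v \<subseteq> X" using lab_image by (auto simp: cluster_def)

lemma cluster_root: "cluster root = X"
  unfolding cluster_def desc_root using leaves_subset lab_image by (simp add: Int_absorb2)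

lemma cluster_outside: "lab T ` (leaves T \<inter> (verts T - desc v)) = X - cluster v"
proof -
  have "leaves T \<inter> (verts T - desc v) = leaves T - leaves T \<inter> desc v"
    using leaves_subset by blast
  then show ?thesis
    using inj_on_image_set_diff[OF lab_inj, of "leaves T" "leaves T \<inter> desc v"] lab_image
    unfolding cluster_def by simp
qed

lemma cluster_nonempty:
  assumes "v \<in> verts T" shows "cluster v \<noteq> {}"
proof -
  obtain w where w: "w \<in> desc v" "\<forall>u\<in>verts T. u \<noteq> root \<longrightarrow> par u \<noteq> w"
    using ex_bottom[OF assms] by blast
  have "w \<in> leaves T"
  proof (cases "w = root")
    case True then show ?thesis using root_leaf by simp
  next
    case False
    then show ?thesis using leaf_iff[of w] w desc_subset by blast
  qed
  then show ?thesis using w unfolding cluster_def by blast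
qed

lemma cluster_mono: "w \<in> desc v \<Longrightarrow> cluster w \<subseteq> cluster v"
  using desc_mono[of w v] by (auto simp: cluster_def)

lemma cluster_disjoint:
  assumes "a \<in> cluster u" "a \<in> cluster v" shows "u \<in> desc v \<or> v \<in> desc u"
proof -
  obtain l m where "l \<in> leaves T" "l \<in> desc u" "a = lab T l" "m \<in> leaves T" "m \<in> desc v" "a = lab T m"
    using assms by (auto simp: cluster_def)
  then show ?thesis using desc_disjoint inj_onD[OF lab_inj] by metis
qed

lemma lab_root_notin: "v \<in> verts T \<Longrightarrow> v \<noteq> root \<Longrightarrow> lab T root \<notin> cluster v"
proof
  assume v: "v \<in> verts T" "v \<noteq> root" "lab T root \<in> cluster v"
  then obtain l where l: "l \<in> leaves T" "l \<in> desc v" "lab T root = lab T l"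
    by (auto simp: cluster_def)
  then have "root \<in> desc v" using inj_onD[OF lab_inj l(3) root_leaf l(1)] by simp
  moreover have "v \<in> desc root" using v desc_root by simp
  ultimately show False using desc_antisym v(2) by blast
qed

lemma labels_from_eq: "labels_from T R v = lab T ` (leaves T \<inter> {w. (v, w) \<in> R\<^sup>*})"
  unfolding labels_from_def by (rule arg_cong[of _ _ "image (lab T)"]) blast

lemma edge_split_eq:
  assumes "v \<in> verts T" "v \<noteq> root"
  shows "edge_split T {v, par v} = {cluster v, X - cluster v}"
  unfolding edge_split_def labels_from_eq arcs_eq
  using edge_components[OF assms] cluster_outside[of v] by (simp add: cluster_def)

lemma node_part_child:
  assumes "N \<in> verts T" "i < length (nbrs T N)" "nbrs T N ! i = c" "c \<in> verts T" "c \<noteq> root" "par c = N"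
  shows "node_part T N i = cluster c"
  unfolding node_part_def labels_from_eq arcs_eq assms(3)
  using node_components(1)[OF assms(1,4,5,6)] by (simp add: cluster_def)

lemma node_part_par:
  assumes "N \<in> verts T" "N \<noteq> root" "nbrs T N ! i = par N"
  shows "node_part T N i = X - cluster N"
  unfolding node_part_def labels_from_eq arcs_eq assms(3)
  using node_components(2)[OF assms(1,2)] cluster_outside[of N] by simp

end

section \<open>Uniqueness of the tree of strong bipartitions\<close>

context pointed_relation
begin

text \<open>A tree has one vertex more than edges: \<open>X\<close> belongs to the root, the leaf
  labelled \<open>r\<close>, while every other vertex stands for the strong set below its edge to
  the parent.\<close>

definition strong_clusters :: "'a set set" where
  "strong_clusters = insert X {S. strong S}"

text \<open>\<open>B\<close> is required to be the least strong cluster above \<open>A\<close>, not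
  just a minimal one; as the clusters above a nonempty set form a chain, this is the usual covering
  relation.\<close>

definition covers :: "'a set \<Rightarrow> 'a set \<Rightarrow> bool" where
  "covers A B \<longleftrightarrow> A \<subset> B \<and> (\<forall>D\<in>strong_clusters. A \<subset> D \<longrightarrow> B \<subseteq> D)"

lemma strong_subset: "strong S \<Longrightarrow> S \<subseteq> X - {r}"
  by (rule member_subset[OF strongD])

lemma not_strong_X: "\<not> strong X"
  using strong_subset[of X] r by blast

text \<open>Adjacency, leaves and labels are all expressed by inclusions of strong clusters, in
  terms that do not depend on the tree.\<close>

definition cluster_map :: "('v, 'a) dtree \<Rightarrow> ('v \<Rightarrow> 'a set) \<Rightarrow> bool" where
  "cluster_map T S \<longleftrightarrow> bij_betw S (verts T) strong_clusters \<and>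
     (\<forall>u\<in>verts T. \<forall>v\<in>verts T. (u, v) \<in> arcs T \<longleftrightarrow> covers (S u) (S v) \<or> covers (S v) (S u)) \<and>
     (\<forall>v\<in>verts T. v \<in> leaves T \<longleftrightarrow> S v = X \<or> \<not> (\<exists>D\<in>strong_clusters. D \<subset> S v)) \<and>
     (\<forall>v\<in>leaves T. lab T v = (if S v = X then r else the_elem (S v)))"

text \<open>The tree is rooted at the leaf labelled \<open>r\<close>. Each edge then has exactly one
  part without \<open>r\<close>, the cluster of its lower end, so the bijection from edges to strong
  bipartitions becomes one from vertices to strong clusters, under which parent arcs become
  covers.\<close>

lemma strong_split_tree_clusters:
  assumes T: "strong_split_tree X H T"
  shows "\<exists>S. cluster_map T S"
proof -
  have tree: "is_tree T" and labb: "bij_betw (lab T) (leaves T) X"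
    and es: "bij_betw (edge_split T) (edges T) (strong_bipartitions X H)"
    using T unfolding strong_split_tree_def by auto
  obtain root where rt: "root \<in> leaves T" "lab T root = r"
    using labb r unfolding bij_betw_def by blast
  have rootV: "root \<in> verts T" using rt(1) by (simp add: leaves_def)
  obtain par depth where P: "parent_tree (verts T) root par depth"
    "arcs T = parent_tree.tree_arcs (verts T) root par" using is_tree_parent[OF tree rootV] by blast
  interpret parent_tree "verts T" root par depth by (rule P)
  interpret L: labelled_tree T root par depth X
  proof
    show "arcs T = tree_arcs" by (rule P)
    show "\<And>v. v \<in> verts T \<Longrightarrow> distinct (nbrs T v)" using tree unfolding is_tree_def by blast
  qed (use rt labb in auto)
  let ?V = "verts T - {root}"
  have sub: "L.cluster v \<subseteq> X" "r \<notin> L.cluster v" if "v \<in> ?V" for v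
    using L.cluster_subset[of v] L.lab_root_notin[of v] rt(2) that by auto
  have espl: "edge_split T {v, par v} = split (L.cluster v)" if "v \<in> ?V" for v
    using L.edge_split_eq[of v] that by (simp add: split_def)
  have edge: "{v, par v} \<in> edges T" if "v \<in> ?V" for v using that L.edges_eq by blast
  have img: "L.cluster ` ?V = {S. strong S}"
  proof -
    have "split ` (L.cluster ` ?V) = edge_split T ` edges T"
      unfolding L.edges_eq image_image using espl by (intro image_cong refl) simp
    also have "\<dots> = split ` {S. strong S}"
      using es strong_bipartitions_eq unfolding bij_betw_def by simp
    finally have eq: "split ` (L.cluster ` ?V) = split ` {S. strong S}" .
    show ?thesis
    proof (intro set_eqI iffI)
      fix A assume A: "A \<in> L.cluster ` ?V"
      then have "split A \<in> split ` {S. strong S}" using eq by blast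
      then obtain S where S: "strong S" "split A = split S" by blast
      have "A \<subseteq> X" "r \<notin> A" using A sub by auto
      then have "A = S" using strong_subset[OF S(1)] S(2) by (intro split_inj) auto
      then show "A \<in> {S. strong S}" using S by simp
    next
      fix A assume A: "A \<in> {S. strong S}"
      then have "split A \<in> split ` (L.cluster ` ?V)" using eq by blast
      then obtain v where v: "v \<in> ?V" "split A = split (L.cluster v)" by blast
      have "A \<subseteq> X" "r \<notin> A" using A strong_subset by auto
      then have "A = L.cluster v" using sub[OF v(1)] v(2) by (intro split_inj) auto
      then show "A \<in> L.cluster ` ?V" using v by blast
    qed
  qed
  have inj: "inj_on L.cluster (verts T)"
  proof (rule inj_onI)
    fix v w assume vw: "v \<in> verts T" "w \<in> verts T" "L.cluster v = L.cluster w"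
    have *: "root = u" if "u \<in> verts T" "L.cluster u = X" for u
      using sub(2)[of u] that r by blast
    show "v = w"
    proof (cases "v = root \<or> w = root")
      case True
      then show ?thesis using * vw L.cluster_root by metis
    next
      case False
      then have V: "v \<in> ?V" "w \<in> ?V" using vw by auto
      have "{v, par v} = {w, par w}"
        by (rule inj_onD[OF bij_betw_imp_inj_on[OF es] _ edge[OF V(1)] edge[OF V(2)]])
          (simp add: espl[OF V(1)] espl[OF V(2)] vw(3))
      then show ?thesis using par_edge_inj V by blast
    qed
  qed
  have "verts T = insert root ?V" using rootV by blast
  then have img': "L.cluster ` verts T = strong_clusters"
    unfolding strong_clusters_def using img L.cluster_root by (metis image_insert)
  have bij: "bij_betw L.cluster (verts T) strong_clusters" using inj img' by (simp add: bij_betw_def)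
  have ord: "v \<in> desc u \<longleftrightarrow> L.cluster v \<subseteq> L.cluster u" if uv: "u \<in> verts T" "v \<in> verts T" for u v
  proof
    assume sub: "L.cluster v \<subseteq> L.cluster u"
    obtain a where a: "a \<in> L.cluster v" using L.cluster_nonempty[OF uv(2)] by blast
    have "u = v" if "u \<in> desc v"
      using inj_onD[OF inj] L.cluster_mono[OF that] sub uv by blast
    then show "v \<in> desc u" using L.cluster_disjoint[of a u v] a sub by blast
  qed (rule L.cluster_mono)
  have strict: "L.cluster v \<subset> L.cluster u \<longleftrightarrow> v \<in> desc u \<and> u \<noteq> v"
    if uv: "u \<in> verts T" "v \<in> verts T" for u v
    using ord[OF uv] ord[OF uv(2,1)] inj_onD[OF inj _ uv] by blast
  have cov: "(v, u) \<in> up \<longleftrightarrow> covers (L.cluster v) (L.cluster u)"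
    if uv: "u \<in> verts T" "v \<in> verts T" for u v
  proof -
    have "(v, u) \<in> up \<longleftrightarrow> L.cluster v \<subset> L.cluster u \<and>
      (\<forall>w\<in>verts T. L.cluster v \<subset> L.cluster w \<longrightarrow> L.cluster u \<subseteq> L.cluster w)"
      unfolding up_desc_iff[OF uv(2,1)] strict[OF uv] using strict[OF _ uv(2)] ord[OF _ uv(1)] by blast
    then show ?thesis unfolding covers_def img'[symmetric] by simp
  qed
  have "cluster_map T L.cluster" unfolding cluster_map_def
  proof (intro conjI ballI bij)
    show "(u, v) \<in> arcs T \<longleftrightarrow>
      covers (L.cluster u) (L.cluster v) \<or> covers (L.cluster v) (L.cluster u)"
      if "u \<in> verts T" "v \<in> verts T" for u v
      using cov that unfolding P(2) tree_arcs_def by simp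
    have rootX: "L.cluster v = X \<longleftrightarrow> v = root" if "v \<in> verts T" for v
      using L.cluster_root inj_onD[OF inj _ that rootV] by auto
    show leaf: "v \<in> leaves T \<longleftrightarrow> L.cluster v = X \<or> \<not> (\<exists>D\<in>strong_clusters. D \<subset> L.cluster v)"
      if v: "v \<in> verts T" for v
    proof (cases "v = root")
      case True then show ?thesis using L.cluster_root rt by simp
    next
      case False
      have "(\<exists>D\<in>strong_clusters. D \<subset> L.cluster v) \<longleftrightarrow> (\<exists>w\<in>verts T. w \<in> desc v \<and> w \<noteq> v)"
        unfolding img'[symmetric] bex_simps using strict[OF v] by (metis (no_types, lifting))
      also have "\<dots> \<longleftrightarrow> (\<exists>u\<in>verts T. u \<noteq> root \<and> par u = v)"
      proof
        assume "\<exists>u\<in>verts T. u \<noteq> root \<and> par u = v"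
        then obtain u where u: "u \<in> verts T" "u \<noteq> root" "par u = v" by blast
        then have "u \<in> desc v" using desc_child[OF u(1,2)] desc_self[OF v] by simp
        moreover have "u \<noteq> v" using depth_par[OF u(1,2)] u(3) by auto
        ultimately show "\<exists>w\<in>verts T. w \<in> desc v \<and> w \<noteq> v" using u by blast
      next
        assume "\<exists>w\<in>verts T. w \<in> desc v \<and> w \<noteq> v"
        then obtain w where w: "w \<in> verts T" "(w, v) \<in> up\<^sup>*" "w \<noteq> v" by (auto simp: desc_def)
        then obtain u where "(u, v) \<in> up" by (metis rtranclE)
        then show "\<exists>u\<in>verts T. u \<noteq> root \<and> par u = v" by (auto simp: up_iff)
      qed
      finally show ?thesis using L.leaf_iff[OF v False] rootX[OF v] False by blast
    qed
    show "lab T v = (if L.cluster v = X then r else the_elem (L.cluster v))" if v: "v \<in> leaves T" for v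
    proof (cases "v = root")
      case True then show ?thesis using rt L.cluster_root by simp
    next
      case False
      have vV: "v \<in> verts T" using v by (simp add: leaves_def)
      have "desc v = {v}"
      proof
        show "desc v \<subseteq> {v}"
        proof
          fix w assume w: "w \<in> desc v"
          show "w \<in> {v}"
          proof (rule ccontr)
            assume "w \<notin> {v}"
            then have "L.cluster w \<subset> L.cluster v" using strict[OF vV, of w] w desc_subset by blast
            moreover have "L.cluster w \<in> strong_clusters" using img' w desc_subset by blast
            ultimately show False using leaf[OF vV] v rootX[OF vV] False by blast
          qed
        qed
      qed (use desc_self[OF vV] in simp)
      then have "L.cluster v = {lab T v}" using v by (simp add: L.cluster_def)
      then show ?thesis using rootX[OF vV] False by simp
    qed
  qed
  then show ?thesis by blast
qed

text \<open>One cluster map followed by the inverse of the other is an isomorphism, because both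
  describe their trees by the same set of clusters.\<close>

theorem strong_split_tree_unique:
  assumes "strong_split_tree X H T" "strong_split_tree X H T'"
  shows "tree_iso T T'"
proof -
  obtain S where S: "cluster_map T S" using strong_split_tree_clusters[OF assms(1)] by blast
  obtain S' where S': "cluster_map T' S'" using strong_split_tree_clusters[OF assms(2)] by blast
  note S = S[unfolded cluster_map_def, THEN conjunct1] S[unfolded cluster_map_def, THEN conjunct2]
  note S' = S'[unfolded cluster_map_def, THEN conjunct1] S'[unfolded cluster_map_def, THEN conjunct2]
  define f where "f = inv_into (verts T') S' \<circ> S"
  have f: "bij_betw f (verts T) (verts T')"
    unfolding f_def by (rule bij_betw_trans[OF S(1) bij_betw_inv_into[OF S'(1)]])
  have S'f: "S' (f v) = S v" if "v \<in> verts T" for v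
  proof -
    have "S v \<in> S' ` verts T'" using imageI[OF that, of S] S(1) S'(1) by (simp add: bij_betw_def)
    then show ?thesis unfolding f_def by (simp add: f_inv_into_f)
  qed
  have fV: "f v \<in> verts T'" if "v \<in> verts T" for v using f that by (auto simp: bij_betw_def)
  have lv: "v \<in> leaves T \<longleftrightarrow> f v \<in> leaves T'" if "v \<in> verts T" for v
    using S(2) S'(2) that fV[OF that] S'f[OF that] by simp
  have "f ` leaves T = leaves T'"
  proof
    show "f ` leaves T \<subseteq> leaves T'" using lv by (auto simp: leaves_def[of T])
    show "leaves T' \<subseteq> f ` leaves T"
    proof
      fix w assume w: "w \<in> leaves T'"
      then have "w \<in> f ` verts T" using f by (auto simp: bij_betw_def leaves_def)
      then show "w \<in> f ` leaves T" using lv w by blast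
    qed
  qed
  moreover have "lab T' (f l) = lab T l" if "l \<in> leaves T" for l
  proof -
    have "l \<in> verts T" using that by (simp add: leaves_def)
    then show ?thesis using S(2) S'(2) lv[of l] that S'f[of l] by simp
  qed
  ultimately show ?thesis unfolding tree_iso_def
    using f S(2) S'(2) fV S'f by (intro exI[of _ f]) simp
qed

end

section \<open>Construction of the decomposition tree from the strong clusters\<close>

text \<open>The index sets at a node with \<open>k\<close> children, up to complement: the last neighbour is the parent, and
  the index sets that contain it are replaced by their complements.\<close>

fun lower_sets :: "kind \<Rightarrow> nat \<Rightarrow> nat set set" where
  "lower_sets Complete k = {I. I \<subseteq> {..<k} \<and> I \<noteq> {}}"
| "lower_sets Circular k = {{i..<j} | i j. i < j \<and> j \<le> k}"
| "lower_sets Prime k = {{a} | a. a < k} \<union> {{..<k}}"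

lemma index_sets_Suc_lower:
  assumes "I \<in> lower_sets K k" "k \<ge> 1" "k \<ge> 2 \<or> K \<noteq> Prime"
  shows "\<exists>J\<in>index_sets K (Suc k). J = I \<or> J = {..k} - I"
proof (cases K)
  case Complete
  then have I: "I \<subseteq> {..<k}" "I \<noteq> {}" using assms(1) by auto
  then have "finite I" using finite_subset by blast
  then have "1 \<le> card I" "card I < Suc k"
    using I card_mono[of "{..<k}" I] by (auto simp: Suc_le_eq card_gt_0_iff)
  moreover have "I \<subseteq> {..<Suc k}" using I by auto
  ultimately show ?thesis using Complete by auto
next
  case Circular
  then obtain i j where "I = {i..<j}" "i < j" "j \<le> k" using assms(1) by auto
  then have "j \<le> Suc k \<and> I = {i..<j}" "1 \<le> card I" "card I < Suc k" by simp_all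
  then have "I \<in> index_sets K (Suc k)" unfolding Circular index_sets.simps by blast
  then show ?thesis by blast
next
  case Prime
  then consider a where "I = {a}" "a < k" | "I = {..<k}" using assms(1) by auto
  then show ?thesis
  proof cases
    case 1
    then have "I \<in> index_sets K (Suc k)" using Prime by auto
    then show ?thesis by blast
  next
    case 2
    \<comment> \<open>All children together are complementary to the parent alone.\<close>
    then have "{..k} - I = {k}" by auto
    moreover have "{k} \<in> index_sets K (Suc k)" using Prime by auto
    ultimately show ?thesis by blast
  qed
qed

lemma lower_index_sets_Suc:
  assumes "J \<in> index_sets K (Suc k)"
  shows "\<exists>I\<in>lower_sets K k. J = I \<or> J = {..k} - I"
proof (cases K)
  case Complete
  then have J: "J \<subseteq> {..k}" "1 \<le> card J" "card J < Suc k" using assms by auto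
  show ?thesis
  proof (cases "k \<in> J")
    case True
    have "{..k} - J \<noteq> {}"
    proof
      assume "{..k} - J = {}"
      then have "J = {..k}" using J(1) by blast
      then show False using J(3) by simp
    qed
    moreover have "{..k} - J \<subseteq> {..<k}" using True by (auto simp: le_less)
    ultimately have "{..k} - J \<in> lower_sets K k" using Complete by simp
    moreover have "J = {..k} - ({..k} - J)" using J(1) by blast
    ultimately show ?thesis by blast
  next
    case False
    then have "J \<subseteq> {..<k}" using J(1) by (auto simp: le_less)
    moreover have "J \<noteq> {}" using J(2) by auto
    ultimately show ?thesis using Complete by auto
  qed
next
  case Circular
  then obtain i j where ij: "J = {i..<j}" "j \<le> Suc k" "1 \<le> j - i" "j - i < Suc k" using assms by auto
  show ?thesis
  proof (cases "j \<le> k")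
    case True
    then have "J = {i..<j} \<and> i < j \<and> j \<le> k" using ij by simp
    then have "J \<in> lower_sets K k" unfolding Circular lower_sets.simps by blast
    then show ?thesis by blast
  next
    case False
    then have j: "j = Suc k" "0 < i" "i \<le> k" using ij by auto
    \<comment> \<open>An interval that ends with the parent is complementary to an initial interval
      of children. So cutting the circle at the parent loses no bipartition.\<close>
    then have "{0..<i} \<in> lower_sets K k" unfolding Circular lower_sets.simps by blast
    moreover have "J = {..k} - {0..<i}" using ij j by auto
    ultimately show ?thesis by blast
  qed
next
  case Prime
  then obtain a where a: "J = {a}" "a < Suc k" using assms by auto
  show ?thesis
  proof (cases "a < k")
    case True then show ?thesis using Prime a by auto
  next
    case False
    then have "J = {..k} - {..<k}" using a by auto
    then show ?thesis using Prime by auto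
  qed
qed

text \<open>\<open>S\<close> assigns to each vertex of \<open>T\<close> its strong set, and to the leaf \<open>root\<close> all of \<open>X\<close>.\<close>

locale clustered_tree = pointed_relation X H r
  for X :: "'a set" and H r +
  fixes T :: "('v, 'a) dtree" and S :: "'v \<Rightarrow> 'a set" and root :: 'v and par :: "'v \<Rightarrow> 'v"
    and ch :: "'v \<Rightarrow> 'v list"
  assumes fin_T: "finite (verts T)"
    and bij_S: "bij_betw S (verts T) strong_clusters"
    and root_V: "root \<in> verts T" and S_root: "S root = X"
    and par_V: "v \<in> verts T \<Longrightarrow> v \<noteq> root \<Longrightarrow> par v \<in> verts T"
    and covers_par: "v \<in> verts T \<Longrightarrow> v \<noteq> root \<Longrightarrow> covers (S v) (S (par v))"
    and nbrs_eq: "v \<in> verts T \<Longrightarrow> nbrs T v = ch v @ (if v = root then [] else [par v])"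
    and distinct_ch: "v \<in> verts T \<Longrightarrow> distinct (ch v)"
    and set_ch: "v \<in> verts T \<Longrightarrow> set (ch v) = {w \<in> verts T. w \<noteq> root \<and> par w = v}"
    and lab_S: "v \<in> verts T \<Longrightarrow> S v = {a} \<Longrightarrow> v \<noteq> root \<Longrightarrow> lab T v = a"
    and lab_root: "lab T root = r"
    and kind_Complete: "N \<in> verts T \<Longrightarrow> N \<noteq> root \<Longrightarrow> card (S N) \<ge> 2 \<Longrightarrow> kind T N = Complete \<Longrightarrow>
      complete_family (child (S N) ` S N) (quotient (S N))"
    and kind_Prime: "N \<in> verts T \<Longrightarrow> N \<noteq> root \<Longrightarrow> card (S N) \<ge> 2 \<Longrightarrow> kind T N = Prime \<Longrightarrow>
      prime_family (child (S N) ` S N) (quotient (S N))"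
    and kind_Circular: "N \<in> verts T \<Longrightarrow> N \<noteq> root \<Longrightarrow> card (S N) \<ge> 2 \<Longrightarrow> kind T N = Circular \<Longrightarrow>
      \<exists>q. linear_family q (child (S N) ` S N) (quotient (S N)) \<and>
        sorted_wrt (\<lambda>v w. q (S v) < q (S w)) (ch N)"
begin

lemma S_image: "S ` verts T = strong_clusters" using bij_S by (simp add: bij_betw_def)

lemma S_inj: "v \<in> verts T \<Longrightarrow> w \<in> verts T \<Longrightarrow> S v = S w \<Longrightarrow> v = w"
  using bij_S by (auto simp: bij_betw_def inj_on_def)

lemma S_strong: "v \<in> verts T \<Longrightarrow> v \<noteq> root \<Longrightarrow> strong (S v)"
proof -
  assume v: "v \<in> verts T" "v \<noteq> root"
  have "S v \<in> strong_clusters" using S_image v(1) by blast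
  moreover have "S v \<noteq> X" using S_inj[OF v(1) root_V] S_root v(2) by auto
  ultimately show ?thesis unfolding strong_clusters_def by blast
qed

lemma S_subset: "v \<in> verts T \<Longrightarrow> S v \<subseteq> X"
  using S_strong[of v] strong_subset S_root by blast

lemma strong_vertex:
  assumes "strong A" obtains v where "v \<in> verts T" "v \<noteq> root" "S v = A"
proof -
  have "A \<in> S ` verts T" unfolding S_image strong_clusters_def using assms by simp
  then obtain v where "v \<in> verts T" "S v = A" by blast
  then show ?thesis using that[of v] not_strong_X S_root assms by blast
qed

lemma card_S_less: "v \<in> verts T \<Longrightarrow> w \<in> verts T \<Longrightarrow> S v \<subset> S w \<Longrightarrow> card (S v) < card (S w)"
  using psubset_card_mono[of "S w" "S v"] finite_subset[OF S_subset finite_X] by blast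

text \<open>Clusters grow strictly towards the root, so the number of missing elements serves as
  depth.\<close>

sublocale parent_tree "verts T" root par "\<lambda>v. card X - card (S v)"
proof
  fix v assume v: "v \<in> verts T" "v \<noteq> root"
  have "card (S v) < card (S (par v))"
    using card_S_less[OF v(1) par_V[OF v]] covers_par[OF v] unfolding covers_def by blast
  moreover have "card (S (par v)) \<le> card X"
    by (rule card_mono[OF finite_X S_subset[OF par_V[OF v]]])
  ultimately show "card X - card (S (par v)) < card X - card (S v)" by simp
qed (rule fin_T root_V par_V; assumption?)+

lemma arcs_T: "arcs T = tree_arcs"
proof -
  have "(u, v) \<in> arcs T \<longleftrightarrow> (u, v) \<in> tree_arcs" for u v
  proof (cases "u \<in> verts T")
    case True
    then show ?thesis using nbrs_eq[OF True] set_ch[OF True] par_V[OF True]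
      by (auto simp: arcs_def tree_arcs_iff)
  qed (auto simp: arcs_def tree_arcs_iff)
  then show ?thesis by auto
qed

lemma distinct_nbrs_T: "v \<in> verts T \<Longrightarrow> distinct (nbrs T v)"
proof -
  assume v: "v \<in> verts T"
  have "par v \<notin> set (ch v)" if vr: "v \<noteq> root"
    using set_ch[OF v] depth_par[OF v vr] depth_par[of "par v"] by fastforce
  then show ?thesis using nbrs_eq[OF v] distinct_ch[OF v] by auto
qed

lemma is_tree_T: "is_tree T"
  unfolding is_tree_def
proof (intro conjI ballI)
  fix v assume v: "v \<in> verts T"
  have "w \<in> verts T - {v}" if "w \<in> set (nbrs T v)" for w
  proof -
    have "(v, w) \<in> tree_arcs" using that v arcs_T by (auto simp: arcs_def)
    then show ?thesis using depth_par[of v] depth_par[of w] by (auto simp: tree_arcs_iff)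
  qed
  then show "set (nbrs T v) \<subseteq> verts T - {v}" by blast
qed (use fin_T distinct_nbrs_T sym_tree_arcs tree_arcs_connected tree_arcs_no_cycle arcs_T in auto)

text \<open>Since \<open>S (par v)\<close> is the least cluster above \<open>S v\<close>, climbing
  from \<open>v\<close> cannot skip a cluster that contains \<open>S v\<close>.\<close>

lemma desc_iff_subset:
  assumes "v \<in> verts T" "u \<in> verts T" shows "v \<in> desc u \<longleftrightarrow> S v \<subseteq> S u"
proof
  assume "v \<in> desc u"
  then have "(v, u) \<in> up\<^sup>*" by (simp add: desc_def)
  then show "S v \<subseteq> S u"
  proof (induction rule: rtrancl_induct)
    case (step y z)
    then show ?case using covers_par[of y] unfolding covers_def by (auto simp: up_iff)
  qed simp
next
  assume "S v \<subseteq> S u"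
  then show "v \<in> desc u" using assms(1)
  proof (induction "card X - card (S v)" arbitrary: v rule: less_induct)
    case less
    show ?case
    proof (cases "v = u")
      case True then show ?thesis using desc_self assms(2) by simp
    next
      case False
      then have ss: "S v \<subset> S u" using less.prems S_inj[OF less.prems(2) assms(2)] by blast
      have vr: "v \<noteq> root" using ss S_root S_subset[OF assms(2)] by blast
      have "S u \<in> strong_clusters" using S_image assms(2) by blast
      then have "S (par v) \<subseteq> S u" using covers_par[OF less.prems(2) vr] ss unfolding covers_def by blast
      then have "par v \<in> desc u"
        using less.hyps[OF depth_par[OF less.prems(2) vr]] par_V[OF less.prems(2) vr] by blast
      then show ?thesis by (rule desc_child[OF less.prems(2) vr])
    qed
  qed
qed

lemma no_child_iff:
  assumes v: "v \<in> verts T" "v \<noteq> root"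
  shows "(\<forall>u\<in>verts T. u \<noteq> root \<longrightarrow> par u \<noteq> v) \<longleftrightarrow> card (S v) = 1"
proof
  assume "card (S v) = 1"
  then obtain a where a: "S v = {a}" using card_1_singletonE by blast
  show "\<forall>u\<in>verts T. u \<noteq> root \<longrightarrow> par u \<noteq> v"
  proof (intro ballI impI notI)
    fix u assume u: "u \<in> verts T" "u \<noteq> root" "par u = v"
    have "S u \<subset> {a}" using covers_par[OF u(1,2)] u(3) a unfolding covers_def by simp
    then show False using member_nonempty[OF strongD[OF S_strong[OF u(1,2)]]] by blast
  qed
next
  assume r: "\<forall>u\<in>verts T. u \<noteq> root \<longrightarrow> par u \<noteq> v"
  obtain a where a: "a \<in> S v" using member_nonempty[OF strongD[OF S_strong[OF v]]] by blast
  then have "strong {a}" using strong_singleton strong_subset[OF S_strong[OF v]] by blast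
  then obtain w where w: "w \<in> verts T" "w \<noteq> root" "S w = {a}" by (rule strong_vertex)
  have "w \<in> desc v" using desc_iff_subset[OF w(1) v(1)] w(3) a by simp
  have "w = v"
  proof (rule ccontr)
    assume "w \<noteq> v"
    then obtain u where "(u, v) \<in> up" using \<open>w \<in> desc v\<close> unfolding desc_def by (metis (no_types, lifting) mem_Collect_eq rtranclE)
    then show False using r by (auto simp: up_iff)
  qed
  then show "card (S v) = 1" using w by simp
qed

lemma leaves_T: "leaves T = {v \<in> verts T. v = root \<or> card (S v) = 1}"
proof -
  have "v \<in> leaves T \<longleftrightarrow> card (S v) = 1" if v: "v \<in> verts T" "v \<noteq> root" for v
  proof -
    have "length (nbrs T v) = Suc (length (ch v))" using nbrs_eq[OF v(1)] v(2) by simp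
    then have "v \<in> leaves T \<longleftrightarrow> set (ch v) = {}" using v by (simp add: leaves_def)
    also have "\<dots> \<longleftrightarrow> (\<forall>u\<in>verts T. u \<noteq> root \<longrightarrow> par u \<noteq> v)"
      unfolding set_ch[OF v(1)] by blast
    finally show ?thesis using no_child_iff[OF v] by simp
  qed
  \<comment> \<open>The root has at most one child: \<open>X - {r}\<close>, if nonempty, is itself
    strong, so it is the only cluster that \<open>X\<close> covers.\<close>
  moreover have "root \<in> leaves T"
  proof -
    have "u = v" if "u \<in> set (ch root)" "v \<in> set (ch root)" for u v
    proof -
      have "S u = X - {r}" if "u \<in> set (ch root)" for u
      proof -
        have u: "u \<in> verts T" "u \<noteq> root" "par u = root" using that set_ch[OF root_V] by auto
        have sub: "S u \<subseteq> X - {r}" by (rule strong_subset[OF S_strong[OF u(1,2)]])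
        show ?thesis
        proof (rule ccontr)
          assume ne: "S u \<noteq> X - {r}"
          then have "strong (X - {r})" using strong_ground sub by blast
          then have "X \<subseteq> X - {r}"
            using covers_par[OF u(1,2)] u(3) S_root sub ne unfolding covers_def strong_clusters_def by auto
          then show False using r by blast
        qed
      qed
      then have "S u = S v" using that by simp
      moreover have "u \<in> verts T" "v \<in> verts T" using that set_ch[OF root_V] by auto
      ultimately show ?thesis using S_inj by blast
    qed
    then have "card (set (ch root)) \<le> 1" by (simp add: card_le_Suc0_iff_eq)
    then show ?thesis using nbrs_eq[OF root_V] root_V distinct_card[OF distinct_ch[OF root_V]]
      by (simp add: leaves_def)
  qed
  ultimately show ?thesis by (auto simp: leaves_def)
qed

lemma lab_bij_T: "bij_betw (lab T) (leaves T) X"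
proof -
  have one: "\<exists>a\<in>X - {r}. S v = {a} \<and> lab T v = a" if "v \<in> leaves T" "v \<noteq> root" for v
  proof -
    have v: "v \<in> verts T" "card (S v) = 1" using that leaves_T by auto
    obtain a where a: "S v = {a}" using v(2) card_1_singletonE by blast
    have "S v \<subseteq> X - {r}" by (rule strong_subset[OF S_strong[OF v(1) that(2)]])
    then have "a \<in> X - {r}" using a by simp
    then show ?thesis using a lab_S[OF v(1) a that(2)] by blast
  qed
  have inj: "inj_on (lab T) (leaves T)"
  proof (rule inj_onI)
    fix v w assume vw: "v \<in> leaves T" "w \<in> leaves T" "lab T v = lab T w"
    then have V: "v \<in> verts T" "w \<in> verts T" by (auto simp: leaves_def)
    show "v = w"
    proof (cases "v = root \<or> w = root")
      case True
      then show ?thesis using one[OF vw(1)] one[OF vw(2)] lab_root vw(3) by force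
    next
      case False
      then have "S v = S w" using one[OF vw(1)] one[OF vw(2)] vw(3) by auto
      then show ?thesis by (rule S_inj[OF V])
    qed
  qed
  have "lab T ` leaves T = X"
  proof
    show "lab T ` leaves T \<subseteq> X"
    proof (rule image_subsetI)
      fix v assume "v \<in> leaves T"
      then show "lab T v \<in> X" using one[of v] lab_root r by (cases "v = root") auto
    qed
    show "X \<subseteq> lab T ` leaves T"
    proof
      fix a assume a: "a \<in> X"
      show "a \<in> lab T ` leaves T"
      proof (cases "a = r")
        case True then show ?thesis using lab_root leaves_T root_V by force
      next
        case False
        then have "strong {a}" using a strong_singleton by blast
        then obtain v where v: "v \<in> verts T" "v \<noteq> root" "S v = {a}" by (rule strong_vertex)
        then have "v \<in> leaves T" using leaves_T by simp
        then show ?thesis using lab_S[OF v(1,3,2)] by blast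
      qed
    qed
  qed
  then show ?thesis using inj by (simp add: bij_betw_def)
qed

sublocale L: labelled_tree T root par "\<lambda>v. card X - card (S v)" X
  by unfold_locales (use arcs_T distinct_nbrs_T leaves_T root_V lab_bij_T in auto)

lemma cluster_eq:
  assumes v: "v \<in> verts T" shows "L.cluster v = S v"
proof (cases "v = root")
  case True then show ?thesis using L.cluster_root S_root by simp
next
  case False
  have sub: "S v \<subseteq> X - {r}" by (rule strong_subset[OF S_strong[OF v False]])
  show ?thesis
  proof
    show "L.cluster v \<subseteq> S v"
    proof
      fix a assume "a \<in> L.cluster v"
      then obtain l where l: "l \<in> leaves T" "l \<in> desc v" "a = lab T l" by (auto simp: L.cluster_def)
      have lV: "l \<in> verts T" using l(1) by (simp add: leaves_def)
      have Sl: "S l \<subseteq> S v" using desc_iff_subset[OF lV v] l(2) by simp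
      then have lr: "l \<noteq> root" using S_root sub r by blast
      then obtain b where "S l = {b}" using l(1) leaves_T card_1_singletonE by blast
      then show "a \<in> S v" using lab_S[OF lV _ lr] Sl l(3) by blast
    qed
    show "S v \<subseteq> L.cluster v"
    proof
      fix a assume a: "a \<in> S v"
      then have "strong {a}" using strong_singleton sub by blast
      then obtain w where w: "w \<in> verts T" "w \<noteq> root" "S w = {a}" by (rule strong_vertex)
      have "w \<in> leaves T" using w leaves_T by simp
      moreover have "w \<in> desc v" using desc_iff_subset[OF w(1) v] w(3) a by simp
      ultimately show "a \<in> L.cluster v" unfolding L.cluster_def using lab_S[OF w(1,3,2)] by blast
    qed
  qed
qed

lemma edge_split_T: "v \<in> verts T \<Longrightarrow> v \<noteq> root \<Longrightarrow> edge_split T {v, par v} = split (S v)"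
  using L.edge_split_eq[of v] cluster_eq[of v] by (simp add: split_def)

lemma S_image_nonroot: "S ` (verts T - {root}) = {A. strong A}"
proof
  show "S ` (verts T - {root}) \<subseteq> {A. strong A}" using S_strong by blast
  show "{A. strong A} \<subseteq> S ` (verts T - {root})"
  proof
    fix A assume "A \<in> {A. strong A}"
    then have "strong A" by simp
    then obtain v where "v \<in> verts T" "v \<noteq> root" "S v = A" by (rule strong_vertex)
    then show "A \<in> S ` (verts T - {root})" by blast
  qed
qed

lemma edge_splits_T: "edge_split T ` edges T = split ` {A. strong A}"
  unfolding L.edges_eq image_image S_image_nonroot[symmetric]
  by (intro image_cong refl) (simp add: edge_split_T)

lemma strong_split_tree_T: "strong_split_tree X H T"
  unfolding strong_split_tree_def bij_betw_def
proof (intro conjI is_tree_T)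
  show "inj_on (lab T) (leaves T)" "lab T ` leaves T = X" using lab_bij_T by (auto simp: bij_betw_def)
  show "edge_split T ` edges T = strong_bipartitions X H"
    unfolding edge_splits_T strong_bipartitions_eq by simp
  show "inj_on (edge_split T) (edges T)"
  proof (rule inj_onI)
    fix e f assume "e \<in> edges T" "f \<in> edges T" and eq: "edge_split T e = edge_split T f"
    then obtain v w where v: "v \<in> verts T" "v \<noteq> root" "e = {v, par v}"
      and w: "w \<in> verts T" "w \<noteq> root" "f = {w, par w}" unfolding L.edges_eq by blast
    have "split (S v) = split (S w)" using eq edge_split_T v w by simp
    moreover have "S v \<subseteq> X - {r}" "S w \<subseteq> X - {r}" using strong_subset S_strong v w by blast+
    ultimately have "S v = S w" by (intro split_inj) auto
    then have "v = w" using S_inj v w by blast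
    then show "e = f" using v w by simp
  qed
qed

text \<open>A strong set covered by \<open>S N\<close> is maximal among its proper strong subsets,
  and conversely the parent of a vertex that represents a maximal one can only be
  \<open>N\<close>.\<close>

lemma children_T:
  assumes N: "N \<in> verts T" "N \<noteq> root" "card (S N) \<ge> 2"
  shows "S ` set (ch N) = child (S N) ` S N"
proof -
  interpret Q: strong_node "X - {r}" away "S N"
    by (rule strong_nodeI[OF S_strong[OF N(1,2)] N(3)])
  have cov: "S w = child (S N) x" if w: "w \<in> verts T" "w \<noteq> root" "covers (S w) (S N)" "x \<in> S w" for w x
  proof -
    have "S w \<subset> S N" using w(3) unfolding covers_def by blast
    then have xN: "x \<in> S N" "S w \<subseteq> child (S N) x"
      using Q.child(4)[OF _ S_strong[OF w(1,2)]] w(4) by blast+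
    have "\<not> S w \<subset> child (S N) x"
    proof
      assume "S w \<subset> child (S N) x"
      moreover have "child (S N) x \<in> strong_clusters"
        using Q.child(1)[OF xN(1)] by (simp add: strong_clusters_def)
      ultimately have "S N \<subseteq> child (S N) x" using w(3) unfolding covers_def by blast
      then show False using Q.child(2)[OF xN(1)] by blast
    qed
    then show ?thesis using xN by blast
  qed
  show ?thesis
  proof
    show "S ` set (ch N) \<subseteq> child (S N) ` S N"
    proof (rule image_subsetI)
      fix w assume "w \<in> set (ch N)"
      then have w: "w \<in> verts T" "w \<noteq> root" "par w = N" using set_ch[OF N(1)] by auto
      have c: "covers (S w) (S N)" using covers_par[OF w(1,2)] w(3) by simp
      obtain x where x: "x \<in> S w" using member_nonempty[OF strongD[OF S_strong[OF w(1,2)]]] by blast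
      have "S w = child (S N) x" by (rule cov[OF w(1,2) c x])
      moreover have "x \<in> S N" using c x unfolding covers_def by blast
      ultimately show "S w \<in> child (S N) ` S N" by blast
    qed
    show "child (S N) ` S N \<subseteq> S ` set (ch N)"
    proof (rule image_subsetI)
      fix x assume x: "x \<in> S N"
      obtain w where w: "w \<in> verts T" "w \<noteq> root" "S w = child (S N) x"
        using Q.child(1)[OF x] by (rule strong_vertex)
      have wN: "S w \<subset> S N" using Q.child(2)[OF x] w(3) by simp
      have cp: "covers (S w) (S (par w))" by (rule covers_par[OF w(1,2)])
      have "S N \<in> strong_clusters" using S_strong[OF N(1,2)] by (simp add: strong_clusters_def)
      then have sub: "S (par w) \<subseteq> S N" using cp wN unfolding covers_def by blast
      have pw: "par w \<in> verts T" by (rule par_V[OF w(1,2)])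
      have "S (par w) = S N"
      proof (rule ccontr)
        assume ne: "S (par w) \<noteq> S N"
        have "par w \<noteq> root" using sub S_root strong_subset[OF S_strong[OF N(1,2)]] r by auto
        then have "strong (S (par w))" by (rule S_strong[OF pw])
        moreover have "x \<in> S (par w)" using cp w(3) Q.child(3)[OF x] unfolding covers_def by blast
        ultimately have "S (par w) \<subseteq> child (S N) x" using Q.child(4)[OF x] sub ne by blast
        then show False using cp w(3) unfolding covers_def by blast
      qed
      then have "par w = N" using S_inj pw N(1) by blast
      then have "w \<in> set (ch N)" using set_ch[OF N(1)] w by simp
      then show "child (S N) x \<in> S ` set (ch N)" using w(3) by (metis imageI)
    qed
  qed
qed

lemma lower_sets_quotient:
  assumes N: "N \<in> verts T" "N \<noteq> root" "card (S N) \<ge> 2"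
  shows "(\<lambda>I. \<Union>i\<in>I. S (ch N ! i)) ` lower_sets (kind T N) (length (ch N)) = Union ` quotient (S N)"
proof -
  interpret Q: strong_node "X - {r}" away "S N"
    by (rule strong_nodeI[OF S_strong[OF N(1,2)] N(3)])
  interpret W: weakly_partitive "child (S N) ` S N" "quotient (S N)"
    by (rule Q.quotient_weakly_partitive)
  let ?k = "length (ch N)"
  let ?C = "\<lambda>i. S (ch N ! i)"
  have C_inj: "inj_on ?C {..<?k}"
  proof (rule inj_onI)
    fix i j assume ij: "i \<in> {..<?k}" "j \<in> {..<?k}" "?C i = ?C j"
    then have "ch N ! i \<in> set (ch N)" "ch N ! j \<in> set (ch N)" by auto
    then have "ch N ! i = ch N ! j" using S_inj ij(3) set_ch[OF N(1)] by blast
    then show "i = j" using ij distinct_ch[OF N(1)] by (simp add: nth_eq_iff_index_eq)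
  qed
  have C_img: "?C ` {..<?k} = child (S N) ` S N"
  proof -
    have "?C ` {..<?k} = S ` ((!) (ch N) ` {..<?k})" by (simp add: image_image)
    also have "(!) (ch N) ` {..<?k} = set (ch N)"
      using nth_image[of ?k "ch N"] by (simp add: lessThan_atLeast0)
    finally show ?thesis using children_T[OF N] by simp
  qed
  have "(\<lambda>I. ?C ` I) ` lower_sets (kind T N) ?k = quotient (S N)"
  proof (cases "kind T N")
    case Complete
    have "quotient (S N) = Pow (?C ` {..<?k}) - {{}}"
      using kind_Complete[OF N Complete] C_img unfolding complete_family_def by simp
    also have "\<dots> = (\<lambda>I. ?C ` I) ` {I. I \<subseteq> {..<?k} \<and> I \<noteq> {}}"
    proof (intro set_eqI iffI)
      fix A assume "A \<in> Pow (?C ` {..<?k}) - {{}}"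
      then obtain I where "I \<subseteq> {..<?k}" "A = ?C ` I" "A \<noteq> {}" by (auto elim: subset_imageE)
      then show "A \<in> (\<lambda>I. ?C ` I) ` {I. I \<subseteq> {..<?k} \<and> I \<noteq> {}}" by blast
    next
      fix A assume "A \<in> (\<lambda>I. ?C ` I) ` {I. I \<subseteq> {..<?k} \<and> I \<noteq> {}}"
      then show "A \<in> Pow (?C ` {..<?k}) - {{}}" by blast
    qed
    finally show ?thesis using Complete by simp
  next
    case Prime
    have pr: "prime_family (child (S N) ` S N) (quotient (S N))" by (rule kind_Prime[OF N Prime])
    have "child (S N) ` S N \<noteq> {}" using N(3) by auto
    have "quotient (S N) = insert (?C ` {..<?k}) ((\<lambda>i. {?C i}) ` {..<?k})"
    proof
      show "insert (?C ` {..<?k}) ((\<lambda>i. {?C i}) ` {..<?k}) \<subseteq> quotient (S N)"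
      proof (intro insert_subsetI image_subsetI)
        show "?C ` {..<?k} \<in> quotient (S N)"
          unfolding C_img by (rule W.ground_member) fact
        fix i assume "i \<in> {..<?k}"
        then have "?C i \<in> child (S N) ` S N" unfolding C_img[symmetric] by (rule imageI)
        then show "{?C i} \<in> quotient (S N)" by (rule W.singleton_member)
      qed
      show "quotient (S N) \<subseteq> insert (?C ` {..<?k}) ((\<lambda>i. {?C i}) ` {..<?k})"
      proof
        fix I assume I: "I \<in> quotient (S N)"
        then consider "card I = 1" | "I = ?C ` {..<?k}"
          using pr unfolding prime_family_def C_img by blast
        then show "I \<in> insert (?C ` {..<?k}) ((\<lambda>i. {?C i}) ` {..<?k})"
        proof cases
          case 1
          then obtain A where A: "I = {A}" using card_1_singletonE by blast
          then have "A \<in> ?C ` {..<?k}" using W.member_subset[OF I] C_img by simp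
          then show ?thesis using A by blast
        qed simp
      qed
    qed
    also have "\<dots> = (\<lambda>I. ?C ` I) ` ({{a} | a. a < ?k} \<union> {{..<?k}})"
      by (auto simp: image_Un image_iff)
    finally show ?thesis using Prime by simp
  next
    case Circular
    obtain q where q: "linear_family q (child (S N) ` S N) (quotient (S N))"
      "sorted_wrt (\<lambda>v w. q (S v) < q (S w)) (ch N)" using kind_Circular[OF N Circular] by blast
    have less: "q (?C i) < q (?C j)" if "i < j" "j < ?k" for i j
      using sorted_wrt_nth_less[OF q(2) that] .
    have less_iff: "q (?C i) < q (?C j) \<longleftrightarrow> i < j" if "i < ?k" "j < ?k" for i j
      using less[of i j] less[of j i] that by (cases i j rule: linorder_cases) auto
    have mem: "A \<in> quotient (S N) \<longleftrightarrow> A \<subseteq> ?C ` {..<?k} \<and> A \<noteq> {} \<and> convex_in q (?C ` {..<?k}) A" for A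
      using q(1) unfolding linear_family_def C_img by blast
    \<comment> \<open>The list of children is sorted by \<open>q\<close>, so convexity of the key
      turns into absence of gaps among the indices.\<close>
    have cv: "convex_in q (?C ` {..<?k}) (?C ` I) \<longleftrightarrow>
        (\<forall>a\<in>I. \<forall>b\<in>I. \<forall>c. a < c \<longrightarrow> c < b \<longrightarrow> c \<in> I)" if I: "I \<subseteq> {..<?k}" for I
    proof -
      have in_iff: "?C c \<in> ?C ` I \<longleftrightarrow> c \<in> I" if "c < ?k" for c
        using inj_on_image_mem_iff[OF C_inj _ I, of c] that by simp
      have "convex_in q (?C ` {..<?k}) (?C ` I) \<longleftrightarrow>
        (\<forall>a\<in>I. \<forall>b\<in>I. \<forall>c\<in>{..<?k}. q (?C a) < q (?C c) \<longrightarrow> q (?C c) < q (?C b) \<longrightarrow> ?C c \<in> ?C ` I)"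
        unfolding convex_in_def by simp
      also have "\<dots> \<longleftrightarrow> (\<forall>a\<in>I. \<forall>b\<in>I. \<forall>c\<in>{..<?k}. a < c \<longrightarrow> c < b \<longrightarrow> c \<in> I)"
        using I by (intro ball_cong refl) (simp add: in_iff less_iff subset_iff)
      also have "\<dots> \<longleftrightarrow> (\<forall>a\<in>I. \<forall>b\<in>I. \<forall>c. a < c \<longrightarrow> c < b \<longrightarrow> c \<in> I)"
        using I by (meson lessThan_iff less_trans subset_iff)
      finally show ?thesis .
    qed
    have "A \<in> (\<lambda>I. ?C ` I) ` {{i..<j} | i j. i < j \<and> j \<le> ?k} \<longleftrightarrow> A \<in> quotient (S N)" for A
    proof
      assume "A \<in> (\<lambda>I. ?C ` I) ` {{i..<j} | i j. i < j \<and> j \<le> ?k}"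
      then obtain i j where ij: "A = ?C ` {i..<j}" "i < j" "j \<le> ?k" by blast
      then have sub: "{i..<j} \<subseteq> {..<?k}" by auto
      show "A \<in> quotient (S N)" unfolding mem ij(1) cv[OF sub] using ij(2) sub by auto
    next
      assume A: "A \<in> quotient (S N)"
      then have Am: "A \<subseteq> ?C ` {..<?k}" "A \<noteq> {}" "convex_in q (?C ` {..<?k}) A" unfolding mem by auto
      obtain I where I: "I \<subseteq> {..<?k}" "A = ?C ` I" using Am(1) by (rule subset_imageE)
      have Ine: "I \<noteq> {}" using I(2) Am(2) by blast
      have c: "\<forall>a\<in>I. \<forall>b\<in>I. \<forall>c. a < c \<longrightarrow> c < b \<longrightarrow> c \<in> I"
        using Am(3) unfolding I(2) cv[OF I(1)] .
      have fin: "finite I" using I(1) finite_subset by blast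
      have "I = {Min I..<Suc (Max I)}"
      proof
        show "I \<subseteq> {Min I..<Suc (Max I)}" using fin by (auto simp: less_Suc_eq_le)
        show "{Min I..<Suc (Max I)} \<subseteq> I"
        proof
          fix x assume x: "x \<in> {Min I..<Suc (Max I)}"
          show "x \<in> I"
          proof (cases "x = Min I \<or> x = Max I")
            case True then show ?thesis using Min_in[OF fin Ine] Max_in[OF fin Ine] by auto
          next
            case False
            then have "Min I < x" "x < Max I" using x by auto
            then show ?thesis using c Min_in[OF fin Ine] Max_in[OF fin Ine] by blast
          qed
        qed
      qed
      moreover have "Min I < Suc (Max I)" using Min_in[OF fin Ine] fin by (simp add: less_Suc_eq_le)
      moreover have "Suc (Max I) \<le> ?k" using Max_in[OF fin Ine] I(1) by auto
      ultimately show "A \<in> (\<lambda>I. ?C ` I) ` {{i..<j} | i j. i < j \<and> j \<le> ?k}" using I(2) by blast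
    qed
    then show ?thesis using Circular by auto
  qed
  then show ?thesis by (metis image_image)
qed

text \<open>The parent contributes the part \<open>X - S N\<close>. Hence an index set that contains
  it yields the complement of the union over the children left out, and thus the same split as those
  children.\<close>

lemma node_splits_T:
  assumes N: "N \<in> internal_nodes T"
  shows "strong (S N)" "card (S N) \<ge> 2" "node_splits X T N = split ` Union ` quotient (S N)"
proof -
  have NV: "N \<in> verts T" "N \<noteq> root" "card (S N) \<noteq> 1"
    using N leaves_T unfolding internal_nodes_def by auto
  show st: "strong (S N)" by (rule S_strong[OF NV(1,2)])
  have "card (S N) \<noteq> 0"
    using member_finite[OF strongD[OF st]] member_nonempty[OF strongD[OF st]] by simp
  then show c2: "card (S N) \<ge> 2" using NV(3) by linarith
  let ?k = "length (ch N)"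
  let ?U = "\<lambda>I. \<Union>i\<in>I. S (ch N ! i)"
  have nb: "nbrs T N = ch N @ [par N]" using nbrs_eq[OF NV(1)] NV(2) by simp
  have part: "node_part T N i = S (ch N ! i)" if "i < ?k" for i
  proof -
    have "ch N ! i \<in> set (ch N)" using that by simp
    then have c: "ch N ! i \<in> verts T" "ch N ! i \<noteq> root" "par (ch N ! i) = N" using set_ch[OF NV(1)] by auto
    have "node_part T N i = L.cluster (ch N ! i)"
      by (rule L.node_part_child[OF NV(1) _ _ c]) (use that nb in \<open>auto simp: nth_append\<close>)
    then show ?thesis using cluster_eq[OF c(1)] by simp
  qed
  have last: "node_part T N ?k = X - S N"
    using L.node_part_par[OF NV(1,2), of ?k] nb cluster_eq[OF NV(1)] by simp
  have chN: "(\<Union>i<?k. S (ch N ! i)) = S N"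
  proof -
    interpret Q: strong_node "X - {r}" away "S N" by (rule strong_nodeI[OF st c2])
    have "(\<Union>i<?k. S (ch N ! i)) = \<Union>(S ` ((!) (ch N) ` {..<?k}))" by (simp add: image_image)
    also have "(!) (ch N) ` {..<?k} = set (ch N)"
      using nth_image[of ?k "ch N"] by (simp add: lessThan_atLeast0)
    finally show ?thesis using children_T[OF NV(1,2) c2] Q.Union_children by simp
  qed
  have SX: "S N \<subseteq> X" by (rule S_subset[OF NV(1)])
  have parts_disjoint: "S (ch N ! i) \<inter> S (ch N ! j) = {}" if "i < ?k" "j < ?k" "i \<noteq> j" for i j
  proof -
    interpret Q: strong_node "X - {r}" away "S N" by (rule strong_nodeI[OF st c2])
    have m: "ch N ! i \<in> set (ch N)" "ch N ! j \<in> set (ch N)" using that by auto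
    have "ch N ! i \<noteq> ch N ! j" using that distinct_ch[OF NV(1)] by (simp add: nth_eq_iff_index_eq)
    then have "S (ch N ! i) \<noteq> S (ch N ! j)" using S_inj m set_ch[OF NV(1)] by blast
    moreover have "S (ch N ! i) \<in> child (S N) ` S N" "S (ch N ! j) \<in> child (S N) ` S N"
      using children_T[OF NV(1,2) c2] m by blast+
    ultimately show ?thesis using Q.child_disjoint by blast
  qed
  have ns: "node_split X T N I = split (?U I)" if I: "I \<subseteq> {..<?k}" for I
  proof -
    have "(\<Union>i\<in>I. node_part T N i) = ?U I" using I part by (intro SUP_cong) auto
    then show ?thesis by (simp add: node_split_def split_def)
  qed
  have ns': "node_split X T N ({..?k} - I) = split (?U I)" if I: "I \<subseteq> {..<?k}" for I
  proof -
    have "{..?k} - I = insert ?k ({..<?k} - I)" using I by auto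
    then have "(\<Union>i\<in>{..?k} - I. node_part T N i) = (X - S N) \<union> ?U ({..<?k} - I)"
      using last part by simp
    also have "\<dots> = X - ?U I"
    proof -
      have d: "?U ({..<?k} - I) \<inter> ?U I = {}" using parts_disjoint I by blast
      have u: "?U ({..<?k} - I) \<union> ?U I = S N" using chN I by blast
      show ?thesis using d u SX by blast
    qed
    finally have "node_split X T N ({..?k} - I) = split (X - ?U I)"
      by (simp add: node_split_def split_def)
    moreover have "?U I \<subseteq> X" using chN I SX by blast
    ultimately show ?thesis using split_compl by simp
  qed
  have len: "length (nbrs T N) = Suc ?k" using nb by simp
  have k1: "?k \<ge> 1" using chN c2 by (cases ?k) auto
  have k2: "?k \<ge> 2"
  proof (rule ccontr)
    interpret Q: strong_node "X - {r}" away "S N" by (rule strong_nodeI[OF st c2])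
    assume "\<not> ?k \<ge> 2"
    then have k: "?k = 1" using k1 by linarith
    then have "S (ch N ! 0) = S N" using chN by (simp add: lessThan_Suc)
    moreover have "S (ch N ! 0) \<in> child (S N) ` S N"
      using children_T[OF NV(1,2) c2] k by (metis imageI less_one nth_mem)
    ultimately show False using Q.child(2) by auto
  qed
  have low: "I \<subseteq> {..<?k}" if "I \<in> lower_sets (kind T N) ?k" for I
    using that k1 by (cases "kind T N") auto
  have "node_splits X T N = split ` ?U ` lower_sets (kind T N) ?k"
  proof
    show "node_splits X T N \<subseteq> split ` ?U ` lower_sets (kind T N) ?k"
    proof
      fix P assume "P \<in> node_splits X T N"
      then obtain J where J: "J \<in> index_sets (kind T N) (Suc ?k)" "P = node_split X T N J"
        unfolding node_splits_def len by blast
      obtain I where I: "I \<in> lower_sets (kind T N) ?k" "J = I \<or> J = {..?k} - I"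
        using lower_index_sets_Suc[OF J(1)] by blast
      then have "P = split (?U I)" using J(2) ns[OF low[OF I(1)]] ns'[OF low[OF I(1)]] by auto
      then show "P \<in> split ` ?U ` lower_sets (kind T N) ?k" using I(1) by blast
    qed
    show "split ` ?U ` lower_sets (kind T N) ?k \<subseteq> node_splits X T N"
    proof clarify
      fix I assume I: "I \<in> lower_sets (kind T N) ?k"
      obtain J where J: "J \<in> index_sets (kind T N) (Suc ?k)" "J = I \<or> J = {..?k} - I"
        using index_sets_Suc_lower[OF I k1] k2 by blast
      then have "node_split X T N J = split (?U I)" using ns[OF low[OF I]] ns'[OF low[OF I]] by auto
      then show "split (?U I) \<in> node_splits X T N" unfolding node_splits_def len using J(1) by (metis imageI)
    qed
  qed
  then show "node_splits X T N = split ` Union ` quotient (S N)"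
    using lower_sets_quotient[OF NV(1,2) c2] by simp
qed

text \<open>Members with at least two points occur in the quotient of some node; singletons are
  strong and occur at edges.\<close>

theorem decomposition_tree: "umodular_decomposition_tree X H T"
  unfolding umodular_decomposition_tree_def
proof (intro conjI strong_split_tree_T)
  show "bipartitions X H = edge_split T ` edges T \<union> (\<Union>N\<in>internal_nodes T. node_splits X T N)"
  proof
    show "edge_split T ` edges T \<union> (\<Union>N\<in>internal_nodes T. node_splits X T N) \<subseteq> bipartitions X H"
    proof -
      have "Union ` quotient (S N) \<subseteq> away" for N by (auto simp: quotient_def)
      then have "node_splits X T N \<subseteq> split ` away" if "N \<in> internal_nodes T" for N
        unfolding node_splits_T(3)[OF that] by blast
      moreover have "split ` {A. strong A} \<subseteq> split ` away" using strongD by blast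
      ultimately show ?thesis unfolding edge_splits_T bipartitions_eq by blast
    qed
    show "bipartitions X H \<subseteq> edge_split T ` edges T \<union> (\<Union>N\<in>internal_nodes T. node_splits X T N)"
      unfolding edge_splits_T bipartitions_eq
    proof (rule image_subsetI)
      fix A assume A: "A \<in> away"
      show "split A \<in> split ` {A. strong A} \<union> (\<Union>N\<in>internal_nodes T. node_splits X T N)"
      proof (cases "card A \<ge> 2")
        case True
        then obtain N I where NI: "strong N" "card N \<ge> 2" "I \<in> quotient N" "A = \<Union>I"
          using member_in_quotient[OF A] by blast
        obtain v where v: "v \<in> verts T" "v \<noteq> root" "S v = N" using NI(1) by (rule strong_vertex)
        have "v \<in> internal_nodes T" unfolding internal_nodes_def leaves_T using v NI(2) by auto
        moreover have "split A \<in> node_splits X T v"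
          unfolding node_splits_T(3)[OF \<open>v \<in> internal_nodes T\<close>] v(3) using NI(3,4) by blast
        ultimately show ?thesis by blast
      next
        case False
        have "card A \<noteq> 0" using member_finite[OF A] member_nonempty[OF A] by simp
        then have "card A = 1" using False by linarith
        then obtain a where a: "A = {a}" using card_1_singletonE by blast
        then have "strong A" using strong_singleton member_subset[OF A] by blast
        then show ?thesis by blast
      qed
    qed
  qed
qed

end

section \<open>Loop programs\<close>

text \<open>The only loop is a counted one, so the semantics is a total function and a time bound
  can be computed by recursion over the program.\<close>

datatype prog =
    PSkip
  | PAssign nat aexp
  | PStore nat aexp aexp
  | PSeq prog prog
  | PCond bexp prog prog
  | PFor nat nat prog

definition set_reg :: "nat \<Rightarrow> nat \<Rightarrow> state \<Rightarrow> state" where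
  "set_reg x v s = s\<lparr>regs := (regs s)(x := v)\<rparr>"

definition set_arr :: "nat \<Rightarrow> nat \<Rightarrow> nat \<Rightarrow> state \<Rightarrow> state" where
  "set_arr a i v s = s\<lparr>arrs := (arrs s)(a := (arrs s a)(i := v))\<rparr>"

lemma regs_set_reg [simp]: "regs (set_reg x v s) y = (if y = x then v else regs s y)"
  by (simp add: set_reg_def)

lemma arrs_set_reg [simp]: "arrs (set_reg x v s) = arrs s"
  by (simp add: set_reg_def)

lemma regs_set_arr [simp]: "regs (set_arr a i v s) = regs s"
  by (simp add: set_arr_def)

lemma arrs_set_arr [simp]:
  "arrs (set_arr a i v s) b = (if b = a then (arrs s a)(i := v) else arrs s b)"
  by (simp add: set_arr_def)

text \<open>\<open>PFor x q c\<close> is meant for registers \<open>x\<close> and \<open>q\<close> that \<open>c\<close> does not change.\<close>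

fun sem :: "prog \<Rightarrow> state \<Rightarrow> state" where
  "sem PSkip s = s"
| "sem (PAssign x e) s = set_reg x (aval s e) s"
| "sem (PStore a i e) s = set_arr a (aval s i) (aval s e) s"
| "sem (PSeq c d) s = sem d (sem c s)"
| "sem (PCond b c d) s = (if bval s b then sem c s else sem d s)"
| "sem (PFor x q c) s =
    ((\<lambda>t. set_reg x (Suc (regs (sem c t) x)) (sem c t)) ^^ regs s q) (set_reg x 0 s)"

fun compile :: "prog \<Rightarrow> com" where
  "compile PSkip = Skip"
| "compile (PAssign x e) = Assign x e"
| "compile (PStore a i e) = Store a i e"
| "compile (PSeq c d) = Seq (compile c) (compile d)"
| "compile (PCond b c d) = Cond b (compile c) (compile d)"
| "compile (PFor x q c) = Seq (Assign x (Num 0))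
    (While (Less (Reg x) (Reg q)) (Seq (compile c) (Assign x (Plus (Reg x) (Num 1)))))"

fun wregs :: "prog \<Rightarrow> nat set" where
  "wregs PSkip = {}"
| "wregs (PAssign x e) = {x}"
| "wregs (PStore a i e) = {}"
| "wregs (PSeq c d) = wregs c \<union> wregs d"
| "wregs (PCond b c d) = wregs c \<union> wregs d"
| "wregs (PFor x q c) = insert x (wregs c)"

fun warrs :: "prog \<Rightarrow> nat set" where
  "warrs PSkip = {}"
| "warrs (PAssign x e) = {}"
| "warrs (PStore a i e) = {a}"
| "warrs (PSeq c d) = warrs c \<union> warrs d"
| "warrs (PCond b c d) = warrs c \<union> warrs d"
| "warrs (PFor x q c) = warrs c"

lemma regs_sem: "y \<notin> wregs c \<Longrightarrow> regs (sem c s) y = regs s y"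
proof (induction c arbitrary: s)
  case (PFor x q c)
  let ?f = "\<lambda>t. set_reg x (Suc (regs (sem c t) x)) (sem c t)"
  have "regs ((?f ^^ n) t) y = regs t y" for n t
    using PFor by (induction n) simp_all
  then show ?case using PFor.prems by simp
qed auto

lemma arrs_sem: "a \<notin> warrs c \<Longrightarrow> arrs (sem c s) a = arrs s a"
proof (induction c arbitrary: s)
  case (PFor x q c)
  let ?f = "\<lambda>t. set_reg x (Suc (regs (sem c t) x)) (sem c t)"
  have "arrs ((?f ^^ n) t) a = arrs t a" for n t
    using PFor by (induction n) simp_all
  then show ?case by simp
qed auto

text \<open>The rule supplies, besides the invariant, that all memory outside the body's reach is as
  it was before the loop; invariants need to mention only what changes.\<close>

lemma For_rule:
  assumes x: "x \<notin> wregs c" "q \<notin> wregs c" "x \<noteq> q"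
    and init: "P 0 (set_reg x 0 s)"
    and step: "\<And>i t. i < regs s q \<Longrightarrow> P i t \<Longrightarrow> regs t x = i \<Longrightarrow>
      (\<And>y. y \<notin> insert x (wregs c) \<Longrightarrow> regs t y = regs s y) \<Longrightarrow>
      (\<And>a. a \<notin> warrs c \<Longrightarrow> arrs t a = arrs s a) \<Longrightarrow> P (Suc i) (set_reg x (Suc i) (sem c t))"
  shows "P (regs s q) (sem (PFor x q c) s)"
proof -
  let ?f = "\<lambda>t. set_reg x (Suc (regs (sem c t) x)) (sem c t)"
  let ?t = "\<lambda>i. (?f ^^ i) (set_reg x 0 s)"
  have "i \<le> regs s q \<Longrightarrow> P i (?t i) \<and> regs (?t i) x = i \<and>
      (\<forall>y. y \<notin> insert x (wregs c) \<longrightarrow> regs (?t i) y = regs s y) \<and>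
      (\<forall>a. a \<notin> warrs c \<longrightarrow> arrs (?t i) a = arrs s a)" for i
  proof (induction i)
    case 0 then show ?case using init by simp
  next
    case (Suc i)
    then have IH: "P i (?t i)" "regs (?t i) x = i"
      "\<And>y. y \<notin> insert x (wregs c) \<Longrightarrow> regs (?t i) y = regs s y"
      "\<And>a. a \<notin> warrs c \<Longrightarrow> arrs (?t i) a = arrs s a" by simp_all
    have e: "?t (Suc i) = set_reg x (Suc i) (sem c (?t i))"
      using regs_sem[OF x(1), of "?t i"] IH(2) by simp
    have "P (Suc i) (?t (Suc i))" unfolding e by (rule step) (use Suc.prems IH in auto)
    moreover have "regs (?t (Suc i)) x = Suc i" unfolding e by simp
    moreover have "regs (?t (Suc i)) y = regs s y" if "y \<notin> insert x (wregs c)" for y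
      unfolding e using that IH(3)[OF that] by (simp add: regs_sem)
    moreover have "arrs (?t (Suc i)) a = arrs s a" if "a \<notin> warrs c" for a
      unfolding e using that IH(4)[OF that] by (simp add: arrs_sem)
    ultimately show ?case by blast
  qed
  then show ?thesis by simp
qed

section \<open>Word size and running time of loop programs\<close>

fun adeg :: "aexp \<Rightarrow> nat" where
  "adeg (Num k) = 1"
| "adeg (Reg x) = 1"
| "adeg (Arr a i) = adeg i"
| "adeg (Plus e f) = Suc (max (adeg e) (adeg f))"
| "adeg (Minus e f) = max (adeg e) (adeg f)"
| "adeg (Times e f) = adeg e + adeg f"

fun small_nums :: "aexp \<Rightarrow> bool" where
  "small_nums (Num k) \<longleftrightarrow> k \<le> 2"
| "small_nums (Reg x) \<longleftrightarrow> True"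
| "small_nums (Arr a i) \<longleftrightarrow> small_nums i"
| "small_nums (Plus e f) \<longleftrightarrow> small_nums e \<and> small_nums f"
| "small_nums (Minus e f) \<longleftrightarrow> small_nums e \<and> small_nums f"
| "small_nums (Times e f) \<longleftrightarrow> small_nums e \<and> small_nums f"

definition aok :: "nat \<Rightarrow> aexp \<Rightarrow> bool" where
  "aok D e \<longleftrightarrow> adeg e \<le> D \<and> small_nums e"

fun bok :: "nat \<Rightarrow> bexp \<Rightarrow> bool" where
  "bok D (Less e f) \<longleftrightarrow> aok D e \<and> aok D f"
| "bok D (Equal e f) \<longleftrightarrow> aok D e \<and> aok D f"
| "bok D (Neg b) \<longleftrightarrow> bok D b"
| "bok D (Conj b c) \<longleftrightarrow> bok D b \<and> bok D c"

text \<open>Assigned values exceed the values in memory by at most 1, so memory grows at most linearly in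
  time.\<close>

fun slow :: "aexp \<Rightarrow> bool" where
  "slow (Num k) \<longleftrightarrow> k \<le> 2"
| "slow (Reg x) \<longleftrightarrow> True"
| "slow (Arr a i) \<longleftrightarrow> True"
| "slow (Plus e f) \<longleftrightarrow> (\<exists>x. e = Reg x) \<and> f = Num 1"
| "slow (Minus e f) \<longleftrightarrow> False"
| "slow (Times e f) \<longleftrightarrow> False"

fun pok :: "nat \<Rightarrow> prog \<Rightarrow> bool" where
  "pok D PSkip \<longleftrightarrow> True"
| "pok D (PAssign x e) \<longleftrightarrow> aok D e \<and> slow e"
| "pok D (PStore a i e) \<longleftrightarrow> aok D i \<and> aok D e \<and> slow e"
| "pok D (PSeq c d) \<longleftrightarrow> pok D c \<and> pok D d"
| "pok D (PCond b c d) \<longleftrightarrow> bok D b \<and> pok D c \<and> pok D d"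
| "pok D (PFor x q c) \<longleftrightarrow> pok D c \<and> x \<notin> wregs c \<and> q \<notin> wregs c \<and> x \<noteq> q"

text \<open>These are the registers that bound loops. Nothing may write them in
  \<open>run_compile\<close>, so that bounds known at the start hold throughout.\<close>

fun bregs :: "prog \<Rightarrow> nat set" where
  "bregs (PSeq c d) = bregs c \<union> bregs d"
| "bregs (PCond b c d) = bregs c \<union> bregs d"
| "bregs (PFor x q c) = insert q (bregs c)"
| "bregs _ = {}"

text \<open>Both branches of a conditional are charged. For a loop, 6 = 2 + 4 pays for clearing the
  counter and for the final failing test, and 8 = 4 + 4 for test and increment in each
  round.\<close>

fun prog_time :: "(nat \<Rightarrow> nat) \<Rightarrow> prog \<Rightarrow> nat" where
  "prog_time N PSkip = 1"
| "prog_time N (PAssign x e) = 1 + acost e"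
| "prog_time N (PStore a i e) = 1 + acost i + acost e"
| "prog_time N (PSeq c d) = prog_time N c + prog_time N d"
| "prog_time N (PCond b c d) = 1 + bcost b + prog_time N c + prog_time N d"
| "prog_time N (PFor x q c) = 6 + N q * (prog_time N c + 8)"

definition bounded :: "nat \<Rightarrow> state \<Rightarrow> bool" where
  "bounded B s \<longleftrightarrow> (\<forall>x. regs s x \<le> B) \<and> (\<forall>a i. arrs s a i \<le> B)"

lemma bounded_mono: "bounded B s \<Longrightarrow> B \<le> B' \<Longrightarrow> bounded B' s"
  unfolding bounded_def by (meson order_trans)

lemma bounded_set_reg: "bounded B s \<Longrightarrow> v \<le> B \<Longrightarrow> bounded B (set_reg x v s)"
  by (simp add: bounded_def)

lemma bounded_set_arr: "bounded B s \<Longrightarrow> v \<le> B \<Longrightarrow> bounded B (set_arr a i v s)"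
  by (simp add: bounded_def)

lemma adeg_pos: "adeg e \<ge> 1"
  by (induction e) auto

text \<open>A sum costs one additional factor because \<open>2 \<le> M\<close>. An array access
  keeps the degree of its index, because the index is computed as a word too.\<close>

lemma aval_le:
  assumes "bounded M s" "M \<ge> 2" "small_nums e"
  shows "aval s e \<le> M ^ adeg e"
  using assms(3)
proof (induction e)
  case (Num k) then show ?case using assms(2) by simp
next
  case (Reg x) then show ?case using assms(1) by (simp add: bounded_def)
next
  case (Arr a i)
  have "aval s (Arr a i) \<le> M ^ 1" using assms(1) by (simp add: bounded_def)
  also have "\<dots> \<le> M ^ adeg i" by (rule power_increasing[OF adeg_pos]) (use assms(2) in simp)
  finally show ?case by simp
next
  case (Plus e f)
  have "M ^ adeg e \<le> M ^ max (adeg e) (adeg f)" "M ^ adeg f \<le> M ^ max (adeg e) (adeg f)"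
    by (rule power_increasing; use assms(2) in simp)+
  then have "aval s (Plus e f) \<le> 2 * M ^ max (adeg e) (adeg f)" using Plus by simp
  also have "\<dots> \<le> M * M ^ max (adeg e) (adeg f)" using assms(2) by (rule mult_le_mono1)
  finally show ?case by simp
next
  case (Minus e f)
  have "M ^ adeg e \<le> M ^ max (adeg e) (adeg f)"
    by (rule power_increasing) (use assms(2) in simp_all)
  then show ?case using Minus by simp
next
  case (Times e f)
  then show ?case by (simp add: power_add mult_le_mono)
qed

lemma afits_ok:
  assumes "bounded M s" "M \<ge> 2" "aok D e" shows "afits (M ^ D) s e"
proof -
  have le: "aval s f \<le> M ^ D" if "adeg f \<le> D" "small_nums f" for f
    using order_trans[OF aval_le[OF assms(1,2) that(2)] power_increasing[OF that(1)]] assms(2) by simp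
  have "adeg e \<le> D \<Longrightarrow> small_nums e \<Longrightarrow> afits (M ^ D) s e"
  proof (induction e)
    case (Num k) then show ?case using le[of "Num k"] by simp
  next
    case (Reg x) then show ?case using le[of "Reg x"] by simp
  next
    case (Arr a i) then show ?case using le[of "Arr a i"] by simp
  next
    case (Plus e f) then show ?case using le[of "Plus e f"] by simp
  next
    case (Minus e f) then show ?case by simp
  next
    case (Times e f) then show ?case using le[of "Times e f"] by simp
  qed
  then show ?thesis using assms(3) by (simp add: aok_def)
qed

lemma bfits_ok:
  assumes "bounded M s" "M \<ge> 2" "bok D b" shows "bfits (M ^ D) s b"
  using assms(3) by (induction b) (use afits_ok[OF assms(1,2)] in auto)

lemma slow_le:
  assumes "bounded B s" "B \<ge> 2" "slow e" shows "aval s e \<le> Suc B"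
  using assms by (cases e) (auto simp: bounded_def le_SucI)

text \<open>Time and memory are bounded in one induction. An assignment raises the bound on memory
  by at most 1 and takes at least one step, so \<open>B + prog_time N c\<close> bounds all stored
  values; intermediate values are then below \<open>M ^ D\<close> by the bound \<open>D\<close> on
  degrees.\<close>

lemma run_compile:
  assumes "pok D c" "bounded B s" "B \<ge> 2" "B + prog_time N c \<le> M" "D \<ge> 2"
    "\<And>q. q \<in> bregs c \<Longrightarrow> regs s q \<le> N q" "bregs c \<inter> wregs c = {}"
  shows "\<exists>t \<le> prog_time N c. run (M ^ D) (compile c) s t (sem c s) \<and> bounded (B + prog_time N c) (sem c s)"
  using assms
proof (induction c arbitrary: s B)
  case PSkip
  have "bounded (B + 1) s" using bounded_mono[OF PSkip(2)] by simp
  then show ?case using run.Skip by auto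
next
  case (PAssign x e)
  have "bounded M s" using bounded_mono[OF PAssign(2)] PAssign(4) by simp
  then have "afits (M ^ D) s e" using afits_ok PAssign by simp
  then have "run (M ^ D) (Assign x e) s (1 + acost e) (set_reg x (aval s e) s)"
    unfolding set_reg_def by (rule run.Assign)
  moreover have "bounded (B + prog_time N (PAssign x e)) (set_reg x (aval s e) s)"
  proof -
    have "aval s e \<le> Suc B" using slow_le PAssign by simp
    then show ?thesis using bounded_mono[OF PAssign(2)] by (intro bounded_set_reg) simp_all
  qed
  ultimately show ?case by auto
next
  case (PStore a i e)
  have "bounded M s" using bounded_mono[OF PStore(2)] PStore(4) by simp
  then have "afits (M ^ D) s i" "afits (M ^ D) s e" using afits_ok PStore by simp_all
  then have "run (M ^ D) (Store a i e) s (1 + acost i + acost e) (set_arr a (aval s i) (aval s e) s)"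
    unfolding set_arr_def by (rule run.Store)
  moreover have "bounded (B + prog_time N (PStore a i e)) (set_arr a (aval s i) (aval s e) s)"
  proof -
    have "aval s e \<le> Suc B" using slow_le PStore by simp
    then show ?thesis using bounded_mono[OF PStore(2)] by (intro bounded_set_arr) simp_all
  qed
  ultimately show ?case by auto
next
  case (PSeq c d)
  obtain t where t: "t \<le> prog_time N c" "run (M ^ D) (compile c) s t (sem c s)"
    "bounded (B + prog_time N c) (sem c s)"
    using PSeq.IH(1)[of B s] PSeq.prems by auto
  have "\<exists>t' \<le> prog_time N d. run (M ^ D) (compile d) (sem c s) t' (sem d (sem c s)) \<and>
      bounded (B + prog_time N c + prog_time N d) (sem d (sem c s))"
  proof (rule PSeq.IH(2))
    show "regs (sem c s) q \<le> N q" if "q \<in> bregs d" for q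
    proof -
      have "q \<notin> wregs c" using PSeq.prems(7) that by auto
      then show ?thesis using PSeq.prems(6)[of q] that by (simp add: regs_sem)
    qed
  qed (use PSeq.prems t(3) in auto)
  then obtain t' where t': "t' \<le> prog_time N d" "run (M ^ D) (compile d) (sem c s) t' (sem d (sem c s))"
    "bounded (B + prog_time N c + prog_time N d) (sem d (sem c s))" by blast
  have "run (M ^ D) (compile (PSeq c d)) s (t + t') (sem (PSeq c d) s)"
    using run.Seq[OF t(2) t'(2)] by simp
  then show ?case using t(1) t'(1,3) by (intro exI[of _ "t + t'"]) (simp add: add.assoc)
next
  case (PCond b c d)
  have "bounded M s" using bounded_mono[OF PCond.prems(2)] PCond.prems(4) by simp
  then have bf: "bfits (M ^ D) s b" using bfits_ok PCond.prems by simp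
  show ?case
  proof (cases "bval s b")
    case True
    obtain t where t: "t \<le> prog_time N c" "run (M ^ D) (compile c) s t (sem c s)"
      "bounded (B + prog_time N c) (sem c s)"
      using PCond.IH(1)[of B s] PCond.prems by auto
    have "run (M ^ D) (compile (PCond b c d)) s (1 + bcost b + t) (sem (PCond b c d) s)"
      using run.CondTrue[OF bf True t(2)] True by simp
    moreover have "bounded (B + prog_time N (PCond b c d)) (sem (PCond b c d) s)"
      using bounded_mono[OF t(3)] True by simp
    ultimately show ?thesis using t(1) by (intro exI[of _ "1 + bcost b + t"]) simp
  next
    case False
    obtain t where t: "t \<le> prog_time N d" "run (M ^ D) (compile d) s t (sem d s)"
      "bounded (B + prog_time N d) (sem d s)"
      using PCond.IH(2)[of B s] PCond.prems by auto
    have "run (M ^ D) (compile (PCond b c d)) s (1 + bcost b + t) (sem (PCond b c d) s)"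
      using run.CondFalse[OF bf False t(2)] False by simp
    moreover have "bounded (B + prog_time N (PCond b c d)) (sem (PCond b c d) s)"
      using bounded_mono[OF t(3)] False by simp
    ultimately show ?thesis using t(1) by (intro exI[of _ "1 + bcost b + t"]) simp
  qed
next
  case (PFor x q c)
  let ?f = "\<lambda>t. set_reg x (Suc (regs (sem c t) x)) (sem c t)"
  let ?W = "While (Less (Reg x) (Reg q)) (Seq (compile c) (Assign x (Plus (Reg x) (Num 1))))"
  let ?T = "prog_time N c + 8"
  have xq: "pok D c" "x \<notin> wregs c" "q \<notin> wregs c" "x \<noteq> q" using PFor.prems(1) by auto
  have br: "bregs c \<inter> wregs c = {}" "x \<notin> bregs c" using PFor.prems(7) by auto
  have M2: "M \<ge> 2" using PFor.prems(3,4) by simp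
  have fits: "bfits (M ^ D) u (Less (Reg x) (Reg q))" "afits (M ^ D) u (Plus (Reg x) (Num 1))"
    if "bounded M u" for u
    using bfits_ok[OF that M2, of D "Less (Reg x) (Reg q)"]
      afits_ok[OF that M2, of D "Plus (Reg x) (Num 1)"] PFor.prems(5) by (simp_all add: aok_def)
  \<comment> \<open>The induction is on the number of rounds still to go; each round may raise the
    bound on memory by \<open>?T\<close>.\<close>
  have loop: "\<exists>t \<le> 4 + m * ?T. run (M ^ D) ?W u t ((?f ^^ m) u) \<and> bounded (B' + m * ?T) ((?f ^^ m) u)"
    if "bounded B' u" "B' \<ge> 2" "B' + 4 + m * ?T \<le> M" "regs u x + m = regs u q"
      "\<And>p. p \<in> bregs c \<Longrightarrow> regs u p \<le> N p" for m u B'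
    using that
  proof (induction m arbitrary: u B')
    case 0
    have "bounded M u" using bounded_mono[OF 0(1)] 0(3) by simp
    then have "run (M ^ D) ?W u (1 + bcost (Less (Reg x) (Reg q))) u"
      by (intro run.WhileFalse fits) (use 0 in auto)
    then have "run (M ^ D) ?W u 4 u" by (simp add: numeral_eq_Suc)
    then show ?case using 0(1) by auto
  next
    case (Suc m)
    have bM: "bounded M u" using bounded_mono[OF Suc.prems(1)] Suc.prems(3) by simp
    obtain t where t: "t \<le> prog_time N c" "run (M ^ D) (compile c) u t (sem c u)"
      "bounded (B' + prog_time N c) (sem c u)"
      using PFor.IH[OF xq(1) Suc.prems(1,2) _ PFor.prems(5) Suc.prems(5) br(1)] Suc.prems(3) by auto
    have bM': "bounded M (sem c u)" using bounded_mono[OF t(3)] Suc.prems(3) by simp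
    let ?u = "?f u"
    have step: "run (M ^ D) (Assign x (Plus (Reg x) (Num 1))) (sem c u) 4 ?u"
      using run.Assign[OF fits(2)[OF bM'], of x] by (simp add: set_reg_def numeral_eq_Suc)
    have bu: "bounded (B' + ?T) ?u"
    proof (rule bounded_set_reg)
      show "bounded (B' + ?T) (sem c u)" by (rule bounded_mono[OF t(3)]) simp
      have "regs (sem c u) x \<le> B' + prog_time N c" using t(3) by (simp add: bounded_def)
      then show "Suc (regs (sem c u) x) \<le> B' + ?T" by simp
    qed
    have "\<exists>t \<le> 4 + m * ?T. run (M ^ D) ?W ?u t ((?f ^^ m) ?u) \<and> bounded (B' + ?T + m * ?T) ((?f ^^ m) ?u)"
    proof (rule Suc.IH[OF bu])
      show "regs ?u x + m = regs ?u q"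
        using Suc.prems(4) xq by (simp add: regs_sem)
      show "regs ?u p \<le> N p" if "p \<in> bregs c" for p
      proof -
        have "p \<notin> wregs c" "p \<noteq> x" using that br by auto
        then show ?thesis using Suc.prems(5)[OF that] by (simp add: regs_sem)
      qed
    qed (use Suc.prems in auto)
    then obtain t' where t': "t' \<le> 4 + m * ?T" "run (M ^ D) ?W ?u t' ((?f ^^ m) ?u)"
      "bounded (B' + ?T + m * ?T) ((?f ^^ m) ?u)" by blast
    have "bval u (Less (Reg x) (Reg q))" using Suc.prems(4) by simp
    then have "run (M ^ D) ?W u (1 + bcost (Less (Reg x) (Reg q)) + (t + 4) + t') ((?f ^^ m) ?u)"
      using run.WhileTrue[OF fits(1)[OF bM] _ run.Seq[OF t(2) step] t'(2)] by simp
    moreover have "(?f ^^ m) ?u = (?f ^^ Suc m) u" by (simp only: funpow_Suc_right o_apply)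
    ultimately show ?case using t(1) t'(1,3)
      by (intro exI[of _ "1 + bcost (Less (Reg x) (Reg q)) + (t + 4) + t'"])
        (simp add: algebra_simps)
  qed
  let ?m = "regs s q"
  let ?u = "set_reg x 0 s"
  have mN: "?m \<le> N q" using PFor.prems(6)[of q] by simp
  then have mT: "?m * ?T \<le> N q * ?T" by (rule mult_le_mono1)
  have bM: "bounded M s" using bounded_mono[OF PFor.prems(2)] PFor.prems(4) by simp
  have init: "run (M ^ D) (Assign x (Num 0)) s 2 ?u"
    using run.Assign[of "M ^ D" s "Num 0" x] by (simp add: set_reg_def numeral_eq_Suc)
  have "\<exists>t \<le> 4 + ?m * ?T. run (M ^ D) ?W ?u t ((?f ^^ ?m) ?u) \<and> bounded (B + ?m * ?T) ((?f ^^ ?m) ?u)"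
  proof (rule loop)
    show "bounded B ?u" using PFor.prems(2) by (auto simp: bounded_def)
    show "B + 4 + ?m * ?T \<le> M" using PFor.prems(4) mT unfolding prog_time.simps by linarith
    show "regs ?u p \<le> N p" if "p \<in> bregs c" for p
      using PFor.prems(6)[of p] that br(2) by auto
  qed (use PFor.prems(3) xq(4) in auto)
  then obtain t where t: "t \<le> 4 + ?m * ?T" "run (M ^ D) ?W ?u t ((?f ^^ ?m) ?u)"
    "bounded (B + ?m * ?T) ((?f ^^ ?m) ?u)" by blast
  have "run (M ^ D) (compile (PFor x q c)) s (2 + t) (sem (PFor x q c) s)"
    using run.Seq[OF init t(2)] by simp
  moreover have "bounded (B + prog_time N (PFor x q c)) (sem (PFor x q c) s)"
    using bounded_mono[OF t(3), of "B + prog_time N (PFor x q c)"] mT by simp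
  moreover have "2 + t \<le> prog_time N (PFor x q c)" using t(1) mT unfolding prog_time.simps by linarith
  ultimately show ?case by blast
qed

text \<open>The only loop bounds are \<open>n\<close>, in register 0, and \<open>n\<^sup>2\<close>, in register 2.\<close>

fun loop_degree :: "prog \<Rightarrow> nat" where
  "loop_degree (PSeq c d) = max (loop_degree c) (loop_degree d)"
| "loop_degree (PCond b c d) = max (loop_degree c) (loop_degree d)"
| "loop_degree (PFor x q c) = (if q = 0 then 1 else 2) + loop_degree c"
| "loop_degree _ = 0"

text \<open>The base \<open>Suc n\<close> keeps every power at least 1, so that lower order terms
  are absorbed for \<open>n = 0\<close> as well.\<close>

lemma time_le:
  "\<exists>C. \<forall>n. prog_time (\<lambda>q. if q = 0 then n else n * n) c \<le> C * Suc n ^ loop_degree c"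
proof (induction c)
  case (PSeq c d)
  then obtain C D where CD: "\<And>n. prog_time (\<lambda>q. if q = 0 then n else n * n) c \<le> C * Suc n ^ loop_degree c"
    "\<And>n. prog_time (\<lambda>q. if q = 0 then n else n * n) d \<le> D * Suc n ^ loop_degree d" by blast
  have "prog_time (\<lambda>q. if q = 0 then n else n * n) (PSeq c d) \<le> (C + D) * Suc n ^ loop_degree (PSeq c d)" for n
  proof -
    let ?m = "Suc n ^ max (loop_degree c) (loop_degree d)"
    have "Suc n ^ loop_degree c \<le> ?m" "Suc n ^ loop_degree d \<le> ?m"
      by (rule power_increasing; simp)+
    then have "C * Suc n ^ loop_degree c \<le> C * ?m" "D * Suc n ^ loop_degree d \<le> D * ?m"
      by (simp_all add: mult_le_mono2)
    then show ?thesis using CD[of n] unfolding prog_time.simps loop_degree.simps add_mult_distrib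
      by linarith
  qed
  then show ?case by blast
next
  case (PCond b c d)
  then obtain C D where CD: "\<And>n. prog_time (\<lambda>q. if q = 0 then n else n * n) c \<le> C * Suc n ^ loop_degree c"
    "\<And>n. prog_time (\<lambda>q. if q = 0 then n else n * n) d \<le> D * Suc n ^ loop_degree d" by blast
  have "prog_time (\<lambda>q. if q = 0 then n else n * n) (PCond b c d)
    \<le> (1 + bcost b + C + D) * Suc n ^ loop_degree (PCond b c d)" for n
  proof -
    let ?m = "Suc n ^ max (loop_degree c) (loop_degree d)"
    have "Suc n ^ loop_degree c \<le> ?m" "Suc n ^ loop_degree d \<le> ?m"
      by (rule power_increasing; simp)+
    then have "C * Suc n ^ loop_degree c \<le> C * ?m" "D * Suc n ^ loop_degree d \<le> D * ?m"
      by (simp_all add: mult_le_mono2)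
    moreover have "(1 + bcost b) * 1 \<le> (1 + bcost b) * ?m" by (rule mult_le_mono2) simp
    ultimately show ?thesis using CD[of n] unfolding prog_time.simps loop_degree.simps add_mult_distrib
      by linarith
  qed
  then show ?case by blast
next
  case (PFor x q c)
  then obtain C where C: "\<And>n. prog_time (\<lambda>q. if q = 0 then n else n * n) c \<le> C * Suc n ^ loop_degree c"
    by blast
  \<comment> \<open>The constant is 14 = 6 + 8: the fixed cost of the loop and the overhead of a
    round.\<close>
  have "prog_time (\<lambda>q. if q = 0 then n else n * n) (PFor x q c) \<le> (C + 14) * Suc n ^ loop_degree (PFor x q c)" for n
  proof -
    let ?b = "if q = 0 then n else n * n" and ?e = "if q = 0 then 1 else (2::nat)"
    let ?m = "Suc n ^ loop_degree c" and ?N = "\<lambda>q. if q = 0 then n else n * n"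
    have b: "?b \<le> Suc n ^ ?e" by (simp add: power2_eq_square)
    have m1: "1 \<le> ?m" "1 \<le> Suc n ^ ?e" by simp_all
    have "prog_time ?N c + 8 \<le> C * ?m + 8 * ?m" using C[of n] m1 by linarith
    then have "?b * (prog_time ?N c + 8) \<le> Suc n ^ ?e * ((C + 8) * ?m)"
      using b by (intro mult_le_mono) (simp_all add: add_mult_distrib)
    moreover have "6 \<le> 6 * (Suc n ^ ?e * ?m)" by simp
    ultimately have "6 + ?b * (prog_time ?N c + 8) \<le> (C + 14) * (Suc n ^ ?e * ?m)"
      by (simp only: add_mult_distrib add_mult_distrib2 mult.assoc mult.left_commute)
    then show ?thesis by (simp only: prog_time.simps loop_degree.simps power_add)
  qed
  then show ?case by blast
qed (auto intro: exI)

lemma ix_eq_iff: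
  fixes n :: nat
  assumes "b < n" "b' < n" shows "a * n + b = a' * n + b' \<longleftrightarrow> a = a' \<and> b = b'"
proof
  assume e: "a * n + b = a' * n + b'"
  have "a = (a * n + b) div n" "a' = (a' * n + b') div n" using assms by simp_all
  then have "a = a'" using e by simp
  then show "a = a' \<and> b = b'" using e by simp
qed simp

lemma ix_less:
  fixes n :: nat
  assumes "a < m" "b < n" shows "a * n + b < m * n"
proof -
  have "a * n + b < Suc a * n" using assms(2) by simp
  also have "\<dots> \<le> m * n" using assms(1) by (intro mult_le_mono1) simp
  finally show ?thesis .
qed

abbreviation ix :: "aexp \<Rightarrow> aexp \<Rightarrow> aexp" where
  "ix e f \<equiv> Plus (Times e (Reg 0)) f"

abbreviation incr :: "nat \<Rightarrow> prog" where
  "incr x \<equiv> PAssign x (Plus (Reg x) (Num 1))"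

lemma nth_concat_map:
  assumes "i < length xs" "j < length (f (xs ! i))"
  shows "length (concat (map f (take i xs))) + j < length (concat (map f xs))"
    "concat (map f xs) ! (length (concat (map f (take i xs))) + j) = f (xs ! i) ! j"
proof -
  have e: "concat (map f xs) = concat (map f (take i xs)) @ f (xs ! i) @ concat (map f (drop (Suc i) xs))"
    using id_take_nth_drop[OF assms(1)] by (metis concat.simps(2) concat_append list.simps(9) map_append)
  show "length (concat (map f (take i xs))) + j < length (concat (map f xs))"
    unfolding e using assms(2) by simp
  show "concat (map f xs) ! (length (concat (map f (take i xs))) + j) = f (xs ! i) ! j"
    unfolding e using assms(2) by (simp add: nth_append)
qed

lemma length_concat_map_Suc:
  "i < length xs \<Longrightarrow> length (concat (map f (take (Suc i) xs))) =
    length (concat (map f (take i xs))) + length (f (xs ! i))"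
  by (simp add: take_Suc_conv_app_nth)

section \<open>Reading the input\<close>

text \<open>Besides the input and output arrays, array 6 holds the class numbers (of \<open>u\<close> in $H_y$ at \<open>y * n + u\<close>),
  array 7 the least members and array 10 the least strong members (whether \<open>c\<close> is in the one for \<open>a\<close>
  and \<open>b\<close>, at \<open>(a * n + b) * n + c\<close>). A vertex \<open>v\<close> of the tree is represented by the first pair with its
  strong member, kept in arrays 4 and 12; array 11 maps pairs to vertices. For vertices, array 16
  holds the inclusions, array 13 the parents, array 14 an end of the linear order at the node, and
  array 17 the positions among the siblings. As the label of a leaf is the first component of its
  pair, array 4 serves as output.\<close>

definition parse_class :: prog where
  "parse_class = PFor 5 0 (PCond (Less (Reg 5) (Reg 8))
     (PSeq (PStore 6 (ix (Reg 3) (Arr 0 (Reg 6))) (Reg 4)) (incr 6)) PSkip)"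

definition parse_classes :: prog where
  "parse_classes = PFor 4 0 (PCond (Less (Reg 4) (Reg 7))
     (PSeq (PAssign 8 (Arr 0 (Reg 6))) (PSeq (incr 6) parse_class)) PSkip)"

definition parse :: prog where
  "parse = PSeq (PAssign 6 (Num 0))
     (PFor 3 0 (PSeq (PAssign 7 (Arr 0 (Reg 6))) (PSeq (incr 6) parse_classes)))"

lemma parse_class:
  assumes n: "regs s 0 = n" and l: "regs s 8 = length C" "length C \<le> n"
    and inp: "\<And>i. i < length C \<Longrightarrow> arrs s 0 (regs s 6 + i) = C ! i"
  shows "regs (sem parse_class s) 6 = regs s 6 + length C \<and> arrs (sem parse_class s) 6 =
    (\<lambda>k. if k \<in> (\<lambda>y. regs s 3 * n + y) ` set C then regs s 4 else arrs s 6 k)"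
proof -
  let ?P = "\<lambda>i (t::state). regs t 6 = regs s 6 + min i (length C) \<and> arrs t 6 =
    (\<lambda>k. if k \<in> (\<lambda>y. regs s 3 * n + y) ` set (take i C) then regs s 4 else arrs s 6 k)"
  have "?P (regs s 0) (sem parse_class s)"
    unfolding parse_class_def
  proof (rule For_rule[where P = ?P])
    fix i t
    assume i: "i < regs s 0" and P: "?P i t" and ti: "regs t 5 = i"
      and r: "\<And>y. y \<notin> insert 5 (wregs (PCond (Less (Reg 5) (Reg 8))
        (PSeq (PStore 6 (ix (Reg 3) (Arr 0 (Reg 6))) (Reg 4)) (incr 6)) PSkip)) \<Longrightarrow> regs t y = regs s y"
      and a: "\<And>a. a \<notin> warrs (PCond (Less (Reg 5) (Reg 8))
        (PSeq (PStore 6 (ix (Reg 3) (Arr 0 (Reg 6))) (Reg 4)) (incr 6)) PSkip) \<Longrightarrow> arrs t a = arrs s a"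
    have fr: "regs t 8 = length C" "regs t 0 = n" "regs t 3 = regs s 3" "regs t 4 = regs s 4"
      "arrs t 0 = arrs s 0"
      using r[of 8] r[of 0] r[of 3] r[of 4] a[of 0] n l by simp_all
    show "?P (Suc i) (set_reg 5 (Suc i) (sem (PCond (Less (Reg 5) (Reg 8))
        (PSeq (PStore 6 (ix (Reg 3) (Arr 0 (Reg 6))) (Reg 4)) (incr 6)) PSkip) t))"
    proof (cases "i < length C")
      case True
      then show ?thesis using P ti fr inp[OF True] by (auto simp: take_Suc_conv_app_nth)
    next
      case False
      then show ?thesis using P ti fr by simp
    qed
  qed simp_all
  then show ?thesis using n l by simp
qed

lemma parse_classes:
  assumes n: "regs s 0 = n" and l: "regs s 7 = length P" "length P \<le> n"
    and lC: "\<And>C. C \<in> set P \<Longrightarrow> length C \<le> n \<and> set C \<subseteq> {..<n}"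
    and disj: "\<And>c c' y. c < length P \<Longrightarrow> c' < length P \<Longrightarrow> y \<in> set (P ! c) \<Longrightarrow> y \<in> set (P ! c') \<Longrightarrow> c = c'"
    and inp: "\<And>i. i < length (concat (map (\<lambda>C. length C # C) P)) \<Longrightarrow>
      arrs s 0 (regs s 6 + i) = concat (map (\<lambda>C. length C # C) P) ! i"
    and less: "\<And>k. arrs s 6 k < n"
  shows "regs (sem parse_classes s) 6 = regs s 6 + length (concat (map (\<lambda>C. length C # C) P)) \<and>
    (\<forall>c<length P. \<forall>y\<in>set (P ! c). arrs (sem parse_classes s) 6 (regs s 3 * n + y) = c) \<and>
    (\<forall>k. k \<notin> (\<lambda>y. regs s 3 * n + y) ` {..<n} \<longrightarrow> arrs (sem parse_classes s) 6 k = arrs s 6 k) \<and>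
    (\<forall>k. arrs (sem parse_classes s) 6 k < n)"
proof -
  let ?f = "\<lambda>C. length C # (C :: nat list)"
  let ?P = "\<lambda>i (t::state). regs t 6 = regs s 6 + length (concat (map ?f (take i P))) \<and>
    (\<forall>c<min i (length P). \<forall>y\<in>set (P ! c). arrs t 6 (regs s 3 * n + y) = c) \<and>
    (\<forall>k. k \<notin> (\<lambda>y. regs s 3 * n + y) ` {..<n} \<longrightarrow> arrs t 6 k = arrs s 6 k) \<and>
    (\<forall>k. arrs t 6 k < n)"
  have "?P (regs s 0) (sem parse_classes s)"
    unfolding parse_classes_def
  proof (rule For_rule[where P = ?P])
    fix i t
    let ?c = "PCond (Less (Reg 4) (Reg 7))
     (PSeq (PAssign 8 (Arr 0 (Reg 6))) (PSeq (incr 6) parse_class)) PSkip"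
    assume i: "i < regs s 0" and P: "?P i t" and ti: "regs t 4 = i"
      and r: "\<And>y. y \<notin> insert 4 (wregs ?c) \<Longrightarrow> regs t y = regs s y"
      and a: "\<And>a. a \<notin> warrs ?c \<Longrightarrow> arrs t a = arrs s a"
    have fr: "regs t 7 = length P" "regs t 0 = n" "regs t 3 = regs s 3" "arrs t 0 = arrs s 0"
      using r[of 7] r[of 0] r[of 3] a[of 0] n l by (simp_all add: parse_class_def)
    show "?P (Suc i) (set_reg 4 (Suc i) (sem ?c t))"
    proof (cases "i < length P")
      case True
      let ?C = "P ! i" and ?o = "length (concat (map ?f (take i P)))"
      have Cs: "length ?C \<le> n" "set ?C \<subseteq> {..<n}" using lC[OF nth_mem[OF True]] by auto
      have rd: "arrs s 0 (regs s 6 + (?o + j)) = ?f ?C ! j" if "j < length (?f ?C)" for j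
        using inp[OF nth_concat_map(1)[of i P j ?f, OF True that]] nth_concat_map(2)[of i P j ?f, OF True that] by simp
      let ?u = "set_reg 6 (Suc (regs t 6)) (set_reg 8 (arrs t 0 (regs t 6)) t)"
      have su: "sem ?c t = sem parse_class ?u" using True ti fr by simp
      have "arrs t 0 (regs t 6) = length ?C" using rd[of 0] P fr by simp
      have pc: "regs (sem parse_class ?u) 6 = regs ?u 6 + length ?C \<and> arrs (sem parse_class ?u) 6 =
        (\<lambda>k. if k \<in> (\<lambda>y. regs ?u 3 * n + y) ` set ?C then regs ?u 4 else arrs ?u 6 k)"
      proof (rule parse_class)
        show "regs ?u 0 = n" "regs ?u 8 = length ?C" "length ?C \<le> n"
          using fr Cs \<open>arrs t 0 (regs t 6) = length ?C\<close> by simp_all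
        show "arrs ?u 0 (regs ?u 6 + j) = ?C ! j" if "j < length ?C" for j
          using rd[of "Suc j"] that P fr by (simp add: add.assoc)
      qed
      have A: "arrs (sem ?c t) 6 = (\<lambda>k. if k \<in> (\<lambda>y. regs s 3 * n + y) ` set ?C then i else arrs t 6 k)"
        unfolding su conjunct2[OF pc] using fr ti by (simp add: fun_eq_iff)
      have R: "regs (sem ?c t) 6 = regs t 6 + length (?f ?C)" unfolding su conjunct1[OF pc] by simp
      show ?thesis
      proof (intro conjI allI impI ballI)
        show "regs (set_reg 4 (Suc i) (sem ?c t)) 6 = regs s 6 + length (concat (map ?f (take (Suc i) P)))"
          using R P length_concat_map_Suc[OF True, of ?f] by simp
        show "arrs (set_reg 4 (Suc i) (sem ?c t)) 6 (regs s 3 * n + y) = c"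
          if c: "c < min (Suc i) (length P)" and y: "y \<in> set (P ! c)" for c y
        proof (cases "c = i")
          case True then show ?thesis using A y by simp
        next
          case False
          then have "y \<notin> set ?C" using disj[of c i y] c y \<open>i < length P\<close> by auto
          then show ?thesis using A P c y False by auto
        qed
        show "arrs (set_reg 4 (Suc i) (sem ?c t)) 6 k = arrs s 6 k"
          if "k \<notin> (\<lambda>y. regs s 3 * n + y) ` {..<n}" for k
        proof -
          have "k \<notin> (\<lambda>y. regs s 3 * n + y) ` set ?C" using that Cs(2) by blast
          then show ?thesis using A P that by simp
        qed
        show "arrs (set_reg 4 (Suc i) (sem ?c t)) 6 k < n" for k
          using A P i n by simp
      qed
    next
      case False
      then show ?thesis using P ti fr by simp
    qed
  qed (use less in \<open>simp_all add: parse_class_def\<close>)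
  then show ?thesis using n l by simp
qed

text \<open>The bound on all entries includes the diagonal ones, at \<open>y * n + y\<close>: they
  belong to no class and keep the initial 0, but the closure computation uses them as indices
  nevertheless.\<close>

lemma parse:
  assumes n: "regs s 0 = n" "length L = n"
    and lP: "\<And>i. i < n \<Longrightarrow> length (L ! i) \<le> n"
    and lC: "\<And>i C. i < n \<Longrightarrow> C \<in> set (L ! i) \<Longrightarrow> length C \<le> n \<and> set C \<subseteq> {..<n}"
    and disj: "\<And>i c c' y. i < n \<Longrightarrow> c < length (L ! i) \<Longrightarrow> c' < length (L ! i) \<Longrightarrow>
      y \<in> set (L ! i ! c) \<Longrightarrow> y \<in> set (L ! i ! c') \<Longrightarrow> c = c'"
    and inp: "\<And>i. i < length (serialize L) \<Longrightarrow> arrs s 0 i = serialize L ! i"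
    and z: "\<And>k. arrs s 6 k = 0"
  shows "i < n \<Longrightarrow> c < length (L ! i) \<Longrightarrow> y \<in> set (L ! i ! c) \<Longrightarrow> arrs (sem parse s) 6 (i * n + y) = c"
    "n > 0 \<Longrightarrow> arrs (sem parse s) 6 k < n"
proof -
  let ?g = "\<lambda>P. concat (map (\<lambda>C. length C # C) (P :: nat list list))"
  let ?f = "\<lambda>P. length P # ?g P"
  have ser: "serialize L = concat (map ?f L)" by (simp add: serialize_def)
  let ?P = "\<lambda>x (t::state). regs t 6 = length (concat (map ?f (take x L))) \<and>
    (\<forall>i<x. \<forall>c<length (L ! i). \<forall>y\<in>set (L ! i ! c). arrs t 6 (i * n + y) = c) \<and>
    (n > 0 \<longrightarrow> (\<forall>k. arrs t 6 k < n))"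
  let ?s = "set_reg 6 0 s"
  let ?c = "PSeq (PAssign 7 (Arr 0 (Reg 6))) (PSeq (incr 6) parse_classes)"
  have "?P (regs ?s 0) (sem (PFor 3 0 ?c) ?s)"
  proof (rule For_rule[where P = ?P])
    fix x t
    assume i: "x < regs ?s 0" and P: "?P x t" and ti: "regs t 3 = x"
      and r: "\<And>y. y \<notin> insert 3 (wregs ?c) \<Longrightarrow> regs t y = regs ?s y"
      and a: "\<And>a. a \<notin> warrs ?c \<Longrightarrow> arrs t a = arrs ?s a"
    have fr: "regs t 0 = n" "arrs t 0 = arrs s 0"
      using r[of 0] a[of 0] n by (simp_all add: parse_class_def parse_classes_def)
    have x: "x < length L" "x < n" using i n by simp_all
    let ?o = "length (concat (map ?f (take x L)))"
    have rd: "arrs s 0 (?o + j) = ?f (L ! x) ! j" if "j < length (?f (L ! x))" for j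
      using inp[of "?o + j"] nth_concat_map[of x L j ?f, OF x(1) that] unfolding ser by simp
    let ?u = "set_reg 6 (Suc (regs t 6)) (set_reg 7 (arrs t 0 (regs t 6)) t)"
    have su: "sem ?c t = sem parse_classes ?u" by simp
    have "arrs t 0 (regs t 6) = length (L ! x)" using rd[of 0] P fr by simp
    have pc: "regs (sem parse_classes ?u) 6 = regs ?u 6 + length (?g (L ! x)) \<and>
      (\<forall>c<length (L ! x). \<forall>y\<in>set (L ! x ! c). arrs (sem parse_classes ?u) 6 (regs ?u 3 * n + y) = c) \<and>
      (\<forall>k. k \<notin> (\<lambda>y. regs ?u 3 * n + y) ` {..<n} \<longrightarrow> arrs (sem parse_classes ?u) 6 k = arrs ?u 6 k) \<and>
      (\<forall>k. arrs (sem parse_classes ?u) 6 k < n)"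
    proof (rule parse_classes)
      show "regs ?u 0 = n" "regs ?u 7 = length (L ! x)" "length (L ! x) \<le> n"
        using fr lP[OF x(2)] \<open>arrs t 0 (regs t 6) = length (L ! x)\<close> by simp_all
      show "arrs ?u 0 (regs ?u 6 + j) = ?g (L ! x) ! j" if "j < length (?g (L ! x))" for j
        using rd[of "Suc j"] that P fr by simp
      show "arrs ?u 6 k < n" for k using P x by simp
    qed (use lC disj x in auto)
    show "?P (Suc x) (set_reg 3 (Suc x) (sem ?c t))"
      unfolding su
    proof (intro conjI allI impI ballI)
      show "regs (set_reg 3 (Suc x) (sem parse_classes ?u)) 6 = length (concat (map ?f (take (Suc x) L)))"
        using pc P length_concat_map_Suc[OF x(1), of ?f] by simp
      show "arrs (set_reg 3 (Suc x) (sem parse_classes ?u)) 6 (i * n + y) = c"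
        if icy: "i < Suc x" "c < length (L ! i)" "y \<in> set (L ! i ! c)" for i c y
      proof (cases "i = x")
        case True then show ?thesis using pc icy ti by simp
      next
        case False
        have "i < n" using icy(1) x(2) by simp
        then have "y < n" using lC[of i "L ! i ! c"] icy by auto
        then have "i * n + y \<notin> (\<lambda>y. x * n + y) ` {..<n}" using False ix_eq_iff[of y n] by auto
        then have "arrs (sem parse_classes ?u) 6 (i * n + y) = arrs t 6 (i * n + y)"
          using pc ti by simp
        then show ?thesis using P icy False by simp
      qed
      show "arrs (set_reg 3 (Suc x) (sem parse_classes ?u)) 6 k < n" for k
        using pc by simp
    qed
  qed (use z in \<open>simp_all add: parse_class_def parse_classes_def\<close>)
  moreover have "sem parse s = sem (PFor 3 0 ?c) ?s" by (simp add: parse_def)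
  ultimately have res: "?P n (sem parse s)" using n by simp
  show "i < n \<Longrightarrow> c < length (L ! i) \<Longrightarrow> y \<in> set (L ! i ! c) \<Longrightarrow> arrs (sem parse s) 6 (i * n + y) = c"
    using res by blast
  show "n > 0 \<Longrightarrow> arrs (sem parse s) 6 k < n" using res by blast
qed

section \<open>Least members\<close>

text \<open>Array 15 marks the current set, array 9 lists it, and \<open>rep\<close> (array 8) maps each class of each
  $H_y$ to the first processed element of that class, plus 1. The classes of $H_y$ and $H_0$ agree on
  the processed elements as long as the representatives agree.\<close>

definition closure_step :: prog where
  "closure_step =
     PSeq (PCond (Equal (Arr 8 (ix (Reg 6) (Arr 6 (ix (Reg 6) (Reg 8))))) (Num 0))
         (PStore 8 (ix (Reg 6) (Arr 6 (ix (Reg 6) (Reg 8)))) (Plus (Reg 8) (Num 1))) PSkip)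
       (PCond (Conj (Equal (Arr 15 (Reg 6)) (Num 0))
            (Neg (Equal (Arr 8 (ix (Reg 6) (Arr 6 (ix (Reg 6) (Reg 8))))) (Arr 8 (Arr 6 (Reg 8))))))
         (PSeq (PStore 15 (Reg 6) (Num 1)) (PSeq (PStore 9 (Reg 7) (Reg 6)) (incr 7))) PSkip)"

text \<open>The queue grows while it is processed, so its length in register 7 occurs in a guard and
  not as the loop bound.\<close>

definition closure_loop :: prog where
  "closure_loop = PFor 5 0 (PCond (Less (Reg 5) (Reg 7))
     (PSeq (PAssign 8 (Arr 9 (Reg 5))) (PFor 6 0 closure_step)) PSkip)"

text \<open>Clearing all \<open>n * n\<close> representatives is of the same order as the closure
  itself. The case of equal points is separate because the queue must be free of
  repetitions.\<close>

definition closure_init :: prog where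
  "closure_init =
     PSeq (PFor 5 0 (PSeq (PStore 15 (Reg 5) (Num 0)) (PFor 6 0 (PStore 8 (ix (Reg 5) (Reg 6)) (Num 0)))))
       (PSeq (PStore 9 (Num 0) (Reg 3)) (PSeq (PStore 15 (Reg 3) (Num 1)) (PSeq (PAssign 7 (Num 1))
         (PCond (Equal (Reg 3) (Reg 4)) PSkip
           (PSeq (PStore 9 (Num 1) (Reg 4)) (PSeq (PStore 15 (Reg 4) (Num 1)) (incr 7)))))))"

text \<open>\<open>cls y u\<close> stands for the number of the class of \<open>u\<close> in $H_y$.\<close>

definition agree_on :: "(nat \<Rightarrow> nat \<Rightarrow> nat) \<Rightarrow> nat \<Rightarrow> nat set \<Rightarrow> bool" where
  "agree_on cls y U \<longleftrightarrow> (\<forall>u\<in>U. \<forall>v\<in>U. cls y u = cls y v \<longleftrightarrow> cls 0 u = cls 0 v)"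

definition least_closed :: "nat \<Rightarrow> (nat \<Rightarrow> nat \<Rightarrow> nat) \<Rightarrow> nat \<Rightarrow> nat \<Rightarrow> nat set \<Rightarrow> bool" where
  "least_closed n cls a b U \<longleftrightarrow> U \<subseteq> {..<n} \<and> 0 \<notin> U \<and> a \<in> U \<and> b \<in> U \<and>
     (\<forall>y<n. y \<notin> U \<longrightarrow> agree_on cls y U) \<and>
     (\<forall>M. M \<subseteq> {..<n} \<longrightarrow> 0 \<notin> M \<longrightarrow> a \<in> M \<longrightarrow> b \<in> M \<longrightarrow> (\<forall>y<n. y \<notin> M \<longrightarrow> agree_on cls y M) \<longrightarrow> U \<subseteq> M)"

lemma closure_step_writes: "wregs closure_step = {7}" "warrs closure_step = {8, 15, 9}"
  by (auto simp: closure_step_def)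

locale closure_run =
  fixes n a b :: nat and C :: "nat \<Rightarrow> nat"
  assumes C: "\<And>k. C k < n" and ab: "a < n" "b < n" "0 < a" "0 < b"
begin

abbreviation cls :: "nat \<Rightarrow> nat \<Rightarrow> nat" where
  "cls y x \<equiv> C (y * n + x)"

text \<open>Row 0 of \<open>R\<close> holds the representatives for the reference relation.
  Representatives are stored with successor, so that 0 means that a class has not been met. Equal
  entries for all processed elements say that rows \<open>y\<close> and 0 partition \<open>D\<close>
  in the same way.\<close>

definition rep_ok :: "nat set \<Rightarrow> (nat \<Rightarrow> nat) \<Rightarrow> nat \<Rightarrow> bool" where
  "rep_ok D R y \<longleftrightarrow>
     (\<forall>u\<in>D. R (y * n + cls y u) \<noteq> 0 \<and> R (y * n + cls y u) = R (cls 0 u)) \<and>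
     (\<forall>c<n. \<forall>e. R (y * n + c) = Suc e \<longrightarrow> e \<in> D \<and> cls y e = c)"

definition queue_ok :: "nat list \<Rightarrow> state \<Rightarrow> bool" where
  "queue_ok qs t \<longleftrightarrow> distinct qs \<and> set qs \<subseteq> {..<n} \<and> 0 \<notin> set qs \<and> a \<in> set qs \<and> b \<in> set qs \<and>
     (\<forall>M. M \<subseteq> {..<n} \<longrightarrow> 0 \<notin> M \<longrightarrow> a \<in> M \<longrightarrow> b \<in> M \<longrightarrow> (\<forall>y<n. y \<notin> M \<longrightarrow> agree_on cls y M) \<longrightarrow> set qs \<subseteq> M) \<and>
     regs t 7 = length qs \<and> (\<forall>k<length qs. arrs t 9 k = qs ! k) \<and>
     (\<forall>y<n. arrs t 15 y = of_bool (y \<in> set qs))"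

lemma queue_ok_set_reg: "x \<noteq> 7 \<Longrightarrow> queue_ok qs (set_reg x v t) \<longleftrightarrow> queue_ok qs t"
  by (simp add: queue_ok_def)

text \<open>The scan begins with row 0, so the reference entry of \<open>x\<close> is set before
  another row is compared with it. A mismatch forces \<open>y\<close> into every closed superset:
  outside of such a set, \<open>y\<close> would agree with position 0 on the representatives of both
  classes of \<open>x\<close>.\<close>

lemma closure_step:
  assumes t: "regs t 0 = n" "regs t 6 = y" "regs t 8 = x" "arrs t 6 = C" and y: "y < n"
    and x: "x \<in> set qs" and q: "queue_ok qs t"
    and D: "D \<subseteq> set qs"
    and R: "\<And>z. z < n \<Longrightarrow> z \<notin> set qs \<Longrightarrow> rep_ok (if z < y then insert x D else D) (arrs t 8) z"
  shows "\<exists>ys. queue_ok (qs @ ys) (sem closure_step t) \<and>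
    (\<forall>z<n. z \<notin> set (qs @ ys) \<longrightarrow>
      rep_ok (if z < Suc y then insert x D else D) (arrs (sem closure_step t) 8) z)"
proof -
  let ?R = "arrs t 8" and ?c = "cls y x" and ?k = "cls 0 x"
  define R' where "R' = (if ?R (y * n + ?c) = 0 then ?R (y * n + ?c := Suc x) else ?R)"
  define t1 where "t1 = (if ?R (y * n + ?c) = 0 then set_arr 8 (y * n + ?c) (Suc x) t else t)"
  have t1: "regs t1 = regs t" "arrs t1 8 = R'" "\<And>a. a \<noteq> 8 \<Longrightarrow> arrs t1 a = arrs t a"
    unfolding t1_def R'_def by auto
  define mark where "mark \<longleftrightarrow> arrs t 15 y = 0 \<and> R' (y * n + ?c) \<noteq> R' ?k"
  have sem: "sem closure_step t =
      (if mark then set_reg 7 (Suc (regs t 7)) (set_arr 9 (regs t 7) y (set_arr 15 y 1 t1)) else t1)"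
    unfolding closure_step_def mark_def t1_def R'_def using t by simp
  have qs: "distinct qs" "set qs \<subseteq> {..<n}" "0 \<notin> set qs" "a \<in> set qs" "b \<in> set qs"
    "regs t 7 = length qs" "\<And>k. k < length qs \<Longrightarrow> arrs t 9 k = qs ! k"
    "\<And>y. y < n \<Longrightarrow> arrs t 15 y = of_bool (y \<in> set qs)" using q unfolding queue_ok_def by auto
  have R'_other: "R' (z * n + c) = ?R (z * n + c)" if "z \<noteq> y" "c < n" for z c
    using ix_eq_iff[OF that(2) C, of z y "y * n + x"] that(1) unfolding R'_def by auto
  have R'_0: "R' c = ?R c" if "y \<noteq> 0" "c < n" for c
    using R'_other[of 0 c] that by simp
  have R'_c: "R' (y * n + ?c) \<noteq> 0" unfolding R'_def by simp
  have R'_keep: "R' k = ?R k" if "?R k \<noteq> 0" for k using that unfolding R'_def by auto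
  have n0: "0 < n" using y by simp
  have ok0: "rep_ok (if 0 < y then insert x D else D) ?R 0" using R[OF n0 qs(3)] .
  text \<open>The invariant for \<open>y\<close>, except for the comparison at \<open>x\<close> itself.\<close>
  have yD: "R' (y * n + cls y u) \<noteq> 0 \<and> R' (y * n + cls y u) = R' (cls 0 u)"
    if "y \<notin> set qs" "u \<in> D" for u
  proof -
    have "rep_ok D ?R y" using R[OF y that(1)] by simp
    then have u: "?R (y * n + cls y u) \<noteq> 0" "?R (y * n + cls y u) = ?R (cls 0 u)"
      using that(2) unfolding rep_ok_def by auto
    then have "?R (cls 0 u) \<noteq> 0" by simp
    then show ?thesis using u R'_keep by simp
  qed
  have yR: "e \<in> insert x D \<and> cls y e = c" if "y \<notin> set qs" "c < n" "R' (y * n + c) = Suc e" for c e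
  proof (cases "?R (y * n + ?c) = 0 \<and> c = ?c")
    case True
    then show ?thesis using that(3) unfolding R'_def by auto
  next
    case False
    then have "R' (y * n + c) = ?R (y * n + c)"
      using ix_eq_iff[OF that(2) C, of y y "y * n + x"] unfolding R'_def by auto
    then show ?thesis using R[OF y that(1)] that(2,3) unfolding rep_ok_def by auto
  qed
  have zR: "rep_ok (if z < Suc y then insert x D else D) R' z"
    if z: "z < n" "z \<notin> set qs" "z \<noteq> y" for z
  proof -
    have "rep_ok (if z < y then insert x D else D) ?R z" using R[OF z(1,2)] .
    moreover have "(z < Suc y) = (z < y)" using z(3) by auto
    ultimately have ok: "rep_ok (if z < Suc y then insert x D else D) ?R z" by simp
    have "R' (z * n + cls z u) \<noteq> 0 \<and> R' (z * n + cls z u) = R' (cls 0 u)"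
      if u: "u \<in> (if z < Suc y then insert x D else D)" for u
    proof -
      have 1: "?R (z * n + cls z u) \<noteq> 0" "?R (z * n + cls z u) = ?R (cls 0 u)"
        using ok u unfolding rep_ok_def by auto
      then have "?R (cls 0 u) \<noteq> 0" by simp
      then show ?thesis using 1 R'_keep by simp
    qed
    moreover have "\<forall>c<n. \<forall>e. R' (z * n + c) = Suc e \<longrightarrow>
        e \<in> (if z < Suc y then insert x D else D) \<and> cls z e = c"
      using ok R'_other[OF z(3)] unfolding rep_ok_def by simp
    ultimately show ?thesis unfolding rep_ok_def by blast
  qed
  show ?thesis
  proof (cases mark)
    case False
    have R8: "arrs (sem closure_step t) 8 = R'" using sem False t1 by simp
    have "queue_ok (qs @ []) (sem closure_step t)"
      using q sem False t1 by (simp add: queue_ok_def)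
    moreover have "rep_ok (if z < Suc y then insert x D else D) R' z"
      if z: "z < n" "z \<notin> set qs" for z
    proof (cases "z = y")
      case True
      have "R' (y * n + ?c) = R' ?k" using False z True qs(8)[OF y] unfolding mark_def by simp
      then have "\<forall>u\<in>insert x D. R' (y * n + cls y u) \<noteq> 0 \<and> R' (y * n + cls y u) = R' (cls 0 u)"
        using yD R'_c z(2) True by (metis insertE)
      moreover have "\<forall>c<n. \<forall>e. R' (y * n + c) = Suc e \<longrightarrow> e \<in> insert x D \<and> cls y e = c"
        using yR z(2) True by blast
      ultimately have "rep_ok (insert x D) R' y" unfolding rep_ok_def by blast
      then show ?thesis using True by simp
    next
      case False then show ?thesis by (rule zR[OF z])
    qed
    ultimately show ?thesis using R8 by (intro exI[of _ "[]"]) simp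
  next
    case True
    then have yq: "y \<notin> set qs" and ne: "R' (y * n + ?c) \<noteq> R' ?k"
      using qs(8)[OF y] unfolding mark_def by (auto split: if_splits)
    \<comment> \<open>Row 0 cannot differ from itself, so position 0 never enters the set.\<close>
    have y0: "y \<noteq> 0"
    proof
      assume "y = 0" then show False using ne by simp
    qed
    have rep0: "?R ?k \<noteq> 0" "\<And>c e. c < n \<Longrightarrow> ?R c = Suc e \<Longrightarrow> e \<in> insert x D \<and> cls 0 e = c"
      using ok0 y0 unfolding rep_ok_def by auto
    have sound: "set qs \<union> {y} \<subseteq> M"
      if M: "M \<subseteq> {..<n}" "0 \<notin> M" "a \<in> M" "b \<in> M" "\<forall>y<n. y \<notin> M \<longrightarrow> agree_on cls y M" for M
    proof -
      have qM: "set qs \<subseteq> M" using q M unfolding queue_ok_def by blast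
      have "y \<in> M"
      proof (rule ccontr)
        assume "y \<notin> M"
        then have ag: "cls y u = cls y v \<longleftrightarrow> cls 0 u = cls 0 v" if "u \<in> M" "v \<in> M" for u v
          using M(5) y that unfolding agree_on_def by blast
        have xM: "insert x D \<subseteq> M" using x D qM by blast
        obtain f where f: "?R ?k = Suc f" using rep0(1) not0_implies_Suc by blast
        have f': "f \<in> insert x D" "cls 0 f = ?k" using rep0(2)[OF C f] by auto
        have R'c0: "R' ?k = Suc f" using R'_0[OF y0 C] f by simp
        have fc: "cls y f = ?c" using ag[of f x] f' xM by blast
        obtain e where e: "R' (y * n + ?c) = Suc e" using R'_c not0_implies_Suc by blast
        have e': "e \<in> insert x D" "cls y e = ?c" using yR[OF yq C e] by auto
        have ec: "cls 0 e = ?k" using ag[of e x] e' xM by blast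
        \<comment> \<open>Here \<open>e\<close> and \<open>f\<close> represent the class of
          \<open>x\<close> in row \<open>y\<close> and in row 0, and under agreement each of them
          lies in both classes. If one of them is old, the invariant at it equates the two entries;
          otherwise both are \<open>x\<close> and the entries are equal anyway.\<close>
        show False
        proof (cases "e \<in> D")
          case True
          then show ?thesis using yD[OF yq True] e'(2) ec ne by simp
        next
          case False
          then have ex: "e = x" using e'(1) by blast
          show ?thesis
          proof (cases "f \<in> D")
            case True
            then show ?thesis using yD[OF yq True] f'(2) fc ne by simp
          next
            case False
            then have "f = x" using f'(1) by blast
            then show ?thesis using ne e R'c0 ex by simp
          qed
        qed
      qed
      then show ?thesis using qM by blast
    qed
    let ?t = "sem closure_step t"
    have st: "regs ?t 7 = Suc (length qs)" "arrs ?t 9 = (arrs t 9)(length qs := y)"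
      "arrs ?t 15 = (arrs t 15)(y := 1)" "arrs ?t 8 = R'"
      using sem True t1 qs(6) by simp_all
    have "queue_ok (qs @ [y]) ?t" unfolding queue_ok_def
      using qs yq y y0 sound by (auto simp: st nth_append)
    moreover have "\<forall>z<n. z \<notin> set (qs @ [y]) \<longrightarrow> rep_ok (if z < Suc y then insert x D else D) R' z"
      using zR by auto
    ultimately show ?thesis using st(4) by (intro exI[of _ "[y]"]) simp
  qed
qed

lemma closure_scan:
  assumes s: "regs s 0 = n" "regs s 8 = x" "arrs s 6 = C"
    and x: "x \<in> set qs" and q: "queue_ok qs s" and D: "D \<subseteq> set qs"
    and R: "\<And>z. z < n \<Longrightarrow> z \<notin> set qs \<Longrightarrow> rep_ok D (arrs s 8) z"
  shows "\<exists>ys. queue_ok (qs @ ys) (sem (PFor 6 0 closure_step) s) \<and>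
    (\<forall>z<n. z \<notin> set (qs @ ys) \<longrightarrow> rep_ok (insert x D) (arrs (sem (PFor 6 0 closure_step) s) 8) z)"
proof -
  let ?P = "\<lambda>i (t::state). \<exists>ys. queue_ok (qs @ ys) t \<and>
    (\<forall>z<n. z \<notin> set (qs @ ys) \<longrightarrow> rep_ok (if z < i then insert x D else D) (arrs t 8) z)"
  have "?P (regs s 0) (sem (PFor 6 0 closure_step) s)"
  proof (rule For_rule[where P = ?P])
    show "?P 0 (set_reg 6 0 s)"
      by (intro exI[of _ "[]"]) (use q R in \<open>simp add: queue_ok_set_reg\<close>)
    fix i t
    assume i: "i < regs s 0" and P: "?P i t" and ti: "regs t 6 = i"
      and r: "\<And>y. y \<notin> insert 6 (wregs closure_step) \<Longrightarrow> regs t y = regs s y"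
      and a: "\<And>a. a \<notin> warrs closure_step \<Longrightarrow> arrs t a = arrs s a"
    obtain ys where ys: "queue_ok (qs @ ys) t"
      "\<And>z. z < n \<Longrightarrow> z \<notin> set (qs @ ys) \<Longrightarrow> rep_ok (if z < i then insert x D else D) (arrs t 8) z"
      using P by blast
    have "\<exists>zs. queue_ok ((qs @ ys) @ zs) (sem closure_step t) \<and>
      (\<forall>z<n. z \<notin> set ((qs @ ys) @ zs) \<longrightarrow>
        rep_ok (if z < Suc i then insert x D else D) (arrs (sem closure_step t) 8) z)"
    proof (rule closure_step)
      show "regs t 0 = n" "regs t 6 = i" "regs t 8 = x" "arrs t 6 = C"
        using r[of 0] r[of 8] a[of 6] s ti by (simp_all add: closure_step_writes)
      show "i < n" using i s by simp
    qed (use x D ys in auto)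
    then obtain zs where "queue_ok (qs @ ys @ zs) (sem closure_step t) \<and>
      (\<forall>z<n. z \<notin> set (qs @ ys @ zs) \<longrightarrow>
        rep_ok (if z < Suc i then insert x D else D) (arrs (sem closure_step t) 8) z)" by auto
    then show "?P (Suc i) (set_reg 6 (Suc i) (sem closure_step t))"
      by (intro exI[of _ "ys @ zs"]) (simp add: queue_ok_set_reg)
  qed (simp_all add: closure_step_writes)
  then show ?thesis using s by auto
qed

text \<open>The queue consists of distinct positions below \<open>n\<close>, so \<open>n\<close>
  rounds leave nothing unprocessed. Then elements share a class in row \<open>y\<close> iff they
  share a representative, iff they share a class in row 0.\<close>

lemma closure_loop:
  assumes s: "regs s 0 = n" "arrs s 6 = C"
    and q: "queue_ok qs s" and R: "\<And>z. z < n \<Longrightarrow> rep_ok {} (arrs s 8) z"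
  shows "\<exists>U. least_closed n cls a b U \<and> (\<forall>y<n. arrs (sem closure_loop s) 15 y = of_bool (y \<in> U))"
proof -
  let ?P = "\<lambda>i (t::state). \<exists>qs. queue_ok qs t \<and>
    (\<forall>z<n. z \<notin> set qs \<longrightarrow> rep_ok (set (take i qs)) (arrs t 8) z)"
  let ?c = "PCond (Less (Reg 5) (Reg 7))
     (PSeq (PAssign 8 (Arr 9 (Reg 5))) (PFor 6 0 closure_step)) PSkip"
  have "?P (regs s 0) (sem closure_loop s)"
    unfolding closure_loop_def
  proof (rule For_rule[where P = ?P])
    show "?P 0 (set_reg 5 0 s)"
      by (intro exI[of _ qs]) (use q R in \<open>simp add: queue_ok_set_reg\<close>)
    fix i t
    assume i: "i < regs s 0" and P: "?P i t" and ti: "regs t 5 = i"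
      and r: "\<And>y. y \<notin> insert 5 (wregs ?c) \<Longrightarrow> regs t y = regs s y"
      and a: "\<And>a. a \<notin> warrs ?c \<Longrightarrow> arrs t a = arrs s a"
    have fr: "regs t 0 = n" "arrs t 6 = C"
      using r[of 0] a[of 6] s by (simp_all add: closure_step_writes)
    obtain qs where qs: "queue_ok qs t"
      "\<And>z. z < n \<Longrightarrow> z \<notin> set qs \<Longrightarrow> rep_ok (set (take i qs)) (arrs t 8) z" using P by blast
    have len: "regs t 7 = length qs" using qs(1) by (simp add: queue_ok_def)
    show "?P (Suc i) (set_reg 5 (Suc i) (sem ?c t))"
    proof (cases "i < length qs")
      case False
      then have "sem ?c t = t" "take (Suc i) qs = take i qs" using ti len by simp_all
      then show ?thesis using qs by (intro exI[of _ qs]) (simp add: queue_ok_set_reg)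
    next
      case True
      let ?x = "qs ! i"
      let ?u = "set_reg 8 (arrs t 9 i) t"
      have st: "sem ?c t = sem (PFor 6 0 closure_step) ?u" using True ti len by simp
      have x: "arrs t 9 i = ?x" using qs(1) True by (simp add: queue_ok_def)
      have "\<exists>ys. queue_ok (qs @ ys) (sem (PFor 6 0 closure_step) ?u) \<and>
        (\<forall>z<n. z \<notin> set (qs @ ys) \<longrightarrow>
          rep_ok (insert ?x (set (take i qs))) (arrs (sem (PFor 6 0 closure_step) ?u) 8) z)"
      proof (rule closure_scan)
        show "set (take i qs) \<subseteq> set qs" by (rule set_take_subset)
      qed (use fr x qs True in \<open>auto simp: queue_ok_set_reg\<close>)
      then obtain ys where ys: "queue_ok (qs @ ys) (sem ?c t)"
        "\<And>z. z < n \<Longrightarrow> z \<notin> set (qs @ ys) \<Longrightarrow>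
          rep_ok (insert ?x (set (take i qs))) (arrs (sem ?c t) 8) z" unfolding st by blast
      have "set (take (Suc i) (qs @ ys)) = insert ?x (set (take i qs))"
        using True by (simp add: take_Suc_conv_app_nth nth_append)
      then show ?thesis using ys by (intro exI[of _ "qs @ ys"]) (simp add: queue_ok_set_reg)
    qed
  qed (simp_all add: closure_step_writes)
  then obtain qs where qs: "queue_ok qs (sem closure_loop s)"
    "\<And>z. z < n \<Longrightarrow> z \<notin> set qs \<Longrightarrow> rep_ok (set (take n qs)) (arrs (sem closure_loop s) 8) z"
    using s by auto
  let ?U = "set qs" and ?R = "arrs (sem closure_loop s) 8"
  have q': "distinct qs" "?U \<subseteq> {..<n}" "0 \<notin> ?U" using qs(1) by (auto simp: queue_ok_def)
  have "length qs \<le> n"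
    using card_mono[OF _ q'(2)] distinct_card[OF q'(1)] by simp
  then have ok: "rep_ok ?U ?R z" if "z < n" "z \<notin> ?U" for z using qs(2)[OF that] by simp
  have agree: "agree_on cls y ?U" if y: "y < n" "y \<notin> ?U" for y
    unfolding agree_on_def
  proof (intro ballI)
    fix u v assume uv: "u \<in> ?U" "v \<in> ?U"
    have n0: "0 < n" using y by simp
    have ok0: "rep_ok ?U ?R 0" by (rule ok[OF n0 q'(3)])
    have *: "\<exists>e. ?R (y * n + cls y u) = Suc e \<and> ?R (cls 0 u) = Suc e \<and> cls y e = cls y u \<and> cls 0 e = cls 0 u"
      if u: "u \<in> ?U" for u
    proof -
      have 1: "?R (y * n + cls y u) \<noteq> 0" "?R (y * n + cls y u) = ?R (cls 0 u)"
        using ok[OF y] u unfolding rep_ok_def by auto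
      then obtain e where e: "?R (y * n + cls y u) = Suc e" using not0_implies_Suc by blast
      then have e0: "?R (0 * n + cls 0 u) = Suc e" using 1 by simp
      have "cls y e = cls y u" using ok[OF y] e C unfolding rep_ok_def by blast
      moreover have "cls 0 e = cls 0 u" using ok0 e0 C unfolding rep_ok_def by blast
      ultimately show ?thesis using e e0 by auto
    qed
    show "cls y u = cls y v \<longleftrightarrow> cls 0 u = cls 0 v" using *[OF uv(1)] *[OF uv(2)] by auto
  qed
  have "least_closed n cls a b ?U"
    unfolding least_closed_def using qs(1) agree unfolding queue_ok_def by blast
  moreover have "\<forall>y<n. arrs (sem closure_loop s) 15 y = of_bool (y \<in> ?U)"
    using qs(1) by (simp add: queue_ok_def)
  ultimately show ?thesis by blast
qed

lemma closure_clear: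
  assumes s: "regs s 0 = n"
  defines "c \<equiv> PFor 5 0 (PSeq (PStore 15 (Reg 5) (Num 0)) (PFor 6 0 (PStore 8 (ix (Reg 5) (Reg 6)) (Num 0))))"
  shows "(\<forall>y<n. arrs (sem c s) 15 y = 0) \<and> (\<forall>y<n. \<forall>z<n. arrs (sem c s) 8 (y * n + z) = 0)"
proof -
  let ?P = "\<lambda>i (t::state). (\<forall>y<i. arrs t 15 y = 0) \<and> (\<forall>y<i. \<forall>z<n. arrs t 8 (y * n + z) = 0)"
  let ?d = "PStore 8 (ix (Reg 5) (Reg 6)) (Num 0)"
  have "?P (regs s 0) (sem c s)" unfolding c_def
  proof (rule For_rule[where P = ?P])
    let ?c = "PSeq (PStore 15 (Reg 5) (Num 0)) (PFor 6 0 ?d)"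
    fix i t
    assume P: "?P i t" and ti: "regs t 5 = i"
      and r: "\<And>y. y \<notin> insert 5 (wregs ?c) \<Longrightarrow> regs t y = regs s y"
    have tn: "regs t 0 = n" using r[of 0] s by simp
    let ?u = "set_arr 15 i 0 t"
    let ?Q = "\<lambda>j (t'::state). (\<forall>y<i. \<forall>z<n. arrs t' 8 (y * n + z) = 0) \<and> (\<forall>z<j. z < n \<longrightarrow> arrs t' 8 (i * n + z) = 0)"
    have "?Q (regs ?u 0) (sem (PFor 6 0 ?d) ?u)"
    proof (rule For_rule[where P = ?Q])
      fix j t'
      assume Q: "?Q j t'" and tj: "regs t' 6 = j"
        and r': "\<And>y. y \<notin> insert 6 (wregs ?d) \<Longrightarrow> regs t' y = regs ?u y"
      have "regs t' 5 = i" "regs t' 0 = n" using r'[of 5] r'[of 0] ti tn by simp_all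
      then show "?Q (Suc j) (set_reg 6 (Suc j) (sem ?d t'))" using Q tj by (auto simp: less_Suc_eq)
    qed (use P in simp_all)
    then have Q: "?Q n (sem (PFor 6 0 ?d) ?u)" using tn by simp
    have "arrs (sem (PFor 6 0 ?d) ?u) 15 = (arrs t 15)(i := 0)" by (subst arrs_sem) simp_all
    moreover have "sem ?c t = sem (PFor 6 0 ?d) ?u" using ti by simp
    ultimately show "?P (Suc i) (set_reg 5 (Suc i) (sem ?c t))"
      using Q P by (simp del: sem.simps add: less_Suc_eq)
  qed simp_all
  then show ?thesis using s by simp
qed

lemma closure_init:
  assumes s: "regs s 0 = n" "regs s 3 = a" "regs s 4 = b" "arrs s 6 = C"
  shows "\<exists>qs. queue_ok qs (sem closure_init s)" "z < n \<Longrightarrow> rep_ok {} (arrs (sem closure_init s) 8) z"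
proof -
  define c where "c = PFor 5 0 (PSeq (PStore 15 (Reg 5) (Num 0)) (PFor 6 0 (PStore 8 (ix (Reg 5) (Reg 6)) (Num 0))))"
  let ?u = "sem c s"
  have cl: "\<forall>y<n. arrs ?u 15 y = 0" "\<forall>y<n. \<forall>z<n. arrs ?u 8 (y * n + z) = 0"
    using closure_clear[OF s(1)] by (simp_all add: c_def del: sem.simps)
  have fr: "regs ?u 0 = n" "regs ?u 3 = a" "regs ?u 4 = b"
    unfolding c_def by (subst regs_sem; simp add: s)+
  let ?qs = "if a = b then [a] else [a, b]"
  have "queue_ok ?qs (sem closure_init s)"
  proof -
    have "sem closure_init s = (if a = b then set_reg 7 1 (set_arr 15 a 1 (set_arr 9 0 a ?u))
      else set_reg 7 2 (set_arr 15 b 1 (set_arr 9 1 b (set_reg 7 1 (set_arr 15 a 1 (set_arr 9 0 a ?u))))))"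
      unfolding closure_init_def c_def[symmetric] sem.simps(4)
      using fr by (simp add: numeral_eq_Suc)
    then show ?thesis unfolding queue_ok_def using ab cl(1) by (auto simp: less_Suc_eq nth_Cons')
  qed
  then show "\<exists>qs. queue_ok qs (sem closure_init s)" by blast
  have "arrs (sem closure_init s) 8 = arrs ?u 8"
    unfolding closure_init_def c_def[symmetric] sem.simps(4) by simp
  then show "z < n \<Longrightarrow> rep_ok {} (arrs (sem closure_init s) 8) z"
    unfolding rep_ok_def using cl(2) by auto
qed

end

lemma closure_correct:
  assumes "regs s 0 = n" "regs s 3 = a" "regs s 4 = b" "arrs s 6 = C"
    and "\<And>k. C k < n" "a < n" "b < n" "0 < a" "0 < b"
  defines "t \<equiv> sem closure_loop (sem closure_init s)"
  shows "\<exists>U. least_closed n (\<lambda>y x. C (y * n + x)) a b U \<and> (\<forall>y<n. arrs t 15 y = of_bool (y \<in> U))"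
proof -
  interpret closure_run n a b C by unfold_locales fact+
  obtain qs where qs: "queue_ok qs (sem closure_init s)" using closure_init(1) assms by blast
  show ?thesis unfolding t_def
  proof (rule closure_loop[OF _ _ qs])
    show "regs (sem closure_init s) 0 = n" "arrs (sem closure_init s) 6 = C"
      using assms by (simp_all add: regs_sem arrs_sem closure_init_def del: sem.simps)
    show "\<And>z. z < n \<Longrightarrow> rep_ok {} (arrs (sem closure_init s) 8) z"
      by (rule closure_init(2)) (use assms in auto)
  qed
qed

section \<open>Tables indexed by pairs and triples\<close>

text \<open>This is the rule for filling a table: each round establishes its own entry, and later
  rounds keep it. Entries must not depend on the loop register.\<close>

lemma For_fill:
  assumes x: "x \<notin> wregs c" "q \<notin> wregs c" "x \<noteq> q"
    and insens: "\<And>i t v. G i (set_reg x v t) \<longleftrightarrow> G i t"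
    and step: "\<And>i t. i < regs s q \<Longrightarrow> regs t x = i \<Longrightarrow>
      (\<And>y. y \<notin> insert x (wregs c) \<Longrightarrow> regs t y = regs s y) \<Longrightarrow>
      (\<And>a. a \<notin> warrs c \<Longrightarrow> arrs t a = arrs s a) \<Longrightarrow> G i (sem c t)"
    and pres: "\<And>i j t. i < regs s q \<Longrightarrow> j < i \<Longrightarrow> regs t x = i \<Longrightarrow>
      (\<And>y. y \<notin> insert x (wregs c) \<Longrightarrow> regs t y = regs s y) \<Longrightarrow>
      (\<And>a. a \<notin> warrs c \<Longrightarrow> arrs t a = arrs s a) \<Longrightarrow> G j t \<Longrightarrow> G j (sem c t)"
  shows "\<forall>i<regs s q. G i (sem (PFor x q c) s)"
proof (rule For_rule[where P = "\<lambda>i t. \<forall>j<i. G j t", OF x])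
  fix i and t :: state
  assume i: "i < regs s q" and P: "\<forall>j<i. G j t" and f: "regs t x = i"
    "\<And>y. y \<notin> insert x (wregs c) \<Longrightarrow> regs t y = regs s y"
    "\<And>a. a \<notin> warrs c \<Longrightarrow> arrs t a = arrs s a"
  have "G j (sem c t)" if "j < Suc i" for j
  proof (cases "j = i")
    case True then show ?thesis using step[OF i f] by simp
  next
    case False
    then show ?thesis using pres[OF i _ f, of j] P that by simp
  qed
  then show "\<forall>j<Suc i. G j (set_reg x (Suc i) (sem c t))" using insens by simp
qed simp

lemma For_pres:
  assumes x: "x \<notin> wregs c" "q \<notin> wregs c" "x \<noteq> q"
    and insens: "\<And>t v. P (set_reg x v t) \<longleftrightarrow> P t"
    and pres: "\<And>i t. i < regs s q \<Longrightarrow> regs t x = i \<Longrightarrow>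
      (\<And>y. y \<notin> insert x (wregs c) \<Longrightarrow> regs t y = regs s y) \<Longrightarrow>
      (\<And>a. a \<notin> warrs c \<Longrightarrow> arrs t a = arrs s a) \<Longrightarrow> P t \<Longrightarrow> P (sem c t)"
    and init: "P s"
  shows "P (sem (PFor x q c) s)"
  by (rule For_rule[where P = "\<lambda>i. P", OF x]) (use insens pres init in auto)

lemma For2_fill:
  assumes x: "x \<notin> wregs c" "q \<notin> wregs c" "x \<noteq> q" and y: "y \<notin> wregs c" "q' \<notin> wregs c" "y \<noteq> q'"
    and xy: "x \<noteq> y" "y \<noteq> q" "x \<noteq> q'"
    and insens: "\<And>i j t v. G i j (set_reg x v t) \<longleftrightarrow> G i j t" "\<And>i j t v. G i j (set_reg y v t) \<longleftrightarrow> G i j t"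
    and step: "\<And>i j t. i < regs s q \<Longrightarrow> j < regs s q' \<Longrightarrow> regs t x = i \<Longrightarrow> regs t y = j \<Longrightarrow>
      (\<And>z. z \<notin> insert x (insert y (wregs c)) \<Longrightarrow> regs t z = regs s z) \<Longrightarrow>
      (\<And>a. a \<notin> warrs c \<Longrightarrow> arrs t a = arrs s a) \<Longrightarrow> G i j (sem c t)"
    and pres: "\<And>i j i' j' t. i < regs s q \<Longrightarrow> j < regs s q' \<Longrightarrow> i' < regs s q \<Longrightarrow> j' < regs s q' \<Longrightarrow>
      (i', j') \<noteq> (i, j) \<Longrightarrow> regs t x = i \<Longrightarrow> regs t y = j \<Longrightarrow>
      (\<And>z. z \<notin> insert x (insert y (wregs c)) \<Longrightarrow> regs t z = regs s z) \<Longrightarrow>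
      (\<And>a. a \<notin> warrs c \<Longrightarrow> arrs t a = arrs s a) \<Longrightarrow> G i' j' t \<Longrightarrow> G i' j' (sem c t)"
  shows "\<forall>i<regs s q. \<forall>j<regs s q'. G i j (sem (PFor x q (PFor y q' c)) s)"
proof (rule For_fill)
  let ?c = "PFor y q' c"
  show "x \<notin> wregs ?c" "q \<notin> wregs ?c" "x \<noteq> q" using x y xy by auto
  show "(\<forall>j<regs s q'. G i j (set_reg x v t)) \<longleftrightarrow> (\<forall>j<regs s q'. G i j t)" for i t v
    using insens by simp
  {
    fix i and t :: state
    assume i: "i < regs s q" and ti: "regs t x = i"
      and r: "\<And>z. z \<notin> insert x (wregs ?c) \<Longrightarrow> regs t z = regs s z"
      and a: "\<And>a. a \<notin> warrs ?c \<Longrightarrow> arrs t a = arrs s a"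
    have q': "regs t q' = regs s q'" using r[of q'] y xy by simp
    have fr: "regs u x = i \<and> (\<forall>z. z \<notin> insert x (insert y (wregs c)) \<longrightarrow> regs u z = regs s z) \<and>
        (\<forall>a. a \<notin> warrs c \<longrightarrow> arrs u a = arrs s a)"
      if "\<And>z. z \<notin> insert y (wregs c) \<Longrightarrow> regs u z = regs t z" "\<And>a. a \<notin> warrs c \<Longrightarrow> arrs u a = arrs t a"
      for u :: state
      using that(1)[of x] that r a ti x(1) xy(1) by simp
    have "\<forall>j<regs t q'. G i j (sem ?c t)"
    proof (rule For_fill[OF y])
      fix j and u :: state
      assume j: "j < regs t q'" and f: "regs u y = j"
        "\<And>z. z \<notin> insert y (wregs c) \<Longrightarrow> regs u z = regs t z" "\<And>a. a \<notin> warrs c \<Longrightarrow> arrs u a = arrs t a"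
      show "G i j (sem c u)" by (rule step) (use fr[of u] f i j q' in auto)
    next
      fix j j' and u :: state
      assume j: "j < regs t q'" "j' < j" and f: "regs u y = j"
        "\<And>z. z \<notin> insert y (wregs c) \<Longrightarrow> regs u z = regs t z" "\<And>a. a \<notin> warrs c \<Longrightarrow> arrs u a = arrs t a"
        and G: "G i j' u"
      show "G i j' (sem c u)"
        by (rule pres[of i j i j']) (use fr[of u] f i j q' G in auto)
    qed (use insens in simp)
    then show "\<forall>j<regs s q'. G i j (sem ?c t)" using q' by simp
  }
  {
    fix i i' and t :: state
    assume i: "i < regs s q" "i' < i" and ti: "regs t x = i"
      and r: "\<And>z. z \<notin> insert x (wregs ?c) \<Longrightarrow> regs t z = regs s z"
      and a: "\<And>a. a \<notin> warrs ?c \<Longrightarrow> arrs t a = arrs s a"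
      and G: "\<forall>j<regs s q'. G i' j t"
    have q': "regs t q' = regs s q'" using r[of q'] y xy by simp
    have "G i' j' (sem ?c t)" if j': "j' < regs s q'" for j'
    proof (rule For_pres[OF y])
      fix j and u :: state
      assume j: "j < regs t q'" and f: "regs u y = j"
        "\<And>z. z \<notin> insert y (wregs c) \<Longrightarrow> regs u z = regs t z" "\<And>a. a \<notin> warrs c \<Longrightarrow> arrs u a = arrs t a"
        and Gu: "G i' j' u"
      show "G i' j' (sem c u)"
        by (rule pres[of i j i' j']) (use f(2)[of x] f r a ti x(1) xy(1) i j j' q' Gu in auto)
    qed (use insens G j' in auto)
    then show "\<forall>j<regs s q'. G i' j (sem ?c t)" by blast
  }
qed

abbreviation ix3 :: "aexp \<Rightarrow> aexp \<Rightarrow> aexp \<Rightarrow> aexp" where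
  "ix3 e f g \<equiv> ix (ix e f) g"

lemma ix3_eq_iff:
  fixes n :: nat
  assumes "b < n" "b' < n" "c < n" "c' < n"
  shows "(a * n + b) * n + c = (a' * n + b') * n + c' \<longleftrightarrow> a = a' \<and> b = b' \<and> c = c'"
  using ix_eq_iff[OF assms(3,4)] ix_eq_iff[OF assms(1,2)] by auto

text \<open>For a pair that involves position 0 the full set is stored. With this convention the
  hull test gives all of \<open>X\<close> to such pairs and keeps position 0 out of the other
  hulls.\<close>

definition least_prog :: prog where
  "least_prog = PFor 3 0 (PFor 4 0
     (PSeq (PCond (Conj (Less (Num 0) (Reg 3)) (Less (Num 0) (Reg 4)))
         (PSeq closure_init closure_loop) (PFor 5 0 (PStore 15 (Reg 5) (Num 1))))
       (PFor 5 0 (PStore 7 (ix3 (Reg 3) (Reg 4) (Reg 5)) (Arr 15 (Reg 5))))))"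

lemma closure_init_writes: "wregs closure_init = {5, 6, 7}" "warrs closure_init = {8, 9, 15}"
  by (auto simp: closure_init_def)

lemma closure_loop_writes: "wregs closure_loop = {5, 6, 7, 8}" "warrs closure_loop = {8, 9, 15}"
  by (auto simp: closure_loop_def closure_step_writes)

lemma least_prog_writes: "wregs least_prog = {3, 4, 5, 6, 7, 8}" "warrs least_prog = {7, 8, 9, 15}"
  by (auto simp: least_prog_def closure_init_writes closure_loop_writes)

lemma least_prog:
  assumes s: "regs s 0 = n" "\<And>k. arrs s 6 k < n"
  shows "\<forall>a<n. \<forall>b<n. \<exists>U.
    (if 0 < a \<and> 0 < b then least_closed n (\<lambda>y x. arrs s 6 (y * n + x)) a b U else U = {..<n}) \<and>
    (\<forall>c<n. arrs (sem least_prog s) 7 ((a * n + b) * n + c) = of_bool (c \<in> U))"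
proof -
  let ?G = "\<lambda>a b (t::state). \<exists>U.
    (if 0 < a \<and> 0 < b then least_closed n (\<lambda>y x. arrs s 6 (y * n + x)) a b U else U = {..<n}) \<and>
    (\<forall>c<n. arrs t 7 ((a * n + b) * n + c) = of_bool (c \<in> U))"
  let ?K = "PCond (Conj (Less (Num 0) (Reg 3)) (Less (Num 0) (Reg 4)))
         (PSeq closure_init closure_loop) (PFor 5 0 (PStore 15 (Reg 5) (Num 1)))"
  let ?E = "PFor 5 0 (PStore 7 (ix3 (Reg 3) (Reg 4) (Reg 5)) (Arr 15 (Reg 5)))"
  have copy: "(\<forall>c<n. arrs (sem ?E t) 7 ((regs t 3 * n + regs t 4) * n + c) = arrs t 15 c) \<and>
      (\<forall>k. (\<forall>c<n. k \<noteq> (regs t 3 * n + regs t 4) * n + c) \<longrightarrow> arrs (sem ?E t) 7 k = arrs t 7 k)"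
    if t: "regs t 0 = n" for t
  proof -
    let ?P = "\<lambda>i (u::state). (\<forall>c<i. c < n \<longrightarrow> arrs u 7 ((regs t 3 * n + regs t 4) * n + c) = arrs t 15 c) \<and>
      (\<forall>k. (\<forall>c<n. k \<noteq> (regs t 3 * n + regs t 4) * n + c) \<longrightarrow> arrs u 7 k = arrs t 7 k)"
    have "?P (regs t 0) (sem ?E t)"
    proof (rule For_rule[where P = ?P])
      let ?c = "PStore 7 (ix3 (Reg 3) (Reg 4) (Reg 5)) (Arr 15 (Reg 5))"
      fix i and u :: state
      assume i: "i < regs t 0" and P: "?P i u" and ui: "regs u 5 = i"
        and r: "\<And>y. y \<notin> insert 5 (wregs ?c) \<Longrightarrow> regs u y = regs t y"
        and a: "\<And>a. a \<notin> warrs ?c \<Longrightarrow> arrs u a = arrs t a"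
      have fr: "regs u 3 = regs t 3" "regs u 4 = regs t 4" "regs u 0 = n" "arrs u 15 = arrs t 15"
        using r[of 3] r[of 4] r[of 0] a[of 15] t by simp_all
      show "?P (Suc i) (set_reg 5 (Suc i) (sem ?c u))"
        using P fr ui i t by (auto simp: less_Suc_eq)
    qed simp_all
    then show ?thesis using t by simp
  qed
  have ones: "\<forall>c<n. arrs (sem (PFor 5 0 (PStore 15 (Reg 5) (Num 1))) t) 15 c = 1"
    if t: "regs t 0 = n" for t
  proof -
    have "\<forall>i<regs t 0. arrs (sem (PFor 5 0 (PStore 15 (Reg 5) (Num 1))) t) 15 i = 1"
      by (rule For_fill[where G = "\<lambda>i u. arrs u 15 i = 1"]) simp_all
    then show ?thesis using t by simp
  qed
  have "\<forall>i<regs s 0. \<forall>j<regs s 0. ?G i j (sem (PFor 3 0 (PFor 4 0 (PSeq ?K ?E))) s)"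
  proof (rule For2_fill[where G = ?G])
    fix a b and t :: state
    assume ab: "a < regs s 0" "b < regs s 0" and tr: "regs t 3 = a" "regs t 4 = b"
      and r: "\<And>z. z \<notin> insert 3 (insert 4 (wregs (PSeq ?K ?E))) \<Longrightarrow> regs t z = regs s z"
      and fa: "\<And>a. a \<notin> warrs (PSeq ?K ?E) \<Longrightarrow> arrs t a = arrs s a"
    have t0: "regs t 0 = n" "arrs t 6 = arrs s 6"
      using r[of 0] fa[of 6] s by (simp_all add: closure_init_writes closure_loop_writes)
    let ?u = "sem ?K t"
    have u: "regs ?u 0 = n" "regs ?u 3 = a" "regs ?u 4 = b"
      by (subst regs_sem; simp add: closure_init_writes closure_loop_writes t0 tr)+
    have "\<exists>U. (if 0 < a \<and> 0 < b then least_closed n (\<lambda>y x. arrs s 6 (y * n + x)) a b U else U = {..<n}) \<and>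
      (\<forall>c<n. arrs ?u 15 c = of_bool (c \<in> U))"
    proof (cases "0 < a \<and> 0 < b")
      case True
      then have "?u = sem closure_loop (sem closure_init t)" using tr by simp
      moreover have "\<exists>U. least_closed n (\<lambda>y x. arrs s 6 (y * n + x)) a b U \<and>
          (\<forall>y<n. arrs (sem closure_loop (sem closure_init t)) 15 y = of_bool (y \<in> U))"
        by (rule closure_correct) (use t0 tr s True ab in auto)
      ultimately show ?thesis using True by simp
    next
      case False
      then have "?u = sem (PFor 5 0 (PStore 15 (Reg 5) (Num 1))) t" using tr by auto
      then have "\<forall>c<n. arrs ?u 15 c = of_bool (c \<in> {..<n})"
        using ones[OF t0(1)] by (simp del: sem.simps)
      moreover have "if 0 < a \<and> 0 < b then least_closed n (\<lambda>y x. arrs s 6 (y * n + x)) a b {..<n}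
        else {..<n} = {..<n}" using False by auto
      ultimately show ?thesis by blast
    qed
    then show "?G a b (sem (PSeq ?K ?E) t)"
      using copy[OF u(1)] u unfolding sem.simps(4) by (metis (no_types, lifting))
  next
    fix a b a' b' and t :: state
    assume ab: "a < regs s 0" "b < regs s 0" "a' < regs s 0" "b' < regs s 0" "(a', b') \<noteq> (a, b)"
      and tr: "regs t 3 = a" "regs t 4 = b"
      and r: "\<And>z. z \<notin> insert 3 (insert 4 (wregs (PSeq ?K ?E))) \<Longrightarrow> regs t z = regs s z"
      and fa: "\<And>a. a \<notin> warrs (PSeq ?K ?E) \<Longrightarrow> arrs t a = arrs s a"
      and G: "?G a' b' t"
    have t0: "regs t 0 = n" using r[of 0] s by (simp_all add: closure_init_writes closure_loop_writes)
    let ?u = "sem ?K t"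
    have u: "regs ?u 0 = n" "regs ?u 3 = a" "regs ?u 4 = b"
      by (subst regs_sem; simp add: closure_init_writes closure_loop_writes t0 tr)+
    have u7: "arrs ?u 7 = arrs t 7"
      by (subst arrs_sem) (simp_all add: closure_init_writes closure_loop_writes)
    have "arrs (sem (PSeq ?K ?E) t) 7 ((a' * n + b') * n + c) = arrs t 7 ((a' * n + b') * n + c)"
      if c: "c < n" for c
    proof -
      have "\<forall>d<n. (a' * n + b') * n + c \<noteq> (a * n + b) * n + d"
        using ix3_eq_iff[of b' n b c _ a' a] ab c s(1) by auto
      then have "arrs (sem ?E ?u) 7 ((a' * n + b') * n + c) = arrs ?u 7 ((a' * n + b') * n + c)"
        using copy[OF u(1)] u by simp
      then show ?thesis using u7 by simp
    qed
    then show "?G a' b' (sem (PSeq ?K ?E) t)" using G by simp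
  qed (simp_all add: closure_init_writes closure_loop_writes)
  then show ?thesis using s unfolding least_prog_def by simp
qed

section \<open>Strong hulls and the vertices that represent them\<close>

definition hull_prog :: prog where
  "hull_prog = PFor 3 0 (PFor 4 0 (PFor 5 0
     (PCond (Conj (Equal (Arr 7 (ix3 (Reg 3) (Reg 4) (Reg 5))) (Num 0))
         (Conj (Equal (Arr 7 (ix3 (Reg 3) (Reg 5) (Reg 4))) (Num 1))
           (Equal (Arr 7 (ix3 (Reg 4) (Reg 5) (Reg 3))) (Num 1))))
       (PStore 10 (ix3 (Reg 3) (Reg 4) (Reg 5)) (Num 0))
       (PStore 10 (ix3 (Reg 3) (Reg 4) (Reg 5)) (Num 1)))))"

text \<open>The expression is the criterion \<open>mem_hull_iff\<close>, read from the table of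
  least members.\<close>

lemma hull_prog:
  assumes s: "regs s 0 = n"
  defines "m \<equiv> \<lambda>a b c. arrs s 7 ((a * n + b) * n + c)"
  shows "\<forall>a<n. \<forall>b<n. \<forall>c<n. arrs (sem hull_prog s) 10 ((a * n + b) * n + c) =
    of_bool (\<not> (m a b c = 0 \<and> m a c b = 1 \<and> m b c a = 1))"
proof -
  let ?B = "PCond (Conj (Equal (Arr 7 (ix3 (Reg 3) (Reg 4) (Reg 5))) (Num 0))
         (Conj (Equal (Arr 7 (ix3 (Reg 3) (Reg 5) (Reg 4))) (Num 1))
           (Equal (Arr 7 (ix3 (Reg 4) (Reg 5) (Reg 3))) (Num 1))))
       (PStore 10 (ix3 (Reg 3) (Reg 4) (Reg 5)) (Num 0))
       (PStore 10 (ix3 (Reg 3) (Reg 4) (Reg 5)) (Num 1))"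
  let ?g = "\<lambda>a b c. of_bool (\<not> (m a b c = 0 \<and> m a c b = 1 \<and> m b c a = 1)) :: nat"
  let ?G = "\<lambda>a b (t::state). \<forall>c<n. arrs t 10 ((a * n + b) * n + c) = ?g a b c"
  have "\<forall>i<regs s 0. \<forall>j<regs s 0. ?G i j (sem (PFor 3 0 (PFor 4 0 (PFor 5 0 ?B))) s)"
  proof (rule For2_fill[where G = ?G])
    fix a b and t :: state
    assume ab: "a < regs s 0" "b < regs s 0" and tr: "regs t 3 = a" "regs t 4 = b"
      and r: "\<And>z. z \<notin> insert 3 (insert 4 (wregs (PFor 5 0 ?B))) \<Longrightarrow> regs t z = regs s z"
      and fa: "\<And>a. a \<notin> warrs (PFor 5 0 ?B) \<Longrightarrow> arrs t a = arrs s a"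
    have t0: "regs t 0 = n" "arrs t 7 = arrs s 7" using r[of 0] fa[of 7] s by simp_all
    have "\<forall>c<regs t 0. arrs (sem (PFor 5 0 ?B) t) 10 ((a * n + b) * n + c) = ?g a b c"
    proof (rule For_fill[where G = "\<lambda>c u. arrs u 10 ((a * n + b) * n + c) = ?g a b c"])
      fix c and u :: state
      assume uc: "regs u 5 = c"
        and r': "\<And>y. y \<notin> insert 5 (wregs ?B) \<Longrightarrow> regs u y = regs t y"
        and fa': "\<And>a. a \<notin> warrs ?B \<Longrightarrow> arrs u a = arrs t a"
      have fr: "regs u 0 = n" "regs u 3 = a" "regs u 4 = b" "arrs u 7 = arrs s 7"
        using r'[of 0] r'[of 3] r'[of 4] fa'[of 7] t0 tr by simp_all
      show "arrs (sem ?B u) 10 ((a * n + b) * n + c) = ?g a b c"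
        using fr uc by (simp add: m_def)
    next
      fix c c' and u :: state
      assume c: "c < regs t 0" "c' < c" and uc: "regs u 5 = c"
        and r': "\<And>y. y \<notin> insert 5 (wregs ?B) \<Longrightarrow> regs u y = regs t y"
        and G: "arrs u 10 ((a * n + b) * n + c') = ?g a b c'"
      have fr: "regs u 0 = n" "regs u 3 = a" "regs u 4 = b"
        using r'[of 0] r'[of 3] r'[of 4] t0 tr by simp_all
      show "arrs (sem ?B u) 10 ((a * n + b) * n + c') = ?g a b c'"
        using fr uc G c by simp
    qed simp_all
    then show "?G a b (sem (PFor 5 0 ?B) t)" using t0 by simp
  next
    fix a b a' b' and t :: state
    assume ab: "a < regs s 0" "b < regs s 0" "a' < regs s 0" "b' < regs s 0" "(a', b') \<noteq> (a, b)"
      and tr: "regs t 3 = a" "regs t 4 = b"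
      and r: "\<And>z. z \<notin> insert 3 (insert 4 (wregs (PFor 5 0 ?B))) \<Longrightarrow> regs t z = regs s z"
      and G: "?G a' b' t"
    have t0: "regs t 0 = n" using r[of 0] s by simp
    show "?G a' b' (sem (PFor 5 0 ?B) t)"
    proof (rule For_pres[where P = "?G a' b'"])
      fix c and u :: state
      assume c: "c < regs t 0" and uc: "regs u 5 = c"
        and r': "\<And>y. y \<notin> insert 5 (wregs ?B) \<Longrightarrow> regs u y = regs t y"
        and G: "?G a' b' u"
      have fr: "regs u 0 = n" "regs u 3 = a" "regs u 4 = b"
        using r'[of 0] r'[of 3] r'[of 4] t0 tr by simp_all
      have ne: "(a' * n + b') * n + d \<noteq> (a * n + b) * n + c" if "d < n" for d
        using ix3_eq_iff[of b' n b d c a' a] ab c that t0 s(1) by auto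
      show "?G a' b' (sem ?B u)" using fr uc G ne by simp
    qed (use G in simp_all)
  qed simp_all
  then show ?thesis using s unfolding hull_prog_def by simp
qed

definition in_hull :: "aexp \<Rightarrow> aexp \<Rightarrow> aexp \<Rightarrow> bexp" where
  "in_hull e f g = Equal (Arr 10 (ix3 e f g)) (Num 1)"

text \<open>Two hulls are equal iff each contains the generating points of the other. Register 2,
  which holds \<open>n * n\<close>, is an upper bound for the number of vertices; the guard
  restricts the search to those found so far.\<close>

definition search_vertex :: prog where
  "search_vertex = PFor 6 2 (PCond (Conj (Less (Reg 6) (Reg 1))
       (Conj (Conj (in_hull (Reg 3) (Reg 4) (Arr 4 (Reg 6))) (in_hull (Reg 3) (Reg 4) (Arr 12 (Reg 6))))
         (Conj (in_hull (Arr 4 (Reg 6)) (Arr 12 (Reg 6)) (Reg 3)) (in_hull (Arr 4 (Reg 6)) (Arr 12 (Reg 6)) (Reg 4)))))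
     (PAssign 5 (Reg 6)) PSkip)"

text \<open>Register 5 starts with the current number of vertices, which means that no vertex was
  found and is at the same time the number of a new one.\<close>

definition vertex_prog :: prog where
  "vertex_prog = PFor 3 0 (PFor 4 0 (PSeq (PAssign 5 (Reg 1)) (PSeq search_vertex
     (PSeq (PCond (Equal (Reg 5) (Reg 1))
         (PSeq (PStore 4 (Reg 1) (Reg 3)) (PSeq (PStore 12 (Reg 1) (Reg 4)) (incr 1))) PSkip)
       (PStore 11 (ix (Reg 3) (Reg 4)) (Reg 5))))))"

lemma vertex_prog_writes: "wregs vertex_prog = {1, 3, 4, 5, 6}" "warrs vertex_prog = {4, 11, 12}"
  by (auto simp: vertex_prog_def search_vertex_def)

lemma vertex_prog:
  assumes s: "regs s 0 = n" "regs s 2 = n * n" "regs s 1 = 0" and n: "0 < n"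
  defines "hl \<equiv> \<lambda>a b c. arrs s 10 ((a * n + b) * n + c) = 1"
  defines "same \<equiv> \<lambda>a b a' b'. hl a b a' \<and> hl a b b' \<and> hl a' b' a \<and> hl a' b' b"
  assumes refl: "\<And>a b. a < n \<Longrightarrow> b < n \<Longrightarrow> same a b a b"
  defines "t \<equiv> sem vertex_prog s"
  shows "regs t 1 \<le> n * n" "0 < regs t 1" "arrs t 4 0 = 0" "arrs t 12 0 = 0"
    "v < regs t 1 \<Longrightarrow> arrs t 4 v < n \<and> arrs t 12 v < n"
    "a < n \<Longrightarrow> b < n \<Longrightarrow> arrs t 11 (a * n + b) < regs t 1 \<and>
      same a b (arrs t 4 (arrs t 11 (a * n + b))) (arrs t 12 (arrs t 11 (a * n + b)))"
    "v < regs t 1 \<Longrightarrow> w < regs t 1 \<Longrightarrow> same (arrs t 4 v) (arrs t 12 v) (arrs t 4 w) (arrs t 12 w) \<Longrightarrow> v = w"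
proof -
  have same_sym: "same a b a' b' \<longleftrightarrow> same a' b' a b" for a b a' b' unfolding same_def by blast
  \<comment> \<open>All pairs lexicographically before \<open>(i, j)\<close> have been treated. The
    first one is \<open>(0, 0)\<close>, so vertex 0 becomes the root.\<close>
  let ?I = "\<lambda>i j (t::state). regs t 1 \<le> i * n + j \<and>
    (0 < i \<or> 0 < j \<longrightarrow> 0 < regs t 1 \<and> arrs t 4 0 = 0 \<and> arrs t 12 0 = 0) \<and>
    (\<forall>v<regs t 1. arrs t 4 v < n \<and> arrs t 12 v < n) \<and>
    (\<forall>a<n. \<forall>b<n. a < i \<or> a = i \<and> b < j \<longrightarrow> arrs t 11 (a * n + b) < regs t 1 \<and>
      same a b (arrs t 4 (arrs t 11 (a * n + b))) (arrs t 12 (arrs t 11 (a * n + b)))) \<and>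
    (\<forall>v<regs t 1. \<forall>w<regs t 1. same (arrs t 4 v) (arrs t 12 v) (arrs t 4 w) (arrs t 12 w) \<longrightarrow> v = w)"
  let ?T = "PSeq (PCond (Equal (Reg 5) (Reg 1))
         (PSeq (PStore 4 (Reg 1) (Reg 3)) (PSeq (PStore 12 (Reg 1) (Reg 4)) (incr 1))) PSkip)
       (PStore 11 (ix (Reg 3) (Reg 4)) (Reg 5))"
  let ?B = "PSeq (PAssign 5 (Reg 1)) (PSeq search_vertex ?T)"
  have search: "regs (sem search_vertex u) 5 = regs u 1 \<and>
        (\<forall>v<regs u 1. \<not> same i j (arrs u 4 v) (arrs u 12 v)) \<or>
      regs (sem search_vertex u) 5 < regs u 1 \<and>
        same i j (arrs u 4 (regs (sem search_vertex u) 5)) (arrs u 12 (regs (sem search_vertex u) 5))"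
    if u: "regs (u::state) 0 = n" "regs u 2 = n * n" "regs u 3 = i" "regs u 4 = j" "regs u 5 = regs u 1"
      "arrs u 10 = arrs s 10" "regs u 1 \<le> n * n" for u i j
  proof -
    let ?P = "\<lambda>k (w::state). regs w 5 = regs u 1 \<and>
        (\<forall>v<k. v < regs u 1 \<longrightarrow> \<not> same i j (arrs u 4 v) (arrs u 12 v)) \<or>
      regs w 5 < regs u 1 \<and> same i j (arrs u 4 (regs w 5)) (arrs u 12 (regs w 5))"
    have "?P (regs u 2) (sem search_vertex u)" unfolding search_vertex_def
    proof (rule For_rule[where P = ?P])
      let ?c = "PCond (Conj (Less (Reg 6) (Reg 1))
       (Conj (Conj (in_hull (Reg 3) (Reg 4) (Arr 4 (Reg 6))) (in_hull (Reg 3) (Reg 4) (Arr 12 (Reg 6))))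
         (Conj (in_hull (Arr 4 (Reg 6)) (Arr 12 (Reg 6)) (Reg 3)) (in_hull (Arr 4 (Reg 6)) (Arr 12 (Reg 6)) (Reg 4)))))
         (PAssign 5 (Reg 6)) PSkip"
      fix k and w :: state
      assume k: "k < regs u 2" and P: "?P k w" and wk: "regs w 6 = k"
        and r: "\<And>y. y \<notin> insert 6 (wregs ?c) \<Longrightarrow> regs w y = regs u y"
        and fa: "\<And>a. a \<notin> warrs ?c \<Longrightarrow> arrs w a = arrs u a"
      have fr: "regs w 0 = n" "regs w 3 = i" "regs w 4 = j" "regs w 1 = regs u 1"
        "arrs w 10 = arrs s 10" "arrs w 4 = arrs u 4" "arrs w 12 = arrs u 12"
        using r[of 0] r[of 3] r[of 4] r[of 1] fa[of 10] fa[of 4] fa[of 12] u by simp_all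
      have "sem ?c w = (if k < regs u 1 \<and> same i j (arrs u 4 k) (arrs u 12 k) then set_reg 5 k w else w)"
        using fr wk by (simp add: in_hull_def same_def hl_def)
      then show "?P (Suc k) (set_reg 6 (Suc k) (sem ?c w))" using P by (auto simp: less_Suc_eq)
    qed (use u in simp_all)
    then show ?thesis using u by auto
  qed
  have body: "?I i (Suc j) (sem ?B t)"
    if I: "?I i j t" and ij: "i < n" "j < n"
      and t: "regs (t::state) 0 = n" "regs t 2 = n * n" "regs t 3 = i" "regs t 4 = j" "arrs t 10 = arrs s 10" for i j t
  proof -
    let ?u = "set_reg 5 (regs t 1) t"
    let ?w = "sem search_vertex ?u"
    let ?V = "regs t 1" and ?f = "regs ?w 5"
    have Vn: "?V \<le> i * n + j" "i * n + j < n * n" using I ix_less[OF ij] by auto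
    have w: "regs ?w 0 = n" "regs ?w 1 = ?V" "regs ?w 3 = i" "regs ?w 4 = j"
      unfolding search_vertex_def by (subst regs_sem; simp add: t)+
    have wa: "arrs ?w a = arrs t a" for a
      unfolding search_vertex_def by (subst arrs_sem) simp_all
    have se: "?f = ?V \<and> (\<forall>v<?V. \<not> same i j (arrs t 4 v) (arrs t 12 v)) \<or>
      ?f < ?V \<and> same i j (arrs t 4 ?f) (arrs t 12 ?f)"
      using search[of ?u i j] t Vn by simp
    have ne: "a * n + b \<noteq> i * n + j" if "a < n" "b < n" "(a, b) \<noteq> (i, j)" for a b
      using ix_eq_iff[OF that(2) ij(2)] that(3) by auto
    have sB: "sem ?B t = sem ?T ?w" by simp
    from se show ?thesis
    proof
      assume f: "?f < ?V \<and> same i j (arrs t 4 ?f) (arrs t 12 ?f)"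
      have e: "sem ?B t = set_arr 11 (i * n + j) ?f ?w" unfolding sB using f w by simp
      have eq: "regs (sem ?B t) 1 = ?V" "arrs (sem ?B t) 4 = arrs t 4" "arrs (sem ?B t) 12 = arrs t 12"
        "arrs (sem ?B t) 11 = (arrs t 11)(i * n + j := ?f)" unfolding e using w wa by simp_all
      have V0: "0 < ?V" using f by simp
      then have "0 < i \<or> 0 < j" using Vn(1) by (cases i) auto
      then have "arrs t 4 0 = 0 \<and> arrs t 12 0 = 0" using I by blast
      then show ?thesis unfolding eq using I f ne V0 by (auto simp: less_Suc_eq)
    next
      assume f: "?f = ?V \<and> (\<forall>v<?V. \<not> same i j (arrs t 4 v) (arrs t 12 v))"
      have e: "sem ?B t = set_arr 11 (i * n + j) ?V (set_reg 1 (Suc ?V) (set_arr 12 ?V j (set_arr 4 ?V i ?w)))"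
        unfolding sB using f w by simp
      have eq: "regs (sem ?B t) 1 = Suc ?V" "arrs (sem ?B t) 4 = (arrs t 4)(?V := i)"
        "arrs (sem ?B t) 12 = (arrs t 12)(?V := j)"
        "arrs (sem ?B t) 11 = (arrs t 11)(i * n + j := ?V)" unfolding e using w wa by simp_all
      have nV: "\<not> same (arrs t 4 v) (arrs t 12 v) i j" "\<not> same i j (arrs t 4 v) (arrs t 12 v)" if "v < ?V" for v
        using f same_sym that by blast+
      have I': "\<And>a b. a < n \<Longrightarrow> b < n \<Longrightarrow> a < i \<or> a = i \<and> b < j \<Longrightarrow> arrs t 11 (a * n + b) < ?V \<and>
          same a b (arrs t 4 (arrs t 11 (a * n + b))) (arrs t 12 (arrs t 11 (a * n + b)))"
        "\<And>v w. v < ?V \<Longrightarrow> w < ?V \<Longrightarrow> same (arrs t 4 v) (arrs t 12 v) (arrs t 4 w) (arrs t 12 w) \<Longrightarrow> v = w"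
        "\<And>v. v < ?V \<Longrightarrow> arrs t 4 v < n \<and> arrs t 12 v < n"
        "0 < i \<or> 0 < j \<Longrightarrow> 0 < ?V \<and> arrs t 4 0 = 0 \<and> arrs t 12 0 = 0" using I by blast+
      show ?thesis unfolding eq
      proof (intro conjI allI impI)
        show "Suc ?V \<le> i * n + Suc j" using Vn by simp
        show "0 < Suc ?V" by simp
        show "((arrs t 4)(?V := i)) 0 = 0" "((arrs t 12)(?V := j)) 0 = 0"
          using I'(4) Vn by (cases "0 < i \<or> 0 < j"; simp)+
        show "((arrs t 4)(?V := i)) v < n" "((arrs t 12)(?V := j)) v < n" if "v < Suc ?V" for v
          using I'(3)[of v] ij that by (auto simp: less_Suc_eq)
        fix a b assume ab: "a < n" "b < n" "a < i \<or> a = i \<and> b < Suc j"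
        show "((arrs t 11)(i * n + j := ?V)) (a * n + b) < Suc ?V"
          using I'(1)[OF ab(1,2)] ab(3) ne[OF ab(1,2)] by (cases "(a, b) = (i, j)") auto
        show "same a b (((arrs t 4)(?V := i)) (((arrs t 11)(i * n + j := ?V)) (a * n + b)))
            (((arrs t 12)(?V := j)) (((arrs t 11)(i * n + j := ?V)) (a * n + b)))"
        proof (cases "(a, b) = (i, j)")
          case True then show ?thesis using refl[OF ij] by simp
        next
          case False
          then have "a < i \<or> a = i \<and> b < j" using ab(3) by auto
          then show ?thesis using I'(1)[OF ab(1,2)] ne[OF ab(1,2) False] by simp
        qed
      next
        fix v w assume vw: "v < Suc ?V" "w < Suc ?V"
          "same (((arrs t 4)(?V := i)) v) (((arrs t 12)(?V := j)) v) (((arrs t 4)(?V := i)) w) (((arrs t 12)(?V := j)) w)"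
        show "v = w"
        proof (cases "v = ?V \<or> w = ?V")
          case True
          show ?thesis
          proof (rule ccontr)
            assume "v \<noteq> w"
            then show False using True vw nV by (auto simp: less_Suc_eq)
          qed
        next
          case False
          then show ?thesis using I'(2)[of v w] vw by simp
        qed
      qed
    qed
  qed
  have Bw: "wregs ?B = {1, 5, 6}" "warrs ?B = {4, 11, 12}" by (auto simp: search_vertex_def)
  have "?I (regs s 0) 0 (sem (PFor 3 0 (PFor 4 0 ?B)) s)"
  proof (rule For_rule[where P = "\<lambda>i. ?I i 0"])
    fix i and t :: state
    assume i: "i < regs s 0" and P: "?I i 0 t" and ti: "regs t 3 = i"
      and r: "\<And>y. y \<notin> insert 3 (wregs (PFor 4 0 ?B)) \<Longrightarrow> regs t y = regs s y"
      and fa: "\<And>a. a \<notin> warrs (PFor 4 0 ?B) \<Longrightarrow> arrs t a = arrs s a"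
    have t: "regs t 0 = n" "regs t 2 = n * n" "arrs t 10 = arrs s 10"
      using r[of 0] r[of 2] fa[of 10] s by (simp_all add: search_vertex_def)
    have "?I i (regs t 0) (sem (PFor 4 0 ?B) t)"
    proof (rule For_rule[where P = "?I i"])
      fix j and u :: state
      assume j: "j < regs t 0" and P: "?I i j u" and uj: "regs u 4 = j"
        and r: "\<And>y. y \<notin> insert 4 (wregs ?B) \<Longrightarrow> regs u y = regs t y"
        and fa: "\<And>a. a \<notin> warrs ?B \<Longrightarrow> arrs u a = arrs t a"
      have "?I i (Suc j) (sem ?B u)"
      proof (rule body[OF P])
        show "regs u 0 = n" "regs u 2 = n * n" "regs u 3 = i" "arrs u 10 = arrs s 10"
          using r[of 0] r[of 2] r[of 3] fa[of 10] t ti unfolding Bw by simp_all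
      qed (use i j s t uj in auto)
      then show "?I i (Suc j) (set_reg 4 (Suc j) (sem ?B u))" by (simp del: sem.simps)
    qed (use P in \<open>simp_all add: search_vertex_def\<close>)
    then have I: "?I i n (sem (PFor 4 0 ?B) t)" using t by (simp del: sem.simps)
    \<comment> \<open>The end of row \<open>i\<close> and the start of row \<open>Suc i\<close>
      describe the same set of treated pairs.\<close>
    have "a < Suc i \<or> a = Suc i \<and> b < 0 \<longleftrightarrow> a < i \<or> a = i \<and> b < n" if "b < n" for a b :: nat
      using that by auto
    then have "?I (Suc i) 0 (sem (PFor 4 0 ?B) t)" using I n by (simp del: sem.simps add: add.commute)
    then show "?I (Suc i) 0 (set_reg 3 (Suc i) (sem (PFor 4 0 ?B) t))" by (simp del: sem.simps)
  qed (use s in \<open>simp_all add: search_vertex_def\<close>)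
  then have I: "?I n 0 t" unfolding t_def vertex_prog_def s(1) .
  show "regs t 1 \<le> n * n" using I by simp
  show "0 < regs t 1" "arrs t 4 0 = 0" "arrs t 12 0 = 0" using I n by blast+
  show "v < regs t 1 \<Longrightarrow> arrs t 4 v < n \<and> arrs t 12 v < n" using I by blast
  show "a < n \<Longrightarrow> b < n \<Longrightarrow> arrs t 11 (a * n + b) < regs t 1 \<and>
      same a b (arrs t 4 (arrs t 11 (a * n + b))) (arrs t 12 (arrs t 11 (a * n + b)))" using I by blast
  show "v < regs t 1 \<Longrightarrow> w < regs t 1 \<Longrightarrow> same (arrs t 4 v) (arrs t 12 v) (arrs t 4 w) (arrs t 12 w) \<Longrightarrow> v = w"
    using I by blast
qed

section \<open>Assembling the tree\<close>

abbreviation nx :: "aexp \<Rightarrow> aexp \<Rightarrow> aexp" where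
  "nx e f \<equiv> Plus (Times e (Reg 2)) f"

definition order_prog :: prog where
  "order_prog = PFor 3 2 (PFor 4 2
     (PCond (Conj (in_hull (Arr 4 (Reg 4)) (Arr 12 (Reg 4)) (Arr 4 (Reg 3)))
         (in_hull (Arr 4 (Reg 4)) (Arr 12 (Reg 4)) (Arr 12 (Reg 3))))
       (PStore 16 (nx (Reg 3) (Reg 4)) (Num 1)) (PStore 16 (nx (Reg 3) (Reg 4)) (Num 0))))"

lemma order_prog:
  assumes s: "regs s 0 = n" "regs s 2 = N"
  defines "hl \<equiv> \<lambda>a b c. arrs s 10 ((a * n + b) * n + c) = 1"
  shows "\<forall>v<N. \<forall>w<N. arrs (sem order_prog s) 16 (v * N + w) =
    of_bool (hl (arrs s 4 w) (arrs s 12 w) (arrs s 4 v) \<and> hl (arrs s 4 w) (arrs s 12 w) (arrs s 12 v))"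
proof -
  let ?G = "\<lambda>v w (t::state). arrs t 16 (v * N + w) =
    of_bool (hl (arrs s 4 w) (arrs s 12 w) (arrs s 4 v) \<and> hl (arrs s 4 w) (arrs s 12 w) (arrs s 12 v))"
  have "\<forall>v<regs s 2. \<forall>w<regs s 2. ?G v w (sem order_prog s)"
    unfolding order_prog_def
  proof (rule For2_fill[where G = ?G], goal_cases)
    case (12 i j t)
    have "regs t 0 = n" "regs t 2 = N" "arrs t 10 = arrs s 10" "arrs t 4 = arrs s 4" "arrs t 12 = arrs s 12"
      using 12(5)[of 0] 12(5)[of 2] 12(6)[of 10] 12(6)[of 4] 12(6)[of 12] s by simp_all
    then show ?case using 12 by (simp add: in_hull_def hl_def)
  next
    case (13 i j i' j' t)
    have "regs t 2 = N" using 13(8)[of 2] s by simp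
    moreover have "i' * N + j' \<noteq> i * N + j" using ix_eq_iff[of j' N j i' i] 13(1-5) s by auto
    ultimately show ?case using 13 by simp
  qed simp_all
  then show ?thesis using s by simp
qed

text \<open>Register 5 holds the best candidate so far, with the number of vertices for none; the
  guard \<open>Less (Reg 5) (Reg 1)\<close> tells the two situations apart.\<close>

definition parent_prog :: prog where
  "parent_prog = PFor 3 2 (PSeq (PAssign 5 (Reg 1)) (PSeq
     (PFor 4 2 (PCond (Conj (Less (Reg 4) (Reg 1)) (Conj (Neg (Equal (Reg 4) (Reg 3)))
         (Conj (Equal (Arr 16 (nx (Reg 3) (Reg 4))) (Num 1))
           (Neg (Conj (Less (Reg 5) (Reg 1)) (Equal (Arr 16 (nx (Reg 5) (Reg 4))) (Num 1)))))))
       (PAssign 5 (Reg 4)) PSkip))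
     (PStore 13 (Reg 3) (Reg 5))))"

text \<open>The value \<open>V\<close>, which is not a vertex, encodes the absence of a
  parent.\<close>

definition is_parent :: "nat \<Rightarrow> (nat \<Rightarrow> nat \<Rightarrow> bool) \<Rightarrow> nat \<Rightarrow> nat \<Rightarrow> bool" where
  "is_parent V le v p \<longleftrightarrow> p = V \<and> (\<forall>w<V. w \<noteq> v \<longrightarrow> \<not> le v w) \<or>
     p < V \<and> p \<noteq> v \<and> le v p \<and> (\<forall>w<V. w \<noteq> v \<longrightarrow> le v w \<longrightarrow> le p w)"

text \<open>Proper supersets of the same set are comparable by \<open>chain\<close>, so comparing
  each new one with the current candidate is enough to find the least.\<close>

lemma parent_prog:
  assumes s: "regs s 1 = V" "regs s 2 = N" "V \<le> N"
  defines "le \<equiv> \<lambda>v w. arrs s 16 (v * N + w) = 1"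
  assumes refl: "\<And>v. v < V \<Longrightarrow> le v v"
    and trans: "\<And>u v w. u < V \<Longrightarrow> v < V \<Longrightarrow> w < V \<Longrightarrow> le u v \<Longrightarrow> le v w \<Longrightarrow> le u w"
    and chain: "\<And>u v w. u < V \<Longrightarrow> v < V \<Longrightarrow> w < V \<Longrightarrow> le u v \<Longrightarrow> le u w \<Longrightarrow> le v w \<or> le w v"
  shows "\<forall>v<V. is_parent V le v (arrs (sem parent_prog s) 13 v)"
proof -
  let ?G = "\<lambda>v (t::state). v < V \<longrightarrow> is_parent V le v (arrs t 13 v)"
  let ?c = "PCond (Conj (Less (Reg 4) (Reg 1)) (Conj (Neg (Equal (Reg 4) (Reg 3)))
         (Conj (Equal (Arr 16 (nx (Reg 3) (Reg 4))) (Num 1))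
           (Neg (Conj (Less (Reg 5) (Reg 1)) (Equal (Arr 16 (nx (Reg 5) (Reg 4))) (Num 1)))))))
       (PAssign 5 (Reg 4)) PSkip"
  have "\<forall>v<regs s 2. ?G v (sem parent_prog s)"
    unfolding parent_prog_def
  proof (rule For_fill[where G = ?G], goal_cases)
    case (5 v t)
    have t: "regs t 1 = V" "regs t 2 = N" "arrs t 16 = arrs s 16"
      using 5(3)[of 1] 5(3)[of 2] 5(4)[of 16] s by simp_all
    let ?u = "set_reg 5 V t"
    let ?P = "\<lambda>k (w::state). v < V \<longrightarrow>
      (regs w 5 = V \<and> (\<forall>x<k. x < V \<longrightarrow> x \<noteq> v \<longrightarrow> \<not> le v x) \<or>
       regs w 5 < V \<and> regs w 5 \<noteq> v \<and> le v (regs w 5) \<and> (\<forall>x<k. x < V \<longrightarrow> x \<noteq> v \<longrightarrow> le v x \<longrightarrow> le (regs w 5) x))"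
    have "?P (regs ?u 2) (sem (PFor 4 2 ?c) ?u)"
    proof (rule For_rule[where P = ?P], goal_cases)
      case (5 k w)
      have w: "regs w 1 = V" "regs w 3 = v" "regs w 2 = N" "arrs w 16 = arrs s 16"
        using 5(4)[of 1] 5(4)[of 3] 5(4)[of 2] 5(5)[of 16] t \<open>regs t 3 = v\<close> by simp_all
      let ?p = "regs w 5"
      have e: "sem ?c w = (if k < V \<and> k \<noteq> v \<and> le v k \<and> \<not> (?p < V \<and> le ?p k) then set_reg 5 k w else w)"
        using w 5(3) by (auto simp: le_def)
      show ?case
      proof (cases "v < V \<and> k < V \<and> k \<noteq> v \<and> le v k \<and> \<not> (?p < V \<and> le ?p k)")
        case True
        have "le k x" if x: "x < k" "x < V" "x \<noteq> v" "le v x" for x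
        proof -
          have p: "?p < V" "le v ?p" "le ?p x" using 5(2) True x by auto
          then have "le k ?p" using chain[of v ?p k] True by blast
          then show ?thesis using trans[of k ?p x] True p x by blast
        qed
        then have "\<forall>x<Suc k. x < V \<longrightarrow> x \<noteq> v \<longrightarrow> le v x \<longrightarrow> le k x"
          using refl[of k] True by (auto simp: less_Suc_eq)
        then show ?thesis unfolding e using True by simp
      next
        case False
        show ?thesis
        proof (cases "v < V")
          case vV: True
          then have "sem ?c w = w" unfolding e using False by auto
          then show ?thesis using 5(2) False vV by (auto simp: less_Suc_eq)
        qed simp
      qed
    qed simp_all
    then have "v < V \<longrightarrow> is_parent V le v (regs (sem (PFor 4 2 ?c) ?u) 5)"
      using t s(3) by (simp del: sem.simps add: is_parent_def) (meson less_le_trans)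
    moreover have "regs (sem (PFor 4 2 ?c) ?u) 3 = v" using 5 by (subst regs_sem) simp_all
    ultimately show ?case using t by (simp del: sem.simps(6))
  next
    case (6 v v' t)
    have "regs (sem (PFor 4 2 ?c) (set_reg 5 (regs t 1) t)) 3 = v" using 6 by (subst regs_sem) simp_all
    moreover have "arrs (sem (PFor 4 2 ?c) (set_reg 5 (regs t 1) t)) 13 = arrs t 13"
      by (subst arrs_sem) simp_all
    ultimately show ?case using 6 by (simp del: sem.simps(6))
  qed simp_all
  then show ?thesis using s by (meson less_le_trans)
qed

text \<open>A triple belongs to a node if its three pairs are mapped to the same vertex. Different
  first components exclude the trivial triples at singletons. All triples of a node write the same
  code, so the order of the writes is immaterial.\<close>

definition kind_prog :: prog where
  "kind_prog = PFor 3 0 (PFor 4 0 (PFor 5 0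
     (PCond (Conj (Neg (Equal (Reg 3) (Reg 4)))
         (Conj (Equal (Arr 11 (ix (Reg 3) (Reg 4))) (Arr 11 (ix (Reg 3) (Reg 5))))
           (Equal (Arr 11 (ix (Reg 3) (Reg 4))) (Arr 11 (ix (Reg 4) (Reg 5))))))
       (PSeq (PAssign 6 (Arr 7 (ix3 (Reg 3) (Reg 4) (Reg 5))))
         (PSeq (PCond (Equal (Arr 7 (ix3 (Reg 4) (Reg 5) (Reg 3))) (Num 1)) (incr 6) PSkip)
           (PSeq (PCond (Equal (Arr 7 (ix3 (Reg 3) (Reg 5) (Reg 4))) (Num 1)) (incr 6) PSkip)
             (PStore 5 (Arr 11 (ix (Reg 3) (Reg 4))) (Reg 6)))))
       PSkip)))"

lemma kind_prog:
  assumes s: "regs s 0 = n"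
  defines "m \<equiv> \<lambda>a b c. arrs s 7 ((a * n + b) * n + c)"
    and "vid \<equiv> \<lambda>a b. arrs s 11 (a * n + b)"
  defines "code \<equiv> \<lambda>a b c. m a b c + of_bool (m b c a = 1) + of_bool (m a c b = 1)"
    and "triple \<equiv> \<lambda>a b c. a \<noteq> b \<and> vid a b = vid a c \<and> vid a b = vid b c"
  assumes cons: "\<And>a b c a' b' c'. a < n \<Longrightarrow> b < n \<Longrightarrow> c < n \<Longrightarrow> a' < n \<Longrightarrow> b' < n \<Longrightarrow> c' < n \<Longrightarrow>
    triple a b c \<Longrightarrow> triple a' b' c' \<Longrightarrow> vid a b = vid a' b' \<Longrightarrow> code a b c = code a' b' c'"
  shows "\<forall>a<n. \<forall>b<n. \<forall>c<n. triple a b c \<longrightarrow> arrs (sem kind_prog s) 5 (vid a b) = code a b c"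
    "(\<And>a b c. a < n \<Longrightarrow> b < n \<Longrightarrow> c < n \<Longrightarrow> triple a b c \<Longrightarrow> vid a b \<noteq> v) \<Longrightarrow>
      arrs (sem kind_prog s) 5 v = arrs s 5 v"
proof -
  let ?B = "PCond (Conj (Neg (Equal (Reg 3) (Reg 4)))
         (Conj (Equal (Arr 11 (ix (Reg 3) (Reg 4))) (Arr 11 (ix (Reg 3) (Reg 5))))
           (Equal (Arr 11 (ix (Reg 3) (Reg 4))) (Arr 11 (ix (Reg 4) (Reg 5))))))
       (PSeq (PAssign 6 (Arr 7 (ix3 (Reg 3) (Reg 4) (Reg 5))))
         (PSeq (PCond (Equal (Arr 7 (ix3 (Reg 4) (Reg 5) (Reg 3))) (Num 1)) (incr 6) PSkip)
           (PSeq (PCond (Equal (Arr 7 (ix3 (Reg 3) (Reg 5) (Reg 4))) (Num 1)) (incr 6) PSkip)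
             (PStore 5 (Arr 11 (ix (Reg 3) (Reg 4))) (Reg 6)))))
       PSkip"
  have body: "arrs (sem ?B t) 5 = (if triple a b c then (arrs t 5)(vid a b := code a b c) else arrs t 5)"
    if "regs t 0 = n" "regs t 3 = a" "regs t 4 = b" "regs t 5 = c" "arrs t 7 = arrs s 7" "arrs t 11 = arrs s 11"
    for t a b c
    using that by (auto simp: triple_def code_def m_def vid_def)
  let ?G = "\<lambda>a b (t::state). \<forall>c<n. triple a b c \<longrightarrow> arrs t 5 (vid a b) = code a b c"
  have keep: "?G a b (sem ?B t)"
    if "?G a b t" "a < n" "b < n" "a' < n" "b' < n" "c' < n"
      "regs t 0 = n" "regs t 3 = a'" "regs t 4 = b'" "regs t 5 = c'" "arrs t 7 = arrs s 7" "arrs t 11 = arrs s 11"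
    for t a b a' b' c'
  proof (intro allI impI)
    fix c assume c: "c < n" "triple a b c"
    show "arrs (sem ?B t) 5 (vid a b) = code a b c"
    proof (cases "triple a' b' c' \<and> vid a' b' = vid a b")
      case True
      then show ?thesis using body[OF that(7-12)] cons[OF that(4-6,2,3) c(1)] c(2) by simp
    next
      case False
      then show ?thesis using body[OF that(7-12)] that(1) c by auto
    qed
  qed
  have "\<forall>a<regs s 0. \<forall>b<regs s 0. ?G a b (sem kind_prog s)"
    unfolding kind_prog_def
  proof (rule For2_fill[where G = ?G], goal_cases)
    case (12 a b t)
    have t: "regs t 0 = n" "arrs t 7 = arrs s 7" "arrs t 11 = arrs s 11"
      using 12(5)[of 0] 12(6)[of 7] 12(6)[of 11] s by simp_all
    have "\<forall>c<regs t 0. triple a b c \<longrightarrow> arrs (sem (PFor 5 0 ?B) t) 5 (vid a b) = code a b c"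
    proof (rule For_fill[where G = "\<lambda>c t. triple a b c \<longrightarrow> arrs t 5 (vid a b) = code a b c"], goal_cases)
      case (5 c u)
      have "regs u 0 = n" "regs u 3 = a" "regs u 4 = b" "arrs u 7 = arrs s 7" "arrs u 11 = arrs s 11"
        using 5(3)[of 0] 5(3)[of 3] 5(3)[of 4] 5(4)[of 7] 5(4)[of 11] t 12 by simp_all
      then show ?case using body[of u a b c] 5(2) by simp
    next
      case (6 c c' u)
      have u: "regs u 0 = n" "regs u 3 = a" "regs u 4 = b" "arrs u 7 = arrs s 7" "arrs u 11 = arrs s 11"
        using 6(4)[of 0] 6(4)[of 3] 6(4)[of 4] 6(5)[of 7] 6(5)[of 11] t 12 by simp_all
      have "c < n" "c' < n" using 6(1,2) t by auto
      then show ?case using body[of u a b c] u 6(3,6) cons[of a b c a b c'] 12(1,2) s by auto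
    qed simp_all
    then show ?case using t by simp
  next
    case (13 i j a b t)
    have t: "regs t 0 = n" "arrs t 7 = arrs s 7" "arrs t 11 = arrs s 11"
      using 13(8)[of 0] 13(9)[of 7] 13(9)[of 11] s by simp_all
    show ?case
    proof (rule For_pres[where P = "?G a b"], goal_cases)
      case (5 c u)
      have "regs u 0 = n" "regs u 3 = i" "regs u 4 = j" "arrs u 7 = arrs s 7" "arrs u 11 = arrs s 11"
        using 5(3)[of 0] 5(3)[of 3] 5(3)[of 4] 5(4)[of 7] 5(4)[of 11] t 13 by simp_all
      then show ?case using keep[of a b u i j c] 5(1,2,5) 13(1-4) s t by simp
    next
      case 6 then show ?case using 13(10) .
    qed simp_all
  qed simp_all
  then show "\<forall>a<n. \<forall>b<n. \<forall>c<n. triple a b c \<longrightarrow> arrs (sem kind_prog s) 5 (vid a b) = code a b c"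
    using s by simp
  assume no: "\<And>a b c. a < n \<Longrightarrow> b < n \<Longrightarrow> c < n \<Longrightarrow> triple a b c \<Longrightarrow> vid a b \<noteq> v"
  let ?P = "\<lambda>t::state. arrs t 5 v = arrs s 5 v"
  show "?P (sem kind_prog s)" unfolding kind_prog_def
  proof (rule For_pres[where P = ?P], goal_cases)
    case (5 a t)
    have t: "regs t 0 = n" "arrs t 7 = arrs s 7" "arrs t 11 = arrs s 11"
      using 5(3)[of 0] 5(4)[of 7] 5(4)[of 11] s by simp_all
    show ?case
    proof (rule For_pres[where P = ?P], goal_cases)
      case (5 b u)
      have u: "regs u 0 = n" "regs u 3 = a" "arrs u 7 = arrs s 7" "arrs u 11 = arrs s 11"
        using 5(3)[of 0] 5(3)[of 3] 5(4)[of 7] 5(4)[of 11] t \<open>regs t 3 = a\<close> by simp_all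
      show ?case
      proof (rule For_pres[where P = ?P], goal_cases)
        case (5 c w)
        have w: "regs w 0 = n" "regs w 3 = a" "regs w 4 = b" "arrs w 7 = arrs s 7" "arrs w 11 = arrs s 11"
          using 5(3)[of 0] 5(3)[of 3] 5(3)[of 4] 5(4)[of 7] 5(4)[of 11] u \<open>regs u 4 = b\<close> by simp_all
        have "a < n" "b < n" "c < n" using \<open>a < regs s 0\<close> \<open>b < regs t 0\<close> \<open>c < regs u 0\<close> s t u by simp_all
        then show ?case using body[of w a b c] w 5(2,5) no[of a b c] by auto
      next
        case 6 then show ?case using 5(5) .
      qed simp_all
    next
      case 6 then show ?case using 5(5) .
    qed simp_all
  qed simp_all
qed

text \<open>A pair whose least member fills its hull reveals the two ends of a linear node. Other
  kinds of nodes may get an entry as well, but only entries at nodes of code 1 are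
  consulted.\<close>

definition end_prog :: prog where
  "end_prog = PFor 3 0 (PFor 4 0 (PSeq (PAssign 6 (Num 1)) (PSeq
     (PFor 5 0 (PCond (Conj (in_hull (Reg 3) (Reg 4) (Reg 5)) (Equal (Arr 7 (ix3 (Reg 3) (Reg 4) (Reg 5))) (Num 0)))
       (PAssign 6 (Num 0)) PSkip))
     (PCond (Equal (Reg 6) (Num 1)) (PStore 14 (Arr 11 (ix (Reg 3) (Reg 4))) (Reg 3)) PSkip))))"

text \<open>Several pairs may write to the same vertex, so all that is known is that the final entry
  stems from some filling pair. The second claim keeps every entry usable as a position, written or
  not.\<close>

lemma end_prog:
  assumes s: "regs s 0 = n"
  defines "m \<equiv> \<lambda>a b c. arrs s 7 ((a * n + b) * n + c)"
    and "hl \<equiv> \<lambda>a b c. arrs s 10 ((a * n + b) * n + c) = 1"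
    and "vid \<equiv> \<lambda>a b. arrs s 11 (a * n + b)"
  defines "full \<equiv> \<lambda>a b. \<forall>c<n. hl a b c \<longrightarrow> m a b c \<noteq> 0"
  shows "\<forall>a<n. \<forall>b<n. full a b \<longrightarrow> (\<exists>a'<n. \<exists>b'<n. full a' b' \<and> vid a' b' = vid a b \<and>
    arrs (sem end_prog s) 14 (vid a b) = a')"
    "(\<And>v. arrs s 14 v < n) \<Longrightarrow> arrs (sem end_prog s) 14 v < n"
proof -
  let ?C = "PCond (Conj (in_hull (Reg 3) (Reg 4) (Reg 5)) (Equal (Arr 7 (ix3 (Reg 3) (Reg 4) (Reg 5))) (Num 0)))
       (PAssign 6 (Num 0)) PSkip"
  let ?B = "PSeq (PAssign 6 (Num 1)) (PSeq (PFor 5 0 ?C)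
     (PCond (Equal (Reg 6) (Num 1)) (PStore 14 (Arr 11 (ix (Reg 3) (Reg 4))) (Reg 3)) PSkip))"
  have body: "arrs (sem ?B t) 14 = (if full a b then (arrs t 14)(vid a b := a) else arrs t 14)"
    if t: "regs t 0 = n" "regs t 3 = a" "regs t 4 = b" "arrs t 7 = arrs s 7" "arrs t 10 = arrs s 10"
      "arrs t 11 = arrs s 11" for t a b
  proof -
    let ?u = "set_reg 6 1 t"
    let ?P = "\<lambda>k (w::state). regs w 6 = of_bool (\<forall>c<k. hl a b c \<longrightarrow> m a b c \<noteq> 0)"
    have "?P (regs ?u 0) (sem (PFor 5 0 ?C) ?u)"
    proof (rule For_rule[where P = ?P], goal_cases)
      case (5 k w)
      have w: "regs w 0 = n" "regs w 3 = a" "regs w 4 = b" "arrs w 7 = arrs s 7" "arrs w 10 = arrs s 10"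
        using 5(4)[of 0] 5(4)[of 3] 5(4)[of 4] 5(5)[of 7] 5(5)[of 10] t by (simp_all add: in_hull_def)
      have e: "sem ?C w = (if hl a b k \<and> m a b k = 0 then set_reg 6 0 w else w)"
        using w 5(3) by (simp add: in_hull_def hl_def m_def)
      show ?case unfolding e using 5(2) by (auto simp: less_Suc_eq)
    qed simp_all
    then have f: "regs (sem (PFor 5 0 ?C) ?u) 6 = of_bool (full a b)"
      using t by (simp del: sem.simps add: full_def)
    have r: "regs (sem (PFor 5 0 ?C) ?u) 0 = n" "regs (sem (PFor 5 0 ?C) ?u) 3 = a" "regs (sem (PFor 5 0 ?C) ?u) 4 = b"
      by (subst regs_sem; simp add: t)+
    have aa: "arrs (sem (PFor 5 0 ?C) ?u) x = arrs t x" for x by (subst arrs_sem) simp_all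
    show ?thesis using f r aa t(6) by (simp add: vid_def del: sem.simps(6))
  qed
  let ?W = "\<lambda>v (t::state). \<exists>a'<n. \<exists>b'<n. full a' b' \<and> vid a' b' = v \<and> arrs t 14 v = a'"
  let ?G = "\<lambda>a b (t::state). full a b \<longrightarrow> ?W (vid a b) t"
  have "\<forall>a<regs s 0. \<forall>b<regs s 0. ?G a b (sem end_prog s)"
    unfolding end_prog_def
  proof (rule For2_fill[where G = ?G], goal_cases)
    case (12 a b t)
    have "regs t 0 = n" "arrs t 7 = arrs s 7" "arrs t 10 = arrs s 10" "arrs t 11 = arrs s 11"
      using 12(5)[of 0] 12(6)[of 7] 12(6)[of 10] 12(6)[of 11] s by simp_all
    then show ?case using body[of t a b] 12(1-4) s by (auto simp del: sem.simps)
  next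
    case (13 i j a b t)
    have "regs t 0 = n" "arrs t 7 = arrs s 7" "arrs t 10 = arrs s 10" "arrs t 11 = arrs s 11"
      using 13(8)[of 0] 13(9)[of 7] 13(9)[of 10] 13(9)[of 11] s by simp_all
    then have e: "arrs (sem ?B t) 14 = (if full i j then (arrs t 14)(vid i j := i) else arrs t 14)"
      using body[of t i j] 13(6,7) by (simp del: sem.simps)
    have "i < n" "j < n" using 13(1,2) s by simp_all
    then show ?case unfolding e using 13(10) by (auto split: if_splits)
  qed simp_all
  then show "\<forall>a<n. \<forall>b<n. full a b \<longrightarrow> (\<exists>a'<n. \<exists>b'<n. full a' b' \<and> vid a' b' = vid a b \<and>
    arrs (sem end_prog s) 14 (vid a b) = a')" using s by simp
  assume less: "\<And>v. arrs s 14 v < n"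
  let ?P = "\<lambda>t::state. \<forall>v. arrs t 14 v < n"
  have "?P (sem end_prog s)" unfolding end_prog_def
  proof (rule For_pres[where P = ?P], goal_cases)
    case (5 a t)
    have t: "regs t 0 = n" "arrs t 7 = arrs s 7" "arrs t 10 = arrs s 10" "arrs t 11 = arrs s 11"
      using 5(3)[of 0] 5(4)[of 7] 5(4)[of 10] 5(4)[of 11] s by simp_all
    show ?case
    proof (rule For_pres[where P = ?P], goal_cases)
      case (5 b u)
      have "regs u 0 = n" "regs u 3 = a" "arrs u 7 = arrs s 7" "arrs u 10 = arrs s 10" "arrs u 11 = arrs s 11"
        using 5(3)[of 0] 5(3)[of 3] 5(4)[of 7] 5(4)[of 10] 5(4)[of 11] t \<open>regs t 3 = a\<close> by simp_all
      then have e: "arrs (sem ?B u) 14 = (if full a b then (arrs u 14)(vid a b := a) else arrs u 14)"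
        using body[of u a b] 5(2) by (simp del: sem.simps)
      have "a < n" using \<open>a < regs s 0\<close> s by simp
      then show ?case unfolding e using 5(5) by simp
    next
      case 6 then show ?case using 5(5) .
    qed simp_all
  qed (use less in simp_all)
  then show "arrs (sem end_prog s) 14 v < n" by blast
qed

text \<open>Assigned values may exceed stored ones only by 1, so the offsets arise from counting
  loops instead of a multiplication. A block of \<open>Suc N\<close> cells has room for
  \<open>N\<close> children and the parent.\<close>

definition offset_prog :: prog where
  "offset_prog = PSeq (PAssign 5 (Num 0))
     (PFor 3 2 (PSeq (PStore 2 (Reg 3) (Reg 5)) (PSeq (incr 5) (PFor 4 2 (incr 5)))))"

lemma offset_prog:
  assumes s: "regs s 2 = N"
  shows "\<forall>v<N. arrs (sem offset_prog s) 2 v = v * Suc N"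
proof -
  let ?P = "\<lambda>i (t::state). regs t 5 = i * Suc N \<and> (\<forall>v<i. arrs t 2 v = v * Suc N)"
  let ?s = "set_reg 5 0 s"
  let ?c = "PSeq (PStore 2 (Reg 3) (Reg 5)) (PSeq (incr 5) (PFor 4 2 (incr 5)))"
  have "?P (regs ?s 2) (sem (PFor 3 2 ?c) ?s)"
  proof (rule For_rule[where P = ?P], goal_cases)
    case (5 i t)
    have t: "regs t 2 = N" using 5(4)[of 2] s by simp
    let ?u = "set_reg 5 (Suc (regs t 5)) (set_arr 2 i (regs t 5) t)"
    have "regs (sem (PFor 4 2 (incr 5)) ?u) 5 = regs ?u 5 + regs ?u 2"
      by (rule For_rule[where P = "\<lambda>j w. regs w 5 = regs ?u 5 + j"]) simp_all
    moreover have "arrs (sem (PFor 4 2 (incr 5)) ?u) 2 = (arrs t 2)(i := regs t 5)"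
      by (subst arrs_sem) simp_all
    ultimately show ?case using 5(2,3) t by (auto simp: less_Suc_eq simp del: sem.simps(6))
  qed simp_all
  then show ?thesis using s by (simp add: offset_prog_def)
qed

lemma count_loop:
  assumes "\<And>t w. w < regs s 2 \<Longrightarrow> regs t 4 = w \<Longrightarrow> (\<And>y. y \<noteq> 4 \<Longrightarrow> y \<noteq> 5 \<Longrightarrow> regs t y = regs s y) \<Longrightarrow>
    (\<And>a. arrs t a = arrs s a) \<Longrightarrow> bval t b \<longleftrightarrow> Q w"
  shows "regs (sem (PFor 4 2 (PCond b (incr 5) PSkip)) s) 5 = regs s 5 + card {w. w < regs s 2 \<and> Q w}"
proof (rule For_rule[where P = "\<lambda>i t. regs t 5 = regs s 5 + card {w. w < i \<and> Q w}"], goal_cases)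
  case (5 i t)
  have b: "bval t b \<longleftrightarrow> Q i" by (rule assms) (use 5 in auto)
  have "{w. w < Suc i \<and> Q w} = (if Q i then insert i {w. w < i \<and> Q w} else {w. w < i \<and> Q w})"
    by (auto simp: less_Suc_eq)
  then show ?case using b 5(2) by simp
qed simp_all

text \<open>Counting the siblings that come before a vertex yields its slot without sorting. The
  nested negations express a disjunction, which \<open>bexp\<close> lacks: at nodes of code 1 the
  order is betweenness from the stored end, elsewhere it is the numbering of the vertices.\<close>

definition position_prog :: prog where
  "position_prog = PFor 3 2 (PSeq (PAssign 5 (Num 0)) (PSeq
     (PFor 4 2 (PCond (Conj (Less (Reg 4) (Reg 1)) (Conj (Neg (Equal (Reg 4) (Reg 3)))
         (Conj (Equal (Arr 13 (Reg 4)) (Arr 13 (Reg 3)))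
           (Neg (Conj
             (Neg (Conj (Equal (Arr 5 (Arr 13 (Reg 3))) (Num 1))
               (Equal (Arr 7 (ix3 (Arr 14 (Arr 13 (Reg 3))) (Arr 4 (Reg 3)) (Arr 4 (Reg 4)))) (Num 1))))
             (Neg (Conj (Neg (Equal (Arr 5 (Arr 13 (Reg 3))) (Num 1))) (Less (Reg 4) (Reg 3)))))))))
       (incr 5) PSkip))
     (PStore 17 (Reg 3) (Reg 5))))"

lemma position_prog:
  assumes s: "regs s 0 = n" "regs s 1 = V" "regs s 2 = N"
  defines "before \<equiv> \<lambda>w v. if arrs s 5 (arrs s 13 v) = 1
    then arrs s 7 ((arrs s 14 (arrs s 13 v) * n + arrs s 4 v) * n + arrs s 4 w) = 1 else w < v"
  shows "\<forall>v<N. arrs (sem position_prog s) 17 v =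
    card {w. w < N \<and> w < V \<and> w \<noteq> v \<and> arrs s 13 w = arrs s 13 v \<and> before w v}"
proof -
  let ?b = "Conj (Less (Reg 4) (Reg 1)) (Conj (Neg (Equal (Reg 4) (Reg 3)))
         (Conj (Equal (Arr 13 (Reg 4)) (Arr 13 (Reg 3)))
           (Neg (Conj
             (Neg (Conj (Equal (Arr 5 (Arr 13 (Reg 3))) (Num 1))
               (Equal (Arr 7 (ix3 (Arr 14 (Arr 13 (Reg 3))) (Arr 4 (Reg 3)) (Arr 4 (Reg 4)))) (Num 1))))
             (Neg (Conj (Neg (Equal (Arr 5 (Arr 13 (Reg 3))) (Num 1))) (Less (Reg 4) (Reg 3))))))))"
  let ?L = "PFor 4 2 (PCond ?b (incr 5) PSkip)"
  let ?Q = "\<lambda>v w. w < V \<and> w \<noteq> v \<and> arrs s 13 w = arrs s 13 v \<and> before w v"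
  let ?G = "\<lambda>v (t::state). arrs t 17 v = card {w. w < N \<and> ?Q v w}"
  have "\<forall>v<regs s 2. ?G v (sem position_prog s)"
    unfolding position_prog_def
  proof (rule For_fill[where G = ?G], goal_cases)
    case (5 v t)
    have t: "regs t 0 = n" "regs t 1 = V" "regs t 2 = N" "arrs t 13 = arrs s 13" "arrs t 5 = arrs s 5"
      "arrs t 7 = arrs s 7" "arrs t 14 = arrs s 14" "arrs t 4 = arrs s 4"
      using 5(3)[of 0] 5(3)[of 1] 5(3)[of 2] 5(4)[of 13] 5(4)[of 5] 5(4)[of 7] 5(4)[of 14] 5(4)[of 4] s
      by simp_all
    let ?u = "set_reg 5 0 t"
    have "regs (sem ?L ?u) 5 = regs ?u 5 + card {w. w < regs ?u 2 \<and> ?Q v w}"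
    proof (rule count_loop)
      fix u :: state and w
      assume u: "regs u 4 = w" "\<And>y. y \<noteq> 4 \<Longrightarrow> y \<noteq> 5 \<Longrightarrow> regs u y = regs ?u y" "\<And>a. arrs u a = arrs ?u a"
      have "regs u 0 = n" "regs u 1 = V" "regs u 3 = v"
        using u(2)[of 0] u(2)[of 1] u(2)[of 3] t 5(2) by simp_all
      then show "bval u ?b \<longleftrightarrow> ?Q v w" using u(1,3) t by (auto simp: before_def)
    qed
    moreover have "regs (sem ?L ?u) 3 = v" using 5 by (subst regs_sem) simp_all
    ultimately show ?case using t by (simp del: sem.simps(6))
  next
    case (6 v v' t)
    have "regs (sem ?L (set_reg 5 0 t)) 3 = v" using 6 by (subst regs_sem) simp_all
    moreover have "arrs (sem ?L (set_reg 5 0 t)) 17 = arrs t 17" by (subst arrs_sem) simp_all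
    ultimately show ?case using 6 by (simp del: sem.simps(6))
  qed simp_all
  then show ?thesis using s by simp
qed

text \<open>Children are written directly into their slots. Register 5 counts them meanwhile;
  afterwards it is the slot of the parent, which has to come last, and finally the degree.\<close>

definition adjacency_prog :: prog where
  "adjacency_prog = PFor 3 2 (PSeq (PAssign 5 (Num 0)) (PSeq
     (PFor 4 2 (PCond (Conj (Less (Reg 4) (Reg 1)) (Equal (Arr 13 (Reg 4)) (Reg 3)))
       (PSeq (PStore 3 (Plus (Arr 2 (Reg 3)) (Arr 17 (Reg 4))) (Reg 4)) (incr 5)) PSkip))
     (PSeq (PCond (Less (Arr 13 (Reg 3)) (Reg 1))
         (PSeq (PStore 3 (Plus (Arr 2 (Reg 3)) (Reg 5)) (Arr 13 (Reg 3))) (incr 5)) PSkip)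
       (PStore 1 (Reg 3) (Reg 5)))))"

lemma adjacency_prog:
  assumes s: "regs s 1 = V" "regs s 2 = N" "V \<le> N"
    and off: "\<And>v. v < N \<Longrightarrow> arrs s 2 v = v * Suc N" and posN: "\<And>v. v < N \<Longrightarrow> arrs s 17 v \<le> N"
  defines "K \<equiv> \<lambda>v. {w. w < V \<and> arrs s 13 w = v}"
  assumes pos: "\<And>v w. v < V \<Longrightarrow> w \<in> K v \<Longrightarrow> arrs s 17 w < card (K v)" "\<And>v. v < V \<Longrightarrow> inj_on (arrs s 17) (K v)"
  defines "t \<equiv> sem adjacency_prog s"
  shows "v < V \<Longrightarrow> arrs t 1 v = card (K v) + of_bool (arrs s 13 v < V)"
    "v < V \<Longrightarrow> w \<in> K v \<Longrightarrow> arrs t 3 (arrs s 2 v + arrs s 17 w) = w"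
    "v < V \<Longrightarrow> arrs s 13 v < V \<Longrightarrow> arrs t 3 (arrs s 2 v + card (K v)) = arrs s 13 v"
proof -
  let ?C = "PCond (Conj (Less (Reg 4) (Reg 1)) (Equal (Arr 13 (Reg 4)) (Reg 3)))
       (PSeq (PStore 3 (Plus (Arr 2 (Reg 3)) (Arr 17 (Reg 4))) (Reg 4)) (incr 5)) PSkip"
  let ?D = "PSeq (PCond (Less (Arr 13 (Reg 3)) (Reg 1))
         (PSeq (PStore 3 (Plus (Arr 2 (Reg 3)) (Reg 5)) (Arr 13 (Reg 3))) (incr 5)) PSkip)
       (PStore 1 (Reg 3) (Reg 5))"
  let ?B = "PSeq (PAssign 5 (Num 0)) (PSeq (PFor 4 2 ?C) ?D)"
  let ?o = "arrs s 2" and ?p = "arrs s 17" and ?par = "arrs s 13"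
  have Kfin: "finite (K v)" for v unfolding K_def by simp
  have Kcard: "card (K v) \<le> N" for v
  proof -
    have "card (K v) \<le> card {..<V}" by (rule card_mono) (auto simp: K_def)
    then show ?thesis using s(3) by simp
  qed
  let ?fr = "\<lambda>u::state. regs u 1 = V \<and> regs u 2 = N \<and> arrs u 2 = ?o \<and> arrs u 17 = ?p \<and> arrs u 13 = ?par"
  have loop: "regs (sem (PFor 4 2 ?C) u) 5 = regs u 5 + card (K v) \<and>
      (v < V \<longrightarrow> (\<forall>w\<in>K v. arrs (sem (PFor 4 2 ?C) u) 3 (?o v + ?p w) = w)) \<and>
      (\<forall>k. (\<forall>j\<le>N. k \<noteq> ?o v + j) \<longrightarrow> arrs (sem (PFor 4 2 ?C) u) 3 k = arrs u 3 k)"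
    if u: "?fr u" "regs u 3 = v" for u v
  proof -
    let ?P = "\<lambda>i (x::state). regs x 5 = regs u 5 + card {w\<in>K v. w < i} \<and>
      (v < V \<longrightarrow> (\<forall>w\<in>K v. w < i \<longrightarrow> arrs x 3 (?o v + ?p w) = w)) \<and>
      (\<forall>k. (\<forall>j\<le>N. k \<noteq> ?o v + j) \<longrightarrow> arrs x 3 k = arrs u 3 k)"
    have "?P (regs u 2) (sem (PFor 4 2 ?C) u)"
    proof (rule For_rule[where P = ?P], goal_cases)
      case (5 i x)
      have x: "regs x 1 = V" "regs x 3 = v" "arrs x 2 = ?o" "arrs x 17 = ?p" "arrs x 13 = ?par"
        using 5(4)[of 1] 5(4)[of 3] 5(5)[of 2] 5(5)[of 17] 5(5)[of 13] u by simp_all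
      have e: "sem ?C x = (if i \<in> K v then set_reg 5 (Suc (regs x 5)) (set_arr 3 (?o v + ?p i) i x) else x)"
        using x 5(3) by (auto simp: K_def)
      show ?case
      proof (cases "i \<in> K v")
        case False
        then have "{w\<in>K v. w < Suc i} = {w\<in>K v. w < i}" by (auto simp: less_Suc_eq)
        then show ?thesis unfolding e using 5(2) False by (auto simp: less_Suc_eq)
      next
        case True
        then have Ki: "{w\<in>K v. w < Suc i} = insert i {w\<in>K v. w < i}" by (auto simp: less_Suc_eq)
        have iN: "?p i \<le> N" using posN 5(1) u by simp
        have inj: "?p w \<noteq> ?p i" if "v < V" "w \<in> K v" "w \<noteq> i" for w
          using inj_onD[OF pos(2)[OF that(1)] _ that(2) True] that(3) by blast
        show ?thesis
        proof (intro conjI allI impI ballI)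
          show "regs (set_reg 4 (Suc i) (sem ?C x)) 5 = regs u 5 + card {w\<in>K v. w < Suc i}"
            unfolding e Ki using True 5(2) Kfin[of v] by simp
          show "arrs (set_reg 4 (Suc i) (sem ?C x)) 3 (?o v + ?p w) = w"
            if "v < V" "w \<in> K v" "w < Suc i" for w
            unfolding e using True 5(2) inj[OF that(1,2)] that by (cases "w = i") auto
          show "arrs (set_reg 4 (Suc i) (sem ?C x)) 3 k = arrs u 3 k" if "\<forall>j\<le>N. k \<noteq> ?o v + j" for k
            unfolding e using True 5(2) iN that by simp
        qed
      qed
    qed simp_all
    moreover have "{w\<in>K v. w < regs u 2} = K v" using u s(3) by (auto simp: K_def)
    moreover have "w < regs u 2" if "w \<in> K v" for w using that u s(3) by (auto simp: K_def)
    ultimately show ?thesis by (simp del: sem.simps)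
  qed
  have body: "(v < V \<longrightarrow> arrs (sem ?B u) 1 v = card (K v) + of_bool (?par v < V) \<and>
      (\<forall>w\<in>K v. arrs (sem ?B u) 3 (?o v + ?p w) = w) \<and>
      (?par v < V \<longrightarrow> arrs (sem ?B u) 3 (?o v + card (K v)) = ?par v)) \<and>
      (\<forall>x. x \<noteq> v \<longrightarrow> arrs (sem ?B u) 1 x = arrs u 1 x) \<and>
      (\<forall>k. (\<forall>j\<le>N. k \<noteq> ?o v + j) \<longrightarrow> arrs (sem ?B u) 3 k = arrs u 3 k)"
    if u: "?fr u" "regs u 3 = v" for u v
  proof -
    let ?x = "sem (PFor 4 2 ?C) (set_reg 5 0 u)"
    have L: "regs ?x 5 = card (K v)"
      "v < V \<Longrightarrow> \<forall>w\<in>K v. arrs ?x 3 (?o v + ?p w) = w"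
      "\<And>k. \<forall>j\<le>N. k \<noteq> ?o v + j \<Longrightarrow> arrs ?x 3 k = arrs u 3 k"
      using loop[of "set_reg 5 0 u" v] u by (simp_all del: sem.simps)
    have x: "regs ?x 1 = V" "regs ?x 3 = v" using u by (subst regs_sem; simp)+
    have xa: "arrs ?x 2 = ?o" "arrs ?x 13 = ?par" "arrs ?x 1 = arrs u 1" using u by (subst arrs_sem; simp)+
    have e: "arrs (sem ?B u) 1 = (arrs u 1)(v := card (K v) + of_bool (?par v < V))"
      "arrs (sem ?B u) 3 = (if ?par v < V then (arrs ?x 3)(?o v + card (K v) := ?par v) else arrs ?x 3)"
      using x xa L(1) by (simp_all del: sem.simps(6))
    show ?thesis unfolding e
    proof (intro conjI impI allI ballI)
      fix w assume v: "v < V" and w: "w \<in> K v"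
      show "(if ?par v < V then (arrs ?x 3)(?o v + card (K v) := ?par v) else arrs ?x 3) (?o v + ?p w) = w"
        using L(2)[OF v] w pos(1)[OF v w] by (simp del: sem.simps)
    next
      fix k assume k: "\<forall>j\<le>N. k \<noteq> ?o v + j"
      then show "(if ?par v < V then (arrs ?x 3)(?o v + card (K v) := ?par v) else arrs ?x 3) k = arrs u 3 k"
        using L(3)[OF k] Kcard[of v] by (simp del: sem.simps)
    qed simp_all
  qed
  let ?G = "\<lambda>v (u::state). v < V \<longrightarrow> arrs u 1 v = card (K v) + of_bool (?par v < V) \<and>
      (\<forall>w\<in>K v. arrs u 3 (?o v + ?p w) = w) \<and>
      (?par v < V \<longrightarrow> arrs u 3 (?o v + card (K v)) = ?par v)"
  have "\<forall>v<regs s 2. ?G v t"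
    unfolding t_def adjacency_prog_def
  proof (rule For_fill[where G = ?G], goal_cases)
    case (5 v u)
    have "?fr u" using 5(3)[of 1] 5(3)[of 2] 5(4)[of 2] 5(4)[of 17] 5(4)[of 13] s by simp
    then show ?case using body[of u v] 5(2) by (simp del: sem.simps)
  next
    case (6 v v' u)
    have "?fr u" using 6(4)[of 1] 6(4)[of 2] 6(5)[of 2] 6(5)[of 17] 6(5)[of 13] s by simp
    then have b: "\<And>x. x \<noteq> v \<Longrightarrow> arrs (sem ?B u) 1 x = arrs u 1 x"
      "\<And>k. \<forall>j\<le>N. k \<noteq> ?o v + j \<Longrightarrow> arrs (sem ?B u) 3 k = arrs u 3 k"
      using body[of u v] 6(3) by blast+
    \<comment> \<open>Offsets are multiples of \<open>Suc N\<close>, so blocks of different vertices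
      are disjoint.\<close>
    have blk: "?o v' + j' \<noteq> ?o v + j" if "j' \<le> N" "j \<le> N" for j j'
      using ix_eq_iff[of j' "Suc N" j v' v] 6(1,2) off s that by auto
    show ?case
    proof (intro impI conjI ballI)
      assume v': "v' < V"
      show "arrs (sem ?B u) 1 v' = card (K v') + of_bool (?par v' < V)"
        using b(1)[of v'] 6(2,6) v' by (simp del: sem.simps)
      show "arrs (sem ?B u) 3 (?o v' + ?p w) = w" if w: "w \<in> K v'" for w
      proof -
        have "?p w \<le> N" using posN w s(3) by (auto simp: K_def)
        then have "arrs (sem ?B u) 3 (?o v' + ?p w) = arrs u 3 (?o v' + ?p w)" using b(2) blk by blast
        then show ?thesis using 6(6) v' w by (simp del: sem.simps)
      qed
      show "arrs (sem ?B u) 3 (?o v' + card (K v')) = ?par v'" if "?par v' < V"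
      proof -
        have "arrs (sem ?B u) 3 (?o v' + card (K v')) = arrs u 3 (?o v' + card (K v'))"
          using b(2) blk Kcard by blast
        then show ?thesis using 6(6) v' that by (simp del: sem.simps)
      qed
    qed
  qed simp_all
  then have G: "?G v t" if "v < V" for v using s that by simp
  show "v < V \<Longrightarrow> arrs t 1 v = card (K v) + of_bool (arrs s 13 v < V)" using G by blast
  show "v < V \<Longrightarrow> w \<in> K v \<Longrightarrow> arrs t 3 (arrs s 2 v + arrs s 17 w) = w" using G by blast
  show "v < V \<Longrightarrow> arrs s 13 v < V \<Longrightarrow> arrs t 3 (arrs s 2 v + card (K v)) = arrs s 13 v" using G by blast
qed

section \<open>What a listing says about the relation\<close>

lemma lists_classes_bounds:
  assumes L: "lists_classes xs H L" and d: "distinct xs" and hom: "homogeneous (set xs) H"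
    and i: "i < length xs"
  shows "length (L ! i) \<le> length xs"
    "C \<in> set (L ! i) \<Longrightarrow> length C \<le> length xs \<and> set C \<subseteq> {..<length xs}"
    "c < length (L ! i) \<Longrightarrow> c' < length (L ! i) \<Longrightarrow> y \<in> set (L ! i ! c) \<Longrightarrow> y \<in> set (L ! i ! c') \<Longrightarrow> c = c'"
    "u < length xs \<Longrightarrow> u \<noteq> i \<Longrightarrow> \<exists>c<length (L ! i). u \<in> set (L ! i ! c)"
    "c < length (L ! i) \<Longrightarrow> c' < length (L ! i) \<Longrightarrow> u \<in> set (L ! i ! c) \<Longrightarrow> v \<in> set (L ! i ! c') \<Longrightarrow>
      c = c' \<longleftrightarrow> H (xs ! i) (xs ! u) (xs ! v)"
proof -
  let ?n = "length xs" and ?x = "xs ! i" and ?R = "rel_at (set xs) H (xs ! i)" and ?f = "\<lambda>C. (!) xs ` set C"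
  have L': "\<And>C. C \<in> set (L ! i) \<Longrightarrow> distinct C \<and> set C \<subseteq> {..<?n}"
    and dm: "distinct (map set (L ! i))" and q: "?f ` set (L ! i) = (set xs - {?x}) // ?R"
    using L i unfolding lists_classes_def by blast+
  have xX: "?x \<in> set xs" using i by simp
  have eqv: "equiv (set xs - {?x}) ?R" using hom xX unfolding homogeneous_def by blast
  have inj: "inj_on ((!) xs) {..<?n}" using d by (simp add: inj_on_nth)
  have f_inj: "set C = set D" if "C \<in> set (L ! i)" "D \<in> set (L ! i)" "?f C = ?f D" for C D
    using inj_on_image_eq_iff[OF inj, of "set C" "set D"] L' that by blast
  have len: "length (L ! i) = card (set ` set (L ! i))"
    using distinct_card[OF dm] by simp
  have "card (set ` set (L ! i)) = card ((`) ((!) xs) ` set ` set (L ! i))"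
    by (rule card_image[symmetric]) (use f_inj in \<open>auto simp: inj_on_def\<close>)
  also have "(`) ((!) xs) ` set ` set (L ! i) = (set xs - {?x}) // ?R"
    using q by (simp add: image_image)
  also have "card ((set xs - {?x}) // ?R) \<le> card (set xs - {?x})"
    unfolding quotient_def by (simp add: UNION_singleton_eq_range card_image_le)
  also have "\<dots> \<le> ?n" using card_mono[of "set xs" "set xs - {?x}"] card_length[of xs] by simp
  finally show "length (L ! i) \<le> ?n" using len by simp
  show "C \<in> set (L ! i) \<Longrightarrow> length C \<le> ?n \<and> set C \<subseteq> {..<?n}"
    using L'[of C] distinct_card[of C] card_mono[of "{..<?n}" "set C"] by simp
  have cls: "?f (L ! i ! c) \<in> (set xs - {?x}) // ?R" if "c < length (L ! i)" for c
    unfolding q[symmetric] using that by simp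
  show disj: "c = c'" if c: "c < length (L ! i)" "c' < length (L ! i)" "y \<in> set (L ! i ! c)" "y \<in> set (L ! i ! c')"
    for c c' y
  proof -
    have "?f (L ! i ! c) = ?f (L ! i ! c')"
      using quotient_disj[OF eqv cls[OF c(1)] cls[OF c(2)]] c(3,4) by blast
    then have "set (L ! i ! c) = set (L ! i ! c')" using f_inj c(1,2) by simp
    then show ?thesis using dm c(1,2) by (metis length_map nth_eq_iff_index_eq nth_map)
  qed
  show "\<exists>c<length (L ! i). u \<in> set (L ! i ! c)" if u: "u < ?n" "u \<noteq> i" for u
  proof -
    have "xs ! u \<in> set xs - {?x}" using u i d by (simp add: nth_eq_iff_index_eq)
    then have "xs ! u \<in> \<Union>((set xs - {?x}) // ?R)" using Union_quotient[OF eqv] by simp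
    then obtain C where C: "C \<in> set (L ! i)" "xs ! u \<in> ?f C" unfolding q[symmetric] by blast
    have "u \<in> set C" using inj_on_image_mem_iff[OF inj, of u "set C"] L'[OF C(1)] C(2) u(1) by simp
    then show ?thesis using C(1) by (metis in_set_conv_nth)
  qed
  show "c = c' \<longleftrightarrow> H ?x (xs ! u) (xs ! v)"
    if c: "c < length (L ! i)" "c' < length (L ! i)" "u \<in> set (L ! i ! c)" "v \<in> set (L ! i ! c')"
    for c c' u v
  proof -
    have uv: "xs ! u \<in> ?f (L ! i ! c)" "xs ! v \<in> ?f (L ! i ! c')" using c by auto
    have "?f (L ! i ! c) = ?f (L ! i ! c') \<longleftrightarrow> (xs ! u, xs ! v) \<in> ?R"
      by (rule quotient_eq_iff[OF eqv cls[OF c(1)] cls[OF c(2)] uv])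
    moreover have "?f (L ! i ! c) = ?f (L ! i ! c') \<longleftrightarrow> c = c'"
    proof
      assume "?f (L ! i ! c) = ?f (L ! i ! c')"
      then have "set (L ! i ! c) = set (L ! i ! c')" using f_inj c(1,2) by simp
      then show "c = c'" using dm c(1,2) by (metis length_map nth_eq_iff_index_eq nth_map)
    qed simp
    moreover have "(xs ! u, xs ! v) \<in> ?R \<longleftrightarrow> H ?x (xs ! u) (xs ! v)"
    proof -
      have "\<Union>((set xs - {?x}) // ?R) = set xs - {?x}" by (rule Union_quotient[OF eqv])
      then have "xs ! u \<in> set xs - {?x}" "xs ! v \<in> set xs - {?x}"
        using uv cls[OF c(1)] cls[OF c(2)] by blast+
      then show ?thesis by (simp add: rel_at_def)
    qed
    ultimately show ?thesis by simp
  qed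
qed

lemma serialize_le:
  assumes "\<And>P. P \<in> set L \<Longrightarrow> length P \<le> n" "\<And>P C. P \<in> set L \<Longrightarrow> C \<in> set P \<Longrightarrow> length C \<le> n \<and> set C \<subseteq> {..<n}"
  shows "x \<in> set (serialize L) \<Longrightarrow> x \<le> n"
  using assms unfolding serialize_def by (auto dest: assms(2)) fastforce

section \<open>Correctness of the tables\<close>

locale enumerated_relation = pointed_relation X H "xs ! 0" for X :: "'a set" and H and xs :: "'a list" +
  assumes xs: "distinct xs" "set xs = X" and xs_ne: "xs \<noteq> []"
begin

abbreviation n :: nat where "n \<equiv> length xs"

lemma n_pos: "0 < n" using xs_ne by simp

lemma nth_mem_X [simp]: "i < n \<Longrightarrow> xs ! i \<in> X" using xs by auto

lemma nth_eq_iff: "i < n \<Longrightarrow> j < n \<Longrightarrow> xs ! i = xs ! j \<longleftrightarrow> i = j"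
  using xs(1) by (simp add: nth_eq_iff_index_eq)

lemma nth_away [simp]: "i < n \<Longrightarrow> 0 < i \<Longrightarrow> xs ! i \<in> X - {xs ! 0}"
  using nth_eq_iff[of i 0] n_pos by auto

lemma ex_nth: "x \<in> X \<Longrightarrow> \<exists>i<n. xs ! i = x"
  using xs(2) by (metis in_set_conv_nth)

lemma nth_neq_0 [simp]: "i < n \<Longrightarrow> 0 < i \<Longrightarrow> xs ! i \<noteq> xs ! 0"
  using nth_eq_iff[of i 0] n_pos by auto

definition position_set :: "'a set \<Rightarrow> nat set" where
  "position_set A = {i. i < n \<and> xs ! i \<in> A}"

text \<open>By self-complementedness a set is a umodule iff its outer elements cannot be told apart by their
  relations on the set.\<close>

lemma away_iff:
  assumes U: "U \<subseteq> X" "U \<noteq> {}" "xs ! 0 \<notin> U"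
  shows "U \<in> away \<longleftrightarrow> (\<forall>y\<in>X - U. \<forall>u\<in>U. \<forall>v\<in>U. H y u v \<longleftrightarrow> H (xs ! 0) u v)"
proof -
  have "U \<in> away \<longleftrightarrow> umodule X H U" using U by (simp add: away_def)
  also have "\<dots> \<longleftrightarrow> umodule X H (X - U)"
    using umodule_compl[of U] umodule_compl[of "X - U"] U(1) by (auto simp: double_diff)
  also have "\<dots> \<longleftrightarrow> (\<forall>y\<in>X - U. \<forall>y'\<in>X - U. \<forall>u\<in>U. \<forall>v\<in>U. H y u v \<longleftrightarrow> H y' u v)"
    using U(1) by (simp add: umodule_def double_diff)
  also have "\<dots> \<longleftrightarrow> (\<forall>y\<in>X - U. \<forall>u\<in>U. \<forall>v\<in>U. H y u v \<longleftrightarrow> H (xs ! 0) u v)"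
    using U(3) r by blast
  finally show ?thesis .
qed

text \<open>Class numbers have a meaning only off the diagonal. As neither 0 nor \<open>y\<close>
  belongs to \<open>M\<close>, no diagonal entry of their rows is involved here.\<close>

lemma closed_iff_away:
  assumes cls: "\<And>y u v. y < n \<Longrightarrow> u < n \<Longrightarrow> v < n \<Longrightarrow> u \<noteq> y \<Longrightarrow> v \<noteq> y \<Longrightarrow>
      cls y u = cls y v \<longleftrightarrow> H (xs ! y) (xs ! u) (xs ! v)"
    and M: "M \<subseteq> {..<n}" "M \<noteq> {}" "0 \<notin> M"
  shows "(\<forall>y<n. y \<notin> M \<longrightarrow> agree_on cls y M) \<longleftrightarrow> (!) xs ` M \<in> away"
proof -
  have mem: "xs ! i \<in> (!) xs ` M \<longleftrightarrow> i \<in> M" if "i < n" for i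
    using that M(1) nth_eq_iff by blast
  have sub: "(!) xs ` M \<subseteq> X" "(!) xs ` M \<noteq> {}" "xs ! 0 \<notin> (!) xs ` M"
    using M mem[OF n_pos] by auto
  have ag: "agree_on cls y M \<longleftrightarrow> (\<forall>u\<in>M. \<forall>v\<in>M. H (xs ! y) (xs ! u) (xs ! v) \<longleftrightarrow> H (xs ! 0) (xs ! u) (xs ! v))"
    if y: "y < n" "y \<notin> M" for y
  proof -
    have "cls y u = cls y v \<longleftrightarrow> H (xs ! y) (xs ! u) (xs ! v)"
      "cls 0 u = cls 0 v \<longleftrightarrow> H (xs ! 0) (xs ! u) (xs ! v)" if "u \<in> M" "v \<in> M" for u v
      using cls[of y u v] cls[of 0 u v] that y M n_pos by (auto simp: subset_iff)
    then show ?thesis unfolding agree_on_def by blast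
  qed
  have "(\<forall>y<n. y \<notin> M \<longrightarrow> agree_on cls y M) \<longleftrightarrow>
    (\<forall>y<n. y \<notin> M \<longrightarrow> (\<forall>u\<in>M. \<forall>v\<in>M. H (xs ! y) (xs ! u) (xs ! v) \<longleftrightarrow> H (xs ! 0) (xs ! u) (xs ! v)))"
    using ag by blast
  also have "\<dots> \<longleftrightarrow> (\<forall>y\<in>X - (!) xs ` M. \<forall>u\<in>(!) xs ` M. \<forall>v\<in>(!) xs ` M. H y u v \<longleftrightarrow> H (xs ! 0) u v)"
  proof
    assume l: "\<forall>y<n. y \<notin> M \<longrightarrow> (\<forall>u\<in>M. \<forall>v\<in>M. H (xs ! y) (xs ! u) (xs ! v) \<longleftrightarrow> H (xs ! 0) (xs ! u) (xs ! v))"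
    show "\<forall>y\<in>X - (!) xs ` M. \<forall>u\<in>(!) xs ` M. \<forall>v\<in>(!) xs ` M. H y u v \<longleftrightarrow> H (xs ! 0) u v"
    proof
      fix y assume y: "y \<in> X - (!) xs ` M"
      then obtain i where "i < n" "xs ! i = y" using ex_nth by blast
      then show "\<forall>u\<in>(!) xs ` M. \<forall>v\<in>(!) xs ` M. H y u v \<longleftrightarrow> H (xs ! 0) u v" using l y by blast
    qed
  next
    assume l: "\<forall>y\<in>X - (!) xs ` M. \<forall>u\<in>(!) xs ` M. \<forall>v\<in>(!) xs ` M. H y u v \<longleftrightarrow> H (xs ! 0) u v"
    show "\<forall>y<n. y \<notin> M \<longrightarrow> (\<forall>u\<in>M. \<forall>v\<in>M. H (xs ! y) (xs ! u) (xs ! v) \<longleftrightarrow> H (xs ! 0) (xs ! u) (xs ! v))"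
    proof (intro allI impI)
      fix y assume "y < n" "y \<notin> M"
      then have "xs ! y \<in> X - (!) xs ` M" using mem by simp
      then show "\<forall>u\<in>M. \<forall>v\<in>M. H (xs ! y) (xs ! u) (xs ! v) \<longleftrightarrow> H (xs ! 0) (xs ! u) (xs ! v)" using l by blast
    qed
  qed
  also have "\<dots> \<longleftrightarrow> (!) xs ` M \<in> away" using away_iff[OF sub] by blast
  finally show ?thesis .
qed

lemma least_closed_least:
  assumes cls: "\<And>y u v. y < n \<Longrightarrow> u < n \<Longrightarrow> v < n \<Longrightarrow> u \<noteq> y \<Longrightarrow> v \<noteq> y \<Longrightarrow>
      cls y u = cls y v \<longleftrightarrow> H (xs ! y) (xs ! u) (xs ! v)"
    and ab: "a < n" "b < n" "0 < a" "0 < b" and U: "least_closed n cls a b U" and c: "c < n"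
  shows "c \<in> U \<longleftrightarrow> xs ! c \<in> least (xs ! a) (xs ! b)"
proof -
  note closed = closed_iff_away[OF cls]
  have abY: "xs ! a \<in> X - {xs ! 0}" "xs ! b \<in> X - {xs ! 0}" using ab by simp_all
  note l = least_member[OF abY]
  have U': "U \<subseteq> {..<n}" "0 \<notin> U" "a \<in> U" "b \<in> U" "\<forall>y<n. y \<notin> U \<longrightarrow> agree_on cls y U"
    and min: "\<And>M. M \<subseteq> {..<n} \<Longrightarrow> 0 \<notin> M \<Longrightarrow> a \<in> M \<Longrightarrow> b \<in> M \<Longrightarrow>
      \<forall>y<n. y \<notin> M \<longrightarrow> agree_on cls y M \<Longrightarrow> U \<subseteq> M"
    using U unfolding least_closed_def by blast+
  have "(!) xs ` U \<in> away" using closed[OF _ _ _ _ _ U'(1) _ U'(2)] U'(3,5) by blast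
  then have 1: "least (xs ! a) (xs ! b) \<subseteq> (!) xs ` U" by (rule least_subset) (use U' in auto)
  let ?M = "position_set (least (xs ! a) (xs ! b))"
  have lX: "least (xs ! a) (xs ! b) \<subseteq> X - {xs ! 0}" by (rule member_subset[OF l(1)])
  have img: "(!) xs ` ?M = least (xs ! a) (xs ! b)"
    unfolding position_set_def using lX ex_nth by blast
  have M: "?M \<subseteq> {..<n}" "0 \<notin> ?M" "a \<in> ?M" "b \<in> ?M" using lX l ab by (auto simp: position_set_def)
  have "?M \<noteq> {}" using M(3) by blast
  then have "\<forall>y<n. y \<notin> ?M \<longrightarrow> agree_on cls y ?M"
    using closed[OF _ _ _ _ _ M(1) _ M(2)] img l(1) by simp
  then have "U \<subseteq> ?M" by (rule min[OF M])
  then show ?thesis using 1 c U'(1) nth_eq_iff unfolding position_set_def by blast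
qed

text \<open>The vacuous truth for position 0 mirrors the full sets stored by
  \<open>least_prog\<close>.\<close>

definition mm :: "nat \<Rightarrow> nat \<Rightarrow> nat \<Rightarrow> bool" where
  "mm a b c \<longleftrightarrow> (0 < a \<and> 0 < b \<longrightarrow> xs ! c \<in> least (xs ! a) (xs ! b))"

text \<open>The position 0 plays the part of all of \<open>X\<close>: its leaf is the root of the tree.\<close>

definition pair_cluster :: "nat \<Rightarrow> nat \<Rightarrow> 'a set" where
  "pair_cluster a b = (if 0 < a \<and> 0 < b then strong_hull (xs ! a) (xs ! b) else X)"

lemma pair_cluster_strong: "a < n \<Longrightarrow> b < n \<Longrightarrow> pair_cluster a b \<in> strong_clusters"
  using hull_strong(1)[of "xs ! a" "xs ! b"] by (auto simp: pair_cluster_def strong_clusters_def)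

lemma pair_cluster_X: "a < n \<Longrightarrow> b < n \<Longrightarrow> pair_cluster a b = X \<longleftrightarrow> a = 0 \<or> b = 0"
  using not_strong_X hull_strong(1)[of "xs ! a" "xs ! b"] by (auto simp: pair_cluster_def)

lemma mem_pair_cluster:
  assumes "a < n" "b < n" shows "xs ! a \<in> pair_cluster a b" "xs ! b \<in> pair_cluster a b"
  using assms hull_strong(2,3)[of "xs ! a" "xs ! b"] by (auto simp: pair_cluster_def)

lemma pair_cluster_least:
  assumes "a < n" "b < n" "D \<in> strong_clusters" "xs ! a \<in> D" "xs ! b \<in> D"
  shows "pair_cluster a b \<subseteq> D"
proof (cases "D = X")
  case True
  have "D' \<subseteq> X" if "D' \<in> strong_clusters" for D'
    using that strong_subset unfolding strong_clusters_def by blast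
  then show ?thesis using True pair_cluster_strong[OF assms(1,2)] by blast
next
  case False
  then have D: "strong D" using assms(3) by (simp add: strong_clusters_def)
  then have "xs ! 0 \<notin> D" using strong_subset by blast
  then have "0 < a" "0 < b" using assms(4,5) by (auto intro: gr0I)
  then show ?thesis using hull_subset[OF D assms(4,5)] by (simp add: pair_cluster_def)
qed

lemma hh_iff:
  assumes "a < n" "b < n" "c < n"
  shows "\<not> (\<not> mm a b c \<and> mm a c b \<and> mm b c a) \<longleftrightarrow> xs ! c \<in> pair_cluster a b"
proof (cases "0 < a \<and> 0 < b")
  case ab: True
  show ?thesis
  proof (cases "c = 0")
    case True
    \<comment> \<open>For \<open>c = 0\<close> the other two tests hold vacuously and the first
      fails, so position 0 is excluded, as it should be.\<close>
    have Y: "xs ! a \<in> X - {xs ! 0}" "xs ! b \<in> X - {xs ! 0}" using assms ab by simp_all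
    have "xs ! 0 \<notin> least (xs ! a) (xs ! b)" "xs ! 0 \<notin> strong_hull (xs ! a) (xs ! b)"
      using member_subset[OF least_member(1)[OF Y]] strong_subset[OF hull_strong(1)[OF Y]] by blast+
    then show ?thesis using True ab by (simp add: mm_def pair_cluster_def)
  next
    case False
    then show ?thesis using mem_hull_iff[of "xs ! a" "xs ! b" "xs ! c"] assms ab
      by (auto simp: mm_def pair_cluster_def)
  qed
next
  case False
  then show ?thesis using assms by (auto simp: mm_def pair_cluster_def)
qed

lemma ex_pair_cluster:
  assumes "D \<in> strong_clusters" shows "\<exists>a<n. \<exists>b<n. pair_cluster a b = D"
proof (cases "D = X")
  case True
  then show ?thesis using n_pos by (intro exI[of _ 0] conjI) (simp_all add: pair_cluster_def)
next
  case False
  then have D: "strong D" using assms by (simp add: strong_clusters_def)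
  have DX: "D \<subseteq> X - {xs ! 0}" by (rule strong_subset[OF D])
  have pos: "\<exists>a<n. 0 < a \<and> xs ! a = x" if "x \<in> D" for x
    using ex_nth[of x] that DX by (metis DiffE gr0I insertI1 subsetD)
  obtain x y where xy: "x \<in> D" "y \<in> D" "strong_hull x y = D"
  proof (cases "card D \<ge> 2")
    case True
    interpret strong_node "X - {xs ! 0}" away D by (rule strong_nodeI[OF D True])
    show thesis using ex_hull that by blast
  next
    case False
    have "card D \<noteq> 0" using member_finite[OF strongD[OF D]] member_nonempty[OF strongD[OF D]] by simp
    then have "card D = 1" using False by linarith
    then obtain x where x: "D = {x}" using card_1_singletonE by blast
    then have "strong_hull x x = D" using hull_same DX by blast
    then show thesis using that[of x x] x by blast
  qed
  obtain a b where "a < n" "0 < a" "xs ! a = x" "b < n" "0 < b" "xs ! b = y"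
    using pos[OF xy(1)] pos[OF xy(2)] by blast
  then show ?thesis using xy(3) by (intro exI[of _ a] conjI exI[of _ b]) (auto simp: pair_cluster_def)
qed

text \<open>A larger child would be a strong cluster strictly between \<open>S\<close> and
  \<open>N\<close>.\<close>

lemma covers_child:
  assumes S: "strong S" "strong N" "covers S N" and x: "x \<in> S"
  shows "card N \<ge> 2" "x \<in> N" "child N x = S"
proof -
  have SN: "S \<subset> N" using S(3) unfolding covers_def by blast
  have fN: "finite N" by (rule member_finite[OF strongD[OF S(2)]])
  have "card S < card N" by (rule psubset_card_mono[OF fN SN])
  moreover have "card S > 0"
    using x finite_subset[OF _ fN, of S] SN by (auto simp: card_gt_0_iff)
  ultimately show N2: "card N \<ge> 2" by linarith
  interpret strong_node "X - {xs ! 0}" away N by (rule strong_nodeI[OF S(2) N2])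
  show xN: "x \<in> N" using x SN by blast
  have sub: "S \<subseteq> child N x" by (rule child(4)[OF xN S(1) SN x])
  show "child N x = S"
  proof (rule ccontr)
    assume "child N x \<noteq> S"
    then have "S \<subset> child N x" using sub by blast
    moreover have "child N x \<in> strong_clusters" using child(1)[OF xN] by (simp add: strong_clusters_def)
    ultimately have "N \<subseteq> child N x" using S(3) unfolding covers_def by blast
    then show False using child(2)[OF xN] by blast
  qed
qed

lemma strong_clusters_chain:
  assumes "A \<in> strong_clusters" "B \<in> strong_clusters" "x \<in> A" "x \<in> B" shows "A \<subseteq> B \<or> B \<subseteq> A"
proof (cases "A = X \<or> B = X")
  case True
  then show ?thesis using assms(1,2) strong_subset unfolding strong_clusters_def by blast
next
  case False
  then show ?thesis using strong_cases[of A B x] assms strongD by (auto simp: strong_clusters_def)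
qed

end

text \<open>The number of smaller keys is the order isomorphism onto an initial segment of the
  naturals, so slots computed by counting have neither gaps nor collisions.\<close>

lemma rank_bij:
  fixes g :: "nat \<Rightarrow> int"
  assumes "finite K" "inj_on g K"
  defines "rank \<equiv> \<lambda>v. card {w \<in> K. g w < g v}"
  shows "v \<in> K \<Longrightarrow> rank v < card K" "inj_on rank K"
    "v \<in> K \<Longrightarrow> w \<in> K \<Longrightarrow> rank v < rank w \<longleftrightarrow> g v < g w" "rank ` K = {..<card K}"
proof -
  have less: "rank v < rank w" if "v \<in> K" "g v < g w" for v w
    unfolding rank_def by (rule psubset_card_mono) (use assms(1) that in auto)
  show lt: "rank v < card K" if "v \<in> K" for v
    unfolding rank_def by (rule psubset_card_mono) (use assms(1) that in auto)
  show iff: "rank v < rank w \<longleftrightarrow> g v < g w" if "v \<in> K" "w \<in> K" for v w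
    using less[of v w] less[of w v] that inj_onD[OF assms(2), of v w] by (cases "g v" "g w" rule: linorder_cases) auto
  show inj: "inj_on rank K"
  proof (rule inj_onI)
    fix v w assume vw: "v \<in> K" "w \<in> K" "rank v = rank w"
    then have "g v = g w" using iff[of v w] iff[of w v] by (metis less_irrefl linorder_neqE)
    then show "v = w" using inj_onD[OF assms(2)] vw by blast
  qed
  have "rank ` K \<subseteq> {..<card K}" using lt by blast
  moreover have "card (rank ` K) = card {..<card K}" using card_image[OF inj] by simp
  ultimately show "rank ` K = {..<card K}" by (intro card_subset_eq) auto
qed

section \<open>From the tables to the decomposition tree\<close>

context enumerated_relation
begin

definition pair_code :: "nat \<Rightarrow> nat \<Rightarrow> nat \<Rightarrow> nat" where
  "pair_code a b c = of_bool (mm a b c) + of_bool (mm b c a) + of_bool (mm a c b)"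

text \<open>By \<open>hull_eq_iff\<close>, a common hull of the three pairs puts the points into
  three different children; this makes the triples found by the program fit for
  \<open>code_cases\<close>.\<close>

lemma pair_code_node:
  assumes abc: "a < n" "b < n" "c < n" "a \<noteq> b"
    and D: "pair_cluster a b = D" "pair_cluster a c = D" "pair_cluster b c = D" "D \<noteq> X"
  shows "strong D" "card D \<ge> 2" "xs ! a \<in> D" "xs ! b \<in> D" "xs ! c \<in> D"
    "child D (xs ! a) \<noteq> child D (xs ! b)" "child D (xs ! a) \<noteq> child D (xs ! c)"
    "child D (xs ! b) \<noteq> child D (xs ! c)" "pair_code a b c = betweenness_code (xs ! a) (xs ! b) (xs ! c)"
proof -
  show D': "strong D" using pair_cluster_strong[OF abc(1,2)] D by (auto simp: strong_clusters_def)
  have pos: "0 < a" "0 < b" "0 < c"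
    using pair_cluster_X[OF abc(1,2)] pair_cluster_X[OF abc(1,3)] D by auto
  then have h: "strong_hull (xs ! a) (xs ! b) = D" "strong_hull (xs ! a) (xs ! c) = D"
    "strong_hull (xs ! b) (xs ! c) = D" using D by (simp_all add: pair_cluster_def)
  show m: "xs ! a \<in> D" "xs ! b \<in> D" "xs ! c \<in> D"
    using mem_pair_cluster[OF abc(1,2)] mem_pair_cluster[OF abc(1,3)] D by auto
  have "card {xs ! a, xs ! b} \<le> card D"
    by (rule card_mono[OF member_finite[OF strongD[OF D']]]) (use m in simp)
  then show D2: "card D \<ge> 2" using nth_eq_iff[OF abc(1,2)] abc(4) by simp
  interpret strong_node "X - {xs ! 0}" away D by (rule strong_nodeI[OF D' D2])
  show "child D (xs ! a) \<noteq> child D (xs ! b)" "child D (xs ! a) \<noteq> child D (xs ! c)"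
    "child D (xs ! b) \<noteq> child D (xs ! c)"
    using hull_eq_iff h m by blast+
  show "pair_code a b c = betweenness_code (xs ! a) (xs ! b) (xs ! c)"
    using pos by (simp add: pair_code_def betweenness_code_def mm_def)
qed

lemma pair_code_consistent:
  assumes "a < n" "b < n" "c < n" "a \<noteq> b" "pair_cluster a b = D" "pair_cluster a c = D" "pair_cluster b c = D"
    and "a' < n" "b' < n" "c' < n" "a' \<noteq> b'" "pair_cluster a' b' = D" "pair_cluster a' c' = D" "pair_cluster b' c' = D"
  shows "pair_code a b c = pair_code a' b' c'"
proof (cases "D = X")
  case True
  \<comment> \<open>At the root each of the three pairs contains position 0, and all tests hold
    vacuously. The root is a leaf, so its code only has to be consistent.\<close>
  have "pair_code a b c = 3" if "a < n" "b < n" "c < n" "pair_cluster a b = X" "pair_cluster a c = X" "pair_cluster b c = X" for a b c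
    using that pair_cluster_X by (auto simp: pair_code_def mm_def)
  then show ?thesis using assms True by simp
next
  case False
  note 1 = pair_code_node[OF assms(1-7) False] and 2 = pair_code_node[OF assms(8-14) False]
  interpret strong_node "X - {xs ! 0}" away D by (rule strong_nodeI[OF 1(1,2)])
  show ?thesis unfolding 1(9) 2(9)
    using code_cases[OF 1(3-8)] code_complete[OF _ 2(3-8)] code_prime[OF _ 2(3-8)] code_linear[OF _ 2(3-8)]
    by auto
qed

end

text \<open>The interface between machine and mathematics: what the arrays must satisfy for the
  encoded tree to be correct, without reference to programs.\<close>

locale tree_tables = enumerated_relation +
  fixes V :: nat and VA VB :: "nat \<Rightarrow> nat" and vid :: "nat \<Rightarrow> nat \<Rightarrow> nat"
    and par kd end_of :: "nat \<Rightarrow> nat"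
  assumes V_pos: "0 < V" and VA_0: "VA 0 = 0" and VB_0: "VB 0 = 0"
    and VAB_less: "v < V \<Longrightarrow> VA v < n \<and> VB v < n"
    and vid: "a < n \<Longrightarrow> b < n \<Longrightarrow> vid a b < V \<and> pair_cluster (VA (vid a b)) (VB (vid a b)) = pair_cluster a b"
    and cl_inj: "v < V \<Longrightarrow> w < V \<Longrightarrow> pair_cluster (VA v) (VB v) = pair_cluster (VA w) (VB w) \<Longrightarrow> v = w"
    and par: "v < V \<Longrightarrow>
      is_parent V (\<lambda>v w. pair_cluster (VA v) (VB v) \<subseteq> pair_cluster (VA w) (VB w)) v (par v)"
    and kd_triple: "a < n \<Longrightarrow> b < n \<Longrightarrow> c < n \<Longrightarrow> a \<noteq> b \<Longrightarrow> vid a b = vid a c \<Longrightarrow> vid a b = vid b c \<Longrightarrow>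
      kd (vid a b) = pair_code a b c"
    and kd_none: "v < V \<Longrightarrow> (\<And>a b c. a < n \<Longrightarrow> b < n \<Longrightarrow> c < n \<Longrightarrow> a \<noteq> b \<Longrightarrow> vid a b = vid a c \<Longrightarrow>
      vid a b = vid b c \<Longrightarrow> vid a b \<noteq> v) \<Longrightarrow> kd v = 0"
    and end_of: "a < n \<Longrightarrow> b < n \<Longrightarrow> (\<And>c. c < n \<Longrightarrow> xs ! c \<in> pair_cluster a b \<Longrightarrow> mm a b c) \<Longrightarrow>
      \<exists>b'<n. end_of (vid a b) < n \<and> vid (end_of (vid a b)) b' = vid a b \<and>
        (\<forall>c<n. xs ! c \<in> pair_cluster (end_of (vid a b)) b' \<longrightarrow> mm (end_of (vid a b)) b' c)"
begin

definition cl :: "nat \<Rightarrow> 'a set" where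
  "cl v = pair_cluster (VA v) (VB v)"

lemma cl_mem: "v < V \<Longrightarrow> cl v \<in> strong_clusters"
  using VAB_less pair_cluster_strong by (simp add: cl_def)

lemma cl_vid: "a < n \<Longrightarrow> b < n \<Longrightarrow> cl (vid a b) = pair_cluster a b"
  using vid by (simp add: cl_def)

lemma cl_eqD: "v < V \<Longrightarrow> w < V \<Longrightarrow> cl v = cl w \<Longrightarrow> v = w"
  using cl_inj by (simp add: cl_def)

lemma cl_image: "cl ` {..<V} = strong_clusters"
proof
  show "cl ` {..<V} \<subseteq> strong_clusters" using cl_mem by blast
  show "strong_clusters \<subseteq> cl ` {..<V}"
  proof
    fix D assume "D \<in> strong_clusters"
    then obtain a b where "a < n" "b < n" "pair_cluster a b = D" using ex_pair_cluster by blast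
    then show "D \<in> cl ` {..<V}" using vid cl_vid by blast
  qed
qed

lemma vid_eq_iff: "a < n \<Longrightarrow> b < n \<Longrightarrow> v < V \<Longrightarrow> vid a b = v \<longleftrightarrow> pair_cluster a b = cl v"
  using cl_vid[of a b] cl_eqD[of "vid a b" v] vid[of a b] by auto

lemma cl_0: "cl 0 = X" by (simp add: cl_def VA_0 pair_cluster_def)

lemma cl_strong: "v < V \<Longrightarrow> v \<noteq> 0 \<Longrightarrow> strong (cl v)"
  using cl_mem[of v] cl_eqD[of v 0] V_pos cl_0 by (auto simp: strong_clusters_def)

lemma cl_subset: "v < V \<Longrightarrow> cl v \<subseteq> X"
  using cl_mem[of v] strong_subset by (auto simp: strong_clusters_def)

lemma VA_mem: "v < V \<Longrightarrow> xs ! VA v \<in> cl v"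
  using VAB_less mem_pair_cluster by (simp add: cl_def)

lemma VA_pos: "v < V \<Longrightarrow> v \<noteq> 0 \<Longrightarrow> 0 < VA v"
  using VA_mem[of v] strong_subset[OF cl_strong, of v] by (auto intro: gr0I)

lemma par_cl: "v < V \<Longrightarrow> is_parent V (\<lambda>v w. cl v \<subseteq> cl w) v (par v)"
  using par by (simp add: cl_def)

lemma par_0: "par 0 = V"
proof -
  have "\<not> (par 0 < V \<and> par 0 \<noteq> 0 \<and> cl 0 \<subseteq> cl (par 0))"
    using cl_0 cl_subset[of "par 0"] cl_eqD[of "par 0" 0] V_pos by auto
  then show ?thesis using par_cl[OF V_pos] unfolding is_parent_def by blast
qed

lemma par_covers:
  assumes v: "v < V" "v \<noteq> 0" shows "par v < V" "par v \<noteq> v" "covers (cl v) (cl (par v))"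
proof -
  have "cl v \<subseteq> cl 0" using cl_subset[OF v(1)] cl_0 by simp
  then have p: "par v < V \<and> par v \<noteq> v \<and> cl v \<subseteq> cl (par v) \<and> (\<forall>w<V. w \<noteq> v \<longrightarrow> cl v \<subseteq> cl w \<longrightarrow> cl (par v) \<subseteq> cl w)"
    using par_cl[OF v(1)] V_pos v(2) unfolding is_parent_def by blast
  then show "par v < V" "par v \<noteq> v" by auto
  have "cl v \<noteq> cl (par v)"
  proof
    assume "cl v = cl (par v)"
    then have "v = par v" using cl_eqD[OF v(1)] p by simp
    then show False using p by simp
  qed
  then show "covers (cl v) (cl (par v))"
    unfolding covers_def cl_image[symmetric]
  proof (intro conjI ballI impI)
    show "cl v \<subset> cl (par v)" using p \<open>cl v \<noteq> cl (par v)\<close> by blast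
    fix D assume "D \<in> cl ` {..<V}" "cl v \<subset> D"
    then obtain w where w: "w < V" "cl v \<subset> cl w" "D = cl w" by blast
    then have "w \<noteq> v" by blast
    then show "cl (par v) \<subseteq> D" using p w by blast
  qed
qed

definition children :: "nat \<Rightarrow> nat set" where
  "children v = {w. w < V \<and> par w = v}"

lemma children_nonroot: "v < V \<Longrightarrow> w \<in> children v \<Longrightarrow> w < V \<and> w \<noteq> 0 \<and> par w = v"
proof -
  assume v: "v < V" and w: "w \<in> children v"
  have "w \<noteq> 0"
  proof
    assume "w = 0"
    then show False using v w par_0 by (simp add: children_def)
  qed
  then show ?thesis using w by (simp add: children_def)
qed

lemma child_cl:
  assumes v: "v < V" "v \<noteq> 0" and w: "w \<in> children v"
  shows "card (cl v) \<ge> 2" "xs ! VA w \<in> cl v" "child (cl v) (xs ! VA w) = cl w"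
proof -
  have w': "w < V" "w \<noteq> 0" "par w = v" using children_nonroot[OF v(1) w] by auto
  have "covers (cl w) (cl v)" using par_covers[OF w'(1,2)] w'(3) by simp
  then show "card (cl v) \<ge> 2" "xs ! VA w \<in> cl v" "child (cl v) (xs ! VA w) = cl w"
    using covers_child[OF cl_strong[OF w'(1,2)] cl_strong[OF v] _ VA_mem[OF w'(1)]] by blast+
qed

text \<open>If some triple belongs to \<open>v\<close>, its code decides. Otherwise \<open>v\<close>
  has no three children, and \<open>two_children_complete\<close> confirms the code 0.\<close>

lemma kind_cases:
  assumes v: "v < V" "v \<noteq> 0" and c2: "card (cl v) \<ge> 2"
  defines "K \<equiv> child (cl v) ` cl v" and "G \<equiv> quotient (cl v)"
  shows "kd v = 0 \<and> complete_family K G \<or> kd v = 1 \<and> (\<exists>p. linear_family p K G) \<or> kd v = 3 \<and> prime_family K G"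
proof (cases "\<exists>a<n. \<exists>b<n. \<exists>c<n. a \<noteq> b \<and> vid a b = v \<and> vid a c = v \<and> vid b c = v")
  case True
  then obtain a b c where abc: "a < n" "b < n" "c < n" "a \<noteq> b" "vid a b = v" "vid a c = v" "vid b c = v" by blast
  have D: "pair_cluster a b = cl v" "pair_cluster a c = cl v" "pair_cluster b c = cl v"
    using abc vid_eq_iff v(1) by auto
  have "cl v \<noteq> X" using cl_strong[OF v] not_strong_X by auto
  note nd = pair_code_node[OF abc(1-4) D this]
  interpret strong_node "X - {xs ! 0}" away "cl v" by (rule strong_nodeI[OF nd(1,2)])
  have "kd v = betweenness_code (xs ! a) (xs ! b) (xs ! c)"
    using kd_triple[OF abc(1-4)] abc(5-7) nd(9) by simp
  then show ?thesis unfolding K_def G_def using code_cases[OF nd(3-8)] by auto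
next
  case False
  have kd0: "kd v = 0" by (rule kd_none[OF v(1)]) (use False in metis)
  have st: "strong (cl v)" by (rule cl_strong[OF v])
  interpret strong_node "X - {xs ! 0}" away "cl v" by (rule strong_nodeI[OF st c2])
  have "complete_family (child (cl v) ` cl v) (quotient (cl v))"
  proof (rule two_children_complete)
    fix x y z assume xyz: "x \<in> cl v" "y \<in> cl v" "z \<in> cl v" "child (cl v) x \<noteq> child (cl v) y"
      "child (cl v) x \<noteq> child (cl v) z" "child (cl v) y \<noteq> child (cl v) z"
    have ex: "\<exists>a<n. 0 < a \<and> xs ! a = u" if "u \<in> cl v" for u
      using ex_nth[of u] that strong_subset[OF st] by (metis DiffE gr0I insertI1 subsetD)
    obtain a b c where abc: "a < n" "0 < a" "xs ! a = x" "b < n" "0 < b" "xs ! b = y" "c < n" "0 < c" "xs ! c = z"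
      using ex[OF xyz(1)] ex[OF xyz(2)] ex[OF xyz(3)] by blast
    have "pair_cluster a b = cl v" "pair_cluster a c = cl v" "pair_cluster b c = cl v"
      using hull_eq_iff xyz abc by (auto simp: pair_cluster_def)
    then have "vid a b = v" "vid a c = v" "vid b c = v" using vid_eq_iff abc v(1) by auto
    moreover have "a \<noteq> b" using abc xyz(4) by auto
    ultimately show False using False abc by blast
  qed
  then show ?thesis unfolding K_def G_def using kd0 by blast
qed

definition before :: "nat \<Rightarrow> nat \<Rightarrow> bool" where
  "before w v \<longleftrightarrow> (if kd (par v) = 1 then mm (end_of (par v)) (VA v) (VA w) else w < v)"

text \<open>Some filling pair exists by \<open>linear_ex_end\<close>. The stored end may come from
  another one, but every filling pair has its points in the extreme children, and
  \<open>linear_end\<close> orients the key so that the stored end lies lowest.\<close>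

lemma circular_before:
  assumes v: "v < V" "v \<noteq> 0" and c2: "card (cl v) \<ge> 2" and k: "kd v = 1"
  shows "\<exists>q. linear_family q (child (cl v) ` cl v) (quotient (cl v)) \<and>
    (\<forall>w\<in>children v. \<forall>u\<in>children v. u \<noteq> w \<longrightarrow> before u w \<longleftrightarrow> q (cl u) < q (cl w))"
proof -
  have st: "strong (cl v)" by (rule cl_strong[OF v])
  interpret strong_node "X - {xs ! 0}" away "cl v" by (rule strong_nodeI[OF st c2])
  obtain p where p: "linear_family p (child (cl v) ` cl v) (quotient (cl v))"
    using kind_cases[OF v c2] k by auto
  have ex: "\<exists>a<n. 0 < a \<and> xs ! a = u" if "u \<in> cl v" for u
    using ex_nth[of u] that strong_subset[OF st] by (metis DiffE gr0I insertI1 subsetD)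
  have full: "least (xs ! a) (xs ! b) = cl v \<longleftrightarrow> (\<forall>c<n. xs ! c \<in> pair_cluster a b \<longrightarrow> mm a b c)"
    if ab: "a < n" "b < n" "0 < a" "0 < b" "pair_cluster a b = cl v" for a b
  proof -
    have "least (xs ! a) (xs ! b) \<subseteq> strong_hull (xs ! a) (xs ! b)"
      by (rule least_subset_hull) (use ab in simp_all)
    then have "least (xs ! a) (xs ! b) = cl v \<longleftrightarrow> cl v \<subseteq> least (xs ! a) (xs ! b)"
      using ab(3-5) by (auto simp: pair_cluster_def)
    also have "\<dots> \<longleftrightarrow> (\<forall>c<n. xs ! c \<in> pair_cluster a b \<longrightarrow> mm a b c)"
      unfolding ab(5) mm_def using ab(3,4) ex_nth cl_subset[OF v(1)] by blast
    finally show ?thesis .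
  qed
  obtain e y where ey: "e \<in> cl v" "y \<in> cl v" "least e y = cl v" using linear_ex_end[OF p] by blast
  obtain a b where ab: "a < n" "0 < a" "xs ! a = e" "b < n" "0 < b" "xs ! b = y"
    using ex[OF ey(1)] ex[OF ey(2)] by blast
  have "cl v \<subseteq> strong_hull e y"
    using least_subset_hull[of e y] ey strong_subset[OF st] by blast
  moreover have "strong_hull e y \<subseteq> cl v" by (rule hull_subset[OF st ey(1,2)])
  ultimately have pab: "pair_cluster a b = cl v" using ab by (simp add: pair_cluster_def)
  then have vab: "vid a b = v" using vid_eq_iff ab v(1) by simp
  have fab: "\<And>c. c < n \<Longrightarrow> xs ! c \<in> pair_cluster a b \<Longrightarrow> mm a b c"
    using full[OF ab(1,4,2,5) pab] ey(3) ab by simp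
  obtain b' where b': "b' < n" "end_of v < n" "vid (end_of v) b' = v"
    "\<forall>c<n. xs ! c \<in> pair_cluster (end_of v) b' \<longrightarrow> mm (end_of v) b' c"
    using end_of[OF ab(1,4) fab] unfolding vab by blast
  let ?e = "end_of v"
  have pe: "pair_cluster ?e b' = cl v" using vid_eq_iff[OF b'(2,1) v(1)] b'(3) by simp
  have "cl v \<noteq> X" using st not_strong_X by auto
  then have pos: "0 < ?e" "0 < b'" using pair_cluster_X[OF b'(2,1)] pe by auto
  have le: "least (xs ! ?e) (xs ! b') = cl v" using full[OF b'(2,1) pos pe] b'(4) by blast
  have em: "xs ! ?e \<in> cl v" "xs ! b' \<in> cl v" using mem_pair_cluster[OF b'(2,1)] pe by auto
  obtain q where q: "linear_family q (child (cl v) ` cl v) (quotient (cl v))"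
    "\<And>u. u \<in> cl v \<Longrightarrow> q (child (cl v) (xs ! ?e)) \<le> q (child (cl v) u)"
    using linear_end[OF p em le] by blast
  have "before u w \<longleftrightarrow> q (cl u) < q (cl w)" if uw: "w \<in> children v" "u \<in> children v" "u \<noteq> w" for u w
  proof -
    have w: "w < V" "w \<noteq> 0" "par w = v" and u: "u < V" "u \<noteq> 0" "par u = v"
      using children_nonroot[OF v(1) uw(1)] children_nonroot[OF v(1) uw(2)] by auto
    have ne: "child (cl v) (xs ! VA w) \<noteq> child (cl v) (xs ! VA u)"
      unfolding child_cl(3)[OF v uw(1)] child_cl(3)[OF v uw(2)] using cl_eqD u w uw(3) by blast
    have "before u w \<longleftrightarrow> xs ! VA u \<in> least (xs ! ?e) (xs ! VA w)"
      using k w(3) pos(1) VA_pos[OF w(1,2)] by (simp add: before_def mm_def)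
    also have "\<dots> \<longleftrightarrow> q (child (cl v) (xs ! VA u)) < q (child (cl v) (xs ! VA w))"
      by (rule linear_before[OF q(1) em(1) q(2) child_cl(2)[OF v uw(1)] child_cl(2)[OF v uw(2)] ne])
    finally show ?thesis unfolding child_cl(3)[OF v uw(1)] child_cl(3)[OF v uw(2)] .
  qed
  then show ?thesis using q(1) by blast
qed

text \<open>An integer key makes the sibling order uniform: the key of the linear family at circular
  nodes, the vertex number elsewhere.\<close>

lemma before_key:
  assumes v: "v < V"
  shows "\<exists>g. inj_on g (children v) \<and>
    (\<forall>w\<in>children v. \<forall>u\<in>children v. u \<noteq> w \<longrightarrow> before u w \<longleftrightarrow> g u < (g w :: int)) \<and>
    (v \<noteq> 0 \<longrightarrow> card (cl v) \<ge> 2 \<longrightarrow> kd v = 1 \<longrightarrow>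
      (\<exists>q. linear_family q (child (cl v) ` cl v) (quotient (cl v)) \<and> (\<forall>u\<in>children v. g u = q (cl u))))"
proof (cases "kd v = 1")
  case False
  have "before u w \<longleftrightarrow> int u < int w" if "w \<in> children v" for u w
    using False that by (simp add: before_def children_def)
  then show ?thesis using False by (intro exI[of _ int]) auto
next
  case True
  show ?thesis
  proof (cases "v \<noteq> 0 \<and> card (cl v) \<ge> 2")
    case c: True
    then obtain q where q: "linear_family q (child (cl v) ` cl v) (quotient (cl v))"
      "\<forall>w\<in>children v. \<forall>u\<in>children v. u \<noteq> w \<longrightarrow> before u w \<longleftrightarrow> q (cl u) < q (cl w)"
      using circular_before[OF v _ _ True] by blast
    have "inj_on (\<lambda>u. q (cl u)) (children v)"
    proof (rule inj_onI)
      fix u w assume uw: "u \<in> children v" "w \<in> children v" "q (cl u) = q (cl w)"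
      have "cl u \<in> child (cl v) ` cl v" "cl w \<in> child (cl v) ` cl v"
        using child_cl[OF v _ uw(1)] child_cl[OF v _ uw(2)] c by (metis imageI)+
      then have "cl u = cl w" using q(1) uw(3) unfolding linear_family_def inj_on_def by blast
      then show "u = w" using cl_eqD uw by (simp add: children_def)
    qed
    then show ?thesis using q by (intro exI[of _ "\<lambda>u. q (cl u)"]) auto
  next
    case False
    \<comment> \<open>The remaining vertices are the root and those of singletons. They have at most
      one child, so any key will do.\<close>
    have "u = w" if uw: "u \<in> children v" "w \<in> children v" for u w
    proof (cases "v = 0")
      case False
      then show ?thesis using child_cl(1)[OF v False uw(1)] \<open>\<not> (v \<noteq> 0 \<and> card (cl v) \<ge> 2)\<close> by blast
    next
      case v0: True
      have "cl u = X - {xs ! 0}" if "u \<in> children v" for u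
      proof -
        have u: "u < V" "u \<noteq> 0" "par u = 0" using children_nonroot[OF v that] v0 by auto
        have sub: "cl u \<subseteq> X - {xs ! 0}" by (rule strong_subset[OF cl_strong[OF u(1,2)]])
        show ?thesis
        proof (rule ccontr)
          assume ne: "cl u \<noteq> X - {xs ! 0}"
          have "X - {xs ! 0} \<noteq> {}" using sub VA_mem[OF u(1)] by blast
          then have "X - {xs ! 0} \<in> strong_clusters" using strong_ground by (simp add: strong_clusters_def)
          moreover have "covers (cl u) X" using par_covers(3)[OF u(1,2)] u(3) cl_0 by simp
          ultimately have "X \<subseteq> X - {xs ! 0}" using sub ne unfolding covers_def by blast
          then show False using r by blast
        qed
      qed
      then show ?thesis using cl_eqD uw by (simp add: children_def)
    qed
    then show ?thesis using False
      by (intro exI[of _ "int"]) (auto simp: inj_on_def)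
  qed
qed

definition position :: "nat \<Rightarrow> nat" where
  "position v = card {w. w < V \<and> w \<noteq> v \<and> par w = par v \<and> before w v}"

text \<open>With a key at hand, the position is a rank, and \<open>rank_bij\<close> applies.\<close>

lemma position:
  assumes v: "v < V"
  shows "\<exists>g. (\<forall>w\<in>children v. position w = card {u \<in> children v. g u < g w}) \<and> inj_on g (children v) \<and>
    (v \<noteq> 0 \<longrightarrow> card (cl v) \<ge> 2 \<longrightarrow> kd v = 1 \<longrightarrow>
      (\<exists>q. linear_family q (child (cl v) ` cl v) (quotient (cl v)) \<and> (\<forall>u\<in>children v. g u = (q (cl u) :: int))))"
proof -
  obtain g where g: "inj_on g (children v)"
    "\<forall>w\<in>children v. \<forall>u\<in>children v. u \<noteq> w \<longrightarrow> before u w \<longleftrightarrow> g u < (g w :: int)"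
    "v \<noteq> 0 \<longrightarrow> card (cl v) \<ge> 2 \<longrightarrow> kd v = 1 \<longrightarrow>
      (\<exists>q. linear_family q (child (cl v) ` cl v) (quotient (cl v)) \<and> (\<forall>u\<in>children v. g u = q (cl u)))"
    using before_key[OF v] by blast
  have "position w = card {u \<in> children v. g u < g w}" if w: "w \<in> children v" for w
  proof -
    have "{u. u < V \<and> u \<noteq> w \<and> par u = par w \<and> before u w} = {u \<in> children v. u \<noteq> w \<and> before u w}"
      using w by (auto simp: children_def)
    also have "\<dots> = {u \<in> children v. g u < g w}" using g(2) w by auto
    finally show ?thesis by (simp add: position_def)
  qed
  then show ?thesis using g by blast
qed

lemma children_finite: "finite (children v)" by (simp add: children_def)

lemma position_less: "v < V \<Longrightarrow> w \<in> children v \<Longrightarrow> position w < card (children v)"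
proof -
  assume v: "v < V" and w: "w \<in> children v"
  obtain g where "\<forall>w\<in>children v. position w = card {u \<in> children v. g u < (g w :: int)}"
    "inj_on g (children v)" using position[OF v] by blast
  then show ?thesis using rank_bij(1)[OF children_finite _ w, of g] w by simp
qed

lemma position_inj: "v < V \<Longrightarrow> inj_on position (children v)"
proof -
  assume "v < V"
  then obtain g where g: "\<forall>w\<in>children v. position w = card {u \<in> children v. g u < (g w :: int)}"
    "inj_on g (children v)" using position by blast
  then show ?thesis using rank_bij(2)[OF children_finite g(2)] by (simp cong: inj_on_cong)
qed

lemma position_image: "v < V \<Longrightarrow> position ` children v = {..<card (children v)}"
proof -
  assume "v < V"
  then obtain g where g: "\<forall>w\<in>children v. position w = card {u \<in> children v. g u < (g w :: int)}"
    "inj_on g (children v)" using position by blast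
  then show ?thesis using rank_bij(4)[OF children_finite g(2)] by simp
qed

theorem tables_tree:
  fixes T :: "(nat, 'a) dtree"
  assumes T: "verts T = {..<V}"
    and nb: "\<And>v. v < V \<Longrightarrow> nbrs T v = map (adj v) [0..<card (children v) + of_bool (par v < V)]"
    and adj: "\<And>v w. v < V \<Longrightarrow> w \<in> children v \<Longrightarrow> adj v (position w) = w"
      "\<And>v. v < V \<Longrightarrow> par v < V \<Longrightarrow> adj v (card (children v)) = par v"
    and lab: "\<And>v. v < V \<Longrightarrow> lab T v = xs ! VA v"
    and kind: "\<And>v. v < V \<Longrightarrow> kind T v = decode_kind (kd v)"
  shows "umodular_decomposition_tree X H T"
proof -
  define ch where "ch v = map (adj v) [0..<card (children v)]" for v
  have pv: "par v < V \<longleftrightarrow> v \<noteq> 0" if "v < V" for v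
    using par_covers(1)[OF that] par_0 by (cases "v = 0") auto
  have ch_img: "set (ch v) = children v" if v: "v < V" for v
  proof -
    have "set (ch v) = adj v ` position ` children v"
      unfolding ch_def position_image[OF v] by (auto simp: lessThan_atLeast0)
    also have "\<dots> = children v" using adj(1)[OF v] by (simp add: image_image)
    finally show ?thesis .
  qed
  have ch_nth: "ch v ! position w = w" if "v < V" "w \<in> children v" for v w
    unfolding ch_def using position_less[OF that] adj(1)[OF that] by simp
  interpret C: clustered_tree X H "xs ! 0" T cl 0 par ch
  proof
    show "finite (verts T)" using T by simp
    show "bij_betw cl (verts T) strong_clusters"
      unfolding bij_betw_def T cl_image by (auto intro: inj_onI cl_eqD)
    show "0 \<in> verts T" "cl 0 = X" using T V_pos cl_0 by auto
    show "lab T 0 = xs ! 0" using lab V_pos VA_0 by simp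
    fix v assume vT: "v \<in> verts T"
    then have v: "v < V" using T by simp
    show "v \<noteq> 0 \<Longrightarrow> par v \<in> verts T" "v \<noteq> 0 \<Longrightarrow> covers (cl v) (cl (par v))"
      using par_covers[OF v] T by auto
    show "nbrs T v = ch v @ (if v = 0 then [] else [par v])"
      using nb[OF v] pv[OF v] adj(2)[OF v] by (simp add: ch_def)
    have "card (set (ch v)) = length (ch v)" using ch_img[OF v] by (simp add: ch_def)
    then show dch: "distinct (ch v)" by (rule card_distinct)
    show "set (ch v) = {w \<in> verts T. w \<noteq> 0 \<and> par w = v}"
      unfolding ch_img[OF v] T using children_nonroot[OF v] by (auto simp: children_def)
    show "cl v = {a} \<Longrightarrow> v \<noteq> 0 \<Longrightarrow> lab T v = a" for a
      using VA_mem[OF v] lab[OF v] by simp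
    assume v0: "v \<noteq> 0" and c2: "card (cl v) \<ge> 2"
    note kc = kind_cases[OF v v0 c2] and kd = kind[OF v]
    show "kind T v = Complete \<Longrightarrow> complete_family (child (cl v) ` cl v) (quotient (cl v))"
      "kind T v = Prime \<Longrightarrow> prime_family (child (cl v) ` cl v) (quotient (cl v))"
      using kc kd by (auto simp: decode_kind_def split: if_splits)
    assume "kind T v = Circular"
    then have k1: "kd v = 1" using kd by (auto simp: decode_kind_def split: if_splits)
    obtain g q where g: "\<forall>w\<in>children v. position w = card {u \<in> children v. g u < (g w :: int)}"
      "inj_on g (children v)" and q: "linear_family q (child (cl v) ` cl v) (quotient (cl v))"
      "\<forall>u\<in>children v. g u = q (cl u)" using position[OF v] v0 c2 k1 by blast
    \<comment> \<open>\<open>position\<close> inverts the listing of the children, so the order of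
      slots is the order of ranks and hence of keys.\<close>
    have "q (cl (ch v ! i)) < q (cl (ch v ! j))" if ij: "i < j" "j < length (ch v)" for i j
    proof -
      have len: "length (ch v) = card (children v)" by (simp add: ch_def)
      have mem: "ch v ! k \<in> children v" if "k < length (ch v)" for k
        using nth_mem[OF that] unfolding ch_img[OF v] .
      have m: "ch v ! i \<in> children v" "ch v ! j \<in> children v" using mem ij by simp_all
      have pos: "position (ch v ! k) = k" if "k < length (ch v)" for k
      proof -
        have mk: "ch v ! k \<in> children v" by (rule mem[OF that])
        have "ch v ! position (ch v ! k) = ch v ! k" by (rule ch_nth[OF v mk])
        then show ?thesis
          using dch that position_less[OF v mk] len by (simp add: nth_eq_iff_index_eq)
      qed
      have "position (ch v ! i) < position (ch v ! j)" using pos ij by simp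
      then have "g (ch v ! i) < g (ch v ! j)"
        using rank_bij(3)[OF children_finite g(2) m] g(1) m by simp
      then show ?thesis using q(2) m by simp
    qed
    then have "sorted_wrt (\<lambda>v w. q (cl v) < q (cl w)) (ch v)" by (simp add: sorted_wrt_iff_nth_less)
    then show "\<exists>q. linear_family q (child (cl v) ` cl v) (quotient (cl v)) \<and>
        sorted_wrt (\<lambda>v w. q (cl v) < q (cl w)) (ch v)" using q(1) by blast
  qed
  show ?thesis by (rule C.decomposition_tree)
qed

end

section \<open>The program\<close>

text \<open>The square is counted because products cannot be assigned. It is a program of its own
  since \<open>run_compile\<close> wants the bound in register 2 to be in place before
  \<open>main_prog\<close> starts and never to be written there.\<close>

definition square_prog :: prog where
  "square_prog = PFor 3 0 (PFor 4 0 (incr 2))"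

definition main_prog :: prog where
  "main_prog = PSeq parse (PSeq least_prog (PSeq hull_prog (PSeq vertex_prog (PSeq order_prog
     (PSeq parent_prog (PSeq kind_prog (PSeq end_prog (PSeq offset_prog (PSeq position_prog adjacency_prog)))))))))"

lemma square_prog: "regs (sem square_prog s) 2 = regs s 2 + regs s 0 * regs s 0"
  unfolding square_prog_def
proof (rule For_rule[where P = "\<lambda>i t. regs t 2 = regs s 2 + i * regs s 0"], goal_cases)
  case (5 i t)
  have r0: "regs t 0 = regs s 0" using 5(4)[of 0] by simp
  have "regs (sem (PFor 4 0 (incr 2)) t) 2 = regs t 2 + regs t 0"
    by (rule For_rule[where P = "\<lambda>j u. regs u 2 = regs t 2 + j"]) simp_all
  then show ?case using 5(2) r0 by (simp del: sem.simps)
qed simp_all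

lemma prog_writes:
  "wregs square_prog = {2, 3, 4}" "warrs square_prog = {}"
  "wregs parse = {3, 4, 5, 6, 7, 8}" "warrs parse = {6}"
  "wregs hull_prog = {3, 4, 5}" "warrs hull_prog = {10}"
  "wregs order_prog = {3, 4}" "warrs order_prog = {16}"
  "wregs parent_prog = {3, 4, 5}" "warrs parent_prog = {13}"
  "wregs kind_prog = {3, 4, 5, 6}" "warrs kind_prog = {5}"
  "wregs end_prog = {3, 4, 5, 6}" "warrs end_prog = {14}"
  "wregs offset_prog = {3, 4, 5}" "warrs offset_prog = {2}"
  "wregs position_prog = {3, 4, 5}" "warrs position_prog = {17}"
  "wregs adjacency_prog = {3, 4, 5}" "warrs adjacency_prog = {1, 3}"
  by (auto simp: square_prog_def parse_def parse_classes_def parse_class_def hull_prog_def order_prog_def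
      parent_prog_def kind_prog_def end_prog_def offset_prog_def position_prog_def adjacency_prog_def)

lemmas frame = regs_sem arrs_sem prog_writes least_prog_writes vertex_prog_writes

lemma is_parent_cong:
  assumes "\<And>w u. w < V \<Longrightarrow> u < V \<Longrightarrow> le w u \<longleftrightarrow> le' w u" "v < V"
  shows "is_parent V le v p \<longleftrightarrow> is_parent V le' v p"
  unfolding is_parent_def using assms by blast

context enumerated_relation
begin

theorem main_prog_correct:
  assumes hom: "homogeneous X H" and L: "lists_classes xs H L"
  shows "umodular_decomposition_tree X H (output_tree xs (sem main_prog (sem square_prog (input_state L))))"
proof -
  define s0 where "s0 = sem square_prog (input_state L)"
  define s1 where "s1 = sem parse s0"
  define s2 where "s2 = sem least_prog s1"
  define s3 where "s3 = sem hull_prog s2"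
  define s4 where "s4 = sem vertex_prog s3"
  define s5 where "s5 = sem order_prog s4"
  define s6 where "s6 = sem parent_prog s5"
  define s7 where "s7 = sem kind_prog s6"
  define s8 where "s8 = sem end_prog s7"
  define s9 where "s9 = sem offset_prog s8"
  define s10 where "s10 = sem position_prog s9"
  define s11 where "s11 = sem adjacency_prog s10"
  note defs = s1_def s2_def s3_def s4_def s5_def s6_def s7_def s8_def s9_def s10_def s11_def
  have final: "sem main_prog (sem square_prog (input_state L)) = s11"
    by (simp add: main_prog_def s0_def defs)
  have hom': "homogeneous (set xs) H" using hom xs by simp
  note Lb = lists_classes_bounds[OF L xs(1) hom']
  have lenL: "length L = n" using L by (simp add: lists_classes_def)
  have in0: "regs (input_state L) 0 = n" "\<And>x. x \<noteq> 0 \<Longrightarrow> regs (input_state L) x = 0"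
    "\<And>a k. a \<noteq> 0 \<Longrightarrow> arrs (input_state L) a k = 0"
    "\<And>k. k < length (serialize L) \<Longrightarrow> arrs (input_state L) 0 k = serialize L ! k"
    using lenL by (simp_all add: input_state_def)
  let ?N = "n * n"
  have r: "regs s0 0 = n" "regs s0 1 = 0" "regs s0 2 = ?N"
    unfolding s0_def using square_prog[of "input_state L"] in0 by (simp_all add: frame)
  have a0: "arrs s0 a = arrs (input_state L) a" for a unfolding s0_def by (simp add: frame)

  define C where "C = arrs s1 6"
  have C_cls: "u \<in> set (L ! y ! c) \<Longrightarrow> C (y * n + u) = c" if "y < n" "c < length (L ! y)" for y c u
    unfolding C_def s1_def by (rule parse(1)[OF r(1) lenL]) (use Lb in0 a0 that in auto)
  have C_less: "C k < n" for k
    unfolding C_def s1_def by (rule parse(2)[OF r(1) lenL]) (use Lb in0 a0 n_pos in auto)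
  have cls: "C (y * n + u) = C (y * n + v) \<longleftrightarrow> H (xs ! y) (xs ! u) (xs ! v)"
    if yuv: "y < n" "u < n" "v < n" "u \<noteq> y" "v \<noteq> y" for y u v
  proof -
    obtain c c' where c: "c < length (L ! y)" "u \<in> set (L ! y ! c)" "c' < length (L ! y)" "v \<in> set (L ! y ! c')"
      using Lb(4)[OF yuv(1,2,4)] Lb(4)[OF yuv(1,3,5)] by blast
    then show ?thesis
      using Lb(5)[OF yuv(1) c(1,3,2,4)] C_cls[OF yuv(1) c(1,2)] C_cls[OF yuv(1) c(3,4)] by simp
  qed

  define m where "m a b c = arrs s2 7 ((a * n + b) * n + c)" for a b c
  have m: "m a b c = of_bool (mm a b c)" if abc: "a < n" "b < n" "c < n" for a b c
  proof -
    have "regs s1 0 = n" using r by (simp add: s1_def frame)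
    then obtain U where U: "if 0 < a \<and> 0 < b then least_closed n (\<lambda>y x. C (y * n + x)) a b U else U = {..<n}"
      "\<forall>c<n. m a b c = of_bool (c \<in> U)"
      using least_prog[of s1 n] C_less abc(1,2) unfolding m_def s2_def C_def by blast
    have "c \<in> U \<longleftrightarrow> mm a b c"
    proof (cases "0 < a \<and> 0 < b")
      case True
      then show ?thesis using least_closed_least[OF cls abc(1,2) _ _ _ abc(3), where U = U] U(1) by (simp add: mm_def)
    next
      case False
      then show ?thesis using U(1) abc by (auto simp: mm_def)
    qed
    then show ?thesis using U(2) abc by simp
  qed

  define h where "h a b c = arrs s3 10 ((a * n + b) * n + c)" for a b c
  have h: "h a b c = of_bool (xs ! c \<in> pair_cluster a b)" if abc: "a < n" "b < n" "c < n" for a b c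
  proof -
    have "regs s2 0 = n" using r by (simp add: defs frame)
    then have "h a b c = of_bool (\<not> (m a b c = 0 \<and> m a c b = 1 \<and> m b c a = 1))"
      using hull_prog[of s2 n] abc unfolding h_def m_def s3_def by blast
    also have "\<dots> = of_bool (\<not> (\<not> mm a b c \<and> mm a c b \<and> mm b c a))"
      unfolding m[OF abc] m[OF abc(1,3,2)] m[OF abc(2,3,1)] of_bool_eq_0_iff of_bool_eq_1_iff ..
    finally show ?thesis unfolding hh_iff[OF abc] .
  qed

  \<comment> \<open>A cluster is the least strong one containing its generating pair, so mutual
    containment of the pairs is equality.\<close>
  have same: "h a b a' = 1 \<and> h a b b' = 1 \<and> h a' b' a = 1 \<and> h a' b' b = 1 \<longleftrightarrow>
      pair_cluster a b = pair_cluster a' b'" if "a < n" "b < n" "a' < n" "b' < n" for a b a' b'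
    using h that mem_pair_cluster pair_cluster_strong pair_cluster_least by (auto simp: subset_antisym)

  define V where "V = regs s4 1"
  define VA where "VA = arrs s4 4"
  define VB where "VB = arrs s4 12"
  define vid where "vid a b = arrs s4 11 (a * n + b)" for a b
  have r3: "regs s3 0 = n" "regs s3 2 = ?N" "regs s3 1 = 0" using r by (simp_all add: defs frame)
  have refl: "arrs s3 10 ((a * n + b) * n + a) = 1 \<and> arrs s3 10 ((a * n + b) * n + b) = 1 \<and>
      arrs s3 10 ((a * n + b) * n + a) = 1 \<and> arrs s3 10 ((a * n + b) * n + b) = 1" if "a < n" "b < n" for a b
    using same[OF that that] by (simp add: h_def)
  note vp = vertex_prog[OF r3 n_pos, OF refl, folded s4_def, folded V_def VA_def VB_def]
  have V: "V \<le> ?N" "0 < V" "VA 0 = 0" "VB 0 = 0" using vp(1-4) by auto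
  have VAB: "VA v < n \<and> VB v < n" if "v < V" for v using vp(5) that by auto
  have vid: "vid a b < V \<and> pair_cluster (VA (vid a b)) (VB (vid a b)) = pair_cluster a b"
    if "a < n" "b < n" for a b
  proof -
    have v: "vid a b < V" and "h a b (VA (vid a b)) = 1 \<and> h a b (VB (vid a b)) = 1 \<and>
        h (VA (vid a b)) (VB (vid a b)) a = 1 \<and> h (VA (vid a b)) (VB (vid a b)) b = 1"
      using vp(6)[of a b] that unfolding vid_def h_def by auto
    then show ?thesis using same[OF that] VAB[OF v] by simp
  qed
  have cl_inj: "v = w"
    if "v < V" "w < V" "pair_cluster (VA v) (VB v) = pair_cluster (VA w) (VB w)" for v w
    using vp(7)[of v w] same[of "VA v" "VB v" "VA w" "VB w"] VAB that unfolding h_def by blast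

  let ?cl = "\<lambda>v. pair_cluster (VA v) (VB v)"
  define le where "le v w \<longleftrightarrow> arrs s5 16 (v * ?N + w) = 1" for v w
  have le: "le v w \<longleftrightarrow> ?cl v \<subseteq> ?cl w" if vw: "v < V" "w < V" for v w
  proof -
    have r4: "regs s4 0 = n" "regs s4 2 = ?N" "arrs s4 10 = arrs s3 10" using r by (simp_all add: defs frame)
    have "v < ?N" "w < ?N" using vw V(1) by simp_all
    then have "arrs s5 16 (v * ?N + w) = of_bool (h (VA w) (VB w) (VA v) = 1 \<and> h (VA w) (VB w) (VB v) = 1)"
      using order_prog[OF r4(1,2)] unfolding s5_def h_def VA_def VB_def r4(3) by blast
    then have "le v w \<longleftrightarrow> xs ! VA v \<in> ?cl w \<and> xs ! VB v \<in> ?cl w"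
      using h VAB[OF vw(1)] VAB[OF vw(2)] unfolding le_def by simp
    also have "\<dots> \<longleftrightarrow> ?cl v \<subseteq> ?cl w"
      using VAB[OF vw(1)] VAB[OF vw(2)] mem_pair_cluster[of "VA v" "VB v"]
        pair_cluster_least[of "VA v" "VB v" "?cl w"] pair_cluster_strong by blast
    finally show ?thesis .
  qed

  define par where "par = arrs s6 13"
  have par: "is_parent V (\<lambda>v w. ?cl v \<subseteq> ?cl w) v (par v)" if v: "v < V" for v
  proof -
    have r5: "regs s5 1 = V" "regs s5 2 = ?N" using r by (simp_all add: V_def s5_def frame) (simp add: defs frame r)
    have "\<forall>v<V. is_parent V le v (arrs (sem parent_prog s5) 13 v)"
      unfolding le_def
    proof (rule parent_prog[OF r5 V(1)], unfold le_def[symmetric])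
      show "le v v" if "v < V" for v using le that by simp
      show "le u w" if "u < V" "v < V" "w < V" "le u v" "le v w" for u v w using le that by blast
      show "le v w \<or> le w v" if "u < V" "v < V" "w < V" "le u v" "le u w" for u v w
      proof -
        have "xs ! VA u \<in> ?cl u" using mem_pair_cluster VAB[OF that(1)] by blast
        then have "?cl v \<subseteq> ?cl w \<or> ?cl w \<subseteq> ?cl v"
          using strong_clusters_chain[of "?cl v" "?cl w" "xs ! VA u"] le that VAB pair_cluster_strong by blast
        then show ?thesis using le that by blast
      qed
    qed
    then have "is_parent V le v (par v)" using v by (simp add: par_def s6_def)
    then show ?thesis using is_parent_cong[of V le "\<lambda>v w. ?cl v \<subseteq> ?cl w", OF le v] by simp
  qed

  define kd where "kd = arrs s7 5"
  \<comment> \<open>Array 5 is still untouched at this point; its zeros become the codes of nodes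
    without triples.\<close>
  have a6: "arrs s6 7 = arrs s2 7" "arrs s6 11 = arrs s4 11" "regs s6 0 = n" "\<And>v. arrs s6 5 v = 0"
    using r a0 in0(3) by (simp_all add: defs frame)
  have trip: "pair_cluster a b = ?cl (vid a b) \<and> pair_cluster a c = ?cl (vid a b) \<and> pair_cluster b c = ?cl (vid a b)"
    if "a < n" "b < n" "c < n" "vid a b = vid a c" "vid a b = vid b c" for a b c
    using vid[of a b] vid[of a c] vid[of b c] that by simp
  have code: "arrs s6 7 ((a * n + b) * n + c) + of_bool (arrs s6 7 ((b * n + c) * n + a) = 1) +
      of_bool (arrs s6 7 ((a * n + c) * n + b) = 1) = pair_code a b c" if "a < n" "b < n" "c < n" for a b c
    using m that unfolding a6 m_def[symmetric] by (simp add: pair_code_def)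
  have cons: "arrs s6 7 ((a * n + b) * n + c) + of_bool (arrs s6 7 ((b * n + c) * n + a) = 1) +
      of_bool (arrs s6 7 ((a * n + c) * n + b) = 1) =
    arrs s6 7 ((a' * n + b') * n + c') + of_bool (arrs s6 7 ((b' * n + c') * n + a') = 1) +
      of_bool (arrs s6 7 ((a' * n + c') * n + b') = 1)"
    if "a < n" "b < n" "c < n" "a' < n" "b' < n" "c' < n"
      and t: "a \<noteq> b \<and> arrs s6 11 (a * n + b) = arrs s6 11 (a * n + c) \<and> arrs s6 11 (a * n + b) = arrs s6 11 (b * n + c)"
      and t': "a' \<noteq> b' \<and> arrs s6 11 (a' * n + b') = arrs s6 11 (a' * n + c') \<and> arrs s6 11 (a' * n + b') = arrs s6 11 (b' * n + c')"
      and e: "arrs s6 11 (a * n + b) = arrs s6 11 (a' * n + b')" for a b c a' b' c'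
  proof -
    have v: "vid a b = vid a c" "vid a b = vid b c" "vid a' b' = vid a' c'" "vid a' b' = vid b' c'" "vid a b = vid a' b'"
      "a \<noteq> b" "a' \<noteq> b'"
      using t t' e unfolding a6 vid_def by auto
    show ?thesis unfolding code[OF that(1-3)] code[OF that(4-6)]
      using pair_code_consistent[OF that(1-3) v(6) _ _ _ that(4-6) v(7)] trip[OF that(1-3) v(1,2)]
        trip[OF that(4-6) v(3,4)] v(5) by metis
  qed
  note kp = kind_prog[OF a6(3), OF cons, folded s7_def, folded kd_def, unfolded a6(2), folded vid_def]
  have kd_triple: "kd (vid a b) = pair_code a b c"
    if "a < n" "b < n" "c < n" "a \<noteq> b" "vid a b = vid a c" "vid a b = vid b c" for a b c
  proof -
    have "kd (vid a b) = arrs s6 7 ((a * n + b) * n + c) + of_bool (arrs s6 7 ((b * n + c) * n + a) = 1) +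
      of_bool (arrs s6 7 ((a * n + c) * n + b) = 1)" using kp(1) that by blast
    then show ?thesis unfolding code[OF that(1-3)] .
  qed
  have kd_none: "kd v = 0" if "\<And>a b c. a < n \<Longrightarrow> b < n \<Longrightarrow> c < n \<Longrightarrow> a \<noteq> b \<Longrightarrow> vid a b = vid a c \<Longrightarrow>
      vid a b = vid b c \<Longrightarrow> vid a b \<noteq> v" for v
  proof -
    have no: "vid a b \<noteq> v" if "a < n" "b < n" "c < n" "a \<noteq> b \<and> vid a b = vid a c \<and> vid a b = vid b c" for a b c
      using that \<open>\<And>a b c. a < n \<Longrightarrow> b < n \<Longrightarrow> c < n \<Longrightarrow> a \<noteq> b \<Longrightarrow> vid a b = vid a c \<Longrightarrow>
        vid a b = vid b c \<Longrightarrow> vid a b \<noteq> v\<close>[of a b c] by blast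
    have "kd v = arrs s6 5 v" by (rule kp(2); (assumption | rule no; assumption))
    then show ?thesis using a6(4) by simp
  qed

  define end_of where "end_of = arrs s8 14"
  have a7: "regs s7 0 = n" "arrs s7 7 = arrs s2 7" "arrs s7 10 = arrs s3 10" "arrs s7 11 = arrs s4 11"
    "\<And>v. arrs s7 14 v < n" using r a0 in0(3) n_pos by (simp_all add: defs frame)
  have full: "(\<forall>c<n. arrs s7 10 ((a * n + b) * n + c) = 1 \<longrightarrow> arrs s7 7 ((a * n + b) * n + c) \<noteq> 0) \<longleftrightarrow>
      (\<forall>c<n. xs ! c \<in> pair_cluster a b \<longrightarrow> mm a b c)" if "a < n" "b < n" for a b
    using h m that unfolding a7 m_def[symmetric] h_def[symmetric] by (simp, blast)
  have end_less: "end_of v < n" for v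
    unfolding end_of_def s8_def by (rule end_prog(2)[OF a7(1)]) (rule a7)
  have end_of: "\<exists>b'<n. end_of (vid a b) < n \<and> vid (end_of (vid a b)) b' = vid a b \<and>
      (\<forall>c<n. xs ! c \<in> pair_cluster (end_of (vid a b)) b' \<longrightarrow> mm (end_of (vid a b)) b' c)"
    if ab: "a < n" "b < n" and f: "\<And>c. c < n \<Longrightarrow> xs ! c \<in> pair_cluster a b \<Longrightarrow> mm a b c" for a b
  proof -
    have "\<exists>a'<n. \<exists>b'<n. (\<forall>c<n. arrs s7 10 ((a' * n + b') * n + c) = 1 \<longrightarrow> arrs s7 7 ((a' * n + b') * n + c) \<noteq> 0) \<and>
        vid a' b' = vid a b \<and> end_of (vid a b) = a'"
      using end_prog(1)[OF a7(1), rule_format, OF ab] full[OF ab] f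
      unfolding end_of_def s8_def vid_def a7(4) by blast
    then obtain b' where b': "b' < n" "vid (end_of (vid a b)) b' = vid a b"
      "\<forall>c<n. arrs s7 10 ((end_of (vid a b) * n + b') * n + c) = 1 \<longrightarrow>
        arrs s7 7 ((end_of (vid a b) * n + b') * n + c) \<noteq> 0" by blast
    show ?thesis
      by (intro exI[of _ b'] conjI end_less b'(1,2) iffD1[OF full[OF end_less b'(1)] b'(3)])
  qed

  interpret T: tree_tables X H xs V VA VB vid par kd end_of
  proof unfold_locales
    show "0 < V" "VA 0 = 0" "VB 0 = 0" by (rule V)+
    fix v assume "v < V"
    then show "VA v < n \<and> VB v < n" by (rule VAB)
  next
    fix a b assume "a < n" "b < n"
    then show "vid a b < V \<and> ?cl (vid a b) = pair_cluster a b" by (rule vid)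
  next
    fix v w assume "v < V" "w < V" "?cl v = ?cl w"
    then show "v = w" by (rule cl_inj)
  next
    fix v assume "v < V"
    then show "is_parent V (\<lambda>v w. ?cl v \<subseteq> ?cl w) v (par v)" by (rule par)
  next
    fix a b c assume "a < n" "b < n" "c < n" "a \<noteq> b" "vid a b = vid a c" "vid a b = vid b c"
    then show "kd (vid a b) = pair_code a b c" by (rule kd_triple)
  next
    fix v assume "\<And>a b c. a < n \<Longrightarrow> b < n \<Longrightarrow> c < n \<Longrightarrow> a \<noteq> b \<Longrightarrow> vid a b = vid a c \<Longrightarrow>
      vid a b = vid b c \<Longrightarrow> vid a b \<noteq> v"
    then show "kd v = 0" by (rule kd_none)
  next
    fix a b assume "a < n" "b < n" "\<And>c. c < n \<Longrightarrow> xs ! c \<in> pair_cluster a b \<Longrightarrow> mm a b c"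
    then show "\<exists>b'<n. end_of (vid a b) < n \<and> vid (end_of (vid a b)) b' = vid a b \<and>
      (\<forall>c<n. xs ! c \<in> pair_cluster (end_of (vid a b)) b' \<longrightarrow> mm (end_of (vid a b)) b' c)" by (rule end_of)
  qed

  have kdV: "kd V = 0" by (rule kd_none) (use vid in fastforce)
  have r9: "regs s9 0 = n" "regs s9 1 = V" "regs s9 2 = ?N" "arrs s9 5 = kd" "arrs s9 13 = par"
    "arrs s9 14 = end_of" "arrs s9 7 = arrs s2 7" "arrs s9 4 = VA"
    using r by (simp_all add: V_def kd_def par_def end_of_def VA_def defs frame)
  have "\<forall>v<?N. arrs s10 17 v = card {w. w < ?N \<and> w < V \<and> w \<noteq> v \<and> par w = par v \<and>
      (if kd (par v) = 1 then m (end_of (par v)) (VA v) (VA w) = 1 else w < v)}"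
    using position_prog[OF r9(1-3)] unfolding s10_def r9 m_def .
  then have pos': "arrs s10 17 v = card {w. w < ?N \<and> w < V \<and> w \<noteq> v \<and> par w = par v \<and>
      (if kd (par v) = 1 then m (end_of (par v)) (VA v) (VA w) = 1 else w < v)}" if "v < ?N" for v
    using that by blast
  have posN: "arrs s10 17 v \<le> ?N" if "v < ?N" for v
    unfolding pos'[OF that] by (rule order_trans[OF card_mono[of "{..<?N}"]]) auto
  have pos: "arrs s10 17 v = T.position v" if v: "v < V" for v
  proof -
    have "v < ?N" using v V(1) by simp
    moreover have "{w. w < ?N \<and> w < V \<and> w \<noteq> v \<and> par w = par v \<and>
        (if kd (par v) = 1 then m (end_of (par v)) (VA v) (VA w) = 1 else w < v)} =
      {w. w < V \<and> w \<noteq> v \<and> par w = par v \<and> T.before w v}"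
    proof -
      have "m (end_of (par v)) (VA v) (VA w) = 1 \<longleftrightarrow> mm (end_of (par v)) (VA v) (VA w)" if "w < V" for w
        using m[OF end_less] VAB v that by (simp only: of_bool_eq_1_iff)
      then show ?thesis using V(1) unfolding T.before_def by auto
    qed
    ultimately show ?thesis using pos' by (simp add: T.position_def)
  qed
  have r10: "regs s10 1 = V" "regs s10 2 = ?N" "arrs s10 13 = par" "arrs s10 2 = arrs s9 2"
    using r9 by (simp_all add: s10_def frame)
  have off: "arrs s10 2 v = v * Suc ?N" if "v < ?N" for v
    using offset_prog[of s8 ?N] that r unfolding r10(4) s9_def by (simp add: defs frame)
  have K: "{w. w < V \<and> arrs s10 13 w = v} = T.children v" for v
    unfolding r10 T.children_def by simp
  have pc: "arrs s10 17 w = T.position w" if "w \<in> T.children v" for v w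
    using that pos by (simp add: T.children_def)
  have p1: "arrs s10 17 w < card {w. w < V \<and> arrs s10 13 w = v}"
    if "v < V" "w \<in> {w. w < V \<and> arrs s10 13 w = v}" for v w
    using that T.position_less pc unfolding K by simp
  have p2: "inj_on (arrs s10 17) {w. w < V \<and> arrs s10 13 w = v}" if "v < V" for v
    unfolding K using T.position_inj[OF that] pc inj_on_cong[of "T.children v" "arrs s10 17" T.position]
    by blast
  have ap: "arrs s11 1 v = card (T.children v) + of_bool (par v < V)"
    "w \<in> T.children v \<Longrightarrow> arrs s11 3 (arrs s10 2 v + arrs s10 17 w) = w"
    "par v < V \<Longrightarrow> arrs s11 3 (arrs s10 2 v + card (T.children v)) = par v" if v: "v < V" for v w
  proof -
    note ap = adjacency_prog[OF r10(1,2) V(1), folded s11_def]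
    have "arrs s11 1 v = card {w. w < V \<and> arrs s10 13 w = v} + of_bool (arrs s10 13 v < V)"
      by (rule ap(1)) (rule off posN p1 p2 v; assumption?)+
    then show "arrs s11 1 v = card (T.children v) + of_bool (par v < V)" unfolding K unfolding r10(3) .
    show "arrs s11 3 (arrs s10 2 v + arrs s10 17 w) = w" if w: "w \<in> T.children v"
      by (rule ap(2)[of v]) (rule off posN p1 p2 v w[folded K]; assumption?)+
    have "arrs s11 3 (arrs s10 2 v + card {w. w < V \<and> arrs s10 13 w = v}) = arrs s10 13 v"
      if p: "par v < V"
      by (rule ap(3)) (rule off posN p1 p2 v p[folded r10(3)]; assumption?)+
    then show "arrs s11 3 (arrs s10 2 v + card (T.children v)) = par v" if "par v < V"
      using that unfolding K unfolding r10(3) by blast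
  qed
  have e11: "regs s11 1 = V" "arrs s11 4 = VA" "arrs s11 5 = kd" "arrs s11 2 = arrs s10 2"
    unfolding s11_def using r9 r10
    by (simp_all add: frame) (simp_all add: s10_def frame)
  show ?thesis unfolding final
  proof (rule T.tables_tree)
    show "verts (output_tree xs s11) = {..<V}" using e11(1) by (simp add: output_tree_def)
    show "nbrs (output_tree xs s11) v =
        map ((\<lambda>v j. arrs s11 3 (arrs s11 2 v + j)) v) [0..<card (T.children v) + of_bool (par v < V)]"
      if "v < V" for v using ap(1)[OF that] by (simp add: output_tree_def)
    show "arrs s11 3 (arrs s11 2 v + T.position w) = w" if "v < V" "w \<in> T.children v" for v w
      using ap(2)[OF that] pc[OF that(2)] by (simp add: e11)
    show "arrs s11 3 (arrs s11 2 v + card (T.children v)) = par v" if "v < V" "par v < V" for v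
      using ap(3)[OF that] by (simp add: e11)
    show "lab (output_tree xs s11) v = xs ! VA v" if "v < V" for v by (simp add: output_tree_def e11)
    show "kind (output_tree xs s11) v = decode_kind (kd v)" if "v < V" for v by (simp add: output_tree_def e11)
  qed
qed

end

section \<open>Growth rates, the empty ground set, and the final bounds\<close>

lemma Suc_power_bigo: "(\<lambda>n. (1 + real n) ^ k) \<in> O(\<lambda>n. real n ^ k)"
proof (rule bigoI[of _ "2 ^ k"], rule eventually_sequentiallyI[of 1])
  fix n :: nat assume "1 \<le> n"
  then have "(1 + real n) ^ k \<le> (2 * real n) ^ k" by (intro power_mono) auto
  then show "norm ((1 + real n) ^ k) \<le> 2 ^ k * norm (real n ^ k)" by (simp add: power_mult_distrib)
qed

lemma cmult_bigo: "f \<in> O(g) \<Longrightarrow> (\<lambda>n. c * f n :: real) \<in> O(g)"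
  by (cases "c = 0") simp_all

text \<open>From 3 on the logarithm is at least 1, since \<open>exp 1 \<le> 3\<close>; the program
  itself has order \<open>n ^ 4\<close>.\<close>

lemma power_bigo_power_ln: "(\<lambda>n. real n ^ k) \<in> O(\<lambda>n. real n ^ k * ln (real n))"
proof (rule bigoI[of _ 1], rule eventually_sequentiallyI[of 3])
  fix n :: nat assume n: "3 \<le> n"
  have "3 \<le> real n" using n by simp
  then have "exp 1 \<le> real n" using exp_le by linarith
  then have "1 \<le> ln (real n)" using n by (simp add: ln_ge_iff)
  then have "real n ^ k * 1 \<le> real n ^ k * ln (real n)" by (intro mult_left_mono) auto
  then show "norm (real n ^ k) \<le> 1 * norm (real n ^ k * ln (real n))"
    using \<open>1 \<le> ln (real n)\<close> by (simp add: abs_mult)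
qed

text \<open>This settles uniqueness for \<open>X = {}\<close>: a tree without leaves must be the
  null graph.\<close>

lemma tree_has_leaf:
  assumes T: "is_tree T" and v: "v \<in> verts T" shows "leaves T \<noteq> {}"
proof -
  obtain par depth where P: "parent_tree (verts T) v par depth"
    "arcs T = parent_tree.tree_arcs (verts T) v par" by (rule is_tree_parent[OF T v])
  interpret parent_tree "verts T" v par depth by (rule P)
  obtain w where w: "w \<in> desc v" "\<forall>u\<in>verts T. u \<noteq> v \<longrightarrow> par u \<noteq> w" using ex_bottom[OF v] by blast
  have wV: "w \<in> verts T" using w(1) desc_subset by blast
  have "x = par w" if "x \<in> set (nbrs T w)" for x
  proof -
    have "(w, x) \<in> tree_arcs" using that wV P(2) by (auto simp: arcs_def)
    then show ?thesis using w(2) by (auto simp: tree_arcs_iff)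
  qed
  then have "card (set (nbrs T w)) \<le> 1" using card_mono[of "{par w}" "set (nbrs T w)"] by auto
  moreover have "distinct (nbrs T w)" using T wV unfolding is_tree_def by blast
  ultimately have "w \<in> leaves T" using wV by (simp add: leaves_def distinct_card)
  then show ?thesis by blast
qed

lemma empty_decomposition_tree:
  assumes T: "verts T = {}"
  shows "umodular_decomposition_tree {} H T" "strong_split_tree {} H T' \<Longrightarrow> tree_iso T T'"
proof -
  have e: "arcs T = {}" "leaves T = {}" "edges T = {}" "internal_nodes T = {}"
    using T by (auto simp: arcs_def leaves_def edges_def internal_nodes_def)
  have b: "bipartitions {} H = {}" by (auto simp: bipartitions_def umodule_def)
  then have s: "strong_bipartitions {} H = {}" by (simp add: strong_bipartitions_def)
  have "is_tree T" using T e by (auto simp: is_tree_def cyclic_path_def)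
  then show "umodular_decomposition_tree {} H T"
    by (simp add: umodular_decomposition_tree_def strong_split_tree_def e b s bij_betw_def)
  show "tree_iso T T'" if T': "strong_split_tree {} H T'"
  proof -
    have "leaves T' = {}" "is_tree T'"
      using T' by (auto simp: strong_split_tree_def bij_betw_def)
    then have "verts T' = {}" using tree_has_leaf[of T'] by blast
    moreover from this have "leaves T' = {}" by (simp add: leaves_def)
    ultimately show ?thesis using T e by (simp add: tree_iso_def bij_betw_def)
  qed
qed

lemma main_prog_empty: "regs s 0 = 0 \<Longrightarrow> regs s 1 = 0 \<Longrightarrow> regs (sem main_prog s) 1 = 0"
  by (simp add: main_prog_def frame) (simp add: vertex_prog_def frame)

text \<open>The indices of triples, \<open>ix3\<close> applied to registers, reach degree 5; 10 is a
  round bound above the degrees that occur.\<close>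

lemma pok_square: "pok 10 square_prog" "bregs square_prog = {0}" "loop_degree square_prog = 2"
  by (simp_all add: square_prog_def aok_def)

lemma pok_main: "pok 10 main_prog"
  by (simp add: main_prog_def parse_def parse_classes_def parse_class_def least_prog_def closure_init_def
      closure_loop_def closure_step_def hull_prog_def vertex_prog_def search_vertex_def in_hull_def
      order_prog_def parent_prog_def kind_prog_def end_prog_def offset_prog_def position_prog_def
      adjacency_prog_def aok_def)

lemma bregs_main: "bregs main_prog = {0, 2}" "loop_degree main_prog = 4"
  by (auto simp add: main_prog_def parse_def parse_classes_def parse_class_def least_prog_def closure_init_def
      closure_loop_def closure_step_def hull_prog_def vertex_prog_def search_vertex_def
      order_prog_def parent_prog_def kind_prog_def end_prog_def offset_prog_def position_prog_def
      adjacency_prog_def)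

lemma wregs_main: "0 \<notin> wregs main_prog" "2 \<notin> wregs main_prog"
  by (simp_all add: main_prog_def prog_writes least_prog_writes vertex_prog_writes)

text \<open>The summand 2 provides the lower bound on \<open>B\<close> that
  \<open>run_compile\<close> asks for, even if the input is empty.\<close>

lemma input_bounded:
  assumes L: "lists_classes xs H L" and "distinct xs" and "homogeneous (set xs) H"
  shows "bounded (length xs + 2) (input_state L)"
proof -
  note Lb = lists_classes_bounds[OF assms]
  have len: "length L = length xs" using L by (simp add: lists_classes_def)
  have "x \<le> length xs" if "x \<in> set (serialize L)" for x
  proof (rule serialize_le[OF _ _ that])
    fix P assume "P \<in> set L"
    then obtain i where i: "i < length xs" "P = L ! i" using len by (metis in_set_conv_nth)
    then show "length P \<le> length xs" using Lb(1) by simp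
    show "C \<in> set P \<Longrightarrow> length C \<le> length xs \<and> set C \<subseteq> {..<length xs}" for C using Lb(2)[OF i(1)] i(2) by simp
  qed
  then have "serialize L ! i \<le> length xs + 2" if "i < length (serialize L)" for i
    using nth_mem[OF that] le_SucI by (metis add_2_eq_Suc' )
  then show ?thesis using len by (simp add: bounded_def input_state_def)
qed

theorem theorem4:
  shows "\<exists>(c :: com) (time :: nat \<Rightarrow> real) (W :: nat \<Rightarrow> nat) (d :: nat).
    time \<in> O(\<lambda>n. real n ^ 4 * ln (real n)) \<and>
    (\<lambda>n. real (W n)) \<in> O(\<lambda>n. real n ^ d) \<and>
    (\<forall>(X :: 'a set) (H :: 'a \<Rightarrow> 'a \<Rightarrow> 'a \<Rightarrow> bool) (xs :: 'a list) (L :: nat list list list).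
       finite X \<longrightarrow> homogeneous X H \<longrightarrow> self_complemented X H \<longrightarrow>
       set xs = X \<longrightarrow> distinct xs \<longrightarrow> lists_classes xs H L \<longrightarrow>
       (\<exists>t s. run (W (card X)) c (input_state L) t s \<and> real t \<le> time (card X) \<and>
          umodular_decomposition_tree X H (output_tree xs s) \<and>
          (\<forall>T :: (nat, 'a) dtree.
             strong_split_tree X H T \<longrightarrow> tree_iso (output_tree xs s) T)))"
proof -
  let ?N = "\<lambda>n q. if q = 0 then n else n * n :: nat"
  obtain C1 where C1: "\<And>n. prog_time (?N n) square_prog \<le> C1 * Suc n ^ 2"
    using time_le[of square_prog] unfolding pok_square(3) by blast
  obtain C2 where C2: "\<And>n. prog_time (?N n) main_prog \<le> C2 * Suc n ^ 4"
    using time_le[of main_prog] unfolding bregs_main(2) by blast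
  define B where "B n = (C1 + C2) * Suc n ^ 4" for n
  \<comment> \<open>The additional 2 leaves room for the initial bound \<open>n + 2\<close> on the
    memory, on top of the running time.\<close>
  define M where "M n = (C1 + C2 + 2) * Suc n ^ 4" for n
  have C1': "prog_time (?N n) square_prog \<le> C1 * Suc n ^ 4" for n
  proof -
    have "Suc n ^ 2 \<le> Suc n ^ 4" by (rule power_increasing) simp_all
    then have "C1 * Suc n ^ 2 \<le> C1 * Suc n ^ 4" by (rule mult_le_mono2)
    then show ?thesis using C1[of n] by linarith
  qed
  have total: "prog_time (?N n) square_prog + prog_time (?N n) main_prog \<le> B n" for n
    using C1'[of n] C2[of n] by (simp add: B_def add_mult_distrib)
  have BM: "n + 2 + B n \<le> M n" for n
  proof -
    have "Suc n ^ 1 \<le> Suc n ^ 4" by (rule power_increasing) simp_all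
    then show ?thesis by (simp add: B_def M_def add_mult_distrib)
  qed
  have B: "(\<lambda>n. real (B n)) \<in> O(\<lambda>n. real n ^ 4 * ln (real n))"
  proof -
    have "(\<lambda>n. (1 + real n) ^ 4) \<in> O(\<lambda>n. real n ^ 4 * ln (real n))"
      by (rule landau_o.big_trans[OF Suc_power_bigo power_bigo_power_ln])
    then have "(\<lambda>n. real (C1 + C2) * (1 + real n) ^ 4) \<in> O(\<lambda>n. real n ^ 4 * ln (real n))"
      by (rule cmult_bigo)
    then show ?thesis unfolding B_def of_nat_mult of_nat_power of_nat_Suc .
  qed
  \<comment> \<open>\<open>M n\<close> has order \<open>n ^ 4\<close> and words hold values up to
    its tenth power, 10 being the degree bound in \<open>pok\<close>; hence 40.\<close>
  have M: "(\<lambda>n. real (M n ^ 10)) \<in> O(\<lambda>n. real n ^ 40)"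
  proof -
    have "(\<lambda>n. ((1 + real n) ^ 4) ^ 10) \<in> O(\<lambda>n. real n ^ 40)"
      using Suc_power_bigo[of 40] by (simp flip: power_mult)
    then have "(\<lambda>n. real (C1 + C2 + 2) ^ 10 * ((1 + real n) ^ 4) ^ 10) \<in> O(\<lambda>n. real n ^ 40)"
      by (rule cmult_bigo)
    then show ?thesis unfolding M_def of_nat_mult of_nat_power of_nat_Suc power_mult_distrib .
  qed
  have main: "\<exists>t s. run (M (card X) ^ 10) (Seq (compile square_prog) (compile main_prog)) (input_state L) t s \<and>
      real t \<le> real (B (card X)) \<and> umodular_decomposition_tree X H (output_tree xs s) \<and>
      (\<forall>T :: (nat, 'a) dtree. strong_split_tree X H T \<longrightarrow> tree_iso (output_tree xs s) T)"
    if X: "finite X" "homogeneous X H" "self_complemented X H" "set xs = X" "distinct xs" "lists_classes xs H L"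
    for X :: "'a set" and H xs L
  proof -
    let ?n = "card X"
    let ?s = "sem square_prog (input_state L)"
    have n: "?n = length xs" using distinct_card[OF X(5)] X(4) by simp
    have len: "length L = ?n" using X(6) n by (simp add: lists_classes_def)
    have b0: "bounded (?n + 2) (input_state L)"
      using input_bounded[OF X(6,5)] X(2,4) n by simp
    have i0: "regs (input_state L) 0 = ?n" "regs (input_state L) 1 = 0" "regs (input_state L) 2 = 0"
      using len by (simp_all add: input_state_def)
    have "\<exists>t \<le> prog_time (?N ?n) square_prog. run (M ?n ^ 10) (compile square_prog) (input_state L) t ?s \<and>
        bounded (?n + 2 + prog_time (?N ?n) square_prog) ?s"
    proof (rule run_compile[OF pok_square(1) b0])
      show "?n + 2 + prog_time (?N ?n) square_prog \<le> M ?n" using total[of ?n] BM[of ?n] by linarith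
      show "regs (input_state L) q \<le> ?N ?n q" if "q \<in> bregs square_prog" for q
        using that i0 by (simp add: pok_square(2))
    qed (simp_all add: pok_square(2) prog_writes)
    then obtain t1 where t1: "t1 \<le> prog_time (?N ?n) square_prog"
      "run (M ?n ^ 10) (compile square_prog) (input_state L) t1 ?s"
      "bounded (?n + 2 + prog_time (?N ?n) square_prog) ?s" by blast
    have r: "regs ?s 0 = ?n" "regs ?s 1 = 0" "regs ?s 2 = ?n * ?n"
      using square_prog[of "input_state L"] i0 by (simp_all add: frame)
    have "\<exists>t \<le> prog_time (?N ?n) main_prog. run (M ?n ^ 10) (compile main_prog) ?s t (sem main_prog ?s) \<and>
        bounded (?n + 2 + prog_time (?N ?n) square_prog + prog_time (?N ?n) main_prog) (sem main_prog ?s)"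
    proof (rule run_compile[OF pok_main t1(3)])
      show "?n + 2 + prog_time (?N ?n) square_prog + prog_time (?N ?n) main_prog \<le> M ?n"
        using total[of ?n] BM[of ?n] by linarith
      show "regs ?s q \<le> ?N ?n q" if "q \<in> bregs main_prog" for q
        using that r unfolding bregs_main by auto
    qed (use wregs_main in \<open>auto simp: bregs_main\<close>)
    then obtain t2 where t2: "t2 \<le> prog_time (?N ?n) main_prog"
      "run (M ?n ^ 10) (compile main_prog) ?s t2 (sem main_prog ?s)" by blast
    let ?T = "output_tree xs (sem main_prog ?s)"
    have "umodular_decomposition_tree X H ?T \<and>
      (\<forall>T :: (nat, 'a) dtree. strong_split_tree X H T \<longrightarrow> tree_iso ?T T)"
    proof (cases "xs = []")
      case True
      then have "X = {}" "verts ?T = {}"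
        using X(4) main_prog_empty[of ?s] r by (simp_all add: output_tree_def)
      then show ?thesis using empty_decomposition_tree[of ?T] by blast
    next
      case False
      then interpret enumerated_relation X H xs
        using X by unfold_locales auto
      have T: "umodular_decomposition_tree X H ?T" by (rule main_prog_correct[OF X(2,6)])
      then have "strong_split_tree X H ?T" by (simp add: umodular_decomposition_tree_def)
      then show ?thesis using T strong_split_tree_unique by blast
    qed
    moreover have "real (t1 + t2) \<le> real (B ?n)" using t1(1) t2(1) total[of ?n] by linarith
    ultimately show ?thesis using run.Seq[OF t1(2) t2(2)] by blast
  qed
  show ?thesis
  proof (rule exI[of _ "Seq (compile square_prog) (compile main_prog)"], rule exI[of _ "\<lambda>n. real (B n)"],
      rule exI[of _ "\<lambda>n. M n ^ 10"], rule exI[of _ "40::nat"], intro conjI B M, intro allI impI)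
  qed (rule main)
qed

end
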